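(* Let $T>0$, $\gamma\ge 2$ and $\rho_0\in L^2(H^{-1-},\mu)$. There exists a measurable function $\rho\in L^\infty\big(0,T;L^2(H^{-1-},\mu)\big)$ such that (i) for every $k\in\mathbb{Z}^2_0$, $\langle\sigma_k\cdot\nabla\omega, D\rho_t\rangle$ exists in the distributional sense; (ii) the gradient estimate holds: $$\sum_{k\in\mathbb{Z}^2_0}\int_0^T\!\!\int\langle\sigma_k\cdot\nabla\omega,D\rho_t\rangle^2\,d\mu\,dt\le\|\rho_0\|_{L^2(\mu)}^2;$$ (iii) if $\gamma>2$, then for any cylindrical function $F\in\mathcal{FC}_P$ and any $\alpha\in C^1([0,T],\mathbb{R})$ satisfying $\alpha(T)=0$, one has $$0=\alpha(0)\int F\rho_0\,d\mu+\int_0^T\!\!\int\rho_t\big(\alpha'(t)F-\alpha(t)\langle u(\omega)\cdot\nabla\omega,DF\rangle\big)\,d\mu\,dt-\frac12\sum_{k\in\mathbb{Z}^2_0}\int_0^T\!\!\int\alpha(t)\langle\sigma_k\cdot\nabla\omega,DF\rangle\langle\sigma_k\cdot\nabla\omega,D\rho_t\rangle\,d\mu\,dt.$$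
   Context: Let $\mathbb{T}^2=\mathbb{R}^2/\mathbb{Z}^2$, $\mathbb{Z}^2_0=\mathbb{Z}^2\setminus\{0\}$, $\mathbb{Z}^2_+=\{k\in\mathbb{Z}^2_0:k_1>0\text{ or }(k_1=0,k_2>0)\}$, $\mathbb{Z}^2_-=-\mathbb{Z}^2_+$, $k^\perp=(k_2,-k_1)$. Put $e_k(x)=\sqrt2\cos(2\pi k\cdot x)$ for $k\in\mathbb{Z}^2_+$ and $e_k(x)=\sqrt2\sin(2\pi k\cdot x)$ for $k\in\mathbb{Z}^2_-$ (an orthonormal basis of the zero-average functions in $L^2(\mathbb{T}^2,\mathbb{R})$), and $\sigma_k(x)=\frac1{\sqrt2}\frac{k^\perp}{|k|^\gamma}e_k(x)$, i.e. $\frac{k^\perp}{|k|^\gamma}\cos(2\pi k\cdot x)$ for $k\in\mathbb{Z}^2_+$ and $\frac{k^\perp}{|k|^\gamma}\sin(2\pi k\cdot x)$ for $k\in\mathbb{Z}^2_-$. $H^{-1-}=H^{-1-}(\mathbb{T}^2)=\bigcap_{s>0}H^{-1-s}(\mathbb{T}^2)$ (zero-average distributions), $\langle\cdot,\cdot\rangle$ is the duality between distributions and smooth functions, and $\mu$ is the law of white noise on $\mathbb{T}^2$: the centered Gaussian measure on $H^{-1-}$ under which $(\langle\omega,e_k\rangle)_{k\in\mathbb{Z}^2_0}$ are i.i.d. standard normal. Integrals without domain are over $H^{-1-}$ (with generic element $\omega$). Cylindrical functions: for finite $\Lambda\subset\mathbb{Z}^2_0$, $\Pi_\Lambda\omega=\sum_{k\in\Lambda}\langle\omega,e_k\rangle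 e_k$, identified with $(\langle\omega,e_k\rangle)_{k\in\Lambda}\in\mathbb{R}^\Lambda$. $\mathcal{FC}_P$ is the set of $F=f\circ\Pi_\Lambda$ with $\Lambda\subset\mathbb{Z}^2_0$ finite and $f\in C^\infty_P(\mathbb{R}^\Lambda)$ (smooth functions with polynomial growth together with all derivatives). For such $F$, $DF(\omega)=\sum_{j\in\Lambda}(\partial_jf)(\Pi_\Lambda\omega)\,e_j$. The distribution $\sigma_k\cdot\nabla\omega$ is defined by $\langle\sigma_k\cdot\nabla\omega,\phi\rangle=-\langle\omega,\sigma_k\cdot\nabla\phi\rangle$, $\phi\in C^\infty(\mathbb{T}^2)$, so $\langle\sigma_k\cdot\nabla\omega,DF\rangle=\sum_{j\in\Lambda}(\partial_jf)(\Pi_\Lambda\omega)\langle\sigma_k\cdot\nabla\omega,e_j\rangle$, again a cylindrical function. For $G\in L^2([0,T]\times H^{-1-},dt\otimes\mu)$, "$\langle\sigma_k\cdot\nabla\omega,DG_t\rangle$ exists in the distributional sense" means that there is $\varphi\in L^2([0,T]\times H^{-1-},dt\otimes\mu)$ such that $\int_0^T\!\int\alpha(t)\langle\sigma_k\cdot\nabla\omega,DF\rangle G_t\,d\mu\,dt=-\int_0^T\!\int\alpha(t)F\varphi_t\,d\mu\,dt$ for all $\alpha\in C([0,T],\mathbb{R})$, $F\in\mathcal{FC}_P$; one then writes $\langle\sigma_k\cdot\nabla\omega,DG_t\rangle=\varphi_t$. Drift: the Biot–Savart kernel is $K(x)=2\pi i\sum_{k\in\mathbb{Z}^2_0}\frac{k^\perp}{|k|^2}e^{2\pi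 ik\cdot x}$ (convergent in $L^p(\mathbb{T}^2)$, $1\le p<2$), and $u(\omega)(x)=\langle\omega,K(x-\cdot)\rangle$. With $\Lambda_N=\{k\in\mathbb{Z}^2_0:|k_1|\vee|k_2|\le N\}$ and $\omega_N=\Pi_{\Lambda_N}\omega$ (a smooth function), $\langle u(\omega)\cdot\nabla\omega,DF\rangle$ is defined for $F\in\mathcal{FC}_P$ as the limit in $L^2(H^{-1-},\mu)$, as $N\to\infty$, of $\langle u(\omega_N)\cdot\nabla\omega_N,DF\rangle=\int_{\mathbb{T}^2}(u(\omega_N)\cdot\nabla\omega_N)(x)\,(DF(\omega))(x)\,dx$ (this limit exists in every $L^p(\mu)$, $p\geq 1$). *)

theory Defs
  imports "HOL-Probability.Probability"
begin

text \<open>Functions on the torus are represented by functions on the plane that are 1-periodic in both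
  variables; integrals over the torus are integrals over the unit square.\<close>

section \<open>Lattice, Fourier basis and noise vector fields\<close>

definition Z20 :: "(int \<times> int) set" where
  "Z20 = UNIV - {(0, 0)}"

definition Z2plus :: "(int \<times> int) set" where
  "Z2plus = {k \<in> Z20. fst k > 0 \<or> (fst k = 0 \<and> snd k > 0)}"

definition vec_of :: "int \<times> int \<Rightarrow> real \<times> real" where
  "vec_of k = (of_int (fst k), of_int (snd k))"

definition perp :: "int \<times> int \<Rightarrow> real \<times> real" where
  "perp k = (of_int (snd k), - of_int (fst k))"

text \<open>Off \<open>Z2plus\<close> the function is only used on \<open>Z20 - Z2plus\<close>, which is the reflection of
  \<open>Z2plus\<close>.\<close>

definition efun :: "int \<times> int \<Rightarrow> real \<times> real \<Rightarrow> real" where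
  "efun k x = (if k \<in> Z2plus then sqrt 2 * cos (2 * pi * (vec_of k \<bullet> x))
               else sqrt 2 * sin (2 * pi * (vec_of k \<bullet> x)))"

definition sigma_field :: "real \<Rightarrow> int \<times> int \<Rightarrow> real \<times> real \<Rightarrow> real \<times> real" where
  "sigma_field \<gamma> k x = (1 / sqrt 2 * efun k x / norm (vec_of k) powr \<gamma>) *\<^sub>R perp k"

definition torus_integral :: "(real \<times> real \<Rightarrow> 'b::{banach, second_countable_topology}) \<Rightarrow> 'b" where
  "torus_integral g = (LINT x:cbox (0, 0) (1, 1)|lborel. g x)"

definition advect :: "(real \<times> real \<Rightarrow> real \<times> real) \<Rightarrow> (real \<times> real \<Rightarrow> real) \<Rightarrow> real \<times> real \<Rightarrow> real"
  \<comment> \<open>\<open>(v \<cdot> \<nabla>\<phi>)(x)\<close>\<close>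
  where "advect v \<phi> x = frechet_derivative \<phi> (at x) (v x)"

section \<open>Distributions on the torus and the space \<open>H\<^sup>-\<^sup>1\<^sup>-\<close>\<close>

type_synonym functional = "(real \<times> real \<Rightarrow> real) \<Rightarrow> real"

definition periodic :: "(real \<times> real \<Rightarrow> 'b) \<Rightarrow> bool" where
  "periodic \<phi> \<longleftrightarrow> (\<forall>x m. \<phi> (x + vec_of m) = \<phi> x)"

fun iter_deriv :: "(real \<times> real) list \<Rightarrow> (real \<times> real \<Rightarrow> real) \<Rightarrow> real \<times> real \<Rightarrow> real" where
  "iter_deriv [] \<phi> = \<phi>"
| "iter_deriv (v # vs) \<phi> = (\<lambda>x. frechet_derivative (iter_deriv vs \<phi>) (at x) v)"

definition test_functions :: "(real \<times> real \<Rightarrow> real) set" where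
  "test_functions = {\<phi>. periodic \<phi> \<and>
     (\<forall>vs \<in> lists Basis. \<forall>x. iter_deriv vs \<phi> differentiable (at x))}"

text \<open>A distribution is a linear functional on the test functions that is continuous for the
  \<open>C\<^sup>\<infinity>\<close> topology, i.e. bounded by a multiple of some \<open>C\<^sup>m\<close> norm. Extensionality makes the
  representation by a total function unique.\<close>

definition distributions :: "functional set" where
  "distributions = {\<omega> \<in> extensional test_functions.
     (\<forall>\<phi> \<in> test_functions. \<forall>\<psi> \<in> test_functions. \<omega> (\<lambda>x. \<phi> x + \<psi> x) = \<omega> \<phi> + \<omega> \<psi>) \<and>
     (\<forall>\<phi> \<in> test_functions. \<forall>c. \<omega> (\<lambda>x. c * \<phi> x) = c * \<omega> \<phi>) \<and>
     (\<exists>C m. \<forall>\<phi> \<in> test_functions. \<forall>B.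
        (\<forall>vs \<in> lists Basis. length vs \<le> m \<longrightarrow> (\<forall>x. \<bar>iter_deriv vs \<phi> x\<bar> \<le> B)) \<longrightarrow> \<bar>\<omega> \<phi>\<bar> \<le> C * B)}"

definition sobolev :: "real \<Rightarrow> functional set"  \<comment> \<open>zero-average distributions in \<open>H\<^sup>r\<close>\<close>
  where "sobolev r = {\<omega> \<in> distributions. \<omega> (\<lambda>x. 1) = 0 \<and>
     (\<lambda>k. norm (vec_of k) powr (2 * r) * (\<omega> (efun k))\<^sup>2) summable_on Z20}"

definition sobolev_dist :: "real \<Rightarrow> functional \<Rightarrow> functional \<Rightarrow> real" where
  "sobolev_dist r \<omega> \<omega>' =
     sqrt (\<Sum>\<^sub>\<infinity>k\<in>Z20. norm (vec_of k) powr (2 * r) * (\<omega> (efun k) - \<omega>' (efun k))\<^sup>2)"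

definition Hm1m :: "functional set" where
  "Hm1m = (\<Inter>s\<in>{0<..}. sobolev (- 1 - s))"

text \<open>The Frechet topology of the intersection: the norms are increasing in the order, so
  balls for a single norm form a neighbourhood base.\<close>

definition Hm1m_open :: "functional set \<Rightarrow> bool" where
  "Hm1m_open U \<longleftrightarrow> U \<subseteq> Hm1m \<and>
     (\<forall>\<omega>\<in>U. \<exists>s>0. \<exists>\<epsilon>>0. \<forall>\<omega>'\<in>Hm1m. sobolev_dist (- 1 - s) \<omega>' \<omega> < \<epsilon> \<longrightarrow> \<omega>' \<in> U)"

definition white_noise :: "functional measure \<Rightarrow> bool" where
  "white_noise \<mu> \<longleftrightarrow> prob_space \<mu> \<and> space \<mu> = Hm1m \<and> sets \<mu> = sigma_sets Hm1m (Collect Hm1m_open) \<and>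
     prob_space.indep_vars \<mu> (\<lambda>_. borel) (\<lambda>k \<omega>. \<omega> (efun k)) Z20 \<and>
     (\<forall>k\<in>Z20. distributed \<mu> lborel (\<lambda>\<omega>. \<omega> (efun k)) std_normal_density)"

section \<open>Cylindrical functions\<close>

text \<open>\<open>\<real>\<^sup>\<Lambda>\<close> is the set \<open>\<Lambda> \<rightarrow>\<^sub>E UNIV\<close>; a function on it is a function on all of
  \<open>int \<times> int \<Rightarrow> real\<close> whose values elsewhere are never used.\<close>

definition partial_deriv ::
  "int \<times> int \<Rightarrow> ((int \<times> int \<Rightarrow> real) \<Rightarrow> real) \<Rightarrow> (int \<times> int \<Rightarrow> real) \<Rightarrow> real" where
  "partial_deriv j f x = deriv (\<lambda>t. f (x(j := t))) (x j)"

fun iter_partial ::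
  "(int \<times> int) list \<Rightarrow> ((int \<times> int \<Rightarrow> real) \<Rightarrow> real) \<Rightarrow> (int \<times> int \<Rightarrow> real) \<Rightarrow> real" where
  "iter_partial [] f = f"
| "iter_partial (j # js) f = partial_deriv j (iter_partial js f)"

definition smooth_poly_growth :: "(int \<times> int) set \<Rightarrow> ((int \<times> int \<Rightarrow> real) \<Rightarrow> real) \<Rightarrow> bool" where
  "smooth_poly_growth \<Lambda> f \<longleftrightarrow> (\<forall>js \<in> lists \<Lambda>.
     (\<forall>j\<in>\<Lambda>. \<forall>x \<in> \<Lambda> \<rightarrow>\<^sub>E UNIV. (\<lambda>t. iter_partial js f (x(j := t))) field_differentiable (at (x j))) \<and>
     continuous_on (\<Lambda> \<rightarrow>\<^sub>E UNIV) (iter_partial js f) \<and>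
     (\<exists>C n. \<forall>x \<in> \<Lambda> \<rightarrow>\<^sub>E UNIV. \<bar>iter_partial js f x\<bar> \<le> C * (1 + L2_set x \<Lambda>) ^ n))"

text \<open>An element of \<open>FC\<^sub>P\<close> is given by a pair of a finite set \<open>\<Lambda>\<close> and a function \<open>f\<close>; the
  functions \<open>cyl \<Lambda> f\<close> and \<open>D_cyl \<Lambda> f\<close> on \<open>Hm1m\<close> are \<open>F\<close> and \<open>DF\<close>.\<close>

definition FCP :: "(int \<times> int) set \<Rightarrow> ((int \<times> int \<Rightarrow> real) \<Rightarrow> real) \<Rightarrow> bool" where
  "FCP \<Lambda> f \<longleftrightarrow> finite \<Lambda> \<and> \<Lambda> \<subseteq> Z20 \<and> smooth_poly_growth \<Lambda> f"

definition coords :: "(int \<times> int) set \<Rightarrow> functional \<Rightarrow> int \<times> int \<Rightarrow> real" where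
  "coords \<Lambda> \<omega> = (\<lambda>k\<in>\<Lambda>. \<omega> (efun k))"

definition proj :: "(int \<times> int) set \<Rightarrow> functional \<Rightarrow> real \<times> real \<Rightarrow> real" where
  "proj \<Lambda> \<omega> x = (\<Sum>k\<in>\<Lambda>. \<omega> (efun k) * efun k x)"

definition cyl :: "(int \<times> int) set \<Rightarrow> ((int \<times> int \<Rightarrow> real) \<Rightarrow> real) \<Rightarrow> functional \<Rightarrow> real" where
  "cyl \<Lambda> f \<omega> = f (coords \<Lambda> \<omega>)"

definition D_cyl ::
  "(int \<times> int) set \<Rightarrow> ((int \<times> int \<Rightarrow> real) \<Rightarrow> real) \<Rightarrow> functional \<Rightarrow> real \<times> real \<Rightarrow> real" where
  "D_cyl \<Lambda> f \<omega> x = (\<Sum>j\<in>\<Lambda>. partial_deriv j f (coords \<Lambda> \<omega>) * efun j x)"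

definition sigma_grad :: "real \<Rightarrow> int \<times> int \<Rightarrow> functional \<Rightarrow> functional"
  \<comment> \<open>the distribution \<open>\<sigma>\<^sub>k \<cdot> \<nabla>\<omega>\<close>\<close>
  where "sigma_grad \<gamma> k \<omega> = (\<lambda>\<phi>\<in>test_functions. - \<omega> (advect (sigma_field \<gamma> k) \<phi>))"

section \<open>Square integrable functions and distributional derivatives\<close>

definition L2_space :: "'a measure \<Rightarrow> ('a \<Rightarrow> real) \<Rightarrow> bool" where
  "L2_space M g \<longleftrightarrow> g \<in> borel_measurable M \<and> integrable M (\<lambda>x. (g x)\<^sup>2)"

definition L2_tendsto :: "'a measure \<Rightarrow> (nat \<Rightarrow> 'a \<Rightarrow> real) \<Rightarrow> ('a \<Rightarrow> real) \<Rightarrow> bool" where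
  "L2_tendsto M X Y \<longleftrightarrow> (\<forall>n. L2_space M (X n)) \<and> L2_space M Y \<and>
     (\<lambda>n. LINT x|M. (X n x - Y x)\<^sup>2) \<longlonglongrightarrow> 0"

abbreviation time_measure :: "real \<Rightarrow> real measure" where
  "time_measure T \<equiv> restrict_space lborel {0..T}"

definition Linf_L2 :: "real \<Rightarrow> 'a measure \<Rightarrow> (real \<Rightarrow> 'a \<Rightarrow> real) \<Rightarrow> bool" where
  "Linf_L2 T \<mu> \<rho> \<longleftrightarrow> case_prod \<rho> \<in> borel_measurable (time_measure T \<Otimes>\<^sub>M \<mu>) \<and>
     (\<exists>C. AE t in time_measure T. L2_space \<mu> (\<rho> t) \<and> (LINT \<omega>|\<mu>. (\<rho> t \<omega>)\<^sup>2) \<le> C)"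

definition has_distr_deriv ::
  "real \<Rightarrow> functional measure \<Rightarrow> real \<Rightarrow> int \<times> int \<Rightarrow>
     (real \<Rightarrow> functional \<Rightarrow> real) \<Rightarrow> (real \<Rightarrow> functional \<Rightarrow> real) \<Rightarrow> bool"
  \<comment> \<open>\<open>\<langle>\<sigma>\<^sub>k \<cdot> \<nabla>\<omega>, DG\<^sub>t\<rangle> = \<phi>\<^sub>t\<close>\<close>
  where "has_distr_deriv T \<mu> \<gamma> k G \<phi> \<longleftrightarrow>
     L2_space (time_measure T \<Otimes>\<^sub>M \<mu>) (case_prod G) \<and>
     L2_space (time_measure T \<Otimes>\<^sub>M \<mu>) (case_prod \<phi>) \<and>
     (\<forall>\<alpha> \<Lambda> f. continuous_on {0..T} \<alpha> \<longrightarrow> FCP \<Lambda> f \<longrightarrow>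
        (LINT t|time_measure T. LINT \<omega>|\<mu>. \<alpha> t * sigma_grad \<gamma> k \<omega> (D_cyl \<Lambda> f \<omega>) * G t \<omega>) =
        - (LINT t|time_measure T. LINT \<omega>|\<mu>. \<alpha> t * cyl \<Lambda> f \<omega> * \<phi> t \<omega>))"

section \<open>Drift\<close>

definition square :: "nat \<Rightarrow> (int \<times> int) set" where
  "square N = {k \<in> Z20. max \<bar>fst k\<bar> \<bar>snd k\<bar> \<le> int N}"

text \<open>The Fourier series of the kernel is not unconditionally convergent in \<open>L\<^sup>p\<close> (its
  coefficients are not square summable), so it is summed along the squares \<open>square N\<close>. The kernel
  is real although the series is written with complex exponentials; it is determined up to
  null sets.\<close>

definition biot_savart_partial :: "(real \<times> real \<Rightarrow> real) \<Rightarrow> nat \<Rightarrow> real \<times> real \<Rightarrow> complex"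
  \<comment> \<open>for \<open>c = fst\<close> and \<open>c = snd\<close>: the components of the partial sum\<close>
  where "biot_savart_partial c N x = 2 * of_real pi * \<i> *
     (\<Sum>k\<in>square N. of_real (c (perp k) / (norm (vec_of k))\<^sup>2) *
                 exp (2 * of_real pi * \<i> * of_real (vec_of k \<bullet> x)))"

definition biot_savart_kernel :: "(real \<times> real \<Rightarrow> real \<times> real) \<Rightarrow> bool" where
  "biot_savart_kernel K \<longleftrightarrow> K \<in> borel_measurable borel \<and> periodic K \<and>
     (\<forall>p. 1 \<le> p \<and> p < 2 \<longrightarrow>
        set_integrable lborel (cbox (0, 0) (1, 1)) (\<lambda>x. norm (K x) powr p) \<and>
        (\<forall>c\<in>{fst, snd}.
           (\<lambda>N. torus_integral (\<lambda>x. cmod (biot_savart_partial c N x - of_real (c (K x))) powr p))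
             \<longlonglongrightarrow> 0))"

definition velocity ::
  "(real \<times> real \<Rightarrow> real \<times> real) \<Rightarrow> (real \<times> real \<Rightarrow> real) \<Rightarrow> real \<times> real \<Rightarrow> real \<times> real" where
  "velocity K w x = torus_integral (\<lambda>y. w y *\<^sub>R K (x - y))"

definition drift_approx ::
  "(real \<times> real \<Rightarrow> real \<times> real) \<Rightarrow> (int \<times> int) set \<Rightarrow> ((int \<times> int \<Rightarrow> real) \<Rightarrow> real) \<Rightarrow>
     nat \<Rightarrow> functional \<Rightarrow> real" where
  "drift_approx K \<Lambda> f N \<omega> =
     (let \<omega>\<^sub>N = proj (square N) \<omega> in
      torus_integral (\<lambda>x. advect (velocity K \<omega>\<^sub>N) \<omega>\<^sub>N x * D_cyl \<Lambda> f \<omega> x))"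

definition drift ::
  "functional measure \<Rightarrow> (real \<times> real \<Rightarrow> real \<times> real) \<Rightarrow> (int \<times> int) set \<Rightarrow>
     ((int \<times> int \<Rightarrow> real) \<Rightarrow> real) \<Rightarrow> functional \<Rightarrow> real"
  \<comment> \<open>some representative of the limit in \<open>L\<^sup>2(\<mu>)\<close>, \<open>\<langle>u(\<omega>) \<cdot> \<nabla>\<omega>, DF\<rangle>\<close>\<close>
  where "drift \<mu> K \<Lambda> f = (SOME B. L2_tendsto \<mu> (drift_approx K \<Lambda> f) B)"

end

theory Submission
  imports Defs "HOL-Real_Asymp.Real_Asymp"
begin

text \<open>The pair \<open>(\<rho>, (\<phi>\<^sub>k)\<^sub>k)\<close> is sought as one element \<open>u\<close> of the \<open>L\<^sup>2\<close> space over time, modes and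
  \<open>\<mu>\<close>. The bounds on \<open>u\<close> (\<open>\<parallel>\<rho>\<^sub>t\<parallel> \<le> \<parallel>\<rho>\<^sub>0\<parallel>\<close> and the gradient estimate) define a bounded closed convex set,
  and the weak equation and the relation between \<open>\<phi>\<^sub>k\<close> and \<open>\<rho>\<close> are linear constraints on \<open>u\<close>. By a minimax
  argument all constraints can be met at once as soon as, for every finite linear combination of them, some admissible
  element is at least as large as required. Linear combinations of test functions are again test functions
  \<open>\<phi>\<close> in time and \<open>\<omega>\<close>; since \<open>\<sigma>\<^sub>k \<cdot> \<nabla>\<omega>\<close> and the drift are antisymmetric, \<open>\<phi>\<close> itself, multiplied by a suitable
  function of time, is such an element. Antisymmetry is Gaussian integration by parts in Fourier
  coordinates: both operators are divergence free vector fields tangent to spheres. The drift is an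
  \<open>L\<^sup>2\<close> limit because its symmetrised coefficients are square summable, and for \<open>\<gamma> > 2\<close> the norms of
  \<open>\<langle>\<sigma>\<^sub>k \<cdot> \<nabla>\<omega>, DF\<rangle>\<close> are square summable in \<open>k\<close>.\<close>

subsection \<open>Square integrable functions\<close>

text \<open>Cylindrical functions are not stable under the dynamics: transport by \<sigma>_k couples
  a mode j to the modes k + j and k - j, and the drift of a cylindrical function in general involves
  infinitely many modes. So no finite set of modes carries a closed equation, and antisymmetry is
  available only as an identity between two cylindrical functions. Minimax suits this obstacle,
  because it only ever pairs test functions with test functions. Its analytic input is completeness
  of L2: the solution is the limit of elements of almost minimal norm in relaxed problems, and the
  parallelogram law makes that limit a strong one. The weight in time is tuned to the energy
  balance: the squared norm of a solution should lose its gradient energy per unit time, which is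
  why the gradient estimate comes out with constant one. The condition \<gamma> > 2 enters at a
  single point: the squared norm of the transported test function is bounded by a multiple of |k|^(2
  - 2 \<gamma>), and such a sum over the planar lattice converges only for exponents below
  -2.\<close>

definition l2_inner :: "'a measure \<Rightarrow> ('a \<Rightarrow> real) \<Rightarrow> ('a \<Rightarrow> real) \<Rightarrow> real" where
  "l2_inner M f g = (LINT x|M. f x * g x)"

lemma L2_measurable: "L2_space M f \<Longrightarrow> f \<in> borel_measurable M"
  by (simp add: L2_space_def)

lemma L2_mult_integrable:
  assumes "L2_space M f" "L2_space M g"
  shows "integrable M (\<lambda>x. f x * g x)"
proof (rule Bochner_Integration.integrable_bound)
  show "integrable M (\<lambda>x. (f x)\<^sup>2 + (g x)\<^sup>2)" using assms by (auto simp: L2_space_def)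
  show "(\<lambda>x. f x * g x) \<in> borel_measurable M" using assms by (auto simp: L2_space_def)
  have "\<bar>a * b\<bar> \<le> \<bar>a\<^sup>2 + b\<^sup>2\<bar>" for a b :: real
  proof -
    have "0 \<le> (\<bar>a\<bar> - \<bar>b\<bar>)\<^sup>2" by simp
    then have "2 * (\<bar>a\<bar> * \<bar>b\<bar>) \<le> a\<^sup>2 + b\<^sup>2" by (simp add: power2_diff)
    moreover have "0 \<le> \<bar>a\<bar> * \<bar>b\<bar>" by simp
    ultimately have "\<bar>a\<bar> * \<bar>b\<bar> \<le> a\<^sup>2 + b\<^sup>2" by linarith
    then show ?thesis by (simp add: abs_mult)
  qed
  then show "AE x in M. norm (f x * g x) \<le> norm ((f x)\<^sup>2 + (g x)\<^sup>2)" by simp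
qed

lemma L2_scale: "L2_space M f \<Longrightarrow> L2_space M (\<lambda>x. c * f x)"
  by (auto simp: L2_space_def power_mult_distrib)

lemma L2_add:
  assumes "L2_space M f" "L2_space M g" shows "L2_space M (\<lambda>x. f x + g x)"
  using assms L2_mult_integrable[OF assms]
  by (auto simp: L2_space_def power2_sum mult.assoc)

lemma L2_diff:
  assumes "L2_space M f" "L2_space M g" shows "L2_space M (\<lambda>x. f x - g x)"
  using L2_add[OF assms(1) L2_scale[OF assms(2), of "-1"]] by simp

lemma L2_zero: "L2_space M (\<lambda>x. 0)"
  by (simp add: L2_space_def)

lemma L2_sum:
  assumes "\<And>i. i \<in> A \<Longrightarrow> L2_space M (f i)" shows "L2_space M (\<lambda>x. \<Sum>i\<in>A. f i x)"
proof (cases "finite A")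
  case True
  from this assms show ?thesis
    by (induction A rule: finite_induct) (auto intro: L2_add L2_zero)
qed (simp add: L2_zero)

lemma L2_bounded_mult:
  assumes "L2_space M f" "w \<in> borel_measurable M" "\<And>x. x \<in> space M \<Longrightarrow> \<bar>w x\<bar> \<le> c"
  shows "L2_space M (\<lambda>x. w x * f x)"
  unfolding L2_space_def
proof
  have m: "f \<in> borel_measurable M" using assms(1) by (rule L2_measurable)
  show "(\<lambda>x. w x * f x) \<in> borel_measurable M" using m assms(2) by measurable
  show "integrable M (\<lambda>x. (w x * f x)\<^sup>2)"
  proof (rule Bochner_Integration.integrable_bound)
    show "integrable M (\<lambda>x. c\<^sup>2 * (f x)\<^sup>2)" using assms(1) by (auto simp: L2_space_def)
    show "(\<lambda>x. (w x * f x)\<^sup>2) \<in> borel_measurable M" using m assms(2) by measurable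
    show "AE x in M. norm ((w x * f x)\<^sup>2) \<le> norm (c\<^sup>2 * (f x)\<^sup>2)"
    proof (rule AE_I2)
      fix x assume "x \<in> space M"
      from power_mono[OF assms(3)[OF this], of 2] show "norm ((w x * f x)\<^sup>2) \<le> norm (c\<^sup>2 * (f x)\<^sup>2)"
        by (simp add: power_mult_distrib mult_right_mono)
    qed
  qed
qed

lemma l2_inner_commute: "l2_inner M f g = l2_inner M g f"
  by (simp add: l2_inner_def mult.commute)

lemma l2_inner_nonneg: "0 \<le> l2_inner M f f"
  by (simp add: l2_inner_def)

lemma l2_inner_add:
  assumes "L2_space M f" "L2_space M g" "L2_space M h"
  shows "l2_inner M (\<lambda>x. f x + g x) h = l2_inner M f h + l2_inner M g h"
  using L2_mult_integrable[OF assms(1,3)] L2_mult_integrable[OF assms(2,3)]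
  by (simp add: l2_inner_def distrib_right)

lemma l2_inner_diff:
  assumes "L2_space M f" "L2_space M g" "L2_space M h"
  shows "l2_inner M (\<lambda>x. f x - g x) h = l2_inner M f h - l2_inner M g h"
  using L2_mult_integrable[OF assms(1,3)] L2_mult_integrable[OF assms(2,3)]
  by (simp add: l2_inner_def left_diff_distrib)

lemma l2_inner_scale: "l2_inner M (\<lambda>x. c * f x) h = c * l2_inner M f h"
  by (simp add: l2_inner_def mult.assoc)

lemma l2_inner_lincomb:
  assumes "L2_space M f" "L2_space M g" "L2_space M h"
  shows "l2_inner M (\<lambda>x. a * f x + b * g x) h = a * l2_inner M f h + b * l2_inner M g h"
  using l2_inner_add[OF L2_scale[OF assms(1), of a] L2_scale[OF assms(2), of b] assms(3)]
  by (simp add: l2_inner_scale)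

lemma l2_inner_lincomb_sq:
  assumes f: "L2_space M f" and g: "L2_space M g"
  shows "l2_inner M (\<lambda>x. a * f x + b * g x) (\<lambda>x. a * f x + b * g x) =
    a\<^sup>2 * l2_inner M f f + 2 * a * b * l2_inner M f g + b\<^sup>2 * l2_inner M g g"
proof -
  let ?h = "\<lambda>x. a * f x + b * g x"
  have h: "L2_space M ?h" by (intro L2_add L2_scale f g)
  have "l2_inner M ?h ?h = a * l2_inner M f ?h + b * l2_inner M g ?h"
    by (rule l2_inner_lincomb[OF f g h])
  also have "l2_inner M f ?h = a * l2_inner M f f + b * l2_inner M f g"
    using l2_inner_lincomb[OF f g f, of a b] by (simp add: l2_inner_commute)
  also have "l2_inner M g ?h = a * l2_inner M f g + b * l2_inner M g g"
    using l2_inner_lincomb[OF f g g, of a b] by (simp add: l2_inner_commute)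
  finally show ?thesis by (simp add: algebra_simps power2_eq_square)
qed

lemma l2_Cauchy_Schwarz:
  assumes f: "L2_space M f" and g: "L2_space M g"
  shows "(l2_inner M f g)\<^sup>2 \<le> l2_inner M f f * l2_inner M g g"
proof -
  define a b c where "a = l2_inner M f f" and "b = l2_inner M f g" and "c = l2_inner M g g"
  have q: "0 \<le> a * s\<^sup>2 + 2 * s * t * b + t\<^sup>2 * c" for s t
    using l2_inner_nonneg[of M "\<lambda>x. s * f x + t * g x"]
    by (subst (asm) l2_inner_lincomb_sq[OF f g]) (simp add: a_def b_def c_def algebra_simps)
  have c0: "0 \<le> c" by (simp add: c_def l2_inner_nonneg)
  have "b\<^sup>2 \<le> a * c"
  proof (cases "c = 0")
    case True
    have "b = 0"
    proof (rule ccontr)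
      assume "b \<noteq> 0"
      \<comment> \<open>With c = 0 the form is a + 2 t b, and this t gives it the value -1.\<close>
      then show False using q[of 1 "- (a + 1) / (2 * b)"] True by (simp add: field_simps)
    qed
    then show ?thesis using True by simp
  next
    case False
    then have "0 < c" using c0 by simp
    have "0 \<le> c * (a * c - b\<^sup>2)" using q[of c "-b"] by (simp add: power2_eq_square algebra_simps)
    then show ?thesis using \<open>0 < c\<close> by (simp add: zero_le_mult_iff)
  qed
  then show ?thesis by (simp add: a_def b_def c_def)
qed

text \<open>The midpoint is written with 1 - 1/2, which makes it literally one of the convex
  combinations under which the set C of \<open>minimax_L2\<close> is closed.\<close>

lemma l2_parallelogram:
  assumes f: "L2_space M f" and g: "L2_space M g"
  shows "l2_inner M (\<lambda>x. f x - g x) (\<lambda>x. f x - g x) = 2 * l2_inner M f f + 2 * l2_inner M g g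
    - 4 * l2_inner M (\<lambda>x. (1 - 1/2) * f x + 1/2 * g x) (\<lambda>x. (1 - 1/2) * f x + 1/2 * g x)"
  using l2_inner_lincomb_sq[OF f g, of 1 "-1"] l2_inner_lincomb_sq[OF f g, of "1-1/2" "1/2"]
  by (simp add: power2_eq_square)

lemma l2_norm_sq_add_le:
  assumes f: "L2_space M f" and g: "L2_space M g"
  shows "l2_inner M (\<lambda>x. f x + g x) (\<lambda>x. f x + g x) \<le> 2 * l2_inner M f f + 2 * l2_inner M g g"
  using l2_inner_lincomb_sq[OF f g, of 1 1] l2_inner_lincomb_sq[OF f g, of 1 "-1"]
    l2_inner_nonneg[of M "\<lambda>x. 1 * f x + (-1) * g x"]
  by simp

text \<open>Riesz-Fischer: along a fast subsequence the squared increments, weighted with 2^k, still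
  have a finite total, so the subsequence converges almost everywhere. Fatou's lemma turns the
  pointwise limit into an L2 limit of the whole sequence.\<close>

lemma L2_complete:
  fixes u :: "nat \<Rightarrow> 'a \<Rightarrow> real"
  assumes L2: "\<And>n. L2_space M (u n)"
    and Cauchy: "\<And>e. e > 0 \<Longrightarrow> \<exists>N. \<forall>m\<ge>N. \<forall>n\<ge>N. (LINT x|M. (u m x - u n x)\<^sup>2) \<le> e"
  shows "\<exists>v. L2_tendsto M u v"
proof -
  let ?d = "\<lambda>m n. LINT x|M. (u m x - u n x)\<^sup>2"
  have [measurable]: "\<And>n. u n \<in> borel_measurable M" using L2 by (rule L2_measurable)
  have int: "integrable M (\<lambda>x. (u m x - u n x)\<^sup>2)" for m n
    using L2_diff[OF L2[of m] L2[of n]] by (simp add: L2_space_def)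
  have "\<exists>N. \<forall>k. \<forall>m\<ge>N k. \<forall>n\<ge>N k. ?d m n \<le> (1/8)^k"
    using Cauchy[of "(1/8)^_"] by (intro choice) auto
  then obtain N :: "nat \<Rightarrow> nat" where N: "\<And>k m n. m \<ge> N k \<Longrightarrow> n \<ge> N k \<Longrightarrow> ?d m n \<le> (1/8)^k" by blast
  \<comment> \<open>The sum up to m lies above every \<open>N k\<close> with k at most m, so
    \<open>r m\<close> can be used at all earlier levels.\<close>
  define r where "r k = (\<Sum>i\<le>k. N i)" for k
  have rge: "N k \<le> r m" if "k \<le> m" for k m
    unfolding r_def using that by (intro member_le_sum) auto
  \<comment> \<open>Against 8^-k the weight 2^k leaves 4^-k in the mean, and pointwise it yields
    increments of order 2^(-k/2), which are summable.\<close>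
  let ?D = "\<lambda>k x. ennreal (2^k * (u (r (Suc k)) x - u (r k) x)\<^sup>2)"
  have "(\<integral>\<^sup>+x. (\<Sum>k. ?D k x) \<partial>M) = (\<Sum>k. \<integral>\<^sup>+x. ?D k x \<partial>M)"
    by (rule nn_integral_suminf) measurable
  also have "\<dots> \<le> (\<Sum>k. ennreal ((1/4)^k))"
  proof (rule suminf_le)
    fix k
    have "(\<integral>\<^sup>+x. ?D k x \<partial>M) = ennreal (2^k * ?d (r (Suc k)) (r k))"
      using int by (subst nn_integral_eq_integral) auto
    also have "\<dots> \<le> ennreal (2^k * (1/8)^k)"
      using N[of k "r (Suc k)" "r k"] rge[of k "Suc k"] rge[of k k] by (intro ennreal_leI mult_left_mono) auto
    also have "(2::real)^k * (1/8)^k = (1/4)^k" by (simp add: power_mult_distrib[symmetric])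
    finally show "(\<integral>\<^sup>+x. ?D k x \<partial>M) \<le> ennreal ((1/4)^k)" .
  qed auto
  also have "\<dots> < \<infinity>"
    by (subst suminf_ennreal2) (auto intro!: summable_geometric)
  finally have fin: "(\<integral>\<^sup>+x. (\<Sum>k. ?D k x) \<partial>M) \<noteq> \<infinity>" by simp
  have measD: "(\<lambda>x. \<Sum>k. ?D k x) \<in> borel_measurable M"
    by (intro borel_measurable_suminf_order) measurable
  have aeS: "AE x in M. (\<Sum>k. ?D k x) \<noteq> \<infinity>"
    using nn_integral_PInf_AE[OF measD fin] .
  have "convergent (\<lambda>k. u (r k) x)" if *: "(\<Sum>k. ?D k x) \<noteq> \<infinity>" for x
  proof -
    have "\<exists>S\<ge>0. X = ennreal S" if "X \<noteq> \<infinity>" for X :: ennreal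
      using that by (cases X) auto
    note this[OF *]
    then obtain S where S: "0 \<le> S" "(\<Sum>k. ?D k x) = ennreal S" by (elim exE conjE) (rule that)
    have b: "\<bar>u (r (Suc k)) x - u (r k) x\<bar> \<le> sqrt S * (1 / sqrt 2)^k" for k
    proof -
      have "sum (\<lambda>k. ?D k x) {k} \<le> (\<Sum>k. ?D k x)"
        by (rule sum_le_suminf[OF summableI]) (rule finite.intros | rule zero_le)+
      then have "?D k x \<le> ennreal S" unfolding S(2) by simp
      then have "2^k * (u (r (Suc k)) x - u (r k) x)\<^sup>2 \<le> S"
        using S(1) by (subst (asm) ennreal_le_iff) auto
      then have "sqrt (2^k * (u (r (Suc k)) x - u (r k) x)\<^sup>2) \<le> sqrt S" by simp
      then have "sqrt 2 ^ k * \<bar>u (r (Suc k)) x - u (r k) x\<bar> \<le> sqrt S"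
        by (simp only: real_sqrt_mult real_sqrt_abs) (simp add: real_sqrt_power)
      then show ?thesis by (simp add: field_simps)
    qed
    have "summable (\<lambda>k. sqrt S * (1 / sqrt 2)^k)"
      by (intro summable_mult summable_geometric) auto
    then have "summable (\<lambda>k. u (r (Suc k)) x - u (r k) x)"
      by (rule summable_comparison_test[rotated]) (use b in auto)
    then have "convergent (\<lambda>n. \<Sum>k<n. u (r (Suc k)) x - u (r k) x)"
      by (simp add: summable_iff_convergent)
    then have "convergent (\<lambda>n. (u (r n) x - u (r 0) x) + u (r 0) x)"
      by (intro convergent_add convergent_const) (simp add: sum_lessThan_telescope[of "\<lambda>k. u (r k) x"])
    then show "convergent (\<lambda>k. u (r k) x)" by simp
  qed
  then have ae: "AE x in M. convergent (\<lambda>k. u (r k) x)"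
    using aeS by (elim eventually_mono) blast
  define v where "v x = lim (\<lambda>k. u (r k) x)" for x
  have [measurable]: "v \<in> borel_measurable M"
    unfolding v_def by (rule borel_measurable_lim_metric) measurable
  have fatou: "(\<integral>\<^sup>+x. ennreal ((u n x - v x)\<^sup>2) \<partial>M) \<le> ennreal ((1/8)^k)" if "n \<ge> N k" for n k
  proof -
    have "(\<integral>\<^sup>+x. ennreal ((u n x - v x)\<^sup>2) \<partial>M) = (\<integral>\<^sup>+x. liminf (\<lambda>j. ennreal ((u n x - u (r j) x)\<^sup>2)) \<partial>M)"
    proof (rule nn_integral_cong_AE, use ae in eventually_elim)
      fix x assume "convergent (\<lambda>k. u (r k) x)"
      then have "(\<lambda>k. u (r k) x) \<longlonglongrightarrow> v x" by (simp add: v_def convergent_LIMSEQ_iff)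
      then have "(\<lambda>j. ennreal ((u n x - u (r j) x)\<^sup>2)) \<longlonglongrightarrow> ennreal ((u n x - v x)\<^sup>2)"
        by (intro tendsto_intros) auto
      then show "ennreal ((u n x - v x)\<^sup>2) = liminf (\<lambda>j. ennreal ((u n x - u (r j) x)\<^sup>2))"
        by (intro lim_imp_Liminf[symmetric]) auto
    qed
    also have "\<dots> \<le> liminf (\<lambda>j. \<integral>\<^sup>+x. ennreal ((u n x - u (r j) x)\<^sup>2) \<partial>M)"
      by (rule nn_integral_liminf) measurable
    also have "\<dots> \<le> ennreal ((1/8)^k)"
    proof -
      have "\<forall>\<^sub>F j in sequentially. (\<integral>\<^sup>+x. ennreal ((u n x - u (r j) x)\<^sup>2) \<partial>M) \<le> ennreal ((1/8)^k)"
        using eventually_ge_at_top[of k]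
      proof eventually_elim
        case (elim j)
        then show ?case using int N[of k n "r j"] that rge[of k j]
          by (subst nn_integral_eq_integral) (auto intro!: ennreal_leI)
      qed
      then have "liminf (\<lambda>j. \<integral>\<^sup>+x. ennreal ((u n x - u (r j) x)\<^sup>2) \<partial>M) \<le> liminf (\<lambda>j::nat. ennreal ((1/8)^k))"
        by (rule Liminf_mono)
      then show ?thesis by (simp add: Liminf_const)
    qed
    finally show ?thesis .
  qed
  have diffL2: "L2_space M (\<lambda>x. u n x - v x)" if "n \<ge> N k" for n k
    unfolding L2_space_def
  proof
    show "(\<lambda>x. u n x - v x) \<in> borel_measurable M" by measurable
    show "integrable M (\<lambda>x. (u n x - v x)\<^sup>2)"
      using fatou[OF that] by (intro integrableI_bounded) (auto simp: le_less_trans)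
  qed
  have vL2: "L2_space M v"
    using L2_diff[OF L2[of "N 0"] diffL2[of 0 "N 0"]] by simp
  have le: "(LINT x|M. (u n x - v x)\<^sup>2) \<le> (1/8)^k" if "n \<ge> N k" for n k
    using fatou[OF that] diffL2[OF that]
    by (subst (asm) nn_integral_eq_integral) (auto simp: L2_space_def)
  have "(\<lambda>n. LINT x|M. (u n x - v x)\<^sup>2) \<longlonglongrightarrow> 0"
  proof (rule LIMSEQ_I)
    fix e :: real assume "e > 0"
    then obtain k where k: "(1/8::real)^k < e" using real_arch_pow_inv[of e "1/8"] by auto
    have "norm ((LINT x|M. (u n x - v x)\<^sup>2) - 0) < e" if "n \<ge> N k" for n
      using le[OF that] k by (simp add: integral_nonneg_AE)
    then show "\<exists>no. \<forall>n\<ge>no. norm ((LINT x|M. (u n x - v x)\<^sup>2) - 0) < e" by blast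
  qed
  then show ?thesis using L2 vL2 by (auto simp: L2_tendsto_def)
qed

subsection \<open>A minimax principle\<close>

text \<open>\<open>dom\<close> says that no linear functional strictly separates l from the convex
  set of value vectors of the elements of C. In finite dimension this forces distance zero. Taking
  the residual itself as the functional r proves it by quadratic descent, with near-minimisers in
  place of a nearest point.\<close>

lemma minimax_approximate:
  fixes T :: "'i \<Rightarrow> 'a \<Rightarrow> real"
  assumes C_L2: "\<And>u. u \<in> C \<Longrightarrow> L2_space M u"
    and bdd: "\<And>u. u \<in> C \<Longrightarrow> l2_inner M u u \<le> B"
    and conv: "\<And>u v s. u \<in> C \<Longrightarrow> v \<in> C \<Longrightarrow> 0 \<le> s \<Longrightarrow> s \<le> 1 \<Longrightarrow> (\<lambda>x. (1 - s) * u x + s * v x) \<in> C"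
    and T_L2: "\<And>i. i \<in> J \<Longrightarrow> L2_space M (T i)"
    and dom: "\<And>r e. e > 0 \<Longrightarrow> \<exists>v\<in>C. (\<Sum>i\<in>J. r i * l2_inner M v (T i)) \<ge> (\<Sum>i\<in>J. r i * l i) - e"
    and J: "finite J" and e: "e > 0"
  shows "\<exists>u\<in>C. \<forall>i\<in>J. \<bar>l2_inner M u (T i) - l i\<bar> \<le> e"
proof -
  define res where "res u = (\<Sum>i\<in>J. (l i - l2_inner M u (T i))\<^sup>2)" for u
  define \<delta> where "\<delta> = Inf (res ` C)"
  obtain u0 where "u0 \<in> C" using dom[of 1] by auto
  have res0: "0 \<le> res u" for u by (simp add: res_def sum_nonneg)
  have bb: "bdd_below (res ` C)" using res0 by (intro bdd_belowI[of _ 0]) auto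
  have \<delta>le: "\<delta> \<le> res u" if "u \<in> C" for u
    unfolding \<delta>_def using that bb by (intro cInf_lower) auto
  \<comment> \<open>A bound for the squared diameter of the set of value vectors: coordinate i
    contributes at most 2 + 2 times B |T i|^2.\<close>
  define M0 where "M0 = (\<Sum>i\<in>J. 4 * B * l2_inner M (T i) (T i))"
  have M0: "(\<Sum>i\<in>J. (l2_inner M v (T i) - l2_inner M u (T i))\<^sup>2) \<le> M0" if "u \<in> C" "v \<in> C" for u v
    unfolding M0_def
  proof (rule sum_mono)
    fix i assume i: "i \<in> J"
    have *: "(l2_inner M w (T i))\<^sup>2 \<le> B * l2_inner M (T i) (T i)" if "w \<in> C" for w
      using l2_Cauchy_Schwarz[OF C_L2[OF that] T_L2[OF i]]
        mult_right_mono[OF bdd[OF that] l2_inner_nonneg[of M "T i"]] by linarith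
    have "(a - b)\<^sup>2 \<le> 2 * a\<^sup>2 + 2 * b\<^sup>2" for a b :: real
      using zero_le_power2[of "a + b"] by (simp add: power2_sum power2_diff)
    from this[of "l2_inner M v (T i)" "l2_inner M u (T i)"] *[OF \<open>u \<in> C\<close>] *[OF \<open>v \<in> C\<close>]
    show "(l2_inner M v (T i) - l2_inner M u (T i))\<^sup>2 \<le> 4 * B * l2_inner M (T i) (T i)"
      by linarith
  qed
  \<comment> \<open>moving a near-minimiser of the residual towards a dominating element decreases the residual\<close>
  have key: "2 * \<delta> \<le> s * (1 + M0)" if s: "0 < s" "s \<le> 1/2" for s
  proof -
    \<comment> \<open>The error s^2, used both for near minimality and for domination, has the order
      of the quadratic term of the descent, while the gain 2 s \<delta> is of first order in
      s.\<close>
    have s2: "s\<^sup>2 > 0" using s by simp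
    have ne: "res ` C \<noteq> {}" using \<open>u0 \<in> C\<close> by auto
    obtain u where u: "u \<in> C" "res u < \<delta> + s\<^sup>2"
      using cInf_lessD[OF ne, of "\<delta> + s\<^sup>2"] s2 unfolding \<delta>_def by auto
    define r where "r i = l i - l2_inner M u (T i)" for i
    obtain v where v: "v \<in> C" "(\<Sum>i\<in>J. r i * l2_inner M v (T i)) \<ge> (\<Sum>i\<in>J. r i * l i) - s\<^sup>2"
      using dom[OF s2] by blast
    define d where "d i = l2_inner M v (T i) - l2_inner M u (T i)" for i
    have "(\<Sum>i\<in>J. r i * d i) - res u \<ge> - s\<^sup>2"
    proof -
      have "(\<Sum>i\<in>J. r i * d i) - res u = (\<Sum>i\<in>J. r i * l2_inner M v (T i)) - (\<Sum>i\<in>J. r i * l i)"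
        unfolding res_def by (simp add: sum_subtractf[symmetric] d_def r_def power2_eq_square algebra_simps)
      then show ?thesis using v(2) by linarith
    qed
    then have rd: "s * (\<Sum>i\<in>J. r i * d i) \<ge> s * (res u - s\<^sup>2)" using s by (intro mult_left_mono) auto
    let ?w = "\<lambda>x. (1 - s) * u x + s * v x"
    have w: "?w \<in> C" using conv[OF u(1) v(1)] s by simp
    have "l i - l2_inner M ?w (T i) = r i - s * d i" if "i \<in> J" for i
      using l2_inner_lincomb[OF C_L2[OF u(1)] C_L2[OF v(1)] T_L2[OF that], of "1 - s" s]
      by (simp add: r_def d_def algebra_simps)
    then have "res ?w = (\<Sum>i\<in>J. (r i - s * d i)\<^sup>2)" by (simp add: res_def)
    also have "\<dots> = res u - 2 * (s * (\<Sum>i\<in>J. r i * d i)) + s\<^sup>2 * (\<Sum>i\<in>J. (d i)\<^sup>2)"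
      by (simp add: res_def r_def[symmetric] power2_diff sum.distrib sum_subtractf sum_distrib_left
          power_mult_distrib algebra_simps)
    also have "\<dots> \<le> res u - 2 * (s * (res u - s\<^sup>2)) + s\<^sup>2 * M0"
      using rd M0[OF u(1) v(1)] s by (intro add_mono diff_mono mult_left_mono) (auto simp: d_def)
    also have "\<dots> = (1 - 2 * s) * res u + 2 * s * s\<^sup>2 + s\<^sup>2 * M0" by (simp add: algebra_simps)
    also have "\<dots> \<le> (1 - 2 * s) * (\<delta> + s\<^sup>2) + 2 * s * s\<^sup>2 + s\<^sup>2 * M0"
      using s u(2) by (intro add_right_mono mult_left_mono) auto
    finally have "\<delta> \<le> (1 - 2 * s) * (\<delta> + s\<^sup>2) + 2 * s * s\<^sup>2 + s\<^sup>2 * M0" using \<delta>le[OF w] by linarith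
    then have "s * (2 * \<delta>) \<le> s * (s * (1 + M0))" by (simp add: algebra_simps power2_eq_square)
    then show ?thesis using s by simp
  qed
  have "\<delta> \<le> 0"
  proof (rule ccontr)
    assume "\<not> \<delta> \<le> 0"
    then have d: "\<delta> > 0" by simp
    have M00: "0 \<le> M0" using M0[OF \<open>u0 \<in> C\<close> \<open>u0 \<in> C\<close>] by simp
    \<comment> \<open>With this s the inequality \<open>key\<close> gives 2 \<delta> \<le>
      \<delta>.\<close>
    define s where "s = min (1/2) (\<delta> / (1 + M0))"
    have s1: "0 < s" using d M00 by (simp add: s_def)
    have s2: "s \<le> 1/2" unfolding s_def by (rule min.cobounded1)
    have s3: "s \<le> \<delta> / (1 + M0)" unfolding s_def by (rule min.cobounded2)
    have "s * (1 + M0) \<le> \<delta>" using s3 M00 by (simp add: field_simps)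
    then show False using key[OF s1 s2] d by linarith
  qed
  have "res ` C \<noteq> {}" using \<open>u0 \<in> C\<close> by auto
  then obtain u where u: "u \<in> C" "res u < e\<^sup>2"
    using cInf_lessD[of "res ` C" "e\<^sup>2"] \<open>\<delta> \<le> 0\<close> e unfolding \<delta>_def[symmetric]
    by (metis (no_types, lifting) imageE le_less_trans zero_less_power)
  have "\<bar>l2_inner M u (T i) - l i\<bar> \<le> e" if "i \<in> J" for i
  proof -
    have "(l i - l2_inner M u (T i))\<^sup>2 \<le> res u"
      unfolding res_def using J that by (intro member_le_sum) auto
    then have "(l2_inner M u (T i) - l i)\<^sup>2 \<le> e\<^sup>2" using u(2) by (simp add: power2_commute)
    then show ?thesis using e by (simp add: abs_le_square_iff[symmetric])
  qed
  then show ?thesis using u(1) by blast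
qed

lemma minimax_L2:
  fixes T :: "'i \<Rightarrow> 'a \<Rightarrow> real"
  assumes C_L2: "\<And>u. u \<in> C \<Longrightarrow> L2_space M u"
    and bdd: "\<And>u. u \<in> C \<Longrightarrow> l2_inner M u u \<le> B"
    and conv: "\<And>u v s. u \<in> C \<Longrightarrow> v \<in> C \<Longrightarrow> 0 \<le> s \<Longrightarrow> s \<le> 1 \<Longrightarrow> (\<lambda>x. (1 - s) * u x + s * v x) \<in> C"
    and closed: "\<And>U u. (\<And>n. U n \<in> C) \<Longrightarrow> L2_tendsto M U u \<Longrightarrow> u \<in> C"
    and T_L2: "\<And>i. i \<in> I \<Longrightarrow> L2_space M (T i)"
    and dom: "\<And>J r e. finite J \<Longrightarrow> J \<subseteq> I \<Longrightarrow> e > 0 \<Longrightarrow>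
      \<exists>v\<in>C. (\<Sum>i\<in>J. r i * l2_inner M v (T i)) \<ge> (\<Sum>i\<in>J. r i * l i) - e"
  shows "\<exists>u\<in>C. \<forall>i\<in>I. l2_inner M u (T i) = l i"
proof -
  define S where "S J e = {u \<in> C. \<forall>i\<in>J. \<bar>l2_inner M u (T i) - l i\<bar> \<le> e}" for J e
  define P where "P = {(J, e). finite J \<and> J \<subseteq> I \<and> (e::real) > 0}"
  define nsq where "nsq u = l2_inner M u u" for u
  define d where "d J e = Inf (nsq ` S J e)" for J e
  have S_ne: "S J e \<noteq> {}" if "(J, e) \<in> P" for J e
  proof -
    have J: "finite J" "J \<subseteq> I" "e > 0" using that by (auto simp: P_def)
    have "\<exists>u\<in>C. \<forall>i\<in>J. \<bar>l2_inner M u (T i) - l i\<bar> \<le> e"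
    proof (rule minimax_approximate[OF _ _ _ _ _ J(1,3)])
      show "L2_space M u" "l2_inner M u u \<le> B" if "u \<in> C" for u
        using that C_L2 bdd by blast+
      show "L2_space M (T i)" if "i \<in> J" for i using that J(2) T_L2 by blast
      show "(\<lambda>x. (1 - s) * u x + s * v x) \<in> C" if "u \<in> C" "v \<in> C" "0 \<le> s" "s \<le> 1" for u v s
        using that by (rule conv)
      show "\<exists>v\<in>C. (\<Sum>i\<in>J. r i * l2_inner M v (T i)) \<ge> (\<Sum>i\<in>J. r i * l i) - e" if "e > 0" for r e
        using J(1,2) that by (rule dom)
    qed
    then show ?thesis by (auto simp: S_def)
  qed
  have bb: "bdd_below (nsq ` S J e)" for J e
    by (intro bdd_belowI[of _ 0]) (auto simp: nsq_def l2_inner_nonneg)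
  have d_le: "d J e \<le> nsq u" if "u \<in> S J e" for J e u
    unfolding d_def using that bb by (intro cInf_lower) auto
  have d_B: "d J e \<le> B" if P: "(J, e) \<in> P" for J e
  proof -
    obtain u where "u \<in> S J e" using S_ne[OF P] by blast
    then show ?thesis using d_le[of u J e] bdd[of u] by (simp add: S_def nsq_def)
  qed
  have near: "\<exists>u\<in>S J e. nsq u < d J e + h" if "(J, e) \<in> P" "h > 0" for J e h
    using cInf_lessD[of "nsq ` S J e" "d J e + h"] S_ne[OF that(1)] that(2) unfolding d_def by auto
  define D where "D = (SUP (J, e)\<in>P. d J e)"
  have bdd_D: "bdd_above ((\<lambda>(J, e). d J e) ` P)"
    using d_B by (intro bdd_aboveI[of _ B]) auto
  have "({}, 1) \<in> P" by (simp add: P_def)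
  then have P_ne: "P \<noteq> {}" by blast
  have d_D: "d J e \<le> D" if "(J, e) \<in> P" for J e
    unfolding D_def using cSUP_upper[OF that bdd_D] by simp
  have "\<exists>p\<in>P. D - 1 / real (Suc n) < (case p of (J, e) \<Rightarrow> d J e)" for n
  proof -
    have "D - 1 / real (Suc n) < D" by simp
    then show ?thesis unfolding D_def using less_cSUP_iff[OF P_ne bdd_D] by blast
  qed
  then obtain p where p: "\<And>n. p n \<in> P" "\<And>n. D - 1 / real (Suc n) < (case p n of (J, e) \<Rightarrow> d J e)"
    by metis
  \<comment> \<open>Accumulating the index sets and taking minima of the tolerances makes the sets
    \<open>S (K n) (\<epsilon> n)\<close> decrease in n; the cap 1/(n+1) on the tolerance makes the
    constraints exact in the limit.\<close>
  define K where "K n = (\<Union>m\<le>n. fst (p m))" for n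
  define \<epsilon> where "\<epsilon> n = min (Min ((\<lambda>m. snd (p m)) ` {..n})) (1 / real (Suc n))" for n
  have pP: "finite (fst (p n))" "fst (p n) \<subseteq> I" "snd (p n) > 0" for n
    using p(1)[of n] by (auto simp: P_def split: prod.splits)
  have KP: "(K n, \<epsilon> n) \<in> P" for n
    using pP by (auto simp: P_def K_def \<epsilon>_def)
  have Kmono: "K n \<subseteq> K m" if "n \<le> m" for n m
    unfolding K_def using that by (intro UN_mono) auto
  have \<epsilon>mono: "\<epsilon> m \<le> \<epsilon> n" if "n \<le> m" for n m
  proof -
    have "Min ((\<lambda>m. snd (p m)) ` {..m}) \<le> Min ((\<lambda>m. snd (p m)) ` {..n})"
      using that by (intro Min_antimono) auto
    moreover have "1 / real (Suc m) \<le> 1 / real (Suc n)" using that by (simp add: field_simps)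
    ultimately show ?thesis unfolding \<epsilon>_def by linarith
  qed
  have Ssub: "S J' e' \<subseteq> S J e" if "J \<subseteq> J'" "e' \<le> e" for J J' e e'
    using that unfolding S_def by (blast intro: order_trans)
  have low: "D - 1 / real (Suc n) \<le> nsq u" if "u \<in> S (K n) (\<epsilon> n)" for n u
  proof -
    have "S (K n) (\<epsilon> n) \<subseteq> S (fst (p n)) (snd (p n))"
      by (rule Ssub) (auto simp: K_def \<epsilon>_def intro: min.coboundedI1)
    then have "d (fst (p n)) (snd (p n)) \<le> nsq u" using that d_le by blast
    then show ?thesis using p(2)[of n] by (simp add: case_prod_beta)
  qed
  have SC: "u \<in> C" if "u \<in> S J e" for u J e using that by (simp add: S_def)
  have close: "nsq (\<lambda>x. a x - b x) \<le> 8 / real (Suc n)"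
    if a: "a \<in> S (K n) (\<epsilon> n)" "nsq a \<le> D + 1 / real (Suc n)"
      and b: "b \<in> S (K n) (\<epsilon> n)" "nsq b \<le> D + 1 / real (Suc n)" for a b n
  proof -
    \<comment> \<open>The midpoint stays in the same convex set, so its squared norm is at least D -
      h with h = 1/(n+1). The parallelogram law then gives 2 (D + h) + 2 (D + h) - 4 (D - h) = 8
      h.\<close>
    let ?m = "\<lambda>x. (1 - 1/2) * a x + 1/2 * b x"
    have "?m \<in> S (K n) (\<epsilon> n)"
      unfolding S_def
    proof (intro CollectI conjI ballI)
      show "?m \<in> C" using conv[OF SC[OF a(1)] SC[OF b(1)], of "1/2"] by simp
      fix i assume i: "i \<in> K n"
      have "i \<in> I" using i pP(2) by (auto simp: K_def)
      have "l2_inner M ?m (T i) = (1 - 1/2) * l2_inner M a (T i) + 1/2 * l2_inner M b (T i)"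
        by (rule l2_inner_lincomb[OF C_L2[OF SC[OF a(1)]] C_L2[OF SC[OF b(1)]] T_L2[OF \<open>i \<in> I\<close>]])
      moreover have "\<bar>l2_inner M a (T i) - l i\<bar> \<le> \<epsilon> n" "\<bar>l2_inner M b (T i) - l i\<bar> \<le> \<epsilon> n"
        using a(1) b(1) i by (auto simp: S_def)
      ultimately show "\<bar>l2_inner M ?m (T i) - l i\<bar> \<le> \<epsilon> n" by (simp add: abs_le_iff field_simps)
    qed
    from low[OF this] have "D - 1 / real (Suc n) \<le> nsq ?m" .
    moreover have "nsq (\<lambda>x. a x - b x) = 2 * nsq a + 2 * nsq b - 4 * nsq ?m"
      unfolding nsq_def by (rule l2_parallelogram[OF C_L2[OF SC[OF a(1)]] C_L2[OF SC[OF b(1)]]])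
    moreover have "8 / real (Suc n) = 8 * (1 / real (Suc n))" by simp
    ultimately show ?thesis using a(2) b(2) by linarith
  qed
  have "\<exists>u\<in>S (K n) (\<epsilon> n). nsq u \<le> D + 1 / real (Suc n)" for n
    using near[OF KP[of n], of "1 / real (Suc n)"] d_D[OF KP[of n]] by (force intro: less_imp_le)
  then obtain u where u: "\<And>n. u n \<in> S (K n) (\<epsilon> n)" "\<And>n. nsq (u n) \<le> D + 1 / real (Suc n)" by metis
  have uL2: "L2_space M (u n)" for n using C_L2 SC u(1) by blast
  have inv_small: "\<exists>N. \<forall>n\<ge>N. 8 / real (Suc n) \<le> e" if "e > 0" for e :: real
  proof -
    obtain N where N: "real N > 8 / e" using reals_Archimedean2 by blast
    have "8 / real (Suc n) \<le> e" if "n \<ge> N" for n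
    proof -
      have "8 / e < real (Suc n)" using N that by linarith
      then show ?thesis using \<open>e > 0\<close> by (simp add: field_simps)
    qed
    then show ?thesis by blast
  qed
  have Cau: "nsq (\<lambda>x. u m x - u n x) \<le> 8 / real (Suc N)" if "m \<ge> N" "n \<ge> N" for m n N
  proof (rule close)
    show "u m \<in> S (K N) (\<epsilon> N)" "u n \<in> S (K N) (\<epsilon> N)"
      using u(1) Ssub[OF Kmono \<epsilon>mono] that by blast+
    have "1 / real (Suc m) \<le> 1 / real (Suc N)" "1 / real (Suc n) \<le> 1 / real (Suc N)"
      using that by (auto simp: field_simps)
    then show "nsq (u m) \<le> D + 1 / real (Suc N)" "nsq (u n) \<le> D + 1 / real (Suc N)"
      using u(2)[of m] u(2)[of n] by linarith+
  qed
  have "\<exists>v. L2_tendsto M u v"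
  proof (rule L2_complete[OF uL2])
    fix e :: real assume "e > 0"
    then obtain N where N: "8 / real (Suc N) \<le> e" using inv_small by blast
    have "(LINT x|M. (u m x - u n x)\<^sup>2) \<le> e" if "m \<ge> N" "n \<ge> N" for m n
    proof -
      have "(LINT x|M. (u m x - u n x)\<^sup>2) = nsq (\<lambda>x. u m x - u n x)"
        by (simp only: nsq_def l2_inner_def power2_eq_square)
      then show ?thesis using Cau[OF that] N by linarith
    qed
    then show "\<exists>N. \<forall>m\<ge>N. \<forall>n\<ge>N. (LINT x|M. (u m x - u n x)\<^sup>2) \<le> e" by blast
  qed
  then obtain v where v: "L2_tendsto M u v" by blast
  have vC: "v \<in> C" using closed[OF _ v] u(1) SC by blast
  have vL2: "L2_space M v" using v by (simp add: L2_tendsto_def)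
  have lim: "(\<lambda>n. nsq (\<lambda>x. u n x - v x)) \<longlonglongrightarrow> 0"
    using v by (simp add: L2_tendsto_def nsq_def l2_inner_def power2_eq_square)
  have "l2_inner M v (T i) = l i" if i: "i \<in> I" for i
  proof -
    \<comment> \<open>With i added the minimum is still at most D, and the near-minimisers
      \<open>w n\<close> also lie in the set of \<open>u n\<close>, so \<open>close\<close> compares
      the two.\<close>
    have KiP: "(insert i (K n), \<epsilon> n) \<in> P" for n using KP[of n] i by (auto simp: P_def)
    have "\<exists>w\<in>S (insert i (K n)) (\<epsilon> n). nsq w \<le> D + 1 / real (Suc n)" for n
      using near[OF KiP[of n], of "1 / real (Suc n)"] d_D[OF KiP[of n]] by (force intro: less_imp_le)
    then obtain w where w: "\<And>n. w n \<in> S (insert i (K n)) (\<epsilon> n)" "\<And>n. nsq (w n) \<le> D + 1 / real (Suc n)" by metis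
    have wS: "w n \<in> S (K n) (\<epsilon> n)" for n
      using w(1)[of n] Ssub[of "K n" "insert i (K n)" "\<epsilon> n" "\<epsilon> n"] by blast
    have wL2: "L2_space M (w n)" for n using C_L2 SC wS by blast
    have wu: "nsq (\<lambda>x. w n x - u n x) \<le> 8 / real (Suc n)" for n
      by (rule close[OF wS w(2) u])
    let ?t = "l2_inner M (T i) (T i)"
    have TiL2: "L2_space M (T i)" by (rule T_L2[OF i])
    have bound: "(l2_inner M v (T i) - l i)\<^sup>2 \<le>
        2 * ((2 * (8 / real (Suc n)) + 2 * nsq (\<lambda>x. u n x - v x)) * ?t) + 2 * (1 / real (Suc n))\<^sup>2" for n
    proof -
      define a b where "a = l2_inner M (w n) (T i) - l2_inner M v (T i)" and "b = l2_inner M (w n) (T i) - l i"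
      have a: "a = l2_inner M (\<lambda>x. w n x - v x) (T i)"
        unfolding a_def by (rule l2_inner_diff[OF wL2 vL2 TiL2, symmetric])
      have "a\<^sup>2 \<le> nsq (\<lambda>x. w n x - v x) * ?t"
        unfolding a nsq_def by (rule l2_Cauchy_Schwarz[OF L2_diff[OF wL2 vL2] TiL2])
      moreover have "nsq (\<lambda>x. w n x - v x) \<le> 2 * nsq (\<lambda>x. w n x - u n x) + 2 * nsq (\<lambda>x. u n x - v x)"
        using l2_norm_sq_add_le[OF L2_diff[OF wL2[of n] uL2[of n]] L2_diff[OF uL2[of n] vL2]]
        by (simp add: nsq_def)
      then have "nsq (\<lambda>x. w n x - v x) * ?t \<le> (2 * (8 / real (Suc n)) + 2 * nsq (\<lambda>x. u n x - v x)) * ?t"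
        using wu[of n] by (intro mult_right_mono l2_inner_nonneg) linarith
      ultimately have a2: "a\<^sup>2 \<le> (2 * (8 / real (Suc n)) + 2 * nsq (\<lambda>x. u n x - v x)) * ?t" by linarith
      have "\<bar>b\<bar> \<le> \<epsilon> n" using w(1)[of n] by (auto simp: S_def b_def)
      also have "\<epsilon> n \<le> 1 / real (Suc n)" by (simp add: \<epsilon>_def)
      finally have b2: "b\<^sup>2 \<le> (1 / real (Suc n))\<^sup>2"
        by (metis abs_ge_zero power2_abs power_mono)
      have "(b - a)\<^sup>2 \<le> 2 * a\<^sup>2 + 2 * b\<^sup>2"
        using zero_le_power2[of "a + b"] by (simp add: power2_sum power2_diff algebra_simps)
      moreover have "l2_inner M v (T i) - l i = b - a" by (simp add: a_def b_def)
      ultimately have "(l2_inner M v (T i) - l i)\<^sup>2 \<le> 2 * a\<^sup>2 + 2 * b\<^sup>2" by simp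
      also have "\<dots> \<le> 2 * ((2 * (8 / real (Suc n)) + 2 * nsq (\<lambda>x. u n x - v x)) * ?t) + 2 * (1 / real (Suc n))\<^sup>2"
        by (intro add_mono mult_left_mono a2 b2) auto
      finally show ?thesis .
    qed
    have i0: "(\<lambda>n. 1 / real (Suc n)) \<longlonglongrightarrow> 0" using LIMSEQ_inverse_real_of_nat by (simp add: inverse_eq_divide)
    have i8: "(\<lambda>n. 8 / real (Suc n)) \<longlonglongrightarrow> 0" using tendsto_mult_right_zero[OF i0, of 8] by simp
    have "(\<lambda>n. 2 * ((2 * (8 / real (Suc n)) + 2 * nsq (\<lambda>x. u n x - v x)) * ?t) + 2 * (1 / real (Suc n))\<^sup>2)
        \<longlonglongrightarrow> 2 * ((2 * 0 + 2 * 0) * ?t) + 2 * 0\<^sup>2"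
      by (intro tendsto_intros i0 i8 lim)
    then have "(l2_inner M v (T i) - l i)\<^sup>2 \<le> 2 * ((2 * 0 + 2 * 0) * ?t) + 2 * 0\<^sup>2"
      by (rule LIMSEQ_le_const) (use bound in blast)
    then show ?thesis by simp
  qed
  then show ?thesis using vC by blast
qed

lemma L2_tendsto_inner:
  assumes U: "L2_tendsto M U u" and h: "L2_space M h"
  shows "(\<lambda>n. l2_inner M (U n) h) \<longlonglongrightarrow> l2_inner M u h"
proof -
  have Un: "L2_space M (U n)" and u: "L2_space M u" for n using U by (auto simp: L2_tendsto_def)
  have lim: "(\<lambda>n. l2_inner M (\<lambda>x. U n x - u x) (\<lambda>x. U n x - u x) * l2_inner M h h) \<longlonglongrightarrow> 0 * l2_inner M h h"
    using U by (intro tendsto_intros) (simp add: L2_tendsto_def l2_inner_def power2_eq_square)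
  have "(\<lambda>n. (l2_inner M (U n) h - l2_inner M u h)\<^sup>2) \<longlonglongrightarrow> 0"
  proof (rule tendsto_sandwich[OF _ _ tendsto_const])
    show "\<forall>\<^sub>F n in sequentially. 0 \<le> (l2_inner M (U n) h - l2_inner M u h)\<^sup>2" by simp
    show "\<forall>\<^sub>F n in sequentially. (l2_inner M (U n) h - l2_inner M u h)\<^sup>2 \<le>
        l2_inner M (\<lambda>x. U n x - u x) (\<lambda>x. U n x - u x) * l2_inner M h h"
      using l2_Cauchy_Schwarz[OF L2_diff[OF Un u] h] l2_inner_diff[OF Un u h] by simp
    show "(\<lambda>n. l2_inner M (\<lambda>x. U n x - u x) (\<lambda>x. U n x - u x) * l2_inner M h h) \<longlonglongrightarrow> 0"
      using lim by simp
  qed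
  then have "(\<lambda>n. sqrt ((l2_inner M (U n) h - l2_inner M u h)\<^sup>2)) \<longlonglongrightarrow> sqrt 0"
    by (intro tendsto_intros)
  then have "(\<lambda>n. l2_inner M (U n) h - l2_inner M u h) \<longlonglongrightarrow> 0"
    by (simp add: tendsto_rabs_zero_iff)
  then show ?thesis by (simp add: LIM_zero_iff)
qed

lemma L2_indicator:
  assumes "L2_space M f" "Z \<in> sets M" shows "L2_space M (\<lambda>x. indicator Z x * f x)"
  using assms by (intro L2_bounded_mult[where c=1]) (auto simp: indicator_def)

lemma l2_inner_indicator_shift:
  "l2_inner M (\<lambda>x. indicator Z x * f x) g = l2_inner M f (\<lambda>x. indicator Z x * g x)"
  by (simp add: l2_inner_def mult.left_commute mult.assoc)

subsection \<open>Admissible elements in space and time\<close>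

text \<open>Bounds are put on integrals over sets Z and not on norms of slices. Such sets of
  functions are convex and closed by Hilbert space arguments alone, and statements for almost every
  time are extracted only at the end.\<close>

definition l2_bounds :: "'a measure \<Rightarrow> ('a set \<times> real) set \<Rightarrow> ('a \<Rightarrow> real) set" where
  "l2_bounds M W = {u. L2_space M u \<and> (\<forall>(Z, c)\<in>W. (LINT x|M. indicator Z x * (u x)\<^sup>2) \<le> c)}"

lemma integral_indicator_sq:
  "(LINT x|M. indicator Z x * (u x)\<^sup>2) = l2_inner M (\<lambda>x. indicator Z x * u x) u"
  by (simp add: l2_inner_def power2_eq_square mult.assoc)

lemma integrable_indicator_sq:
  assumes "L2_space M u" "Z \<in> sets M"
  shows "integrable M (\<lambda>x. indicator Z x * (u x)\<^sup>2)"
  using L2_mult_integrable[OF L2_indicator[OF assms] assms(1)]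
  by (simp add: power2_eq_square mult.assoc)

lemma l2_bounds_convex:
  assumes W: "\<And>Z c. (Z, c) \<in> W \<Longrightarrow> Z \<in> sets M"
    and u: "u \<in> l2_bounds M W" and v: "v \<in> l2_bounds M W" and s: "0 \<le> s" "s \<le> (1::real)"
  shows "(\<lambda>x. (1 - s) * u x + s * v x) \<in> l2_bounds M W"
proof -
  have uL: "L2_space M u" and vL: "L2_space M v" using u v by (auto simp: l2_bounds_def)
  have wL: "L2_space M (\<lambda>x. (1 - s) * u x + s * v x)" by (intro L2_add L2_scale uL vL)
  have "(LINT x|M. indicator Z x * ((1 - s) * u x + s * v x)\<^sup>2) \<le> c" if Zc: "(Z, c) \<in> W" for Z c
  proof -
    have Z: "Z \<in> sets M" using W Zc by blast
    have conv: "((1 - s) * a + s * b)\<^sup>2 \<le> (1 - s) * a\<^sup>2 + s * b\<^sup>2" for a b :: real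
    proof -
      have "(1 - s) * a\<^sup>2 + s * b\<^sup>2 - ((1 - s) * a + s * b)\<^sup>2 = s * (1 - s) * (a - b)\<^sup>2"
        by (simp add: power2_eq_square algebra_simps)
      moreover have "0 \<le> s * (1 - s) * (a - b)\<^sup>2" using s by simp
      ultimately show ?thesis by linarith
    qed
    have "(LINT x|M. indicator Z x * ((1 - s) * u x + s * v x)\<^sup>2) \<le>
        (LINT x|M. (1 - s) * (indicator Z x * (u x)\<^sup>2) + s * (indicator Z x * (v x)\<^sup>2))"
      using conv integrable_indicator_sq[OF wL Z] integrable_indicator_sq[OF uL Z] integrable_indicator_sq[OF vL Z]
      by (intro integral_mono) (auto simp: indicator_def)
    also have "\<dots> = (1 - s) * (LINT x|M. indicator Z x * (u x)\<^sup>2) + s * (LINT x|M. indicator Z x * (v x)\<^sup>2)"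
      using integrable_indicator_sq[OF uL Z] integrable_indicator_sq[OF vL Z] by simp
    also have "\<dots> \<le> (1 - s) * c + s * c"
      using u v Zc s by (intro add_mono mult_left_mono) (auto simp: l2_bounds_def)
    finally show ?thesis by (simp add: algebra_simps)
  qed
  then show ?thesis using wL by (auto simp: l2_bounds_def)
qed

text \<open>A squared norm is a supremum of affine functions: 2 a b - b^2 \<le> a^2. Taking b to be
  the limit restricted to Z bounds an expression that is affine in the sequence, so convergence of
  inner products suffices.\<close>

lemma l2_bounds_closed:
  assumes W: "\<And>Z c. (Z, c) \<in> W \<Longrightarrow> Z \<in> sets M"
    and U: "\<And>n. U n \<in> l2_bounds M W" and lim: "L2_tendsto M U u"
  shows "u \<in> l2_bounds M W"
proof -
  have UL: "L2_space M (U n)" and uL: "L2_space M u" for n using lim by (auto simp: L2_tendsto_def)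
  have "(LINT x|M. indicator Z x * (u x)\<^sup>2) \<le> c" if Zc: "(Z, c) \<in> W" for Z c
  proof -
    have Z: "Z \<in> sets M" using W Zc by blast
    let ?h = "\<lambda>x. indicator Z x * u x"
    have hL: "L2_space M ?h" by (rule L2_indicator[OF uL Z])
    have "2 * l2_inner M (U n) ?h - l2_inner M u ?h \<le> c" for n
    proof -
      have "2 * l2_inner M (U n) ?h - l2_inner M u ?h = (LINT x|M. 2 * (U n x * ?h x) - u x * ?h x)"
        using L2_mult_integrable[OF UL[of n] hL] L2_mult_integrable[OF uL hL] by (simp add: l2_inner_def)
      also have "\<dots> \<le> (LINT x|M. indicator Z x * (U n x)\<^sup>2)"
      proof (rule integral_mono)
        show "integrable M (\<lambda>x. 2 * (U n x * ?h x) - u x * ?h x)"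
          using L2_mult_integrable[OF UL[of n] hL] L2_mult_integrable[OF uL hL] by simp
        show "integrable M (\<lambda>x. indicator Z x * (U n x)\<^sup>2)" by (rule integrable_indicator_sq[OF UL Z])
        show "2 * (U n x * ?h x) - u x * ?h x \<le> indicator Z x * (U n x)\<^sup>2" for x
          using zero_le_power2[of "U n x - u x"] by (auto simp: indicator_def power2_eq_square algebra_simps)
      qed
      also have "\<dots> \<le> c" using U[of n] Zc by (auto simp: l2_bounds_def)
      finally show ?thesis .
    qed
    moreover have "(\<lambda>n. 2 * l2_inner M (U n) ?h - l2_inner M u ?h) \<longlonglongrightarrow> 2 * l2_inner M u ?h - l2_inner M u ?h"
      by (intro tendsto_intros L2_tendsto_inner[OF lim hL])
    ultimately have "2 * l2_inner M u ?h - l2_inner M u ?h \<le> c"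
      by (intro LIMSEQ_le_const2) auto
    then show ?thesis by (simp add: integral_indicator_sq l2_inner_indicator_shift)
  qed
  then show ?thesis using uL by (auto simp: l2_bounds_def)
qed

lemma l2_inner_sum_left:
  assumes "\<And>i. i \<in> J \<Longrightarrow> L2_space M (f i)" "L2_space M h"
  shows "l2_inner M (\<lambda>x. \<Sum>i\<in>J. f i x) h = (\<Sum>i\<in>J. l2_inner M (f i) h)"
  using assms unfolding l2_inner_def sum_distrib_right
  by (subst Bochner_Integration.integral_sum) (auto intro: L2_mult_integrable)

lemma l2_inner_sum_right:
  assumes "\<And>i. i \<in> J \<Longrightarrow> L2_space M (f i)" "L2_space M h"
  shows "l2_inner M h (\<lambda>x. \<Sum>i\<in>J. f i x) = (\<Sum>i\<in>J. l2_inner M h (f i))"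
  using l2_inner_sum_left[OF assms] by (simp add: l2_inner_commute)

lemma l2_inner_add_right:
  assumes "L2_space M f" "L2_space M g" "L2_space M h"
  shows "l2_inner M h (\<lambda>x. f x + g x) = l2_inner M h f + l2_inner M h g"
  using l2_inner_add[OF assms] by (simp add: l2_inner_commute)

lemma l2_inner_scale_right: "l2_inner M h (\<lambda>x. c * f x) = c * l2_inner M h f"
  using l2_inner_scale[of M c f h] by (simp add: l2_inner_commute)

section \<open>Products of a time profile and a function of the state\<close>

lemma time_measure_finite: "finite_measure (time_measure T)"
  by (rule finite_measureI) (simp add: emeasure_restrict_space space_restrict_space emeasure_lborel_Icc_eq)

lemma space_time_measure: "space (time_measure T) = {0..T}"
  by (simp add: space_restrict_space)

lemma continuous_measurable_time:
  fixes a :: "real \<Rightarrow> real"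
  assumes "continuous_on {0..T} a" shows "a \<in> borel_measurable (time_measure T)"
  using borel_measurable_continuous_on_restrict[OF assms]
  by (simp add: measurable_def space_restrict_space sets_restrict_space)

lemma continuous_integrable_time:
  fixes a :: "real \<Rightarrow> real"
  assumes "continuous_on {0..T} a" shows "integrable (time_measure T) a"
  using borel_integrable_atLeastAtMost'[OF assms] by (simp add: integrable_restrict_space set_integrable_def)

lemma time_integral_FTC:
  fixes a :: "real \<Rightarrow> real"
  assumes "0 \<le> T" "\<And>t. t \<in> {0..T} \<Longrightarrow> (A has_real_derivative a t) (at t within {0..T})"
    and "continuous_on {0..T} a"
  shows "(LINT t|time_measure T. a t) = A T - A 0"
proof -
  have "(LINT t|time_measure T. a t) = (LINT t|lborel. indicator {0..T} t *\<^sub>R a t)"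
    by (subst integral_restrict_space) auto
  also have "\<dots> = A T - A 0"
    using assms by (intro integral_FTC_atLeastAtMost)
      (auto simp: has_real_derivative_iff_has_vector_derivative)
  finally show ?thesis .
qed

lemma tensor_integrable:
  fixes a :: "real \<Rightarrow> real"
  assumes Q: "sigma_finite_measure Q" and a: "continuous_on {0..T} a" and f: "integrable Q f"
  shows "integrable (time_measure T \<Otimes>\<^sub>M Q) (\<lambda>(t, x). a t * f x)"
    and "(LINT z|(time_measure T \<Otimes>\<^sub>M Q). (case z of (t, x) \<Rightarrow> a t * f x)) = (LINT t|time_measure T. a t) * (LINT x|Q. f x)"
proof -
  interpret t: finite_measure "time_measure T" by (rule time_measure_finite)
  interpret Q: sigma_finite_measure Q by (rule Q)
  interpret p: pair_sigma_finite "time_measure T" Q ..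
  have [measurable]: "a \<in> borel_measurable (time_measure T)" by (rule continuous_measurable_time[OF a])
  have [measurable]: "f \<in> borel_measurable Q" using f by simp
  have "continuous_on {0..T} (\<lambda>t. \<bar>a t\<bar> * (LINT x|Q. \<bar>f x\<bar>))" by (intro continuous_intros a)
  from continuous_integrable_time[OF this]
  have "integrable (time_measure T) (\<lambda>t. LINT x|Q. norm (case (t, x) of (t, x) \<Rightarrow> a t * f x))"
    using f by (simp add: abs_mult)
  then show i: "integrable (time_measure T \<Otimes>\<^sub>M Q) (\<lambda>(t, x). a t * f x)"
    by (intro p.Fubini_integrable) (use f in auto)
  show "(LINT z|(time_measure T \<Otimes>\<^sub>M Q). (case z of (t, x) \<Rightarrow> a t * f x)) = (LINT t|time_measure T. a t) * (LINT x|Q. f x)"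
    using p.integral_fst'[OF i] by simp
qed

lemma tensor_L2:
  fixes a :: "real \<Rightarrow> real"
  assumes Q: "sigma_finite_measure Q" and a: "continuous_on {0..T} a" and f: "L2_space Q f"
  shows "L2_space (time_measure T \<Otimes>\<^sub>M Q) (\<lambda>(t, x). a t * f x)"
proof -
  have [measurable]: "a \<in> borel_measurable (time_measure T)" by (rule continuous_measurable_time[OF a])
  have [measurable]: "f \<in> borel_measurable Q" using f by (rule L2_measurable)
  have "integrable (time_measure T \<Otimes>\<^sub>M Q) (\<lambda>(t, x). (a t)\<^sup>2 * (f x)\<^sup>2)"
    using f by (intro tensor_integrable[OF Q] continuous_intros a) (simp add: L2_space_def)
  then show ?thesis by (simp add: L2_space_def case_prod_beta' power_mult_distrib)
qed

lemma tensor_inner: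
  fixes a b :: "real \<Rightarrow> real"
  assumes Q: "sigma_finite_measure Q" and a: "continuous_on {0..T} a" and b: "continuous_on {0..T} b"
    and f: "L2_space Q f" and g: "L2_space Q g"
  shows "l2_inner (time_measure T \<Otimes>\<^sub>M Q) (\<lambda>(t, x). a t * f x) (\<lambda>(t, x). b t * g x) =
    (LINT t|time_measure T. a t * b t) * l2_inner Q f g"
proof -
  have ab: "continuous_on {0..T} (\<lambda>t. a t * b t)" by (intro continuous_intros a b)
  show ?thesis
    using tensor_integrable(2)[OF Q ab L2_mult_integrable[OF f g]]
    by (simp add: l2_inner_def case_prod_beta' algebra_simps)
qed

lemma l2_inner_disjoint_support:
  assumes "\<And>x. x \<in> space M \<Longrightarrow> f x = 0 \<or> g x = 0" shows "l2_inner M f g = 0"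
proof -
  have "l2_inner M f g = (LINT x|M. 0)"
    unfolding l2_inner_def using assms by (intro Bochner_Integration.integral_cong refl) auto
  then show ?thesis by simp
qed

lemma double_sum_antisym_zero:
  fixes b :: "'i \<Rightarrow> 'i \<Rightarrow> real"
  assumes "\<And>i j. i \<in> J \<Longrightarrow> j \<in> J \<Longrightarrow> b i j = - b j i"
  shows "(\<Sum>i\<in>J. \<Sum>j\<in>J. b i j) = 0"
proof -
  have "(\<Sum>i\<in>J. \<Sum>j\<in>J. b i j) = (\<Sum>i\<in>J. \<Sum>j\<in>J. - b j i)"
    by (intro sum.cong refl assms)
  also have "\<dots> = - (\<Sum>i\<in>J. \<Sum>j\<in>J. b j i)" by (simp add: sum_negf)
  also have "(\<Sum>i\<in>J. \<Sum>j\<in>J. b j i) = (\<Sum>i\<in>J. \<Sum>j\<in>J. b i j)" by (rule sum.swap)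
  finally show ?thesis by simp
qed

text \<open>The comparison element is \<open>\<phi> = \<Sum> \<alpha>\<^sub>i E\<^sub>i\<close> renormalised in time: with \<open>N = sqrt (|\<phi>|\<^sup>2 + \<epsilon>\<^sup>2)\<close>
  and \<open>y = exp (- 1/2 \<integral>\<^sub>0\<^sup>t |D\<phi>|\<^sup>2 / N\<^sup>2)\<close>, the weight \<open>w = R y / N\<close> makes the energy of \<open>w \<phi>\<close> at most
  \<open>R\<^sup>2\<close>, and the form evaluates to the exact derivative of \<open>- R y N\<close>.\<close>

lemma space_time_domination:
  fixes Q :: "'q measure" and E B G :: "'i \<Rightarrow> 'q \<Rightarrow> real" and \<alpha> \<alpha>' :: "'i \<Rightarrow> real \<Rightarrow> real"
  assumes T: "T > 0" and R: "R \<ge> 0" and Q: "sigma_finite_measure Q" and A: "A \<in> sets Q"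
    and J: "finite J"
    and E: "\<And>i. i \<in> J \<Longrightarrow> L2_space Q (E i)" and B: "\<And>i. i \<in> J \<Longrightarrow> L2_space Q (B i)"
    and G: "\<And>i. i \<in> J \<Longrightarrow> L2_space Q (G i)"
    and suppE: "\<And>i x. i \<in> J \<Longrightarrow> x \<in> space Q \<Longrightarrow> x \<notin> A \<Longrightarrow> E i x = 0"
    and suppB: "\<And>i x. i \<in> J \<Longrightarrow> x \<in> space Q \<Longrightarrow> x \<notin> A \<Longrightarrow> B i x = 0"
    and suppG: "\<And>i x. i \<in> J \<Longrightarrow> x \<in> space Q \<Longrightarrow> x \<in> A \<Longrightarrow> G i x = 0"
    and anti: "\<And>i j. i \<in> J \<Longrightarrow> j \<in> J \<Longrightarrow> l2_inner Q (E i) (B j) = - l2_inner Q (E j) (B i)"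
    and \<alpha>: "\<And>i t. i \<in> J \<Longrightarrow> t \<in> {0..T} \<Longrightarrow> (\<alpha> i has_real_derivative \<alpha>' i t) (at t within {0..T})"
    and \<alpha>'c: "\<And>i. i \<in> J \<Longrightarrow> continuous_on {0..T} (\<alpha>' i)"
    and \<alpha>T: "\<And>i. i \<in> J \<Longrightarrow> \<alpha> i T = 0"
    and \<rho>: "L2_space Q \<rho>" "l2_inner Q \<rho> \<rho> \<le> R\<^sup>2" and e: "e > 0"
    and W: "W = (\<lambda>S. (S \<times> A, R\<^sup>2 * measure (time_measure T) S)) ` sets (time_measure T)
       \<union> {({0..T} \<times> (space Q - A), R\<^sup>2)}"
  shows "\<exists>v\<in>l2_bounds (time_measure T \<Otimes>\<^sub>M Q) W.
     (\<Sum>i\<in>J. l2_inner (time_measure T \<Otimes>\<^sub>M Q) v (\<lambda>(t, x). - \<alpha>' i t * E i x + \<alpha> i t * (B i x + 1/2 * G i x)))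
       \<ge> (\<Sum>i\<in>J. \<alpha> i 0 * l2_inner Q (E i) \<rho>) - e \<and>
     (\<forall>\<beta> H. continuous_on {0..T} \<beta> \<longrightarrow> L2_space Q H \<longrightarrow>
        (\<forall>i\<in>J. l2_inner Q (E i) H + l2_inner Q (G i) H = 0) \<longrightarrow>
        l2_inner (time_measure T \<Otimes>\<^sub>M Q) v (\<lambda>(t, x). \<beta> t * H x) = 0)"
proof -
  let ?\<tau> = "time_measure T" and ?P = "time_measure T \<Otimes>\<^sub>M Q"
  interpret t: finite_measure ?\<tau> by (rule time_measure_finite)
  interpret Q: sigma_finite_measure Q by (rule Q)
  interpret p: pair_sigma_finite ?\<tau> Q ..
  have \<alpha>c: "continuous_on {0..T} (\<alpha> i)" if "i \<in> J" for i
    using \<alpha>[OF that] by (intro DERIV_continuous_on) auto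
  \<comment> \<open>The denominator R + 1 covers the case R = 0.\<close>
  define \<epsilon> where "\<epsilon> = e / (R + 1)"
  have \<epsilon>: "\<epsilon> > 0" "R * \<epsilon> \<le> e" using R e by (auto simp: \<epsilon>_def field_simps)
  \<comment> \<open>Gram matrices of the test functions and of their gradients, and the matrix of
    the drift. Below, p and q are |\<phi>|^2 and |D\<phi>|^2 at time t.\<close>
  define a where "a i j = l2_inner Q (E i) (E j)" for i j
  define g where "g i j = l2_inner Q (G i) (G j)" for i j
  define b where "b i j = l2_inner Q (E i) (B j)" for i j
  have asym: "a i j = a j i" for i j by (simp add: a_def l2_inner_commute)
  define p where "p t = (\<Sum>i\<in>J. \<Sum>j\<in>J. \<alpha> i t * \<alpha> j t * a i j)" for t
  define p' where "p' t = (\<Sum>i\<in>J. \<Sum>j\<in>J. (\<alpha>' i t * \<alpha> j t + \<alpha>' j t * \<alpha> i t) * a i j)" for t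
  define q where "q t = (\<Sum>i\<in>J. \<Sum>j\<in>J. \<alpha> i t * \<alpha> j t * g i j)" for t
  have sq: "l2_inner Q (\<lambda>x. \<Sum>i\<in>J. c i * f i x) (\<lambda>x. \<Sum>i\<in>J. c i * f i x) =
      (\<Sum>i\<in>J. \<Sum>j\<in>J. c i * c j * l2_inner Q (f i) (f j))"
    if f: "\<And>i. i \<in> J \<Longrightarrow> L2_space Q (f i)" for c :: "'i \<Rightarrow> real" and f
  proof -
    have "l2_inner Q (\<lambda>x. \<Sum>i\<in>J. c i * f i x) (\<lambda>x. \<Sum>i\<in>J. c i * f i x) =
        (\<Sum>i\<in>J. l2_inner Q (\<lambda>x. c i * f i x) (\<lambda>x. \<Sum>i\<in>J. c i * f i x))"
      by (rule l2_inner_sum_left) (auto intro!: L2_scale L2_sum f)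
    also have "\<dots> = (\<Sum>i\<in>J. \<Sum>j\<in>J. l2_inner Q (\<lambda>x. c i * f i x) (\<lambda>x. c j * f j x))"
      by (intro sum.cong refl l2_inner_sum_right) (auto intro!: L2_scale f)
    finally show ?thesis by (simp add: l2_inner_scale l2_inner_scale_right mult.assoc)
  qed
  have p_sq: "p t = l2_inner Q (\<lambda>x. \<Sum>i\<in>J. \<alpha> i t * E i x) (\<lambda>x. \<Sum>i\<in>J. \<alpha> i t * E i x)" for t
    by (subst sq) (auto simp: E p_def a_def)
  have p0: "0 \<le> p t" for t unfolding p_sq by (rule l2_inner_nonneg)
  have q_sq: "q t = l2_inner Q (\<lambda>x. \<Sum>i\<in>J. \<alpha> i t * G i x) (\<lambda>x. \<Sum>i\<in>J. \<alpha> i t * G i x)" for t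
    by (subst sq) (auto simp: G q_def g_def)
  have q0: "0 \<le> q t" for t unfolding q_sq by (rule l2_inner_nonneg)
  have pc: "continuous_on {0..T} p" and qc: "continuous_on {0..T} q" and p'c: "continuous_on {0..T} p'"
    unfolding p_def q_def p'_def by (auto intro!: continuous_intros \<alpha>c \<alpha>'c)
  have pd: "(p has_real_derivative p' t) (at t within {0..T})" if t: "t \<in> {0..T}" for t
    unfolding p_def p'_def
  proof (intro DERIV_sum)
    fix i j assume "i \<in> J" "j \<in> J"
    then show "((\<lambda>x. \<alpha> i x * \<alpha> j x * a i j) has_real_derivative
      (\<alpha>' i t * \<alpha> j t + \<alpha>' j t * \<alpha> i t) * a i j) (at t within {0..T})"
      by (intro DERIV_cmult_right DERIV_mult \<alpha> t)
  qed
  \<comment> \<open>This is N^2; the summand \<epsilon>^2 permits division at times where \<phi>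
    vanishes, in particular at T.\<close>
  define m where "m t = p t + \<epsilon>\<^sup>2" for t
  have m0: "0 < m t" for t using p0[of t] \<epsilon> by (simp add: m_def add_nonneg_pos)
  have mc: "continuous_on {0..T} m" unfolding m_def by (intro continuous_intros pc)
  have md: "(m has_real_derivative p' t) (at t within {0..T})" if t: "t \<in> {0..T}" for t
    unfolding m_def using DERIV_add[OF pd[OF t] DERIV_const[of "\<epsilon>\<^sup>2"]] by simp
  have qmc: "continuous_on {0..T} (\<lambda>t. q t / m t)"
    using m0 by (intro continuous_intros qc mc) (auto simp: less_imp_neq[symmetric])
  define I where "I t = integral {0..t} (\<lambda>s. q s / m s)" for t
  have Id: "(I has_real_derivative q t / m t) (at t within {0..T})" if "t \<in> {0..T}" for t
    unfolding I_def using that by (intro integral_has_real_derivative qmc)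
  have I0: "I 0 = 0" by (simp add: I_def)
  have Ic: "continuous_on {0..T} I" using Id by (intro DERIV_continuous_on) auto
  \<comment> \<open>Claimed for every real t: where the integrand is not integrable the integral is
    0 by convention.\<close>
  have Inn: "0 \<le> I t" for t
  proof (cases "(\<lambda>s. q s / m s) integrable_on {0..t}")
    case True
    then show ?thesis unfolding I_def
      by (rule Henstock_Kurzweil_Integration.integral_nonneg) (intro divide_nonneg_pos q0 m0)
  qed (simp add: I_def not_integrable_integral)
  define y where "y t = exp (- (1/2) * I t)" for t
  have y: "0 < y t" "y t \<le> 1" for t using Inn by (auto simp: y_def)
  have yc: "continuous_on {0..T} y" unfolding y_def by (intro continuous_intros Ic)
  have yd: "(y has_real_derivative - (1/2) * (q t / m t) * y t) (at t within {0..T})" if "t \<in> {0..T}" for t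
    unfolding y_def using Id[OF that] by (auto intro!: derivative_eq_intros)
  define N where "N t = sqrt (m t)" for t
  have N0: "0 < N t" for t using m0 by (simp add: N_def)
  have NN: "N t * N t = m t" for t using m0[of t] by (simp add: N_def)
  have Nc: "continuous_on {0..T} N" unfolding N_def by (intro continuous_intros mc)
  have Nd: "(N has_real_derivative p' t / (2 * N t)) (at t within {0..T})" if t: "t \<in> {0..T}" for t
    unfolding N_def using DERIV_chain2[OF DERIV_real_sqrt[OF m0] md[OF t]]
    by (simp add: field_simps)
  define w where "w t = R * y t / N t" for t
  have wc: "continuous_on {0..T} w" unfolding w_def
    using N0 by (intro continuous_intros yc Nc) (auto simp: less_imp_neq[symmetric])
  \<comment> \<open>On A the function \<open>V j\<close> is the test function, off A it is its
    gradient, so v below is the pair of w \<phi> and w D\<phi>.\<close>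
  define V where "V j x = E j x + G j x" for j x
  have VL: "L2_space Q (V j)" if "j \<in> J" for j
    unfolding V_def using that by (intro L2_add E G)
  define v where "v = (\<lambda>z. \<Sum>j\<in>J. case z of (t, x) \<Rightarrow> (w t * \<alpha> j t) * V j x)"
  have wac: "continuous_on {0..T} (\<lambda>t. w t * \<alpha> j t)" if "j \<in> J" for j
    using that by (intro continuous_intros wc \<alpha>c)
  have vjL: "L2_space ?P (\<lambda>(t, x). (w t * \<alpha> j t) * V j x)" if "j \<in> J" for j
    using that by (intro tensor_L2 Q wac VL)
  have vL: "L2_space ?P v" unfolding v_def by (intro L2_sum vjL)
  have inner_tensor: "l2_inner ?P v (\<lambda>(t, x). \<beta> t * H x) = (\<Sum>j\<in>J. (LINT t|?\<tau>. w t * \<alpha> j t * \<beta> t) * l2_inner Q (V j) H)"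
    if \<beta>: "continuous_on {0..T} \<beta>" and H: "L2_space Q H" for \<beta> H
  proof -
    have "l2_inner ?P v (\<lambda>(t, x). \<beta> t * H x) = (\<Sum>j\<in>J. l2_inner ?P (\<lambda>(t, x). (w t * \<alpha> j t) * V j x) (\<lambda>(t, x). \<beta> t * H x))"
      unfolding v_def by (intro l2_inner_sum_left vjL tensor_L2 Q \<beta> H)
    also have "\<dots> = (\<Sum>j\<in>J. (LINT t|?\<tau>. w t * \<alpha> j t * \<beta> t) * l2_inner Q (V j) H)"
      by (intro sum.cong refl tensor_inner Q wac VL \<beta> H)
    finally show ?thesis .
  qed
  have GE0: "l2_inner Q (G j) (E i) = 0" "l2_inner Q (E j) (G i) = 0" "l2_inner Q (G j) (B i) = 0"
    if "i \<in> J" "j \<in> J" for i j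
    by (rule l2_inner_disjoint_support, use suppE suppG suppB that in metis)+
  have VE: "l2_inner Q (V j) (E i) = a j i" if "i \<in> J" "j \<in> J" for i j
    using l2_inner_add[OF E[OF that(2)] G[OF that(2)] E[OF that(1)]] GE0[OF that]
    by (simp add: V_def[abs_def] a_def)
  have BGL: "L2_space Q (\<lambda>x. B i x + 1/2 * G i x)" if "i \<in> J" for i
    using that by (intro L2_add L2_scale B G)
  have VB: "l2_inner Q (V j) (\<lambda>x. B i x + 1/2 * G i x) = b j i + 1/2 * g j i" if "i \<in> J" "j \<in> J" for i j
  proof -
    have "l2_inner Q (V j) (\<lambda>x. B i x + 1/2 * G i x) = l2_inner Q (V j) (B i) + l2_inner Q (V j) (\<lambda>x. 1/2 * G i x)"
      using that by (intro l2_inner_add_right B L2_scale G VL)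
    also have "l2_inner Q (V j) (\<lambda>x. 1/2 * G i x) = 1/2 * l2_inner Q (V j) (G i)" by (rule l2_inner_scale_right)
    also have "l2_inner Q (V j) (G i) = g j i"
      using l2_inner_add[OF E[OF that(2)] G[OF that(2)] G[OF that(1)]] GE0[OF that]
      by (simp add: V_def[abs_def] g_def)
    also have "l2_inner Q (V j) (B i) = b j i"
      using l2_inner_add[OF E[OF that(2)] G[OF that(2)] B[OF that(1)]] GE0[OF that]
      by (simp add: V_def[abs_def] b_def)
    finally show ?thesis .
  qed
  have slice: "(LINT x|Q. indicator Z x * (v (t, x))\<^sup>2) = (w t)\<^sup>2 * l2_inner Q (\<lambda>x. \<Sum>j\<in>J. \<alpha> j t * U j x) (\<lambda>x. \<Sum>j\<in>J. \<alpha> j t * U j x)"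
    if "\<And>j x. j \<in> J \<Longrightarrow> x \<in> space Q \<Longrightarrow> indicator Z x * V j x = U j x" for Z U t
  proof -
    have "indicator Z x * (v (t, x))\<^sup>2 = (w t)\<^sup>2 * ((\<Sum>j\<in>J. \<alpha> j t * U j x) * (\<Sum>j\<in>J. \<alpha> j t * U j x))" if x: "x \<in> space Q" for x
    proof -
      have "indicator Z x * (v (t, x))\<^sup>2 = (\<Sum>j\<in>J. indicator Z x * ((w t * \<alpha> j t) * V j x))\<^sup>2"
        by (auto simp: v_def indicator_def)
      also have "(\<Sum>j\<in>J. indicator Z x * ((w t * \<alpha> j t) * V j x)) = (\<Sum>j\<in>J. w t * (\<alpha> j t * U j x))"
        by (intro sum.cong refl) (use \<open>\<And>j x. j \<in> J \<Longrightarrow> x \<in> space Q \<Longrightarrow> indicator Z x * V j x = U j x\<close> x in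
          \<open>metis (no_types, opaque_lifting) mult.assoc mult.left_commute\<close>)
      finally show ?thesis by (simp add: sum_distrib_left[symmetric] power2_eq_square mult_ac)
    qed
    then have "(LINT x|Q. indicator Z x * (v (t, x))\<^sup>2) = (LINT x|Q. (w t)\<^sup>2 * ((\<Sum>j\<in>J. \<alpha> j t * U j x) * (\<Sum>j\<in>J. \<alpha> j t * U j x)))"
      by (intro Bochner_Integration.integral_cong refl)
    then show ?thesis by (simp add: l2_inner_def)
  qed
  have sliceE: "(LINT x|Q. indicator A x * (v (t, x))\<^sup>2) = (w t)\<^sup>2 * p t" for t
    unfolding p_sq by (rule slice) (auto simp: V_def indicator_def suppE suppG)
  have sliceG: "(LINT x|Q. indicator (space Q - A) x * (v (t, x))\<^sup>2) = (w t)\<^sup>2 * q t" for t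
    unfolding q_sq by (rule slice) (auto simp: V_def indicator_def suppE suppG)
  have w2: "(w t)\<^sup>2 = R\<^sup>2 * (y t)\<^sup>2 / m t" for t
    using NN[of t] by (simp add: w_def power_mult_distrib power_divide power2_eq_square)
  \<comment> \<open>At each time the energy on A is R^2 y^2 p / m, which is at most R^2 because y
    \<le> 1 and p \<le> m.\<close>
  have boundE: "(LINT z|?P. indicator (S \<times> A) z * (v z)\<^sup>2) \<le> R\<^sup>2 * measure ?\<tau> S" if S: "S \<in> sets ?\<tau>" for S
  proof -
    have SA: "S \<times> A \<in> sets ?P" using S A by simp
    have "(LINT z|?P. indicator (S \<times> A) z * (v z)\<^sup>2) = (LINT t|?\<tau>. LINT x|Q. indicator (S \<times> A) (t, x) * (v (t, x))\<^sup>2)"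
      by (rule p.integral_fst'[symmetric]) (rule integrable_indicator_sq[OF vL SA])
    also have "\<dots> = (LINT t|?\<tau>. indicator S t * ((w t)\<^sup>2 * p t))"
      by (simp add: indicator_times mult.assoc sliceE)
    also have "\<dots> \<le> (LINT t|?\<tau>. R\<^sup>2 * indicator S t)"
    proof (rule integral_mono)
      have "integrable ?\<tau> (\<lambda>t. (w t)\<^sup>2 * p t)"
        by (intro continuous_integrable_time continuous_intros wc pc)
      then show "integrable ?\<tau> (\<lambda>t. indicator S t * ((w t)\<^sup>2 * p t))"
        using integrable_mult_indicator[OF S, of "\<lambda>t. (w t)\<^sup>2 * p t"] by simp
      show "integrable ?\<tau> (\<lambda>t. R\<^sup>2 * indicator S t)" using S by (intro integrable_mult_right) (auto simp: t.emeasure_eq_measure)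
      fix t assume "t \<in> space ?\<tau>"
      have "(w t)\<^sup>2 * p t = R\<^sup>2 * ((y t)\<^sup>2 * (p t / m t))" by (simp add: w2)
      also have "\<dots> \<le> R\<^sup>2 * (1 * 1)"
        using y[of t] p0[of t] m0[of t] \<epsilon> by (intro mult_left_mono mult_mono) (auto simp: power_le_one m_def)
      finally show "indicator S t * ((w t)\<^sup>2 * p t) \<le> R\<^sup>2 * indicator S t" by (auto simp: indicator_def)
    qed
    also have "\<dots> = R\<^sup>2 * measure ?\<tau> S" using S sets.sets_into_space[OF S] by (simp add: Int_absorb2)
    finally show ?thesis .
  qed
  have boundG: "(LINT z|?P. indicator ({0..T} \<times> (space Q - A)) z * (v z)\<^sup>2) \<le> R\<^sup>2"
  proof -
    have s0T: "{0..T} \<in> sets ?\<tau>" using sets.top[of ?\<tau>] by (simp add: space_time_measure)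
    have SA: "{0..T} \<times> (space Q - A) \<in> sets ?P" using s0T A by (intro pair_measureI) auto
    have "(LINT z|?P. indicator ({0..T} \<times> (space Q - A)) z * (v z)\<^sup>2) = (LINT t|?\<tau>. LINT x|Q. indicator ({0..T} \<times> (space Q - A)) (t, x) * (v (t, x))\<^sup>2)"
      by (rule p.integral_fst'[symmetric]) (rule integrable_indicator_sq[OF vL SA])
    also have "\<dots> = (LINT t|?\<tau>. indicator {0..T} t * ((w t)\<^sup>2 * q t))"
      by (simp add: indicator_times mult.assoc sliceG)
    also have "\<dots> = (LINT t|?\<tau>. R\<^sup>2 * ((y t)\<^sup>2 * (q t / m t)))"
      by (intro Bochner_Integration.integral_cong refl) (simp add: space_time_measure w2)
    \<comment> \<open>Since y' = - (1/2) (q / m) y, the integrand is minus the derivative of R^2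
      y^2. The total gradient energy is therefore R^2 (1 - y(T)^2).\<close>
    also have "\<dots> = (- (R\<^sup>2) * (y T)\<^sup>2) - (- (R\<^sup>2) * (y 0)\<^sup>2)"
    proof (rule time_integral_FTC)
      show "((\<lambda>t. - (R\<^sup>2) * (y t)\<^sup>2) has_real_derivative R\<^sup>2 * ((y t)\<^sup>2 * (q t / m t))) (at t within {0..T})" if "t \<in> {0..T}" for t
        using yd[OF that] by (auto intro!: derivative_eq_intros simp: power2_eq_square)
      show "continuous_on {0..T} (\<lambda>t. R\<^sup>2 * ((y t)\<^sup>2 * (q t / m t)))" by (intro continuous_intros yc qmc)
    qed (use T in simp)
    also have "\<dots> \<le> R\<^sup>2" by (simp add: y_def I0)
    finally show ?thesis .
  qed
  have vC: "v \<in> l2_bounds ?P W"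
    unfolding l2_bounds_def W using vL boundE boundG by auto
  define c where "c i j t = w t * (- (\<alpha> j t * \<alpha>' i t) * a j i + \<alpha> j t * \<alpha> i t * (b j i + 1/2 * g j i))" for i j t
  have inner_T: "l2_inner ?P v (\<lambda>(t, x). - \<alpha>' i t * E i x + \<alpha> i t * (B i x + 1/2 * G i x)) = (\<Sum>j\<in>J. LINT t|?\<tau>. c i j t)"
    if i: "i \<in> J" for i
  proof -
    have ca: "continuous_on {0..T} (\<lambda>t. - \<alpha>' i t)" using i by (intro continuous_intros \<alpha>'c)
    have "l2_inner ?P v (\<lambda>z. (case z of (t, x) \<Rightarrow> - \<alpha>' i t * E i x) + (case z of (t, x) \<Rightarrow> \<alpha> i t * (B i x + 1/2 * G i x))) =
        l2_inner ?P v (\<lambda>(t, x). - \<alpha>' i t * E i x) + l2_inner ?P v (\<lambda>(t, x). \<alpha> i t * (B i x + 1/2 * G i x))"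
      using i by (intro l2_inner_add_right tensor_L2 Q ca \<alpha>c E BGL vL)
    also have "\<dots> = (\<Sum>j\<in>J. (LINT t|?\<tau>. w t * \<alpha> j t * (- \<alpha>' i t)) * a j i + (LINT t|?\<tau>. w t * \<alpha> j t * \<alpha> i t) * (b j i + 1/2 * g j i))"
      using i by (subst (1 2) inner_tensor) (auto intro!: ca \<alpha>c E BGL[simplified] simp: sum.distrib[symmetric] VE VB[simplified])
    also have "\<dots> = (\<Sum>j\<in>J. LINT t|?\<tau>. c i j t)"
    proof (intro sum.cong refl)
      fix j assume j: "j \<in> J"
      have i1: "integrable ?\<tau> (\<lambda>t. w t * \<alpha> j t * (- \<alpha>' i t))" and i2: "integrable ?\<tau> (\<lambda>t. w t * \<alpha> j t * \<alpha> i t)"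
        using i j by (auto intro!: continuous_integrable_time continuous_intros wc \<alpha>c \<alpha>'c)
      have "(LINT t|?\<tau>. w t * \<alpha> j t * (- \<alpha>' i t)) * a j i + (LINT t|?\<tau>. w t * \<alpha> j t * \<alpha> i t) * (b j i + 1/2 * g j i)
        = (LINT t|?\<tau>. w t * \<alpha> j t * (- \<alpha>' i t) * a j i + w t * \<alpha> j t * \<alpha> i t * (b j i + 1/2 * g j i))"
        using i1 i2 by simp
      also have "\<dots> = (LINT t|?\<tau>. c i j t)"
        by (intro Bochner_Integration.integral_cong refl) (simp add: c_def algebra_simps)
      finally show "(LINT t|?\<tau>. w t * \<alpha> j t * (- \<alpha>' i t)) * a j i + (LINT t|?\<tau>. w t * \<alpha> j t * \<alpha> i t) * (b j i + 1/2 * g j i)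
        = (LINT t|?\<tau>. c i j t)" .
    qed
    finally show ?thesis by (simp add: case_prod_beta')
  qed
  have cint: "integrable ?\<tau> (c i j)" if "i \<in> J" "j \<in> J" for i j
    unfolding c_def[abs_def] using that by (intro continuous_integrable_time continuous_intros wc \<alpha>c \<alpha>'c)
  \<comment> \<open>The drift entries cancel in pairs by antisymmetry; the remaining ones add up to
    the derivative of |\<phi>|^2 and to |D\<phi>|^2.\<close>
  have pw: "(\<Sum>i\<in>J. \<Sum>j\<in>J. c i j t) = w t * (- (1/2) * p' t + 1/2 * q t)" for t
  proof -
    have b0: "(\<Sum>i\<in>J. \<Sum>j\<in>J. \<alpha> j t * \<alpha> i t * b j i) = 0"
    proof (rule double_sum_antisym_zero)
      fix i j assume "i \<in> J" "j \<in> J"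
      then have "b j i = - b i j" unfolding b_def by (rule anti[rotated])
      then show "\<alpha> j t * \<alpha> i t * b j i = - (\<alpha> i t * \<alpha> j t * b i j)" by simp
    qed
    have a1: "(\<Sum>i\<in>J. \<Sum>j\<in>J. \<alpha> j t * \<alpha>' i t * a j i) = 1/2 * p' t"
    proof -
      have "p' t = (\<Sum>i\<in>J. \<Sum>j\<in>J. \<alpha> j t * \<alpha>' i t * a j i) + (\<Sum>i\<in>J. \<Sum>j\<in>J. \<alpha> i t * \<alpha>' j t * a i j)"
        unfolding p'_def sum.distrib[symmetric] by (intro sum.cong refl) (simp add: asym algebra_simps)
      also have "(\<Sum>i\<in>J. \<Sum>j\<in>J. \<alpha> i t * \<alpha>' j t * a i j) = (\<Sum>i\<in>J. \<Sum>j\<in>J. \<alpha> j t * \<alpha>' i t * a j i)"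
        by (rule sum.swap)
      finally show ?thesis by simp
    qed
    have g1: "(\<Sum>i\<in>J. \<Sum>j\<in>J. \<alpha> j t * \<alpha> i t * g j i) = q t"
      unfolding q_def by (intro sum.cong refl) (simp add: g_def l2_inner_commute mult_ac)
    have "(\<Sum>i\<in>J. \<Sum>j\<in>J. c i j t) = w t * (- (\<Sum>i\<in>J. \<Sum>j\<in>J. \<alpha> j t * \<alpha>' i t * a j i)
        + (\<Sum>i\<in>J. \<Sum>j\<in>J. \<alpha> j t * \<alpha> i t * b j i) + 1/2 * (\<Sum>i\<in>J. \<Sum>j\<in>J. \<alpha> j t * \<alpha> i t * g j i))"
      unfolding sum_distrib_left sum_negf[symmetric] sum.distrib[symmetric]
      by (intro sum.cong refl) (simp add: c_def algebra_simps)
    then show ?thesis unfolding b0 a1 g1 by simp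
  qed
  have "(\<Sum>i\<in>J. l2_inner ?P v (\<lambda>(t, x). - \<alpha>' i t * E i x + \<alpha> i t * (B i x + 1/2 * G i x))) = (\<Sum>i\<in>J. \<Sum>j\<in>J. LINT t|?\<tau>. c i j t)"
    by (intro sum.cong refl inner_T)
  also have "\<dots> = (LINT t|?\<tau>. (\<Sum>i\<in>J. \<Sum>j\<in>J. c i j t))"
    using cint by (simp add: Bochner_Integration.integral_sum)
  also have "\<dots> = (LINT t|?\<tau>. w t * (- (1/2) * p' t + 1/2 * q t))" by (simp only: pw)
  also have "\<dots> = (- R * (y T * N T)) - (- R * (y 0 * N 0))"
  proof (rule time_integral_FTC)
    fix t assume t: "t \<in> {0..T}"
    have "((\<lambda>t. - R * (y t * N t)) has_real_derivative - R * (- (1/2) * (q t / m t) * y t * N t + p' t / (2 * N t) * y t)) (at t within {0..T})"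
      by (intro DERIV_cmult DERIV_mult yd Nd t)
    moreover have "- R * (- (1/2) * (q t / m t) * y t * N t + p' t / (2 * N t) * y t) = w t * (- (1/2) * p' t + 1/2 * q t)"
      unfolding NN[symmetric] w_def using N0[of t] by (simp add: field_simps)
    ultimately show "((\<lambda>t. - R * (y t * N t)) has_real_derivative w t * (- (1/2) * p' t + 1/2 * q t)) (at t within {0..T})"
      by simp
  next
    show "continuous_on {0..T} (\<lambda>t. w t * (- (1/2) * p' t + 1/2 * q t))" by (intro continuous_intros wc p'c qc)
  qed (use T in simp)
  also have "\<dots> = R * N 0 - R * (y T * N T)" by (simp add: y_def I0)
  \<comment> \<open>At time T the function \<phi> vanishes, so N(T) = \<epsilon> and the loss is at
    most R \<epsilon> \<le> e. At time 0, R N(0) is at least R |\<phi>|, which dominates the pairing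
    with the initial datum by Cauchy-Schwarz.\<close>
  also have "\<dots> \<ge> (\<Sum>i\<in>J. \<alpha> i 0 * l2_inner Q (E i) \<rho>) - e"
  proof -
    have "p T = 0" unfolding p_def using \<alpha>T by simp
    then have "N T = \<epsilon>" using \<epsilon> by (simp add: N_def m_def)
    then have "R * (y T * N T) \<le> R * (1 * \<epsilon>)" using y[of T] \<epsilon> R by (intro mult_left_mono mult_right_mono) auto
    then have 1: "R * (y T * N T) \<le> e" using \<epsilon>(2) by simp
    have fL: "L2_space Q (\<lambda>x. \<Sum>i\<in>J. \<alpha> i 0 * E i x)" by (intro L2_sum L2_scale E)
    have "(\<Sum>i\<in>J. \<alpha> i 0 * l2_inner Q (E i) \<rho>) = l2_inner Q (\<lambda>x. \<Sum>i\<in>J. \<alpha> i 0 * E i x) \<rho>"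
      by (subst l2_inner_sum_left) (auto intro!: L2_scale E \<rho> simp: l2_inner_scale)
    also have "\<dots> \<le> sqrt (p 0 * R\<^sup>2)"
    proof (rule real_le_rsqrt)
      have "(l2_inner Q (\<lambda>x. \<Sum>i\<in>J. \<alpha> i 0 * E i x) \<rho>)\<^sup>2 \<le> p 0 * l2_inner Q \<rho> \<rho>"
        unfolding p_sq by (rule l2_Cauchy_Schwarz[OF fL \<rho>(1)])
      also have "\<dots> \<le> p 0 * R\<^sup>2" by (intro mult_left_mono \<rho>(2) p0)
      finally show "(l2_inner Q (\<lambda>x. \<Sum>i\<in>J. \<alpha> i 0 * E i x) \<rho>)\<^sup>2 \<le> p 0 * R\<^sup>2" .
    qed
    also have "\<dots> = R * sqrt (p 0)" using R by (simp add: real_sqrt_mult)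
    also have "\<dots> \<le> R * N 0" using R by (intro mult_left_mono) (auto simp: N_def m_def)
    finally show ?thesis using 1 by linarith
  qed
  finally have main: "(\<Sum>i\<in>J. l2_inner ?P v (\<lambda>(t, x). - \<alpha>' i t * E i x + \<alpha> i t * (B i x + 1/2 * G i x)))
      \<ge> (\<Sum>i\<in>J. \<alpha> i 0 * l2_inner Q (E i) \<rho>) - e" .
  have "l2_inner ?P v (\<lambda>(t, x). \<beta> t * H x) = 0"
    if "continuous_on {0..T} \<beta>" "L2_space Q H" "\<forall>i\<in>J. l2_inner Q (E i) H + l2_inner Q (G i) H = 0" for \<beta> H
  proof -
    have "l2_inner Q (V j) H = 0" if j: "j \<in> J" for j
      using l2_inner_add[OF E[OF j] G[OF j] \<open>L2_space Q H\<close>] \<open>\<forall>i\<in>J. _\<close> j by (simp add: V_def[abs_def])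
    then show ?thesis by (simp add: inner_tensor[OF that(1,2)])
  qed
  then show ?thesis using vC main by blast
qed

text \<open>One inequality per measurable set S of times is the integrated form of a bound by c at
  almost every time on A. The last pair bounds the total energy off A, where the gradient part
  lives.\<close>

definition admissible_bounds :: "real \<Rightarrow> real \<Rightarrow> 'q measure \<Rightarrow> 'q set \<Rightarrow> ((real \<times> 'q) set \<times> real) set" where
  "admissible_bounds T c Q A = (\<lambda>S. (S \<times> A, c * measure (time_measure T) S)) ` sets (time_measure T)
     \<union> {({0..T} \<times> (space Q - A), c)}"

lemma sum_projl_cong:
  "(\<Sum>j\<in>{j \<in> J. isl j}. f j) = (\<Sum>j\<in>J. if isl j then f j else 0)" if "finite J"
  using that by (simp add: sum.inter_filter)

text \<open>The sum type keeps two kinds of constraints apart: \<open>Inl\<close> for the weak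
  equation, \<open>Inr\<close> for the relations indexed by Y. The latter have target 0 and vanish
  on the comparison element by \<open>con\<close>, so a mixed linear combination is dominated as
  soon as its \<open>Inl\<close> part is.\<close>

lemma space_time_solution:
  fixes Q :: "'q measure" and E B G :: "'x \<Rightarrow> 'q \<Rightarrow> real" and H :: "'c \<Rightarrow> 'q \<Rightarrow> real"
  assumes T: "T > 0" and R: "R \<ge> 0" and Q: "sigma_finite_measure Q" and A: "A \<in> sets Q"
    and E: "\<And>f. f \<in> X \<Longrightarrow> L2_space Q (E f)" and B: "\<And>f. f \<in> X \<Longrightarrow> L2_space Q (B f)"
    and G: "\<And>f. f \<in> X \<Longrightarrow> L2_space Q (G f)" and H: "\<And>c. c \<in> Y \<Longrightarrow> L2_space Q (H c)"
    and suppE: "\<And>f x. f \<in> X \<Longrightarrow> x \<in> space Q \<Longrightarrow> x \<notin> A \<Longrightarrow> E f x = 0"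
    and suppB: "\<And>f x. f \<in> X \<Longrightarrow> x \<in> space Q \<Longrightarrow> x \<notin> A \<Longrightarrow> B f x = 0"
    and suppG: "\<And>f x. f \<in> X \<Longrightarrow> x \<in> space Q \<Longrightarrow> x \<in> A \<Longrightarrow> G f x = 0"
    and anti: "\<And>f g. f \<in> X \<Longrightarrow> g \<in> X \<Longrightarrow> l2_inner Q (E f) (B g) = - l2_inner Q (E g) (B f)"
    and con: "\<And>f c. f \<in> X \<Longrightarrow> c \<in> Y \<Longrightarrow> l2_inner Q (E f) (H c) + l2_inner Q (G f) (H c) = 0"
    and \<rho>: "L2_space Q \<rho>" "l2_inner Q \<rho> \<rho> \<le> R\<^sup>2"
  shows "\<exists>u\<in>l2_bounds (time_measure T \<Otimes>\<^sub>M Q) (admissible_bounds T (R\<^sup>2) Q A).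
     (\<forall>f \<alpha> \<alpha>'. f \<in> X \<longrightarrow> (\<forall>t\<in>{0..T}. (\<alpha> has_real_derivative \<alpha>' t) (at t within {0..T})) \<longrightarrow>
        continuous_on {0..T} \<alpha>' \<longrightarrow> \<alpha> T = 0 \<longrightarrow>
        l2_inner (time_measure T \<Otimes>\<^sub>M Q) u (\<lambda>(t, x). - \<alpha>' t * E f x + \<alpha> t * (B f x + 1/2 * G f x))
          = \<alpha> 0 * l2_inner Q (E f) \<rho>) \<and>
     (\<forall>c \<beta>. c \<in> Y \<longrightarrow> continuous_on {0..T} \<beta> \<longrightarrow>
        l2_inner (time_measure T \<Otimes>\<^sub>M Q) u (\<lambda>(t, x). \<beta> t * H c x) = 0)"
proof -
  let ?P = "time_measure T \<Otimes>\<^sub>M Q" and ?W = "admissible_bounds T (R\<^sup>2) Q A"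
  define I1 :: "((real \<Rightarrow> real) \<times> (real \<Rightarrow> real) \<times> 'x) set" where
    "I1 = {(\<alpha>, \<alpha>', f). f \<in> X \<and> (\<forall>t\<in>{0..T}. (\<alpha> has_real_derivative \<alpha>' t) (at t within {0..T})) \<and>
        continuous_on {0..T} \<alpha>' \<and> \<alpha> T = 0}"
  define I2 :: "((real \<Rightarrow> real) \<times> 'c) set" where "I2 = {(\<beta>, c). c \<in> Y \<and> continuous_on {0..T} \<beta>}"
  define I where "I = I1 <+> I2"
  define test where "test j = (case j of Inl (\<alpha>, \<alpha>', f) \<Rightarrow> (\<lambda>(t, x). - \<alpha>' t * E f x + \<alpha> t * (B f x + 1/2 * G f x))
      | Inr (\<beta>, c) \<Rightarrow> (\<lambda>(t, x). \<beta> t * H c x))"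
    for j :: "((real \<Rightarrow> real) \<times> (real \<Rightarrow> real) \<times> 'x) + (real \<Rightarrow> real) \<times> 'c"
  define l where "l j = (case j of Inl (\<alpha>, \<alpha>', f) \<Rightarrow> \<alpha> 0 * l2_inner Q (E f) \<rho> | Inr _ \<Rightarrow> 0)"
    for j :: "((real \<Rightarrow> real) \<times> (real \<Rightarrow> real) \<times> 'x) + (real \<Rightarrow> real) \<times> 'c"
  have s0T: "{0..T} \<in> sets (time_measure T)" using sets.top[of "time_measure T"] by (simp add: space_time_measure)
  have Wsets: "Z \<in> sets ?P" if "(Z, c) \<in> ?W" for Z c
    using that A s0T by (auto simp: admissible_bounds_def intro!: pair_measureI)
  have ac: "continuous_on {0..T} \<alpha>" if "\<forall>t\<in>{0..T}. (\<alpha> has_real_derivative \<alpha>' t) (at t within {0..T})"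
    for \<alpha> \<alpha>' :: "real \<Rightarrow> real"
    using that by (intro DERIV_continuous_on) auto
  have "\<exists>u\<in>l2_bounds ?P ?W. \<forall>j\<in>I. l2_inner ?P u (test j) = l j"
  proof (rule minimax_L2[where B = "R\<^sup>2 * T + R\<^sup>2"])
    show "L2_space ?P u" if "u \<in> l2_bounds ?P ?W" for u using that by (simp add: l2_bounds_def)
    show "l2_inner ?P u u \<le> R\<^sup>2 * T + R\<^sup>2" if u: "u \<in> l2_bounds ?P ?W" for u
    proof -
      have uL: "L2_space ?P u" using u by (simp add: l2_bounds_def)
      let ?Z1 = "{0..T} \<times> A" and ?Z2 = "{0..T} \<times> (space Q - A)"
      have W1: "(?Z1, R\<^sup>2 * measure (time_measure T) {0..T}) \<in> ?W" using s0T by (auto simp: admissible_bounds_def)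
      have W2: "(?Z2, R\<^sup>2) \<in> ?W" by (auto simp: admissible_bounds_def)
      have "l2_inner ?P u u = (LINT z|?P. indicator ?Z1 z * (u z)\<^sup>2 + indicator ?Z2 z * (u z)\<^sup>2)"
        unfolding l2_inner_def using sets.sets_into_space[OF A]
        by (intro Bochner_Integration.integral_cong refl)
          (auto simp: indicator_def space_pair_measure space_time_measure power2_eq_square)
      also have "\<dots> = (LINT z|?P. indicator ?Z1 z * (u z)\<^sup>2) + (LINT z|?P. indicator ?Z2 z * (u z)\<^sup>2)"
        using integrable_indicator_sq[OF uL Wsets[OF W1]] integrable_indicator_sq[OF uL Wsets[OF W2]] by simp
      also have "\<dots> \<le> R\<^sup>2 * measure (time_measure T) {0..T} + R\<^sup>2"
        using u W1 W2 unfolding l2_bounds_def by (intro add_mono) blast+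
      also have "measure (time_measure T) {0..T} = T" using T by (simp add: measure_restrict_space)
      finally show ?thesis .
    qed
    show "(\<lambda>x. (1 - s) * u x + s * v x) \<in> l2_bounds ?P ?W"
      if "u \<in> l2_bounds ?P ?W" "v \<in> l2_bounds ?P ?W" "0 \<le> s" "s \<le> 1" for u v s
      using l2_bounds_convex[OF Wsets that] .
    show "u \<in> l2_bounds ?P ?W" if "\<And>n. U n \<in> l2_bounds ?P ?W" "L2_tendsto ?P U u" for U u
      using l2_bounds_closed[OF Wsets that] .
    show "L2_space ?P (test j)" if j: "j \<in> I" for j
    proof (cases j)
      case (Inl a)
      obtain \<alpha> \<alpha>' f where a: "a = (\<alpha>, \<alpha>', f)" by (cases a)
      have *: "f \<in> X" "continuous_on {0..T} \<alpha>" "continuous_on {0..T} (\<lambda>t. - \<alpha>' t)"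
        using j Inl a ac by (auto simp: I_def I1_def intro!: continuous_intros)
      have "L2_space ?P (\<lambda>z. (case z of (t, x) \<Rightarrow> - \<alpha>' t * E f x) + (case z of (t, x) \<Rightarrow> \<alpha> t * (B f x + 1/2 * G f x)))"
        by (intro L2_add[of ?P "\<lambda>(t, x). - \<alpha>' t * E f x" "\<lambda>(t, x). \<alpha> t * (B f x + 1/2 * G f x)"]
            tensor_L2 Q * E L2_add[of Q "B f" "\<lambda>x. 1/2 * G f x"] B L2_scale G)
      then show ?thesis by (simp add: test_def Inl a case_prod_beta')
    next
      case (Inr a)
      obtain \<beta> c where a: "a = (\<beta>, c)" by (cases a)
      have *: "c \<in> Y" "continuous_on {0..T} \<beta>" using j Inr a by (auto simp: I_def I2_def)
      then show ?thesis unfolding test_def Inr a using tensor_L2[OF Q *(2) H[OF *(1)]] by simp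
    qed
    fix J and r :: "_ \<Rightarrow> real" and e :: real
    assume J: "finite J" "J \<subseteq> I" and e: "e > 0"
    define J1 where "J1 = {j \<in> J. isl j}"
    \<comment> \<open>The coefficients r are absorbed into the time profiles, so a linear
      combination of constraints is again given by profiles that vanish at T.\<close>
    define \<alpha> where "\<alpha> j t = r j * fst (projl j) t" for j :: "((real \<Rightarrow> real) \<times> (real \<Rightarrow> real) \<times> 'x) + (real \<Rightarrow> real) \<times> 'c" and t
    define \<alpha>' where "\<alpha>' j t = r j * fst (snd (projl j)) t" for j :: "((real \<Rightarrow> real) \<times> (real \<Rightarrow> real) \<times> 'x) + (real \<Rightarrow> real) \<times> 'c" and t
    define f where "f j = snd (snd (projl j))" for j :: "((real \<Rightarrow> real) \<times> (real \<Rightarrow> real) \<times> 'x) + (real \<Rightarrow> real) \<times> 'c"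
    have J1I: "projl j \<in> I1" if "j \<in> J1" for j
      using that J(2) by (auto simp: J1_def I_def)
    have fX: "f j \<in> X" if "j \<in> J1" for j using J1I[OF that] by (auto simp: I1_def f_def)
    have J1: "finite J1" using J(1) by (simp add: J1_def)
    have "\<exists>v\<in>l2_bounds ?P ?W.
     (\<Sum>i\<in>J1. l2_inner ?P v (\<lambda>(t, x). - \<alpha>' i t * E (f i) x + \<alpha> i t * (B (f i) x + 1/2 * G (f i) x)))
       \<ge> (\<Sum>i\<in>J1. \<alpha> i 0 * l2_inner Q (E (f i)) \<rho>) - e \<and>
     (\<forall>\<beta> H. continuous_on {0..T} \<beta> \<longrightarrow> L2_space Q H \<longrightarrow>
        (\<forall>i\<in>J1. l2_inner Q (E (f i)) H + l2_inner Q (G (f i)) H = 0) \<longrightarrow>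
        l2_inner ?P v (\<lambda>(t, x). \<beta> t * H x) = 0)"
    proof (rule space_time_domination[OF T R Q A J1 E[OF fX] B[OF fX] G[OF fX] _ _ _ anti[OF fX fX] _ _ _ \<rho> e admissible_bounds_def])
      fix i t assume i: "i \<in> J1"
      show "x \<in> space Q \<Longrightarrow> x \<notin> A \<Longrightarrow> E (f i) x = 0" "x \<in> space Q \<Longrightarrow> x \<notin> A \<Longrightarrow> B (f i) x = 0"
        "x \<in> space Q \<Longrightarrow> x \<in> A \<Longrightarrow> G (f i) x = 0" for x
        using suppE[OF fX[OF i]] suppB[OF fX[OF i]] suppG[OF fX[OF i]] by blast+
      show "\<alpha> i T = 0" "continuous_on {0..T} (\<alpha>' i)" using J1I[OF i]
        by (auto simp: I1_def \<alpha>_def \<alpha>'_def[abs_def] intro!: continuous_intros)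
      assume "t \<in> {0..T}"
      then show "(\<alpha> i has_real_derivative \<alpha>' i t) (at t within {0..T})"
        using J1I[OF i] unfolding \<alpha>_def[abs_def] \<alpha>'_def by (intro DERIV_cmult) (auto simp: I1_def)
    qed
    then obtain v where v: "v \<in> l2_bounds ?P ?W"
     "(\<Sum>i\<in>J1. l2_inner ?P v (\<lambda>(t, x). - \<alpha>' i t * E (f i) x + \<alpha> i t * (B (f i) x + 1/2 * G (f i) x)))
       \<ge> (\<Sum>i\<in>J1. \<alpha> i 0 * l2_inner Q (E (f i)) \<rho>) - e"
     "\<And>\<beta> H. continuous_on {0..T} \<beta> \<Longrightarrow> L2_space Q H \<Longrightarrow>
        (\<forall>i\<in>J1. l2_inner Q (E (f i)) H + l2_inner Q (G (f i)) H = 0) \<Longrightarrow>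
        l2_inner ?P v (\<lambda>(t, x). \<beta> t * H x) = 0" by blast
    have Inr0: "l2_inner ?P v (test j) = 0" if "j \<in> J" "\<not> isl j" for j
    proof -
      obtain \<beta> c where j: "j = Inr (\<beta>, c)" using \<open>\<not> isl j\<close> by (cases j) auto
      have c: "c \<in> Y" "continuous_on {0..T} \<beta>" using j that(1) J(2) by (auto simp: I_def I2_def)
      show ?thesis using v(3)[OF c(2) H[OF c(1)]] con[OF fX c(1)] by (simp add: test_def j)
    qed
    have "(\<Sum>j\<in>J. r j * l2_inner ?P v (test j)) = (\<Sum>j\<in>J. if isl j then r j * l2_inner ?P v (test j) else 0)"
      using Inr0 by (intro sum.cong refl) auto
    also have "\<dots> = (\<Sum>i\<in>J1. r i * l2_inner ?P v (test i))"
      unfolding J1_def by (rule sum_projl_cong[OF J(1), symmetric])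
    also have "\<dots> = (\<Sum>i\<in>J1. l2_inner ?P v (\<lambda>(t, x). - \<alpha>' i t * E (f i) x + \<alpha> i t * (B (f i) x + 1/2 * G (f i) x)))"
    proof (intro sum.cong refl)
      fix i assume "i \<in> J1"
      then obtain a a' g where i: "i = Inl (a, a', g)" by (auto simp: J1_def isl_def)
      have "r i * l2_inner ?P v (test i) = l2_inner ?P v (\<lambda>z. r i * test i z)" by (rule l2_inner_scale_right[symmetric])
      also have "(\<lambda>z. r i * test i z) = (\<lambda>(t, x). - \<alpha>' i t * E (f i) x + \<alpha> i t * (B (f i) x + 1/2 * G (f i) x))"
        by (auto simp: fun_eq_iff test_def i \<alpha>_def \<alpha>'_def f_def algebra_simps)
      finally show "r i * l2_inner ?P v (test i) = l2_inner ?P v (\<lambda>(t, x). - \<alpha>' i t * E (f i) x + \<alpha> i t * (B (f i) x + 1/2 * G (f i) x))" .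
    qed
    finally have s1: "(\<Sum>j\<in>J. r j * l2_inner ?P v (test j)) = (\<Sum>i\<in>J1. l2_inner ?P v (\<lambda>(t, x). - \<alpha>' i t * E (f i) x + \<alpha> i t * (B (f i) x + 1/2 * G (f i) x)))" .
    have "(\<Sum>j\<in>J. r j * l j) = (\<Sum>j\<in>J. if isl j then r j * l j else 0)"
      by (intro sum.cong refl) (auto simp: l_def split: sum.split)
    also have "\<dots> = (\<Sum>i\<in>J1. r i * l i)"
      unfolding J1_def by (rule sum_projl_cong[OF J(1), symmetric])
    also have "\<dots> = (\<Sum>i\<in>J1. \<alpha> i 0 * l2_inner Q (E (f i)) \<rho>)"
      by (intro sum.cong refl) (auto simp: J1_def isl_def l_def \<alpha>_def f_def)
    finally have s2: "(\<Sum>j\<in>J. r j * l j) = (\<Sum>i\<in>J1. \<alpha> i 0 * l2_inner Q (E (f i)) \<rho>)" .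
    show "\<exists>v\<in>l2_bounds ?P ?W. (\<Sum>j\<in>J. r j * l2_inner ?P v (test j)) \<ge> (\<Sum>j\<in>J. r j * l j) - e"
      using v(2) by (intro bexI[OF _ v(1)]) (simp only: s1 s2)
  qed
  then obtain u where u: "u \<in> l2_bounds ?P ?W" "\<And>j. j \<in> I \<Longrightarrow> l2_inner ?P u (test j) = l j" by blast
  have "l2_inner ?P u (\<lambda>(t, x). - \<alpha>' t * E f x + \<alpha> t * (B f x + 1/2 * G f x)) = \<alpha> 0 * l2_inner Q (E f) \<rho>"
    if "f \<in> X" "\<forall>t\<in>{0..T}. (\<alpha> has_real_derivative \<alpha>' t) (at t within {0..T})"
       "continuous_on {0..T} \<alpha>'" "\<alpha> T = 0" for f \<alpha> \<alpha>'
  proof -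
    have "Inl (\<alpha>, \<alpha>', f) \<in> I" unfolding I_def by (rule InlI) (use that in \<open>simp add: I1_def\<close>)
    from u(2)[OF this] show ?thesis by (simp add: test_def l_def)
  qed
  moreover have "l2_inner ?P u (\<lambda>(t, x). \<beta> t * H c x) = 0" if "c \<in> Y" "continuous_on {0..T} \<beta>" for c \<beta>
  proof -
    have "Inr (\<beta>, c) \<in> I" unfolding I_def by (rule InrI) (use that in \<open>simp add: I2_def\<close>)
    from u(2)[OF this] show ?thesis by (simp add: test_def l_def)
  qed
  ultimately show ?thesis using u(1) by (intro bexI[of _ u]) blast+
qed

subsection \<open>Weak solutions\<close>

lemma count_space_prod_sigma_finite:
  assumes "sigma_finite_measure M"
  shows "sigma_finite_measure (count_space (UNIV :: 'k::countable set) \<Otimes>\<^sub>M M)"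
proof -
  interpret M: sigma_finite_measure M by fact
  interpret k: sigma_finite_measure "count_space (UNIV :: 'k set)"
    by (rule sigma_finite_measure_count_space)
  interpret p: pair_sigma_finite "count_space (UNIV :: 'k set)" M ..
  show ?thesis by (rule p.sigma_finite_measure_axioms)
qed

lemma count_space_prod_measurable:
  fixes h :: "'k::countable \<Rightarrow> 'a \<Rightarrow> real"
  assumes "\<And>k. h k \<in> borel_measurable M"
  shows "case_prod h \<in> borel_measurable (count_space UNIV \<Otimes>\<^sub>M M)"
  using assms by (intro measurable_pair_measure_countable1) auto

lemma count_space_prod_integrable:
  fixes h :: "'k::countable \<Rightarrow> 'a \<Rightarrow> real"
  assumes M: "sigma_finite_measure M" and h: "\<And>k. integrable M (h k)"
    and s: "(\<lambda>k. LINT x|M. \<bar>h k x\<bar>) summable_on UNIV"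
  shows "integrable (count_space UNIV \<Otimes>\<^sub>M M) (case_prod h)"
proof -
  interpret M: sigma_finite_measure M by fact
  interpret k: sigma_finite_measure "count_space (UNIV :: 'k set)"
    by (rule sigma_finite_measure_count_space)
  interpret p: pair_sigma_finite "count_space (UNIV :: 'k set)" M ..
  have "Infinite_Set_Sum.abs_summable_on (\<lambda>k. LINT x|M. \<bar>h k x\<bar>) UNIV"
    using s by (simp add: abs_summable_equivalent[symmetric])
  then have "integrable (count_space UNIV) (\<lambda>k. LINT x|M. norm (case (k, x) of (k, x) \<Rightarrow> h k x))"
    by (simp add: abs_summable_on_def)
  then show ?thesis
    using h by (intro p.Fubini_integrable count_space_prod_measurable) (auto simp: AE_count_space)
qed

lemma count_space_prod_L2:
  fixes h :: "'k::countable \<Rightarrow> 'a \<Rightarrow> real"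
  assumes M: "sigma_finite_measure M" and h: "\<And>k. L2_space M (h k)"
    and s: "(\<lambda>k. LINT x|M. (h k x)\<^sup>2) summable_on UNIV"
  shows "L2_space (count_space UNIV \<Otimes>\<^sub>M M) (case_prod h)"
proof -
  have "integrable (count_space UNIV \<Otimes>\<^sub>M M) (\<lambda>(k, x). (h k x)\<^sup>2)"
    using h s by (intro count_space_prod_integrable[OF M]) (auto simp: L2_space_def)
  moreover have "case_prod h \<in> borel_measurable (count_space UNIV \<Otimes>\<^sub>M M)"
    using h by (intro count_space_prod_measurable) (auto simp: L2_space_def)
  ultimately show ?thesis by (simp add: L2_space_def case_prod_beta')
qed

lemma count_space_prod_integral_finite:
  fixes h :: "'k::countable \<Rightarrow> 'a \<Rightarrow> real"
  assumes M: "sigma_finite_measure M" and h: "integrable (count_space UNIV \<Otimes>\<^sub>M M) (case_prod h)"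
    and K: "finite K" "\<And>k x. k \<notin> K \<Longrightarrow> h k x = 0"
  shows "(LINT z|(count_space UNIV \<Otimes>\<^sub>M M). case_prod h z) = (\<Sum>k\<in>K. LINT x|M. h k x)"
proof -
  interpret M: sigma_finite_measure M by fact
  interpret k: sigma_finite_measure "count_space (UNIV :: 'k set)"
    by (rule sigma_finite_measure_count_space)
  interpret p: pair_sigma_finite "count_space (UNIV :: 'k set)" M ..
  have z: "(LINT x|M. h k x) = 0" if "k \<notin> K" for k
    using K(2)[OF that] Bochner_Integration.integral_cong[of M M "h k" "\<lambda>_. 0"] by simp
  have "(LINT z|(count_space UNIV \<Otimes>\<^sub>M M). case_prod h z) = (LINT k|count_space UNIV. LINT x|M. h k x)"
    using p.integral_fst'[OF h] by simp
  also have "\<dots> = (\<Sum>k | k \<in> UNIV \<and> (LINT x|M. h k x) \<noteq> 0. LINT x|M. h k x)"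
    by (rule lebesgue_integral_count_space_finite_support)
      (rule finite_subset[OF _ K(1)], use z in blast)
  also have "\<dots> = (\<Sum>k\<in>K. LINT x|M. h k x)"
    by (rule sum.mono_neutral_left) (use K(1) z in auto)
  finally show ?thesis .
qed

text \<open>For each x exactly one k equals \<kappa> x, so this is Fubini for P and counting
  measure, applied to h times the indicator of that event.\<close>

lemma has_sum_integral_slices:
  fixes h :: "'p \<Rightarrow> real" and \<kappa> :: "'p \<Rightarrow> 'k::countable"
  assumes P: "sigma_finite_measure P" and \<kappa>: "\<kappa> \<in> measurable P (count_space UNIV)"
    and h: "integrable P h"
  shows "((\<lambda>k. LINT x|P. indicator {k} (\<kappa> x) * h x) has_sum (LINT x|P. h x)) UNIV"
proof -
  interpret P: sigma_finite_measure P by fact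
  interpret k: sigma_finite_measure "count_space (UNIV :: 'k set)"
    by (rule sigma_finite_measure_count_space)
  interpret p: pair_sigma_finite P "count_space (UNIV :: 'k set)" ..
  let ?f = "\<lambda>x k. indicator {k} (\<kappa> x) * h x"
  have [measurable]: "h \<in> borel_measurable P" using h by simp
  have sets[measurable]: "\<kappa> -` {k} \<inter> space P \<in> sets P" for k using \<kappa> by (rule measurable_sets) auto
  have meas: "(\<lambda>x. ?f x k) \<in> borel_measurable P" for k
  proof -
    have "(\<lambda>x. indicator (\<kappa> -` {k} \<inter> space P) x * h x) \<in> borel_measurable P" by measurable
    then show ?thesis by (rule subst[OF measurable_cong, rotated]) (auto simp: indicator_def)
  qed
  have "(\<lambda>(k, x). ?f x k) \<in> borel_measurable (count_space UNIV \<Otimes>\<^sub>M P)"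
    by (rule count_space_prod_measurable[OF meas])
  then have m: "(\<lambda>(x, k). ?f x k) \<in> borel_measurable (P \<Otimes>\<^sub>M count_space UNIV)"
    by (subst measurable_pair_swap_iff) (simp add: case_prod_beta')
  have single: "has_bochner_integral (count_space UNIV) (\<lambda>k. indicator {k} (\<kappa> x) :: real) 1" for x
  proof -
    have "has_bochner_integral (count_space UNIV) (indicator {\<kappa> x} :: _ \<Rightarrow> real) (measure (count_space UNIV) {\<kappa> x})"
      by (intro has_bochner_integral_real_indicator) auto
    moreover have "(indicator {\<kappa> x} :: _ \<Rightarrow> real) = (\<lambda>k. indicator {k} (\<kappa> x))"
      by (auto simp: indicator_def fun_eq_iff)
    moreover have "measure (count_space UNIV) {\<kappa> x} = 1"
      by (simp add: measure_def)
    ultimately show ?thesis by simp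
  qed
  note single = has_bochner_integral_integral_eq[OF single] integrable.intros[OF single]
  have int: "integrable (P \<Otimes>\<^sub>M count_space UNIV) (\<lambda>(x, k). ?f x k)"
  proof (rule p.Fubini_integrable[OF m])
    show "integrable P (\<lambda>x. LINT k|count_space UNIV. norm (case (x, k) of (x, k) \<Rightarrow> ?f x k))"
      using h by (simp add: abs_mult single)
    show "AE x in P. integrable (count_space UNIV) (\<lambda>k. case (x, k) of (x, k) \<Rightarrow> ?f x k)"
      by (simp add: single)
  qed
  have "integrable (count_space UNIV) (\<lambda>k. LINT x|P. ?f x k)"
    using p.integrable_snd[OF int] .
  then have as: "Infinite_Set_Sum.abs_summable_on (\<lambda>k. LINT x|P. ?f x k) UNIV" by (simp add: abs_summable_on_def)
  have "infsum (\<lambda>k. LINT x|P. ?f x k) UNIV = (LINT k|count_space UNIV. LINT x|P. ?f x k)"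
    using infsetsum_infsum[OF as] by (simp add: infsetsum_def)
  also have "\<dots> = (LINT x|P. LINT k|count_space UNIV. ?f x k)"
    by (rule p.Fubini_integral[OF int])
  also have "\<dots> = (LINT x|P. h x)" by (simp add: single)
  finally have "infsum (\<lambda>k. LINT x|P. ?f x k) UNIV = (LINT x|P. h x)" .
  moreover have "((\<lambda>k. LINT x|P. ?f x k) has_sum infsum (\<lambda>k. LINT x|P. ?f x k) UNIV) UNIV"
    by (rule has_sum_infsum[OF abs_summable_summable])
      (use as in \<open>unfold abs_summable_equivalent\<close>)
  ultimately show ?thesis by simp
qed

text \<open>Counting measure gives the index k mass one. Hence inserting k carries the product of N
  and M to the triple product restricted to mode k, and both claims are a change of variables along
  this map.\<close>

lemma slice_integral:
  fixes h :: "'t \<times> 'k::countable \<times> 'a \<Rightarrow> real"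
  assumes N: "sigma_finite_measure N" and M: "sigma_finite_measure M"
    and h: "integrable (N \<Otimes>\<^sub>M (count_space UNIV \<Otimes>\<^sub>M M)) h"
  shows "integrable (N \<Otimes>\<^sub>M M) (\<lambda>(t, x). h (t, k, x))"
    and "(LINT t|N. LINT x|M. h (t, k, x)) =
      (LINT z|(N \<Otimes>\<^sub>M (count_space UNIV \<Otimes>\<^sub>M M)). indicator {k} (fst (snd z)) * h z)"
proof -
  interpret N: sigma_finite_measure N by fact
  interpret M: sigma_finite_measure M by fact
  let ?C = "count_space (UNIV :: 'k set)"
  interpret C: sigma_finite_measure ?C by (rule sigma_finite_measure_count_space)
  interpret CM: pair_sigma_finite ?C M ..
  interpret Q: sigma_finite_measure "?C \<Otimes>\<^sub>M M" by (rule count_space_prod_sigma_finite[OF M])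
  interpret P: pair_sigma_finite N "?C \<Otimes>\<^sub>M M" ..
  interpret NM: pair_sigma_finite N M ..
  let ?P = "N \<Otimes>\<^sub>M (?C \<Otimes>\<^sub>M M)" and ?j = "\<lambda>z. (fst z, k, snd z)"
  have jm[measurable]: "?j \<in> measurable (N \<Otimes>\<^sub>M M) ?P" by measurable
  have km: "(\<lambda>z. indicator {k} (fst (snd z)) :: ennreal) \<in> borel_measurable ?P" by measurable
  have kmr: "(\<lambda>z. indicator {k} (fst (snd z)) :: real) \<in> borel_measurable ?P" by measurable
  have eq: "distr (N \<Otimes>\<^sub>M M) ?P ?j = density ?P (\<lambda>z. ennreal (indicator {k} (fst (snd z))))"
  proof (rule measure_eqI)
    fix A assume "A \<in> sets (distr (N \<Otimes>\<^sub>M M) ?P ?j)"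
    then have A[measurable]: "A \<in> sets ?P" by simp
    have "emeasure (distr (N \<Otimes>\<^sub>M M) ?P ?j) A = (\<integral>\<^sup>+z. indicator A z \<partial>distr (N \<Otimes>\<^sub>M M) ?P ?j)"
      using A by simp
    also have "\<dots> = (\<integral>\<^sup>+z. indicator A (?j z) \<partial>(N \<Otimes>\<^sub>M M))"
      by (rule nn_integral_distr) (use jm A in auto)
    also have "\<dots> = (\<integral>\<^sup>+t. \<integral>\<^sup>+x. indicator A (t, k, x) \<partial>M \<partial>N)"
      by (subst M.nn_integral_fst[symmetric]) (auto intro: borel_measurable_indicator measurable_compose[OF jm])
    also have "\<dots> = (\<integral>\<^sup>+t. \<integral>\<^sup>+q. ennreal (indicator {k} (fst q)) * indicator A (t, q) \<partial>(?C \<Otimes>\<^sub>M M) \<partial>N)"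
    proof (rule nn_integral_cong)
      fix t assume t: "t \<in> space N"
      have [measurable]: "(\<lambda>q. (t, q)) \<in> measurable (?C \<Otimes>\<^sub>M M) ?P" using t by measurable
      have mm: "(\<lambda>q. ennreal (indicator {k} (fst q)) * indicator A (t, q)) \<in> borel_measurable (?C \<Otimes>\<^sub>M M)"
        by measurable
      have "(\<integral>\<^sup>+q. ennreal (indicator {k} (fst q)) * indicator A (t, q) \<partial>(?C \<Otimes>\<^sub>M M)) =
          (\<integral>\<^sup>+l. \<integral>\<^sup>+x. ennreal (indicator {k} l) * indicator A (t, l, x) \<partial>M \<partial>?C)"
        by (subst M.nn_integral_fst[OF mm, symmetric]) simp
      also have "\<dots> = (\<Sum>l\<in>{k}. \<integral>\<^sup>+x. ennreal (indicator {k} l) * indicator A (t, l, x) \<partial>M)"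
        by (rule nn_integral_count_space') auto
      finally show "(\<integral>\<^sup>+x. indicator A (t, k, x) \<partial>M) =
          (\<integral>\<^sup>+q. ennreal (indicator {k} (fst q)) * indicator A (t, q) \<partial>(?C \<Otimes>\<^sub>M M))" by simp
    qed
    also have "\<dots> = (\<integral>\<^sup>+z. ennreal (indicator {k} (fst (snd z))) * indicator A z \<partial>?P)"
      by (subst sigma_finite_measure.nn_integral_fst[OF count_space_prod_sigma_finite[OF M], symmetric]) (auto intro!: borel_measurable_times measurable_compose[OF kmr])
    also have "\<dots> = emeasure (density ?P (\<lambda>z. ennreal (indicator {k} (fst (snd z))))) A"
      by (rule emeasure_density[symmetric]) (use A kmr in auto)
    finally show "emeasure (distr (N \<Otimes>\<^sub>M M) ?P ?j) A = emeasure (density ?P (\<lambda>z. ennreal (indicator {k} (fst (snd z))))) A" .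
  qed simp
  have hm: "h \<in> borel_measurable ?P" using h by simp
  have "integrable ?P (\<lambda>z. indicator {k} (fst (snd z)) * h z)"
    by (rule Bochner_Integration.integrable_bound[OF h]) (use hm kmr in \<open>auto simp: indicator_def\<close>)
  then have "integrable (density ?P (\<lambda>z. ennreal (indicator {k} (fst (snd z))))) h"
    using hm kmr by (subst integrable_density) auto
  then have "integrable (distr (N \<Otimes>\<^sub>M M) ?P ?j) h" by (simp add: eq)
  then have i: "integrable (N \<Otimes>\<^sub>M M) (\<lambda>z. h (?j z))" using hm jm by (subst (asm) integrable_distr_eq) auto
  then show i': "integrable (N \<Otimes>\<^sub>M M) (\<lambda>(t, x). h (t, k, x))" by (simp add: case_prod_beta')
  have "(LINT t|N. LINT x|M. h (t, k, x)) = (LINT z|(N \<Otimes>\<^sub>M M). h (?j z))"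
    using NM.integral_fst'[OF i] by simp
  also have "\<dots> = (LINT z|distr (N \<Otimes>\<^sub>M M) ?P ?j. h z)" using hm jm by (subst integral_distr) auto
  also have "\<dots> = (LINT z|density ?P (\<lambda>z. ennreal (indicator {k} (fst (snd z)))). h z)" by (simp add: eq)
  also have "\<dots> = (LINT z|?P. indicator {k} (fst (snd z)) * h z)"
    using hm kmr by (subst integral_density) auto
  finally show "(LINT t|N. LINT x|M. h (t, k, x)) = (LINT z|?P. indicator {k} (fst (snd z)) * h z)" .
qed

lemma has_sum_slices:
  fixes h :: "'t \<times> 'k::countable \<times> 'a \<Rightarrow> real"
  assumes N: "sigma_finite_measure N" and M: "sigma_finite_measure M"
    and h: "integrable (N \<Otimes>\<^sub>M (count_space UNIV \<Otimes>\<^sub>M M)) h"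
  shows "((\<lambda>k. LINT t|N. LINT x|M. h (t, k, x)) has_sum (LINT z|(N \<Otimes>\<^sub>M (count_space UNIV \<Otimes>\<^sub>M M)). h z)) UNIV"
proof -
  interpret N: sigma_finite_measure N by fact
  interpret Q: sigma_finite_measure "count_space (UNIV :: 'k set) \<Otimes>\<^sub>M M" by (rule count_space_prod_sigma_finite[OF M])
  interpret P: pair_sigma_finite N "count_space (UNIV :: 'k set) \<Otimes>\<^sub>M M" ..
  show ?thesis unfolding slice_integral(2)[OF N M h]
    by (rule has_sum_integral_slices[where \<kappa> = "\<lambda>z. fst (snd z)", OF P.sigma_finite_measure_axioms _ h])
      (rule measurable_compose[OF measurable_snd measurable_fst])
qed

section \<open>The abstract existence theorem\<close>

lemma L2_if:
  "(P \<Longrightarrow> L2_space M g) \<Longrightarrow> (\<not> P \<Longrightarrow> L2_space M h) \<Longrightarrow> L2_space M (\<lambda>x. if P then g x else h x)"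
  by (cases P) simp_all

text \<open>\<open>k\<^sub>0\<close> is a spare index, distinct from the modes of the noise. With it
  \<rho> and all \<phi>_k form one function of time, index and state, and the set A of
  \<open>space_time_solution\<close> becomes the slice at that index.\<close>

theorem weak_solution_exists:
  fixes M :: "'a measure" and F :: "'x \<Rightarrow> 'a \<Rightarrow> real" and D :: "'k::countable \<Rightarrow> 'x \<Rightarrow> 'a \<Rightarrow> real"
    and b :: "'x \<Rightarrow> 'a \<Rightarrow> real" and \<rho>\<^sub>0 :: "'a \<Rightarrow> real" and k\<^sub>0 :: 'k
  assumes T: "T > 0" and M: "sigma_finite_measure M"
    and F: "\<And>f. f \<in> X \<Longrightarrow> L2_space M (F f)" and b: "\<And>f. f \<in> X \<Longrightarrow> L2_space M (b f)"
    and D: "\<And>k f. f \<in> X \<Longrightarrow> k \<noteq> k\<^sub>0 \<Longrightarrow> L2_space M (D k f)"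
    and D_summable: "\<And>f. f \<in> X \<Longrightarrow> (\<lambda>k. LINT x|M. (D k f x)\<^sup>2) summable_on (- {k\<^sub>0})"
    and D_anti: "\<And>k f g. f \<in> X \<Longrightarrow> g \<in> X \<Longrightarrow> k \<noteq> k\<^sub>0 \<Longrightarrow> l2_inner M (D k f) (F g) = - l2_inner M (F f) (D k g)"
    and b_anti: "\<And>f g. f \<in> X \<Longrightarrow> g \<in> X \<Longrightarrow> l2_inner M (b f) (F g) = - l2_inner M (F f) (b g)"
    and \<rho>\<^sub>0: "L2_space M \<rho>\<^sub>0"
  shows "\<exists>\<rho> \<phi>. case_prod \<rho> \<in> borel_measurable (time_measure T \<Otimes>\<^sub>M M) \<and>
     (AE t in time_measure T. L2_space M (\<rho> t) \<and> (LINT x|M. (\<rho> t x)\<^sup>2) \<le> (LINT x|M. (\<rho>\<^sub>0 x)\<^sup>2)) \<and>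
     L2_space (time_measure T \<Otimes>\<^sub>M M) (case_prod \<rho>) \<and>
     (\<forall>k. L2_space (time_measure T \<Otimes>\<^sub>M M) (case_prod (\<phi> k))) \<and>
     (\<forall>k f \<beta>. k \<noteq> k\<^sub>0 \<longrightarrow> f \<in> X \<longrightarrow> continuous_on {0..T} \<beta> \<longrightarrow>
        (LINT t|time_measure T. LINT x|M. \<beta> t * D k f x * \<rho> t x) =
        - (LINT t|time_measure T. LINT x|M. \<beta> t * F f x * \<phi> k t x)) \<and>
     (\<lambda>k. LINT t|time_measure T. LINT x|M. (\<phi> k t x)\<^sup>2) summable_on (- {k\<^sub>0}) \<and>
     (\<Sum>\<^sub>\<infinity>k\<in>- {k\<^sub>0}. LINT t|time_measure T. LINT x|M. (\<phi> k t x)\<^sup>2) \<le> (LINT x|M. (\<rho>\<^sub>0 x)\<^sup>2) \<and>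
     (\<forall>f \<alpha> \<alpha>'. f \<in> X \<longrightarrow> (\<forall>t\<in>{0..T}. (\<alpha> has_real_derivative \<alpha>' t) (at t within {0..T})) \<longrightarrow>
        continuous_on {0..T} \<alpha>' \<longrightarrow> \<alpha> T = 0 \<longrightarrow>
        (\<lambda>k. LINT t|time_measure T. LINT x|M. \<alpha> t * D k f x * \<phi> k t x) summable_on (- {k\<^sub>0}) \<and>
        0 = \<alpha> 0 * (LINT x|M. F f x * \<rho>\<^sub>0 x)
          + (LINT t|time_measure T. LINT x|M. \<rho> t x * (\<alpha>' t * F f x - \<alpha> t * b f x))
          - 1 / 2 * (\<Sum>\<^sub>\<infinity>k\<in>- {k\<^sub>0}. LINT t|time_measure T. LINT x|M. \<alpha> t * D k f x * \<phi> k t x))"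
proof -
  let ?\<tau> = "time_measure T" and ?Q = "count_space (UNIV :: 'k set) \<Otimes>\<^sub>M M"
  let ?P = "?\<tau> \<Otimes>\<^sub>M ?Q" and ?A = "{k\<^sub>0} \<times> space M"
  interpret t: finite_measure ?\<tau> by (rule time_measure_finite)
  interpret M: sigma_finite_measure M by fact
  interpret tM: pair_sigma_finite ?\<tau> M ..
  have tau: "sigma_finite_measure ?\<tau>" ..
  define R where "R = sqrt (LINT x|M. (\<rho>\<^sub>0 x)\<^sup>2)"
  have R: "R \<ge> 0" "R\<^sup>2 = (LINT x|M. (\<rho>\<^sub>0 x)\<^sup>2)" by (simp_all add: R_def)
  have Q: "sigma_finite_measure ?Q" by (rule count_space_prod_sigma_finite[OF M])
  have A: "?A \<in> sets ?Q" by simp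
  \<comment> \<open>the index \<open>k\<^sub>0\<close> carries \<open>\<rho>\<close>, every other index \<open>k\<close> carries \<open>\<phi>\<^sub>k\<close>\<close>
  define at0 where "at0 g = (\<lambda>(k, x). if k = k\<^sub>0 then g x else 0)" for g :: "'a \<Rightarrow> real"
  define G where "G f = (\<lambda>(k, x). if k = k\<^sub>0 then 0 else D k f x)" for f
  \<comment> \<open>Orthogonality to H of (k, f) is the defining relation of the distributional
    derivative: the pairing of D k f with \<rho> plus the pairing of F f with \<phi>_k is 0.\<close>
  define H where "H c = (\<lambda>(k, x). if k = k\<^sub>0 then D (fst c) (snd c) x else if k = fst c then F (snd c) x else 0)" for c
  have fin_L2: "L2_space ?Q (case_prod h)" if "\<And>k. L2_space M (h k)" "finite K" "\<And>k x. k \<notin> K \<Longrightarrow> h k x = 0"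
    for h :: "'k \<Rightarrow> 'a \<Rightarrow> real" and K
  proof (rule count_space_prod_L2[OF M that(1)])
    show "(\<lambda>k. LINT x|M. (h k x)\<^sup>2) summable_on UNIV"
      using summable_on_finite[OF that(2), of "\<lambda>k. LINT x|M. (h k x)\<^sup>2"]
      by (rule summable_on_cong_neutral[THEN iffD1, rotated -1]) (auto simp: that(3))
  qed
  have fin_inner: "l2_inner ?Q (case_prod g) (case_prod h) = (\<Sum>k\<in>K. l2_inner M (g k) (h k))"
    if "L2_space ?Q (case_prod g)" "L2_space ?Q (case_prod h)" "finite K" "\<And>k x. k \<notin> K \<Longrightarrow> g k x * h k x = 0"
    for g h :: "'k \<Rightarrow> 'a \<Rightarrow> real" and K
    using count_space_prod_integral_finite[OF M, of "\<lambda>k x. g k x * h k x" K] L2_mult_integrable[OF that(1,2)] that(3,4)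
    by (simp add: l2_inner_def case_prod_beta')
  have at0_L2: "L2_space ?Q (at0 g)" if "L2_space M g" for g
    unfolding at0_def by (rule fin_L2[where K = "{k\<^sub>0}"]) (use that in \<open>auto intro!: L2_if L2_zero\<close>)
  have at0_inner: "l2_inner ?Q (at0 g) (case_prod h) = l2_inner M g (h k\<^sub>0)"
    if "L2_space M g" "L2_space ?Q (case_prod h)" for g h
    using fin_inner[of "\<lambda>k x. if k = k\<^sub>0 then g x else 0" h "{k\<^sub>0}"] at0_L2[OF that(1)] that(2) by (simp add: at0_def)
  have G_L2: "L2_space ?Q (G f)" if "f \<in> X" for f
    unfolding G_def
  proof (rule count_space_prod_L2[OF M])
    show "L2_space M (\<lambda>x. if k = k\<^sub>0 then 0 else D k f x)" for k by (intro L2_if L2_zero D[OF that])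
    have "(\<lambda>k. LINT x|M. (if k = k\<^sub>0 then 0 else D k f x)\<^sup>2) summable_on UNIV \<longleftrightarrow> (\<lambda>k. LINT x|M. (D k f x)\<^sup>2) summable_on (- {k\<^sub>0})"
      by (rule summable_on_cong_neutral) auto
    then show "(\<lambda>k. LINT x|M. (if k = k\<^sub>0 then 0 else D k f x)\<^sup>2) summable_on UNIV" using D_summable[OF that] by simp
  qed
  have H_L2: "L2_space ?Q (H c)" if "c \<in> (- {k\<^sub>0}) \<times> X" for c
    unfolding H_def by (rule fin_L2[where K = "{k\<^sub>0, fst c}"]) (use that in \<open>auto intro!: L2_if L2_zero D F\<close>)
  have "\<exists>u\<in>l2_bounds ?P (admissible_bounds T (R\<^sup>2) ?Q ?A).
     (\<forall>f \<alpha> \<alpha>'. f \<in> X \<longrightarrow> (\<forall>t\<in>{0..T}. (\<alpha> has_real_derivative \<alpha>' t) (at t within {0..T})) \<longrightarrow>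
        continuous_on {0..T} \<alpha>' \<longrightarrow> \<alpha> T = 0 \<longrightarrow>
        l2_inner ?P u (\<lambda>(t, x). - \<alpha>' t * at0 (F f) x + \<alpha> t * (at0 (b f) x + 1/2 * G f x))
          = \<alpha> 0 * l2_inner ?Q (at0 (F f)) (at0 \<rho>\<^sub>0)) \<and>
     (\<forall>c \<beta>. c \<in> (- {k\<^sub>0}) \<times> X \<longrightarrow> continuous_on {0..T} \<beta> \<longrightarrow>
        l2_inner ?P u (\<lambda>(t, x). \<beta> t * H c x) = 0)"
  proof (rule space_time_solution[OF T R(1) Q A])
    show "L2_space ?Q (at0 (F f))" "L2_space ?Q (at0 (b f))" "L2_space ?Q (G f)" if "f \<in> X" for f
      using that F b by (auto intro: at0_L2 G_L2)
    show "L2_space ?Q (H c)" if "c \<in> (- {k\<^sub>0}) \<times> X" for c by (rule H_L2[OF that])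
    show "at0 (F f) x = 0" "at0 (b f) x = 0" if "f \<in> X" "x \<in> space ?Q" "x \<notin> ?A" for f x
      using that(2,3) by (auto simp: at0_def space_pair_measure split: if_splits)
    show "G f x = 0" if "f \<in> X" "x \<in> space ?Q" "x \<in> ?A" for f x
      using that(3) by (auto simp: G_def)
    show "l2_inner ?Q (at0 (F f)) (at0 (b g)) = - l2_inner ?Q (at0 (F g)) (at0 (b f))" if "f \<in> X" "g \<in> X" for f g
      using at0_inner[OF F[OF that(1)], of "\<lambda>k x. if k = k\<^sub>0 then b g x else 0"] at0_L2[OF b[OF that(2)]]
        at0_inner[OF F[OF that(2)], of "\<lambda>k x. if k = k\<^sub>0 then b f x else 0"] at0_L2[OF b[OF that(1)]]
        b_anti[OF that]
      by (simp add: at0_def l2_inner_commute)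
    \<comment> \<open>A test function together with its gradient satisfies this relation precisely
      because D k is antisymmetric.\<close>
    show "l2_inner ?Q (at0 (F f)) (H c) + l2_inner ?Q (G f) (H c) = 0" if "f \<in> X" "c \<in> (- {k\<^sub>0}) \<times> X" for f c
    proof -
      note cX = that(2)
      obtain k g where c: "c = (k, g)" "k \<noteq> k\<^sub>0" "g \<in> X" using cX by auto
      define h' where "h' l x = (if l = k\<^sub>0 then D k g x else if l = k then F g x else 0)" for l x
      have Hc: "H c = case_prod h'" by (simp add: H_def c h'_def fun_eq_iff)
      have h'L: "L2_space ?Q (case_prod h')" using H_L2[OF cX] by (simp add: Hc)
      have h'0: "h' k\<^sub>0 = D k g" and h'k: "h' k = F g" using c by (simp_all add: h'_def fun_eq_iff)
      have "l2_inner ?Q (at0 (F f)) (H c) = l2_inner M (F f) (D k g)"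
        unfolding Hc using at0_inner[OF F[OF that(1)] h'L] by (simp add: h'0)
      moreover have "l2_inner ?Q (G f) (H c) = (\<Sum>l\<in>{k}. l2_inner M (\<lambda>x. if l = k\<^sub>0 then 0 else D l f x) (h' l))"
        unfolding Hc G_def by (rule fin_inner[OF G_L2[OF that(1), unfolded G_def] h'L]) (auto simp: h'_def)
      then have "l2_inner ?Q (G f) (H c) = l2_inner M (D k f) (F g)" using c by (simp add: h'k)
      ultimately show ?thesis using D_anti[OF that(1) c(3,2)] by simp
    qed
    show "L2_space ?Q (at0 \<rho>\<^sub>0)" by (rule at0_L2[OF \<rho>\<^sub>0])
    show "l2_inner ?Q (at0 \<rho>\<^sub>0) (at0 \<rho>\<^sub>0) \<le> R\<^sup>2"
    proof -
      have "l2_inner M \<rho>\<^sub>0 \<rho>\<^sub>0 = R\<^sup>2" unfolding R(2) l2_inner_def by (simp add: power2_eq_square)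
      then show ?thesis
        using at0_inner[OF \<rho>\<^sub>0, of "\<lambda>k x. if k = k\<^sub>0 then \<rho>\<^sub>0 x else 0"] at0_L2[OF \<rho>\<^sub>0] by (simp add: at0_def)
    qed
  qed
  then obtain u where u: "u \<in> l2_bounds ?P (admissible_bounds T (R\<^sup>2) ?Q ?A)"
    and weak: "\<And>f \<alpha> \<alpha>'. f \<in> X \<Longrightarrow> (\<forall>t\<in>{0..T}. (\<alpha> has_real_derivative \<alpha>' t) (at t within {0..T})) \<Longrightarrow>
        continuous_on {0..T} \<alpha>' \<Longrightarrow> \<alpha> T = 0 \<Longrightarrow>
        l2_inner ?P u (\<lambda>(t, x). - \<alpha>' t * at0 (F f) x + \<alpha> t * (at0 (b f) x + 1/2 * G f x))
          = \<alpha> 0 * l2_inner ?Q (at0 (F f)) (at0 \<rho>\<^sub>0)"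
    and constraint: "\<And>c \<beta>. c \<in> (- {k\<^sub>0}) \<times> X \<Longrightarrow> continuous_on {0..T} \<beta> \<Longrightarrow>
        l2_inner ?P u (\<lambda>(t, x). \<beta> t * H c x) = 0" by blast
  have uL: "L2_space ?P u" using u by (simp add: l2_bounds_def)
  define \<phi> where "\<phi> k t x = u (t, k, x)" for k t x
  define \<rho> where "\<rho> = \<phi> k\<^sub>0"
  note sl = slice_integral[OF tau M] and hs = has_sum_slices[OF tau M]
  have u2: "integrable ?P (\<lambda>z. (u z)\<^sup>2)" using uL by (simp add: L2_space_def)
  have meas: "case_prod (\<phi> k) \<in> borel_measurable (?\<tau> \<Otimes>\<^sub>M M)" for k
  proof -
    have "(\<lambda>z. (fst z, k, snd z)) \<in> measurable (?\<tau> \<Otimes>\<^sub>M M) ?P" by measurable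
    from measurable_compose[OF this L2_measurable[OF uL]] show ?thesis
      by (simp add: \<phi>_def case_prod_beta')
  qed
  have phi2: "integrable (?\<tau> \<Otimes>\<^sub>M M) (\<lambda>(t, x). (\<phi> k t x)\<^sup>2)" for k
    unfolding \<phi>_def by (rule sl(1)[OF u2])
  have \<phi>L: "L2_space (?\<tau> \<Otimes>\<^sub>M M) (case_prod (\<phi> k))" for k
    using meas[of k] phi2[of k] by (simp add: L2_space_def case_prod_beta')
  define r where "r t = (LINT x|M. (\<rho> t x)\<^sup>2)" for t
  have r_int: "integrable ?\<tau> r" unfolding r_def \<rho>_def using tM.integrable_fst'[OF phi2[of k\<^sub>0]] by simp
  have r_bound: "(LINT t|?\<tau>. indicator S t * r t) \<le> R\<^sup>2 * measure ?\<tau> S" if S: "S \<in> sets ?\<tau>" for S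
  proof -
    have SA: "S \<times> ?A \<in> sets ?P" using S A by simp
    have W: "(S \<times> ?A, R\<^sup>2 * measure ?\<tau> S) \<in> admissible_bounds T (R\<^sup>2) ?Q ?A"
      using S by (auto simp: admissible_bounds_def)
    have "(LINT t|?\<tau>. LINT x|M. indicator (S \<times> ?A) (t, k\<^sub>0, x) * (u (t, k\<^sub>0, x))\<^sup>2) =
       (LINT z|?P. indicator {k\<^sub>0} (fst (snd z)) * (indicator (S \<times> ?A) z * (u z)\<^sup>2))"
      by (rule sl(2)[OF integrable_indicator_sq[OF uL SA]])
    also have "\<dots> = (LINT z|?P. indicator (S \<times> ?A) z * (u z)\<^sup>2)"
      by (intro Bochner_Integration.integral_cong refl) (auto simp: indicator_def)
    also have "\<dots> \<le> R\<^sup>2 * measure ?\<tau> S" using u W by (auto simp: l2_bounds_def)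
    also have "(LINT t|?\<tau>. LINT x|M. indicator (S \<times> ?A) (t, k\<^sub>0, x) * (u (t, k\<^sub>0, x))\<^sup>2) = (LINT t|?\<tau>. indicator S t * r t)"
    proof (intro Bochner_Integration.integral_cong refl)
      fix t
      have "(LINT x|M. indicator (S \<times> ?A) (t, k\<^sub>0, x) * (u (t, k\<^sub>0, x))\<^sup>2) = (LINT x|M. indicator S t * (\<rho> t x)\<^sup>2)"
        by (intro Bochner_Integration.integral_cong refl) (auto simp: indicator_def \<rho>_def \<phi>_def)
      then show "(LINT x|M. indicator (S \<times> ?A) (t, k\<^sub>0, x) * (u (t, k\<^sub>0, x))\<^sup>2) = indicator S t * r t"
        by (simp add: r_def)
    qed
    finally show ?thesis .
  qed
  have "AE t in ?\<tau>. r t \<le> R\<^sup>2"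
  proof -
    \<comment> \<open>The integrated bound is applied to the set of times where the pointwise bound
      fails. The excess is nonnegative there with integral at most 0, so it vanishes almost
      everywhere.\<close>
    define S where "S = {t \<in> space ?\<tau>. R\<^sup>2 < r t}"
    have [measurable]: "r \<in> borel_measurable ?\<tau>" using r_int by simp
    have S: "S \<in> sets ?\<tau>" unfolding S_def by measurable
    have i1: "integrable ?\<tau> (\<lambda>t. indicator S t * r t)" using integrable_mult_indicator[OF S r_int] by simp
    have i2: "integrable ?\<tau> (\<lambda>t. R\<^sup>2 * indicator S t :: real)"
      using S by (intro integrable_mult_right) (auto simp: t.emeasure_eq_measure)
    let ?g = "\<lambda>t. indicator S t * r t - R\<^sup>2 * indicator S t"
    have i: "integrable ?\<tau> ?g" by (intro Bochner_Integration.integrable_diff i1 i2)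
    have g0: "0 \<le> ?g t" for t by (auto simp: S_def indicator_def)
    have "(LINT t|?\<tau>. ?g t) = (LINT t|?\<tau>. indicator S t * r t) - R\<^sup>2 * measure ?\<tau> S"
      using i1 i2 sets.sets_into_space[OF S] by (simp add: Int_absorb2)
    also have "\<dots> \<le> 0" using r_bound[OF S] by simp
    finally have "(LINT t|?\<tau>. ?g t) = 0" using g0 by (intro antisym integral_nonneg_AE) auto
    then have "AE t in ?\<tau>. ?g t = 0" using integral_nonneg_eq_0_iff_AE[OF i] g0 by simp
    moreover have "AE t in ?\<tau>. t \<in> space ?\<tau>" by (rule AE_space)
    ultimately show ?thesis
      by eventually_elim (auto simp: S_def indicator_def split: if_splits)
  qed
  moreover have "AE t in ?\<tau>. integrable M (\<lambda>x. (\<rho> t x)\<^sup>2)"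
    using tM.AE_integrable_fst'[OF phi2[of k\<^sub>0]] by (simp add: \<rho>_def)
  moreover have "AE t in ?\<tau>. t \<in> space ?\<tau>" by (rule AE_space)
  ultimately have Linf: "AE t in ?\<tau>. L2_space M (\<rho> t) \<and> (LINT x|M. (\<rho> t x)\<^sup>2) \<le> R\<^sup>2"
  proof eventually_elim
    case (elim t)
    have "\<rho> t \<in> borel_measurable M"
      using measurable_compose[OF measurable_Pair1'[OF elim(3)] meas[of k\<^sub>0]] by (simp add: \<rho>_def)
    then show ?case using elim by (simp add: L2_space_def r_def)
  qed
  have s0T: "{0..T} \<in> sets ?\<tau>" using sets.top[of ?\<tau>] by (simp add: space_time_measure)
  have en: "((\<lambda>k. LINT t|?\<tau>. LINT x|M. (\<phi> k t x)\<^sup>2) has_sum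
      (LINT z|?P. indicator ({0..T} \<times> (space ?Q - ?A)) z * (u z)\<^sup>2)) (- {k\<^sub>0})"
  proof -
    have ZA: "{0..T} \<times> (space ?Q - ?A) \<in> sets ?P" using s0T A by (intro pair_measureI) auto
    have h: "((\<lambda>k. LINT t|?\<tau>. LINT x|M. indicator ({0..T} \<times> (space ?Q - ?A)) (t, k, x) * (u (t, k, x))\<^sup>2) has_sum
      (LINT z|?P. indicator ({0..T} \<times> (space ?Q - ?A)) z * (u z)\<^sup>2)) UNIV"
      by (rule hs[OF integrable_indicator_sq[OF uL ZA]])
    have "(LINT t|?\<tau>. LINT x|M. indicator ({0..T} \<times> (space ?Q - ?A)) (t, k, x) * (u (t, k, x))\<^sup>2) =
       (if k = k\<^sub>0 then 0 else LINT t|?\<tau>. LINT x|M. (\<phi> k t x)\<^sup>2)" for k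
    proof -
      have "(LINT t|?\<tau>. LINT x|M. indicator ({0..T} \<times> (space ?Q - ?A)) (t, k, x) * (u (t, k, x))\<^sup>2) =
        (LINT t|?\<tau>. LINT x|M. (if k = k\<^sub>0 then 0 else (\<phi> k t x)\<^sup>2))"
        by (intro Bochner_Integration.integral_cong refl)
          (auto simp: indicator_def space_time_measure space_pair_measure \<phi>_def)
      then show ?thesis by simp
    qed
    then have "((\<lambda>k. if k = k\<^sub>0 then 0 else LINT t|?\<tau>. LINT x|M. (\<phi> k t x)\<^sup>2) has_sum
      (LINT z|?P. indicator ({0..T} \<times> (space ?Q - ?A)) z * (u z)\<^sup>2)) UNIV" using h by simp
    then show ?thesis
      by (rule has_sum_cong_neutral[THEN iffD1, rotated -1]) auto
  qed
  have en_le: "(\<Sum>\<^sub>\<infinity>k\<in>- {k\<^sub>0}. LINT t|?\<tau>. LINT x|M. (\<phi> k t x)\<^sup>2) \<le> R\<^sup>2"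
  proof -
    have "({0..T} \<times> (space ?Q - ?A), R\<^sup>2) \<in> admissible_bounds T (R\<^sup>2) ?Q ?A" by (simp add: admissible_bounds_def)
    then show ?thesis using u infsumI[OF en] by (auto simp: l2_bounds_def)
  qed
  have con: "(LINT t|?\<tau>. LINT x|M. \<beta> t * D k f x * \<rho> t x) = - (LINT t|?\<tau>. LINT x|M. \<beta> t * F f x * \<phi> k t x)"
    if k: "k \<noteq> k\<^sub>0" and f: "f \<in> X" and \<beta>: "continuous_on {0..T} \<beta>" for k f \<beta>
  proof -
    have c: "(k, f) \<in> (- {k\<^sub>0}) \<times> X" using k f by simp
    have hL: "L2_space ?P (\<lambda>(t, x). \<beta> t * H (k, f) x)" by (rule tensor_L2[OF Q \<beta> H_L2[OF c]])
    define h where "h z = u z * (case z of (t, x) \<Rightarrow> \<beta> t * H (k, f) x)" for z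
    have h: "integrable ?P h" unfolding h_def by (rule L2_mult_integrable[OF uL hL])
    have 0: "(LINT z|?P. h z) = 0" using constraint[OF c \<beta>] by (simp add: l2_inner_def h_def)
    have "((\<lambda>k'. LINT t|?\<tau>. LINT x|M. h (t, k', x)) has_sum 0) UNIV" using hs[OF h] 0 by simp
    \<comment> \<open>H has only two nonzero slices, so the sum over all indices reduces to the
      slice of \<rho> and the slice of \<phi>_k.\<close>
    then have "((\<lambda>k'. LINT t|?\<tau>. LINT x|M. h (t, k', x)) has_sum 0) {k\<^sub>0, k}"
      by (rule has_sum_cong_neutral[THEN iffD1, rotated -1]) (auto simp: h_def H_def)
    moreover have "((\<lambda>k'. LINT t|?\<tau>. LINT x|M. h (t, k', x)) has_sum (\<Sum>k'\<in>{k\<^sub>0, k}. LINT t|?\<tau>. LINT x|M. h (t, k', x))) {k\<^sub>0, k}"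
      by (rule has_sum_finite) simp
    ultimately have "(\<Sum>k'\<in>{k\<^sub>0, k}. LINT t|?\<tau>. LINT x|M. h (t, k', x)) = 0" by (rule has_sum_unique[symmetric])
    then have "(LINT t|?\<tau>. LINT x|M. h (t, k\<^sub>0, x)) + (LINT t|?\<tau>. LINT x|M. h (t, k, x)) = 0" using k by simp
    moreover have "h (t, k\<^sub>0, x) = \<beta> t * D k f x * \<rho> t x" "h (t, k, x) = \<beta> t * F f x * \<phi> k t x" for t x
      using k by (simp_all add: h_def H_def \<rho>_def \<phi>_def)
    ultimately show ?thesis by simp
  qed
  have eq: "(\<lambda>k. LINT t|?\<tau>. LINT x|M. \<alpha> t * D k f x * \<phi> k t x) summable_on (- {k\<^sub>0}) \<and>
        0 = \<alpha> 0 * (LINT x|M. F f x * \<rho>\<^sub>0 x)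
          + (LINT t|?\<tau>. LINT x|M. \<rho> t x * (\<alpha>' t * F f x - \<alpha> t * b f x))
          - 1 / 2 * (\<Sum>\<^sub>\<infinity>k\<in>- {k\<^sub>0}. LINT t|?\<tau>. LINT x|M. \<alpha> t * D k f x * \<phi> k t x)"
    if f: "f \<in> X" and \<alpha>: "\<forall>t\<in>{0..T}. (\<alpha> has_real_derivative \<alpha>' t) (at t within {0..T})"
      and \<alpha>': "continuous_on {0..T} \<alpha>'" and \<alpha>T: "\<alpha> T = 0" for f \<alpha> \<alpha>'
  proof -
    have \<alpha>c: "continuous_on {0..T} \<alpha>" using \<alpha> by (intro DERIV_continuous_on) auto
    have \<alpha>'c: "continuous_on {0..T} (\<lambda>t. - \<alpha>' t)" using \<alpha>' by (intro continuous_intros)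
    let ?test = "\<lambda>(t, x). - \<alpha>' t * at0 (F f) x + \<alpha> t * (at0 (b f) x + 1/2 * G f x)"
    have "L2_space ?P (\<lambda>z. (case z of (t, x) \<Rightarrow> - \<alpha>' t * at0 (F f) x) + (case z of (t, x) \<Rightarrow> \<alpha> t * (at0 (b f) x + 1/2 * G f x)))"
      by (intro L2_add[of ?P "\<lambda>(t, x). - \<alpha>' t * at0 (F f) x" "\<lambda>(t, x). \<alpha> t * (at0 (b f) x + 1/2 * G f x)"]
          tensor_L2 Q \<alpha>c \<alpha>'c at0_L2 F f L2_add[of ?Q "at0 (b f)" "\<lambda>x. 1/2 * G f x"] b L2_scale G_L2)
    then have tL: "L2_space ?P ?test" by (simp add: case_prod_beta')
    define h where "h z = u z * ?test z" for z
    have h: "integrable ?P h" unfolding h_def by (rule L2_mult_integrable[OF uL tL])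
    have tot: "(LINT z|?P. h z) = \<alpha> 0 * (LINT x|M. F f x * \<rho>\<^sub>0 x)"
      using weak[OF f \<alpha> \<alpha>' \<alpha>T] at0_inner[OF F[OF f], of "\<lambda>k x. if k = k\<^sub>0 then \<rho>\<^sub>0 x else 0"] at0_L2[OF \<rho>\<^sub>0]
      by (simp add: l2_inner_def h_def at0_def)
    let ?s = "\<lambda>k. LINT t|?\<tau>. LINT x|M. h (t, k, x)"
    have all: "(?s has_sum (\<alpha> 0 * (LINT x|M. F f x * \<rho>\<^sub>0 x))) UNIV" using hs[OF h] tot by simp
    have one: "(?s has_sum ?s k\<^sub>0) {k\<^sub>0}" using has_sum_finite[of "{k\<^sub>0}" ?s] by simp
    \<comment> \<open>Removing the slice of \<rho> leaves the series over the noise modes, whose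
      convergence thus comes from Fubini as well.\<close>
    have "(?s has_sum (\<alpha> 0 * (LINT x|M. F f x * \<rho>\<^sub>0 x) - ?s k\<^sub>0)) (UNIV - {k\<^sub>0})"
      by (rule has_sum_Diff[OF all one]) simp
    then have "(?s has_sum (\<alpha> 0 * (LINT x|M. F f x * \<rho>\<^sub>0 x) - ?s k\<^sub>0)) (- {k\<^sub>0})" by (simp add: Compl_eq_Diff_UNIV)
    moreover have "?s k = 1/2 * (LINT t|?\<tau>. LINT x|M. \<alpha> t * D k f x * \<phi> k t x)" if "k \<in> - {k\<^sub>0}" for k
    proof -
      have "h (t, k, x) = 1/2 * (\<alpha> t * D k f x * \<phi> k t x)" for t x
        using that by (simp add: h_def at0_def G_def \<phi>_def)
      then have "?s k = (LINT t|?\<tau>. LINT x|M. 1/2 * (\<alpha> t * D k f x * \<phi> k t x))" by presburger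
      then show ?thesis by simp
    qed
    ultimately have "((\<lambda>k. 1/2 * (LINT t|?\<tau>. LINT x|M. \<alpha> t * D k f x * \<phi> k t x)) has_sum (\<alpha> 0 * (LINT x|M. F f x * \<rho>\<^sub>0 x) - ?s k\<^sub>0)) (- {k\<^sub>0})"
      using has_sum_cong[of "- {k\<^sub>0}" ?s "\<lambda>k. 1/2 * (LINT t|?\<tau>. LINT x|M. \<alpha> t * D k f x * \<phi> k t x)"] by blast
    from has_sum_cmult_right[OF this, of 2]
    have sum: "((\<lambda>k. LINT t|?\<tau>. LINT x|M. \<alpha> t * D k f x * \<phi> k t x) has_sum 2 * (\<alpha> 0 * (LINT x|M. F f x * \<rho>\<^sub>0 x) - ?s k\<^sub>0)) (- {k\<^sub>0})"
      by simp
    have "?s k\<^sub>0 = (LINT t|?\<tau>. LINT x|M. - (\<rho> t x * (\<alpha>' t * F f x - \<alpha> t * b f x)))"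
      by (intro Bochner_Integration.integral_cong refl) (simp add: h_def at0_def G_def \<rho>_def \<phi>_def algebra_simps)
    then have "?s k\<^sub>0 = - (LINT t|?\<tau>. LINT x|M. \<rho> t x * (\<alpha>' t * F f x - \<alpha> t * b f x))" by simp
    then show ?thesis using has_sum_imp_summable[OF sum] infsumI[OF sum] by simp
  qed
  show ?thesis
    unfolding R(2)[symmetric]
    using meas[of k\<^sub>0] Linf \<phi>L con en_le has_sum_imp_summable[OF en] eq
    by (intro exI[of _ \<rho>] exI[of _ \<phi>]) (auto simp: \<rho>_def)
qed

section \<open>Lattice vectors and the two half-lattices\<close>

lemma vec_of_add: "vec_of (a + b) = vec_of a + vec_of b" and vec_of_diff: "vec_of (a - b) = vec_of a - vec_of b"
  and vec_of_minus: "vec_of (- a) = - vec_of a" and vec_of_zero: "vec_of 0 = 0"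
  by (simp_all add: vec_of_def zero_prod_def)

lemma vec_of_eq_iff: "vec_of a = vec_of b \<longleftrightarrow> a = b"
  by (cases a; cases b) (simp add: vec_of_def)

lemma vec_of_neq_zero: "a \<noteq> 0 \<Longrightarrow> vec_of a \<noteq> 0"
  using vec_of_eq_iff[of a 0] by (simp add: vec_of_zero)

lemma Z20_iff: "a \<in> Z20 \<longleftrightarrow> a \<noteq> 0"
  by (simp add: Z20_def zero_prod_def)

lemma Z2plus_minus: "a \<in> Z20 \<Longrightarrow> - a \<in> Z2plus \<longleftrightarrow> a \<notin> Z2plus"
  by (cases a) (auto simp: Z2plus_def Z20_def)

subsection \<open>Periodicity and fundamental domains\<close>

text \<open>Both sides equal the sum over m of the integrals of g over B \<inter> (B' - m): insert
  the identity that the translates of a fundamental domain cover each point exactly once, exchange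
  sum and integral, and translate by m.\<close>

lemma nn_integral_fundamental_domain:
  fixes g :: "real \<times> real \<Rightarrow> ennreal"
  assumes [measurable]: "g \<in> borel_measurable borel" "B \<in> sets borel" "B' \<in> sets borel"
    and per: "\<And>x m. g (x + vec_of m) = g x"
    and B: "\<And>x. \<exists>!m. x + vec_of m \<in> B" and B': "\<And>x. \<exists>!m. x + vec_of m \<in> B'"
  shows "(\<integral>\<^sup>+x. indicator B x * g x \<partial>lborel) = (\<integral>\<^sup>+x. indicator B' x * g x \<partial>lborel)"
proof -
  have one: "(\<integral>\<^sup>+m. indicator A (x + vec_of m) \<partial>count_space UNIV) = 1" if A: "\<And>x. \<exists>!m. x + vec_of m \<in> A" for A x
  proof -
    from A[of x] obtain m where m: "x + vec_of m \<in> A" "\<And>n. x + vec_of n \<in> A \<Longrightarrow> n = m" by blast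
    have "(\<integral>\<^sup>+m. indicator A (x + vec_of m) \<partial>count_space UNIV) = (\<integral>\<^sup>+n. indicator {m} n \<partial>count_space UNIV)"
    proof (intro nn_integral_cong)
      fix n
      have "x + vec_of n \<in> A \<longleftrightarrow> n = m" using m by blast
      then show "indicator A (x + vec_of n) = (indicator {m} n :: ennreal)" by (simp add: indicator_def)
    qed
    then show ?thesis by simp
  qed
  have one': "(\<integral>\<^sup>+m. indicator A (x - vec_of m) \<partial>count_space UNIV) = 1" if A: "\<And>x. \<exists>!m. x + vec_of m \<in> A" for A x
  proof -
    have "bij (uminus :: int \<times> int \<Rightarrow> _)" by (rule bij_uminus)
    then have "(\<integral>\<^sup>+m. indicator A (x + vec_of (- m)) \<partial>count_space UNIV) = (\<integral>\<^sup>+m. indicator A (x + vec_of m) \<partial>count_space UNIV)"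
      by (rule nn_integral_bij_count_space)
    then show ?thesis using one[OF A] by (simp add: vec_of_minus)
  qed
  have "(\<integral>\<^sup>+x. indicator B x * g x \<partial>lborel) = (\<integral>\<^sup>+x. (\<integral>\<^sup>+m. indicator B x * g x * indicator B' (x + vec_of m) \<partial>count_space UNIV) \<partial>lborel)"
    by (simp add: nn_integral_cmult one[OF B'])
  also have "\<dots> = (\<integral>\<^sup>+m. (\<integral>\<^sup>+x. indicator B x * g x * indicator B' (x + vec_of m) \<partial>lborel) \<partial>count_space UNIV)"
    by (rule nn_integral_count_space_nn_integral) simp_all
  also have "\<dots> = (\<integral>\<^sup>+m. (\<integral>\<^sup>+x. indicator B (x - vec_of m) * g x * indicator B' x \<partial>lborel) \<partial>count_space UNIV)"
  proof (rule nn_integral_cong)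
    fix m
    have "(\<integral>\<^sup>+x. indicator B (x - vec_of m) * g x * indicator B' x \<partial>lborel) =
       (\<integral>\<^sup>+x. indicator B (x - vec_of m) * g x * indicator B' x \<partial>distr lborel borel ((+) (vec_of m)))"
      by (simp add: lborel_distr_plus)
    also have "\<dots> = (\<integral>\<^sup>+x. indicator B (vec_of m + x - vec_of m) * g (vec_of m + x) * indicator B' (vec_of m + x) \<partial>lborel)"
      by (rule nn_integral_distr) measurable
    also have "\<dots> = (\<integral>\<^sup>+x. indicator B x * g x * indicator B' (x + vec_of m) \<partial>lborel)"
      using per by (simp add: add.commute)
    finally show "(\<integral>\<^sup>+x. indicator B x * g x * indicator B' (x + vec_of m) \<partial>lborel) =
      (\<integral>\<^sup>+x. indicator B (x - vec_of m) * g x * indicator B' x \<partial>lborel)" ..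
  qed
  also have "\<dots> = (\<integral>\<^sup>+x. (\<integral>\<^sup>+m. indicator B (x - vec_of m) * g x * indicator B' x \<partial>count_space UNIV) \<partial>lborel)"
    by (rule nn_integral_count_space_nn_integral[symmetric]) simp_all
  also have "\<dots> = (\<integral>\<^sup>+x. indicator B' x * g x \<partial>lborel)"
  proof (rule nn_integral_cong)
    fix x
    have "(\<integral>\<^sup>+m. indicator B (x - vec_of m) * g x * indicator B' x \<partial>count_space UNIV) =
        (\<integral>\<^sup>+m. (indicator B' x * g x) * indicator B (x - vec_of m) \<partial>count_space UNIV)"
      by (intro nn_integral_cong) (simp add: mult_ac)
    also have "\<dots> = indicator B' x * g x" by (simp add: nn_integral_cmult one'[OF B])
    finally show "(\<integral>\<^sup>+m. indicator B (x - vec_of m) * g x * indicator B' x \<partial>count_space UNIV) = indicator B' x * g x" .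
  qed
  finally show ?thesis .
qed

text \<open>Half open, so that every point has exactly one lattice translate in it. The closed
  square of \<open>torus_integral\<close> differs from it by a null set.\<close>

definition unit_square :: "(real \<times> real) set" where
  "unit_square = {0..<1} \<times> {0..<1}"

lemma ex1_int_Ico: "\<exists>!n::int. 0 \<le> x + of_int n \<and> x + of_int n < (1::real)"
proof (rule ex1I[of _ "- \<lfloor>x\<rfloor>"])
  show "0 \<le> x + of_int (- \<lfloor>x\<rfloor>) \<and> x + of_int (- \<lfloor>x\<rfloor>) < 1" by simp linarith
  fix n assume "0 \<le> x + of_int n \<and> x + of_int n < (1::real)"
  then have "\<lfloor>x\<rfloor> = - n" by (intro floor_unique) auto
  then show "n = - \<lfloor>x\<rfloor>" by simp
qed

lemma ex1_unit_square: "\<exists>!m. x + vec_of m \<in> unit_square"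
proof -
  obtain a b where x: "x = (a, b)" by (cases x)
  obtain n where n: "0 \<le> a + of_int n \<and> a + of_int n < 1" "\<And>n'. 0 \<le> a + of_int n' \<and> a + of_int n' < 1 \<Longrightarrow> n' = n"
    using ex1_int_Ico[of a] by metis
  obtain k where k: "0 \<le> b + of_int k \<and> b + of_int k < 1" "\<And>k'. 0 \<le> b + of_int k' \<and> b + of_int k' < 1 \<Longrightarrow> k' = k"
    using ex1_int_Ico[of b] by metis
  show ?thesis
    by (rule ex1I[of _ "(n, k)"]) (use n k in \<open>auto simp: x vec_of_def unit_square_def\<close>)
qed

lemma unit_square_borel[measurable]: "unit_square \<in> sets borel"
  unfolding unit_square_def borel_prod[symmetric] by measurable

lemma nn_torus_cbox:
  "(\<integral>\<^sup>+x. indicator (cbox (0, 0) (1, 1)) x * g x \<partial>lborel) = (\<integral>\<^sup>+x. indicator unit_square x * g x \<partial>lborel)"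
proof (rule nn_integral_cong_AE)
  let ?a = "(0, 0) :: real \<times> real" and ?b = "(1, 1) :: real \<times> real"
  have "cbox ?a ?b - box ?a ?b \<in> null_sets lborel"
    using negligible_frontier_interval[of ?a ?b]
    by (auto simp: negligible_iff_null_sets null_sets_completion_iff)
  then have "AE x in lborel. x \<notin> cbox ?a ?b - box ?a ?b" by (rule AE_not_in)
  then show "AE x in lborel. indicator (cbox ?a ?b) x * g x = indicator unit_square x * g x"
    by eventually_elim (auto simp: indicator_def unit_square_def box_prod cbox_prod mem_box)
qed

text \<open>A translate or a reflection of the unit square is again a fundamental domain. The
  reflected form serves the convolution with the Biot-Savart kernel.\<close>

lemma nn_torus_shift:
  fixes g :: "real \<times> real \<Rightarrow> ennreal"
  assumes [measurable]: "g \<in> borel_measurable borel" and per: "\<And>x m. g (x + vec_of m) = g x"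
  shows "(\<integral>\<^sup>+y. indicator (cbox (0, 0) (1, 1)) y * g (y + x) \<partial>lborel) = (\<integral>\<^sup>+y. indicator (cbox (0, 0) (1, 1)) y * g y \<partial>lborel)"
    and "(\<integral>\<^sup>+y. indicator (cbox (0, 0) (1, 1)) y * g (x - y) \<partial>lborel) = (\<integral>\<^sup>+y. indicator (cbox (0, 0) (1, 1)) y * g y \<partial>lborel)"
proof -
  let ?B1 = "(\<lambda>z. z - x) -` unit_square" and ?B2 = "(\<lambda>z. x - z) -` unit_square"
  have [measurable]: "?B1 \<in> sets borel" "?B2 \<in> sets borel"
    using measurable_sets[of "\<lambda>z. z - x" borel borel unit_square] measurable_sets[of "\<lambda>z. x - z" borel borel unit_square]
    by auto
  have ex1: "\<exists>!m. z + vec_of m \<in> ?B1" for z using ex1_unit_square[of "z - x"] by (simp add: algebra_simps)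
  have ex2: "\<exists>!m. z + vec_of m \<in> ?B2" for z
  proof -
    obtain m where m: "x - z + vec_of m \<in> unit_square" "\<And>n. x - z + vec_of n \<in> unit_square \<Longrightarrow> n = m"
      using ex1_unit_square[of "x - z"] by metis
    show ?thesis
    proof (rule ex1I[of _ "- m"])
      show "z + vec_of (- m) \<in> ?B2" using m(1) by (simp add: vec_of_minus algebra_simps)
      fix n assume "z + vec_of n \<in> ?B2"
      then have "x - z + vec_of (- n) \<in> unit_square" by (simp add: vec_of_minus algebra_simps)
      from m(2)[OF this] show "n = - m" by (metis minus_minus)
    qed
  qed
  have "(\<integral>\<^sup>+y. indicator unit_square y * g (y + x) \<partial>lborel) = (\<integral>\<^sup>+y. indicator ?B1 (x + y) * g (x + y) \<partial>lborel)"
    by (intro nn_integral_cong) (simp add: add.commute indicator_def)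
  also have "\<dots> = (\<integral>\<^sup>+y. indicator ?B1 y * g y \<partial>distr lborel borel ((+) x))"
    by (rule nn_integral_distr[symmetric]) measurable
  also have "\<dots> = (\<integral>\<^sup>+y. indicator ?B1 y * g y \<partial>lborel)" by (simp add: lborel_distr_plus)
  also have "\<dots> = (\<integral>\<^sup>+y. indicator unit_square y * g y \<partial>lborel)"
    by (intro nn_integral_fundamental_domain per ex1 ex1_unit_square) measurable
  finally show "(\<integral>\<^sup>+y. indicator (cbox (0, 0) (1, 1)) y * g (y + x) \<partial>lborel) = (\<integral>\<^sup>+y. indicator (cbox (0, 0) (1, 1)) y * g y \<partial>lborel)"
    by (simp add: nn_torus_cbox)
  have refl: "distr lborel borel (\<lambda>y. x - y) = (lborel :: (real \<times> real) measure)"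
    using lborel_affine[of "-1" x] by (simp add: density_1)
  have "(\<integral>\<^sup>+y. indicator unit_square y * g (x - y) \<partial>lborel) = (\<integral>\<^sup>+y. indicator ?B2 (x - y) * g (x - y) \<partial>lborel)"
    by (intro nn_integral_cong) (simp add: indicator_def)
  also have "\<dots> = (\<integral>\<^sup>+y. indicator ?B2 y * g y \<partial>distr lborel borel (\<lambda>y. x - y))"
    by (rule nn_integral_distr[symmetric]) measurable
  also have "\<dots> = (\<integral>\<^sup>+y. indicator ?B2 y * g y \<partial>lborel)" by (simp only: refl)
  also have "\<dots> = (\<integral>\<^sup>+y. indicator unit_square y * g y \<partial>lborel)"
    by (intro nn_integral_fundamental_domain per ex2 ex1_unit_square) measurable
  finally show "(\<integral>\<^sup>+y. indicator (cbox (0, 0) (1, 1)) y * g (x - y) \<partial>lborel) = (\<integral>\<^sup>+y. indicator (cbox (0, 0) (1, 1)) y * g y \<partial>lborel)"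
    by (simp add: nn_torus_cbox)
qed

subsection \<open>Trigonometric polynomials\<close>

text \<open>A cosine with free phase: cosine and sine modes, their products and their derivatives
  all stay in this family, so the case distinction in \<open>efun\<close> is confined to
  \<open>phase\<close>.\<close>

definition trig :: "int \<times> int \<Rightarrow> real \<Rightarrow> real \<times> real \<Rightarrow> real" where
  "trig m \<theta> x = cos (2 * pi * (vec_of m \<bullet> x) - \<theta>)"

definition phase :: "int \<times> int \<Rightarrow> real" where
  "phase a = (if a \<in> Z2plus then 0 else pi / 2)"

lemma efun_trig: "efun a x = sqrt 2 * trig a (phase a) x"
  by (simp add: efun_def trig_def phase_def cos_diff)

text \<open>The phase shift by - pi / 2 is also the effect of differentiation on
  \<open>trig\<close>. So a directional derivative of e_a is a multiple of e_{-a}, with the same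
  factor on both halves of the lattice.\<close>

lemma efun_minus_trig:
  assumes "a \<in> Z20" shows "efun (- a) x = sqrt 2 * trig a (phase a - pi / 2) x"
  using Z2plus_minus[OF assms]
  by (auto simp: efun_def trig_def phase_def cos_diff cos_add vec_of_minus)

lemma trig_periodic: "trig m \<theta> (x + vec_of n) = trig m \<theta> x"
proof -
  have "vec_of m \<bullet> vec_of n = of_int (fst m * fst n + snd m * snd n)"
    by (simp add: vec_of_def)
  then have "2 * pi * (vec_of m \<bullet> (x + vec_of n)) - \<theta> = (2 * pi * (vec_of m \<bullet> x) - \<theta>) + 2 * pi * of_int (fst m * fst n + snd m * snd n)"
    by (simp only: inner_add_right distrib_left)
  then show ?thesis unfolding trig_def by (simp only: cos_add cos_int_2pin sin_int_2pin)
qed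

lemma trig_derivative:
  "(trig m \<theta> has_derivative (\<lambda>v. 2 * pi * (vec_of m \<bullet> v) * trig m (\<theta> - pi / 2) x)) (at x)"
proof -
  have s: "cos (z - (\<theta> - pi / 2)) = - sin (z - \<theta>)" for z
    using cos_add[of "z - \<theta>" "pi / 2"] by (simp add: algebra_simps)
  show ?thesis unfolding trig_def[abs_def] s
    by (auto intro!: derivative_eq_intros simp: algebra_simps)
qed

lemma trig_mult: "trig a \<theta> x * trig b \<eta> x = 1/2 * trig (a + b) (\<theta> + \<eta>) x + 1/2 * trig (a - b) (\<theta> - \<eta>) x"
proof -
  let ?A = "2 * pi * (vec_of a \<bullet> x) - \<theta>" and ?B = "2 * pi * (vec_of b \<bullet> x) - \<eta>"
  have "trig (a + b) (\<theta> + \<eta>) x = cos (?A + ?B)" "trig (a - b) (\<theta> - \<eta>) x = cos (?A - ?B)"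
    by (simp_all add: trig_def vec_of_add vec_of_diff inner_add_left inner_diff_left algebra_simps)
  then show ?thesis by (simp add: trig_def cos_times_cos)
qed

text \<open>One class, closed under products and derivatives, settles the side conditions: its
  members are periodic test functions, integrable over the square.\<close>

inductive trigpoly :: "(real \<times> real \<Rightarrow> real) \<Rightarrow> bool" where
  base: "trigpoly (\<lambda>x. c * trig m \<theta> x)"
| add: "trigpoly f \<Longrightarrow> trigpoly g \<Longrightarrow> trigpoly (\<lambda>x. f x + g x)"

lemma trigpoly_scale: "trigpoly f \<Longrightarrow> trigpoly (\<lambda>x. c * f x)"
proof (induction rule: trigpoly.induct)
  case (base d m \<theta>)
  show ?case using trigpoly.base[of "c * d" m \<theta>] by (simp add: mult.assoc)
qed (auto simp: distrib_left intro: trigpoly.add)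

lemma trigpoly_const: "trigpoly (\<lambda>x. c)"
  using trigpoly.base[of c 0 0] by (simp add: trig_def vec_of_zero)

lemma trigpoly_sum: "(\<And>i. i \<in> I \<Longrightarrow> trigpoly (f i)) \<Longrightarrow> trigpoly (\<lambda>x. \<Sum>i\<in>I. f i x)"
  by (induction I rule: infinite_finite_induct) (auto intro: trigpoly_const trigpoly.add)

lemma trigpoly_trig_mult: "trigpoly f \<Longrightarrow> trigpoly (\<lambda>x. trig m \<theta> x * f x)"
proof (induction rule: trigpoly.induct)
  case (base c n \<eta>)
  have "(\<lambda>x. trig m \<theta> x * (c * trig n \<eta> x)) = (\<lambda>x. (c * (1/2)) * trig (m + n) (\<theta> + \<eta>) x + (c * (1/2)) * trig (m - n) (\<theta> - \<eta>) x)"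
    using trig_mult[of m \<theta> _ n \<eta>] by (simp add: fun_eq_iff algebra_simps)
  then show ?case by (simp only:) (intro trigpoly.intros)
qed (auto simp: distrib_left intro: trigpoly.add)

lemma trigpoly_mult:
  assumes "trigpoly f" "trigpoly g" shows "trigpoly (\<lambda>x. f x * g x)"
  using assms
proof (induction rule: trigpoly.induct)
  case (base c m \<theta>)
  then show ?case using trigpoly_scale[OF trigpoly_trig_mult] by (simp add: mult.assoc)
qed (auto simp: distrib_right intro: trigpoly.add)

lemma trigpoly_efun: "trigpoly (efun a)"
  using trigpoly.base[of "sqrt 2" a "phase a"] by (simp add: efun_trig[abs_def])

lemma trigpoly_periodic: "trigpoly f \<Longrightarrow> f (x + vec_of n) = f x"
  by (induction rule: trigpoly.induct) (auto simp: trig_periodic)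

lemma trigpoly_derivative:
  "trigpoly f \<Longrightarrow> \<exists>f'. (\<forall>x. (f has_derivative f' x) (at x)) \<and> (\<forall>v. trigpoly (\<lambda>x. f' x v))"
proof (induction rule: trigpoly.induct)
  case (base c m \<theta>)
  have "trigpoly (\<lambda>x. c * (2 * pi * (vec_of m \<bullet> v) * trig m (\<theta> - pi / 2) x))" for v
    by (intro trigpoly_scale trigpoly.base)
  then show ?case
    by (intro exI[of _ "\<lambda>x v. c * (2 * pi * (vec_of m \<bullet> v) * trig m (\<theta> - pi / 2) x)"])
      (auto intro!: derivative_eq_intros trig_derivative)
next
  case (add f g)
  then obtain f' g' where "\<forall>x. (f has_derivative f' x) (at x)" "\<forall>v. trigpoly (\<lambda>x. f' x v)"
    "\<forall>x. (g has_derivative g' x) (at x)" "\<forall>v. trigpoly (\<lambda>x. g' x v)" by blast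
  then show ?case
    by (intro exI[of _ "\<lambda>x v. f' x v + g' x v"]) (auto intro: has_derivative_add trigpoly.add)
qed

lemma trigpoly_differentiable: "trigpoly f \<Longrightarrow> f differentiable (at x)"
  using trigpoly_derivative[of f] unfolding differentiable_def by blast

lemma trigpoly_frechet: "trigpoly f \<Longrightarrow> trigpoly (\<lambda>x. frechet_derivative f (at x) v)"
proof -
  assume "trigpoly f"
  then obtain f' where f': "\<forall>x. (f has_derivative f' x) (at x)" "\<forall>v. trigpoly (\<lambda>x. f' x v)"
    using trigpoly_derivative by blast
  then have "(\<lambda>x. frechet_derivative f (at x) v) = (\<lambda>x. f' x v)"
    by (metis frechet_derivative_at)
  then show ?thesis using f'(2) by metis
qed

lemma trigpoly_iter_deriv: "trigpoly f \<Longrightarrow> trigpoly (iter_deriv vs f)"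
  by (induction vs) (auto intro: trigpoly_frechet)

lemma trigpoly_test_function: "trigpoly f \<Longrightarrow> f \<in> test_functions"
  by (auto simp: test_functions_def periodic_def intro: trigpoly_periodic trigpoly_differentiable trigpoly_iter_deriv)

lemma trigpoly_continuous: "trigpoly f \<Longrightarrow> continuous_on UNIV f"
  by (intro differentiable_imp_continuous_on) (simp add: differentiable_on_def trigpoly_differentiable)

lemma trigpoly_set_integrable: "trigpoly f \<Longrightarrow> set_integrable lborel (cbox (0, 0) (1, 1)) f"
  unfolding set_integrable_def
  by (intro borel_integrable_compact compact_cbox continuous_on_subset[OF trigpoly_continuous]) auto

lemma torus_integral_add:
  assumes "trigpoly f" "trigpoly g"
  shows "torus_integral (\<lambda>x. f x + g x) = torus_integral f + torus_integral g"
  unfolding torus_integral_def by (intro set_integral_add trigpoly_set_integrable assms)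

lemma torus_integral_scale: "torus_integral (\<lambda>x. c * f x) = c * torus_integral f" for c :: real
  unfolding torus_integral_def by simp

lemma torus_integral_sum:
  assumes "\<And>i. i \<in> I \<Longrightarrow> trigpoly (f i)"
  shows "torus_integral (\<lambda>x. \<Sum>i\<in>I. f i x) = (\<Sum>i\<in>I. torus_integral (f i))"
  using assms
proof (induction I rule: infinite_finite_induct)
  case (insert i I)
  have "torus_integral (\<lambda>x. f i x + (\<Sum>i\<in>I. f i x)) = torus_integral (f i) + torus_integral (\<lambda>x. \<Sum>i\<in>I. f i x)"
    using insert by (intro torus_integral_add trigpoly_sum) auto
  then show ?case using insert by simp
qed (simp_all add: torus_integral_def)

lemma torus_integral_shift:
  assumes f: "trigpoly f"
  shows "torus_integral (\<lambda>y. f (y + x)) = torus_integral f"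
proof -
  let ?i = "indicator (cbox (0, 0) (1, 1)) :: real \<times> real \<Rightarrow> real"
  have [measurable]: "f \<in> borel_measurable borel"
    using trigpoly_continuous[OF f] by (rule borel_measurable_continuous_onI)
  have i1: "integrable lborel (\<lambda>y. ?i y * f y)" using trigpoly_set_integrable[OF f] by (simp add: set_integrable_def)
  have c: "continuous_on (cbox (0, 0) (1, 1)) (\<lambda>y. f (y + x))"
    by (rule continuous_on_compose2[OF trigpoly_continuous[OF f]]) (auto intro!: continuous_intros)
  have "integrable lborel (\<lambda>y. ?i y *\<^sub>R f (y + x))"
    by (rule borel_integrable_compact[OF compact_cbox c])
  then have i2: "integrable lborel (\<lambda>y. ?i y * f (y + x))" by simp
  have eq: "(\<integral>\<^sup>+y. ennreal (?i y * h (y + x)) \<partial>lborel) = (\<integral>\<^sup>+y. ennreal (?i y * h y) \<partial>lborel)"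
    if [measurable]: "h \<in> borel_measurable borel" and "\<And>x m. h (x + vec_of m) = h x" for h :: "real \<times> real \<Rightarrow> real"
  proof -
    have e: "ennreal (?i y * c) = indicator (cbox (0, 0) (1, 1)) y * ennreal c" for y c
      by (simp add: indicator_def)
    show ?thesis unfolding e by (rule nn_torus_shift(1)) (simp_all add: that(2))
  qed
  have "(LINT y|lborel. ?i y * f (y + x)) = (LINT y|lborel. ?i y * f y)"
    using eq[of f] eq[of "\<lambda>y. - f y"] trigpoly_periodic[OF f]
    by (simp add: real_lebesgue_integral_def[OF i1] real_lebesgue_integral_def[OF i2])
  then show ?thesis by (simp add: torus_integral_def set_lebesgue_integral_def)
qed

lemma torus_integral_const: "torus_integral (\<lambda>x. c) = (c :: real)"
  by (simp add: torus_integral_def set_lebesgue_integral_def content_Pair)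

lemma torus_integral_trig: "torus_integral (trig m \<theta>) = (if m = 0 then cos \<theta> else 0)"
proof (cases "m = 0")
  case True
  then show ?thesis using torus_integral_const[of "cos \<theta>"] by (simp add: trig_def[abs_def] vec_of_zero)
next
  case False
  \<comment> \<open>Translation by h is half a period of the mode m and flips the sign of the
    integrand, while it leaves the integral unchanged.\<close>
  let ?v = "vec_of m" let ?h = "(1 / (2 * (?v \<bullet> ?v))) *\<^sub>R ?v"
  have "?v \<bullet> ?v \<noteq> 0" using vec_of_neq_zero[OF False] by simp
  then have h: "2 * pi * (?v \<bullet> ?h) = pi" by simp
  have "trig m \<theta> (y + ?h) = - trig m \<theta> y" for y
  proof -
    have "2 * pi * (?v \<bullet> (y + ?h)) - \<theta> = (2 * pi * (?v \<bullet> y) - \<theta>) + pi"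
      using h by (simp only: inner_add_right distrib_left)
    then show ?thesis unfolding trig_def by (simp only: cos_periodic_pi)
  qed
  then have "torus_integral (\<lambda>y. trig m \<theta> (y + ?h)) = - torus_integral (trig m \<theta>)"
    using torus_integral_scale[of "-1" "trig m \<theta>"] by simp
  moreover have "torus_integral (\<lambda>y. trig m \<theta> (y + ?h)) = torus_integral (trig m \<theta>)"
    using torus_integral_shift[of "trig m \<theta>"] trigpoly.base[of 1 m \<theta>] by simp
  ultimately show ?thesis using False by simp
qed

section \<open>Integrals of products of three modes\<close>

definition dl :: "int \<times> int \<Rightarrow> real \<Rightarrow> real" where
  "dl m \<theta> = (if m = 0 then cos \<theta> else 0)"

lemma torus_integral_trig_sum:
  "torus_integral (\<lambda>x. c * trig a \<alpha> x + d * trig b \<beta> x) = c * dl a \<alpha> + d * dl b \<beta>"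
  by (simp add: torus_integral_add trigpoly.base torus_integral_scale torus_integral_trig dl_def)

text \<open>Two applications of the product-to-sum formula turn three normalised cosines into four
  cosines with the factor (sqrt 2)^3 / 4 = sqrt 2 / 2, and each of them integrates to a
  \<open>dl\<close>.\<close>

definition triple :: "int \<times> int \<Rightarrow> real \<Rightarrow> int \<times> int \<Rightarrow> real \<Rightarrow> int \<times> int \<Rightarrow> real \<Rightarrow> real" where
  "triple a \<alpha> b \<beta> c \<gamma> = sqrt 2 / 2 * (dl (a + b + c) (\<alpha> + \<beta> + \<gamma>) + dl (a + b - c) (\<alpha> + \<beta> - \<gamma>)
     + dl (a - b + c) (\<alpha> - \<beta> + \<gamma>) + dl (a - b - c) (\<alpha> - \<beta> - \<gamma>))"

lemma torus_integral_triple: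
  "torus_integral (\<lambda>x. (sqrt 2 * trig a \<alpha> x) * (sqrt 2 * trig b \<beta> x) * (sqrt 2 * trig c \<gamma> x)) = triple a \<alpha> b \<beta> c \<gamma>"
proof -
  let ?s = "sqrt 2 / 2"
  have s3: "sqrt 2 * sqrt 2 * sqrt 2 = 4 * (sqrt 2 / 2 :: real)" by simp
  have "(\<lambda>x. (sqrt 2 * trig a \<alpha> x) * (sqrt 2 * trig b \<beta> x) * (sqrt 2 * trig c \<gamma> x)) =
    (\<lambda>x. (?s * trig (a + b + c) (\<alpha> + \<beta> + \<gamma>) x + ?s * trig (a + b - c) (\<alpha> + \<beta> - \<gamma>) x)
       + (?s * trig (a - b + c) (\<alpha> - \<beta> + \<gamma>) x + ?s * trig (a - b - c) (\<alpha> - \<beta> - \<gamma>) x))"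
  proof (rule ext)
    fix x
    have "(sqrt 2 * trig a \<alpha> x) * (sqrt 2 * trig b \<beta> x) * (sqrt 2 * trig c \<gamma> x) =
       (sqrt 2 * sqrt 2 * sqrt 2) * (trig a \<alpha> x * trig b \<beta> x * trig c \<gamma> x)" by (simp only: mult_ac)
    also have "\<dots> = 4 * ?s * ((1/2 * trig (a + b) (\<alpha> + \<beta>) x + 1/2 * trig (a - b) (\<alpha> - \<beta>) x) * trig c \<gamma> x)"
      unfolding s3 trig_mult[of a \<alpha> x b \<beta>] by (simp only: mult_ac)
    also have "\<dots> = 2 * ?s * (trig (a + b) (\<alpha> + \<beta>) x * trig c \<gamma> x + trig (a - b) (\<alpha> - \<beta>) x * trig c \<gamma> x)"
      by (simp add: algebra_simps)
    also have "\<dots> = (?s * trig (a + b + c) (\<alpha> + \<beta> + \<gamma>) x + ?s * trig (a + b - c) (\<alpha> + \<beta> - \<gamma>) x)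
       + (?s * trig (a - b + c) (\<alpha> - \<beta> + \<gamma>) x + ?s * trig (a - b - c) (\<alpha> - \<beta> - \<gamma>) x)"
      unfolding trig_mult by (simp add: algebra_simps)
    finally show "(sqrt 2 * trig a \<alpha> x) * (sqrt 2 * trig b \<beta> x) * (sqrt 2 * trig c \<gamma> x) = \<dots>" .
  qed
  moreover have "torus_integral (\<lambda>x. (?s * trig (a + b + c) (\<alpha> + \<beta> + \<gamma>) x + ?s * trig (a + b - c) (\<alpha> + \<beta> - \<gamma>) x)
       + (?s * trig (a - b + c) (\<alpha> - \<beta> + \<gamma>) x + ?s * trig (a - b - c) (\<alpha> - \<beta> - \<gamma>) x)) =
     torus_integral (\<lambda>x. ?s * trig (a + b + c) (\<alpha> + \<beta> + \<gamma>) x + ?s * trig (a + b - c) (\<alpha> + \<beta> - \<gamma>) x)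
       + torus_integral (\<lambda>x. ?s * trig (a - b + c) (\<alpha> - \<beta> + \<gamma>) x + ?s * trig (a - b - c) (\<alpha> - \<beta> - \<gamma>) x)"
    by (intro torus_integral_add trigpoly.add trigpoly.base)
  moreover have "r * d1 + r * d2 + (r * d3 + r * d4) = r * (d1 + d2 + d3 + d4)" for r d1 d2 d3 d4 :: real
    by (simp add: algebra_simps)
  ultimately show ?thesis by (simp only: torus_integral_trig_sum triple_def)
qed

text \<open>The integral over the torus of the directional derivative of \<open>e\<^sub>a e\<^sub>b e\<^sub>c\<close> vanishes.\<close>

lemma triple_identity:
  "(vec_of a \<bullet> v) * triple a (\<alpha> - pi / 2) b \<beta> c \<gamma> + (vec_of b \<bullet> v) * triple a \<alpha> b (\<beta> - pi / 2) c \<gamma>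
    + (vec_of c \<bullet> v) * triple a \<alpha> b \<beta> c (\<gamma> - pi / 2) = 0"
proof -
  have minus: "cos (\<theta> - pi / 2) = sin \<theta>" for \<theta> :: real by (simp add: cos_diff)
  have plus: "cos (\<theta> + pi / 2) = - sin \<theta>" for \<theta> :: real by (simp add: cos_add)
  \<comment> \<open>Resonance: a term survives only if its frequency is zero, and then the three
    directional factors, taken with the signs of that frequency, add up to zero.\<close>
  have gen: "(vec_of a \<bullet> v) * dl m (\<theta> - pi / 2) + s * (vec_of b \<bullet> v) * dl m (\<theta> - pi / 2)
      + t * (vec_of c \<bullet> v) * dl m (\<theta> - pi / 2) = 0"
    if "vec_of m = vec_of a + s *\<^sub>R vec_of b + t *\<^sub>R vec_of c" for m \<theta> s t
  proof (cases "m = 0")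
    case True
    then have "(vec_of a + s *\<^sub>R vec_of b + t *\<^sub>R vec_of c) \<bullet> v = 0" using that by (simp add: vec_of_zero)
    then have "(vec_of a \<bullet> v + s * (vec_of b \<bullet> v) + t * (vec_of c \<bullet> v)) * dl m (\<theta> - pi / 2) = 0"
      by (simp add: inner_add_left)
    then show ?thesis by (simp add: algebra_simps)
  qed (simp add: dl_def)
  \<comment> \<open>A shift of a phase that enters with a minus sign comes out reversed; this
    produces the signs that \<open>gen\<close> requires.\<close>
  have flip: "dl m (\<theta> + pi / 2) = - dl m (\<theta> - pi / 2)" for m \<theta> by (simp add: dl_def minus plus)
  define A B C where "A = vec_of a \<bullet> v" and "B = vec_of b \<bullet> v" and "C = vec_of c \<bullet> v"
  have 1: "A * dl (a + b + c) (\<alpha> + \<beta> + \<gamma> - pi/2) + B * dl (a + b + c) (\<alpha> + \<beta> + \<gamma> - pi/2) + C * dl (a + b + c) (\<alpha> + \<beta> + \<gamma> - pi/2) = 0"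
    using gen[of "a + b + c" 1 1 "\<alpha> + \<beta> + \<gamma>"] by (simp add: vec_of_add A_def B_def C_def)
  have 2: "A * dl (a + b - c) (\<alpha> + \<beta> - \<gamma> - pi/2) + B * dl (a + b - c) (\<alpha> + \<beta> - \<gamma> - pi/2) - C * dl (a + b - c) (\<alpha> + \<beta> - \<gamma> - pi/2) = 0"
    using gen[of "a + b - c" 1 "-1" "\<alpha> + \<beta> - \<gamma>"] by (simp add: vec_of_add vec_of_diff A_def B_def C_def)
  have 3: "A * dl (a - b + c) (\<alpha> - \<beta> + \<gamma> - pi/2) - B * dl (a - b + c) (\<alpha> - \<beta> + \<gamma> - pi/2) + C * dl (a - b + c) (\<alpha> - \<beta> + \<gamma> - pi/2) = 0"
    using gen[of "a - b + c" "-1" 1 "\<alpha> - \<beta> + \<gamma>"] by (simp add: vec_of_add vec_of_diff A_def B_def C_def)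
  have 4: "A * dl (a - b - c) (\<alpha> - \<beta> - \<gamma> - pi/2) - B * dl (a - b - c) (\<alpha> - \<beta> - \<gamma> - pi/2) - C * dl (a - b - c) (\<alpha> - \<beta> - \<gamma> - pi/2) = 0"
    using gen[of "a - b - c" "-1" "-1" "\<alpha> - \<beta> - \<gamma>"] by (simp add: vec_of_add vec_of_diff A_def B_def C_def)
  define d1 d2 d3 d4 where "d1 = dl (a + b + c) (\<alpha> + \<beta> + \<gamma> - pi/2)" and "d2 = dl (a + b - c) (\<alpha> + \<beta> - \<gamma> - pi/2)"
    and "d3 = dl (a - b + c) (\<alpha> - \<beta> + \<gamma> - pi/2)" and "d4 = dl (a - b - c) (\<alpha> - \<beta> - \<gamma> - pi/2)"
  have ang: "\<alpha> - pi/2 + \<beta> + \<gamma> = \<alpha> + \<beta> + \<gamma> - pi/2" "\<alpha> - pi/2 + \<beta> - \<gamma> = \<alpha> + \<beta> - \<gamma> - pi/2"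
    "\<alpha> - pi/2 - \<beta> + \<gamma> = \<alpha> - \<beta> + \<gamma> - pi/2" "\<alpha> - pi/2 - \<beta> - \<gamma> = \<alpha> - \<beta> - \<gamma> - pi/2"
    "\<alpha> + (\<beta> - pi/2) + \<gamma> = \<alpha> + \<beta> + \<gamma> - pi/2" "\<alpha> + (\<beta> - pi/2) - \<gamma> = \<alpha> + \<beta> - \<gamma> - pi/2"
    "\<alpha> - (\<beta> - pi/2) + \<gamma> = \<alpha> - \<beta> + \<gamma> + pi/2" "\<alpha> - (\<beta> - pi/2) - \<gamma> = \<alpha> - \<beta> - \<gamma> + pi/2"
    "\<alpha> + \<beta> + (\<gamma> - pi/2) = \<alpha> + \<beta> + \<gamma> - pi/2" "\<alpha> + \<beta> - (\<gamma> - pi/2) = \<alpha> + \<beta> - \<gamma> + pi/2"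
    "\<alpha> - \<beta> + (\<gamma> - pi/2) = \<alpha> - \<beta> + \<gamma> - pi/2" "\<alpha> - \<beta> - (\<gamma> - pi/2) = \<alpha> - \<beta> - \<gamma> + pi/2"
    by simp_all
  have "A * (d1 + d2 + d3 + d4) + B * (d1 + d2 - d3 - d4) + C * (d1 - d2 + d3 - d4) = 0"
    using 1 2 3 4 unfolding d1_def[symmetric] d2_def[symmetric] d3_def[symmetric] d4_def[symmetric]
    by (simp add: algebra_simps)
  then have z: "r * (A * (d1 + d2 + d3 + d4) + B * (d1 + d2 - d3 - d4) + C * (d1 - d2 + d3 - d4)) = 0" for r by simp
  have "A * (r * (d1 + d2 + d3 + d4)) + B * (r * (d1 + d2 + - d3 + - d4)) + C * (r * (d1 + - d2 + d3 + - d4)) = 0" for r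
    using z[of r] by (simp add: algebra_simps)
  then show ?thesis
    unfolding triple_def ang flip d1_def[symmetric] d2_def[symmetric] d3_def[symmetric] d4_def[symmetric]
      A_def[symmetric] B_def[symmetric] C_def[symmetric] .
qed

text \<open>The structure constants of pointwise multiplication in the basis, from which all
  transport coefficients are built.\<close>

definition tau :: "int \<times> int \<Rightarrow> int \<times> int \<Rightarrow> int \<times> int \<Rightarrow> real" where
  "tau a b c = torus_integral (\<lambda>x. efun a x * efun b x * efun c x)"

lemma tau_triple: "tau a b c = triple a (phase a) b (phase b) c (phase c)"
  unfolding tau_def efun_trig by (rule torus_integral_triple)

lemma tau_minus1: "a \<in> Z20 \<Longrightarrow> tau (- a) b c = triple a (phase a - pi / 2) b (phase b) c (phase c)"
  unfolding tau_def efun_trig[of b] efun_trig[of c] efun_minus_trig by (rule torus_integral_triple)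

lemma tau_minus2: "b \<in> Z20 \<Longrightarrow> tau a (- b) c = triple a (phase a) b (phase b - pi / 2) c (phase c)"
  unfolding tau_def efun_trig[of a] efun_trig[of c] efun_minus_trig by (rule torus_integral_triple)

lemma tau_minus3: "c \<in> Z20 \<Longrightarrow> tau a b (- c) = triple a (phase a) b (phase b) c (phase c - pi / 2)"
  unfolding tau_def efun_trig[of a] efun_trig[of b] efun_minus_trig by (rule torus_integral_triple)

lemma tau_commute: "tau a b c = tau b a c" "tau a b c = tau a c b"
  unfolding tau_def by (simp_all add: mult_ac)

text \<open>For v orthogonal to one of the three frequencies one term drops out, and an antisymmetry
  in the other two remains. Every cancellation of the transport operators is of this kind.\<close>

lemma tau_identity:
  assumes "a \<in> Z20" "b \<in> Z20" "c \<in> Z20"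
  shows "(vec_of a \<bullet> v) * tau (- a) b c + (vec_of b \<bullet> v) * tau a (- b) c + (vec_of c \<bullet> v) * tau a b (- c) = 0"
  using assms by (simp add: tau_minus1 tau_minus2 tau_minus3 triple_identity)

lemma tau_bound: "\<bar>tau a b c\<bar> \<le> 2 * sqrt 2"
proof -
  have d: "\<bar>dl m \<theta>\<bar> \<le> 1" for m \<theta> by (simp add: dl_def)
  have "\<bar>w + x + y + z\<bar> \<le> 4" if "\<bar>w\<bar> \<le> 1" "\<bar>x\<bar> \<le> 1" "\<bar>y\<bar> \<le> 1" "\<bar>z\<bar> \<le> 1" for w x y z :: real
    using that by linarith
  from mult_left_mono[OF this[OF d d d d], of "sqrt 2 / 2"] show ?thesis
    unfolding tau_triple triple_def by (simp add: abs_mult)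
qed

section \<open>Orthonormality and expansion of products\<close>

lemma efun_mult_trig:
  "efun a x * efun b x = trig (a + b) (phase a + phase b) x + trig (a - b) (phase a - phase b) x"
proof -
  have "efun a x * efun b x = (sqrt 2 * sqrt 2) * (trig a (phase a) x * trig b (phase b) x)"
    by (simp only: efun_trig mult_ac)
  then show ?thesis unfolding trig_mult by simp
qed

lemma efun_integral: "a \<in> Z20 \<Longrightarrow> torus_integral (efun a) = 0"
  unfolding efun_trig[abs_def] by (simp add: torus_integral_scale torus_integral_trig Z20_iff)

lemma efun_orthonormal:
  assumes "a \<in> Z20" "b \<in> Z20"
  shows "torus_integral (\<lambda>x. efun a x * efun b x) = (if a = b then 1 else 0)"
proof -
  have "(\<lambda>x. efun a x * efun b x) = (\<lambda>x. 1 * trig (a + b) (phase a + phase b) x + 1 * trig (a - b) (phase a - phase b) x)"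
    by (simp add: efun_mult_trig)
  then have I: "torus_integral (\<lambda>x. efun a x * efun b x) = dl (a + b) (phase a + phase b) + dl (a - b) (phase a - phase b)"
    by (simp only: torus_integral_trig_sum)
  \<comment> \<open>If b = - a, one mode is a cosine and the other a sine; their phases add up to pi
    / 2, whose cosine is 0.\<close>
  have s: "dl (a + b) (phase a + phase b) = 0"
  proof (cases "a + b = 0")
    case True
    then have "b = - a" by (simp add: add_eq_0_iff)
    then have "phase a + phase b = pi / 2" using Z2plus_minus[OF assms(1)] by (auto simp: phase_def)
    then have "cos (phase a + phase b) = 0" by (simp only: cos_pi_half)
    then show ?thesis by (simp add: dl_def)
  qed (simp add: dl_def)
  show ?thesis unfolding I s by (simp add: dl_def)
qed

lemma trig_expand:
  assumes "m \<in> Z20"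
  shows "trig m \<theta> x = cos (\<theta> - phase m) / sqrt 2 * efun m x + (- sin (\<theta> - phase m) / sqrt 2) * efun (- m) x"
proof -
  define z where "z = 2 * pi * (vec_of m \<bullet> x) - phase m"
  have e1: "efun m x = sqrt 2 * cos z" by (simp add: efun_trig trig_def z_def)
  have "efun (- m) x = sqrt 2 * cos (z + pi / 2)"
    by (simp add: efun_minus_trig[OF assms] trig_def z_def algebra_simps)
  then have e2: "efun (- m) x = - (sqrt 2 * sin z)" by (simp add: cos_add)
  have "trig m \<theta> x = cos (z - (\<theta> - phase m))" by (simp add: trig_def z_def)
  also have "\<dots> = cos z * cos (\<theta> - phase m) + sin z * sin (\<theta> - phase m)" by (rule cos_diff)
  finally show ?thesis unfolding e1 e2 by simp
qed

text \<open>The coefficients stay existential: orthonormality recovers them as integrals in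
  \<open>expands_coeff\<close>, so only the set of frequencies has to be tracked.\<close>

definition expands :: "(real \<times> real \<Rightarrow> real) \<Rightarrow> (int \<times> int) set \<Rightarrow> bool" where
  "expands f S \<longleftrightarrow> finite S \<and> S \<subseteq> Z20 \<and> (\<exists>c\<^sub>0 c. \<forall>x. f x = c\<^sub>0 + (\<Sum>m\<in>S. c m * efun m x))"

lemma expands_add:
  assumes "expands f S" "expands g S" shows "expands (\<lambda>x. f x + g x) S"
proof -
  obtain c0 c d0 d where "\<And>x. f x = c0 + (\<Sum>m\<in>S. c m * efun m x)" "\<And>x. g x = d0 + (\<Sum>m\<in>S. d m * efun m x)"
    using assms by (auto simp: expands_def)
  then have "f x + g x = (c0 + d0) + (\<Sum>m\<in>S. (c m + d m) * efun m x)" for x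
    by (simp add: distrib_right sum.distrib)
  moreover have "finite S" "S \<subseteq> Z20" using assms(1) by (simp_all add: expands_def)
  ultimately show ?thesis
    unfolding expands_def by (intro conjI exI[of _ "c0 + d0"] exI[of _ "\<lambda>m. c m + d m"] allI)
qed

lemma expands_trig:
  assumes S: "finite S" "S \<subseteq> Z20" and m: "m \<noteq> 0 \<Longrightarrow> m \<in> S \<and> - m \<in> S"
  shows "expands (trig m \<theta>) S"
proof (cases "m = 0")
  case True
  then have "\<forall>x. trig m \<theta> x = cos \<theta> + (\<Sum>m\<in>S. 0 * efun m x)" by (simp add: trig_def vec_of_zero)
  then show ?thesis using S unfolding expands_def
    by (intro conjI exI[of _ "cos \<theta>"] exI[of _ "\<lambda>_. 0"]) auto
next
  case False
  then have Z: "m \<in> Z20" "m \<in> S" "- m \<in> S" using m by (auto simp: Z20_iff)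
  have ne: "m \<noteq> - m" using False by (cases m) (auto simp: zero_prod_def)
  define c where "c n = (if n = m then cos (\<theta> - phase m) / sqrt 2 else if n = - m then - sin (\<theta> - phase m) / sqrt 2 else 0)" for n
  have "trig m \<theta> x = 0 + (\<Sum>n\<in>S. c n * efun n x)" for x
  proof -
    have "(\<Sum>n\<in>S. c n * efun n x) = (\<Sum>n\<in>{m, - m}. c n * efun n x)"
      using S Z by (intro sum.mono_neutral_right) (auto simp: c_def)
    also have "\<dots> = c m * efun m x + c (- m) * efun (- m) x" using ne by simp
    finally show ?thesis using ne unfolding trig_expand[OF Z(1)] by (simp add: c_def)
  qed
  then show ?thesis using S unfolding expands_def by blast
qed

lemma trigpoly_sum_efun: "trigpoly (\<lambda>x. \<Sum>m\<in>S. c m * efun m x)"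
  by (intro trigpoly_sum trigpoly_scale trigpoly_efun)

lemma expands_coeff:
  assumes f: "expands f S"
  shows "f x = torus_integral f + (\<Sum>m\<in>S. torus_integral (\<lambda>x. f x * efun m x) * efun m x)"
    and "n \<in> Z20 \<Longrightarrow> n \<notin> S \<Longrightarrow> torus_integral (\<lambda>x. f x * efun n x) = 0"
proof -
  obtain c0 c where S: "finite S" "S \<subseteq> Z20" and fx: "\<And>x. f x = c0 + (\<Sum>m\<in>S. c m * efun m x)"
    using f by (auto simp: expands_def)
  have fe: "f = (\<lambda>x. c0 + (\<Sum>m\<in>S. c m * efun m x))" using fx by (rule ext)
  have "torus_integral f = torus_integral (\<lambda>x. c0) + torus_integral (\<lambda>x. \<Sum>m\<in>S. c m * efun m x)"
    unfolding fe by (intro torus_integral_add trigpoly_const trigpoly_sum_efun)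
  also have "torus_integral (\<lambda>x. \<Sum>m\<in>S. c m * efun m x) = (\<Sum>m\<in>S. c m * torus_integral (efun m))"
    by (subst torus_integral_sum) (auto intro!: trigpoly_scale trigpoly_efun simp: torus_integral_scale)
  also have "\<dots> = 0" using S by (intro sum.neutral) (auto simp: efun_integral)
  finally have c0: "torus_integral f = c0" by (simp add: torus_integral_const)
  have cn: "torus_integral (\<lambda>x. f x * efun n x) = (if n \<in> S then c n else 0)" if n: "n \<in> Z20" for n
  proof -
    have "torus_integral (\<lambda>x. f x * efun n x) = torus_integral (\<lambda>x. c0 * efun n x + (\<Sum>m\<in>S. c m * (efun m x * efun n x)))"
      unfolding fe by (simp add: distrib_right sum_distrib_right mult.assoc)
    also have "\<dots> = torus_integral (\<lambda>x. c0 * efun n x) + torus_integral (\<lambda>x. \<Sum>m\<in>S. c m * (efun m x * efun n x))"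
      by (intro torus_integral_add trigpoly_scale trigpoly_efun trigpoly_sum trigpoly_mult)
    also have "torus_integral (\<lambda>x. \<Sum>m\<in>S. c m * (efun m x * efun n x)) = (\<Sum>m\<in>S. c m * torus_integral (\<lambda>x. efun m x * efun n x))"
      by (subst torus_integral_sum) (auto intro!: trigpoly_scale trigpoly_efun trigpoly_mult simp: torus_integral_scale)
    also have "\<dots> = (\<Sum>m\<in>S. if m = n then c n else 0)"
      using S n by (intro sum.cong refl) (auto simp: efun_orthonormal)
    finally show ?thesis using S n by (simp add: torus_integral_scale efun_integral)
  qed
  show "f x = torus_integral f + (\<Sum>m\<in>S. torus_integral (\<lambda>x. f x * efun m x) * efun m x)"
    using S unfolding c0 by (subst fx) (auto intro!: sum.cong simp: cn subsetD)
  show "n \<in> Z20 \<Longrightarrow> n \<notin> S \<Longrightarrow> torus_integral (\<lambda>x. f x * efun n x) = 0" by (simp add: cn)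
qed

text \<open>The nonzero frequencies that can occur in the product of e_a and e_b. Both signs are
  listed because a general phase mixes e_m with e_{-m}; the zero mode is removed because elements of
  \<open>Hm1m\<close> have zero average.\<close>

definition nbr :: "int \<times> int \<Rightarrow> int \<times> int \<Rightarrow> (int \<times> int) set" where
  "nbr a b = {a + b, - (a + b), a - b, - (a - b)} - {0}"

lemma nbr_Z20: "nbr a b \<subseteq> Z20" and nbr_finite: "finite (nbr a b)" and nbr_minus: "nbr a (- b) = nbr a b"
  by (simp_all add: nbr_def Z20_iff subset_iff) blast

lemma nbr_sym:
  assumes "m \<in> nbr a b" "a \<in> Z20" shows "a \<in> nbr m b"
proof -
  have "a = m - b \<or> a = - (m + b) \<or> a = m + b \<or> a = - (m - b)"
    using assms(1) by (auto simp: nbr_def)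
  then show ?thesis using assms(2) by (auto simp: nbr_def Z20_iff)
qed

lemma card_nbr: "card (nbr a b) \<le> 4"
proof -
  have "card (nbr a b) \<le> card {a + b, - (a + b), a - b, - (a - b)}"
    unfolding nbr_def by (intro card_mono) auto
  also have "\<dots> \<le> 4" using card_length[of "[a + b, - (a + b), a - b, - (a - b)]"] by simp
  finally show ?thesis .
qed

lemma efun_mult_expand:
  shows "efun a x * efun b x = torus_integral (\<lambda>x. efun a x * efun b x) + (\<Sum>m\<in>nbr a b. tau a b m * efun m x)"
    and "m \<in> Z20 \<Longrightarrow> m \<notin> nbr a b \<Longrightarrow> tau a b m = 0"
proof -
  have eq: "(\<lambda>x. efun a x * efun b x) = (\<lambda>x. trig (a + b) (phase a + phase b) x + trig (a - b) (phase a - phase b) x)"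
    by (simp add: efun_mult_trig)
  have ex: "expands (\<lambda>x. efun a x * efun b x) (nbr a b)"
    unfolding eq by (intro expands_add expands_trig nbr_finite nbr_Z20) (auto simp: nbr_def)
  show "efun a x * efun b x = torus_integral (\<lambda>x. efun a x * efun b x) + (\<Sum>m\<in>nbr a b. tau a b m * efun m x)"
    unfolding tau_def by (rule expands_coeff(1)[OF ex])
  show "m \<in> Z20 \<Longrightarrow> m \<notin> nbr a b \<Longrightarrow> tau a b m = 0"
    unfolding tau_def by (rule expands_coeff(2)[OF ex])
qed

lemma efun_derivative:
  assumes "j \<in> Z20"
  shows "(efun j has_derivative (\<lambda>v. 2 * pi * (vec_of j \<bullet> v) * efun (- j) x)) (at x)"
proof -
  have "((\<lambda>x. sqrt 2 * trig j (phase j) x) has_derivative (\<lambda>v. sqrt 2 * (2 * pi * (vec_of j \<bullet> v) * trig j (phase j - pi / 2) x))) (at x)"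
    by (intro has_derivative_mult_right trig_derivative)
  moreover have "efun j = (\<lambda>x. sqrt 2 * trig j (phase j) x)" by (rule ext) (rule efun_trig)
  ultimately show ?thesis unfolding efun_minus_trig[OF assms] by (simp add: mult_ac)
qed

lemma advect_efun_sum:
  assumes "\<Lambda> \<subseteq> Z20"
  shows "advect v (\<lambda>x. \<Sum>j\<in>\<Lambda>. p j * efun j x) x = (\<Sum>j\<in>\<Lambda>. p j * (2 * pi * (vec_of j \<bullet> v x) * efun (- j) x))"
proof -
  have "((\<lambda>x. \<Sum>j\<in>\<Lambda>. p j * efun j x) has_derivative (\<lambda>v. \<Sum>j\<in>\<Lambda>. p j * (2 * pi * (vec_of j \<bullet> v) * efun (- j) x))) (at x)"
    using assms by (intro has_derivative_sum has_derivative_mult_right efun_derivative) auto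
  from frechet_derivative_at[OF this, symmetric] show ?thesis by (simp add: advect_def)
qed

subsection \<open>The transport operators in Fourier coordinates\<close>

text \<open>Matrix of the transport operator: the component of \<sigma>_k \<cdot> \<nabla> e_j along
  e_m. The factor sqrt 2 * pi is the 2 pi of the derivative times the 1 / sqrt 2 of the
  field.\<close>

definition sigma_coeff :: "real \<Rightarrow> int \<times> int \<Rightarrow> int \<times> int \<Rightarrow> int \<times> int \<Rightarrow> real" where
  "sigma_coeff \<gamma> k j m = sqrt 2 * pi * (vec_of j \<bullet> perp k) / norm (vec_of k) powr \<gamma> * tau k (- j) m"

lemma perp_inner_self: "vec_of k \<bullet> perp k = 0"
  by (simp add: vec_of_def perp_def)

lemma norm_perp: "norm (perp k) = norm (vec_of k)"
  by (simp add: vec_of_def perp_def norm_prod_def add.commute)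

text \<open>The field is parallel to \<open>perp k\<close> and varies only in the direction k, so it
  is divergence free: in \<open>tau_identity\<close> with v = \<open>perp k\<close> the term of k
  vanishes.\<close>

lemma sigma_coeff_antisym:
  assumes "k \<in> Z20" "j \<in> Z20" "m \<in> Z20"
  shows "sigma_coeff \<gamma> k j m = - sigma_coeff \<gamma> k m j"
proof -
  have "(vec_of j \<bullet> perp k) * tau k (- j) m + (vec_of m \<bullet> perp k) * tau k (- m) j = 0"
    using tau_identity[OF assms, of "perp k"] tau_commute(2)[of k j "- m"] by (simp add: perp_inner_self)
  then have *: "(vec_of j \<bullet> perp k) * tau k (- j) m = - ((vec_of m \<bullet> perp k) * tau k (- m) j)" by simp
  have "sigma_coeff \<gamma> k j m = sqrt 2 * pi / norm (vec_of k) powr \<gamma> * ((vec_of j \<bullet> perp k) * tau k (- j) m)"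
    by (simp add: sigma_coeff_def)
  then show ?thesis unfolding * by (simp add: sigma_coeff_def)
qed

lemma sigma_coeff_zero: "m \<in> Z20 \<Longrightarrow> m \<notin> nbr k j \<Longrightarrow> sigma_coeff \<gamma> k j m = 0"
  using efun_mult_expand(2)[of m k "- j"] by (simp add: sigma_coeff_def nbr_minus)

text \<open>The inner product with \<open>perp k\<close> costs a factor |k|, which is set against
  |k|^-\<gamma>. The constant is sqrt 2 * pi times the bound 2 sqrt 2 on \<open>tau\<close>.\<close>

lemma sigma_coeff_bound:
  assumes "k \<in> Z20"
  shows "\<bar>sigma_coeff \<gamma> k j m\<bar> \<le> 4 * pi * norm (vec_of j) * norm (vec_of k) powr (1 - \<gamma>)"
proof -
  let ?n = "norm (vec_of k)"
  have n: "?n > 0" using assms vec_of_neq_zero by (simp add: Z20_iff)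
  have "\<bar>sigma_coeff \<gamma> k j m\<bar> = sqrt 2 * pi * \<bar>vec_of j \<bullet> perp k\<bar> / ?n powr \<gamma> * \<bar>tau k (- j) m\<bar>"
    by (simp add: sigma_coeff_def abs_mult)
  also have "\<dots> \<le> sqrt 2 * pi * (norm (vec_of j) * ?n) / ?n powr \<gamma> * (2 * sqrt 2)"
    using Cauchy_Schwarz_ineq2[of "vec_of j" "perp k"] n
    by (intro mult_mono divide_right_mono mult_left_mono tau_bound) (auto simp: norm_perp)
  also have "\<dots> = 4 * pi * norm (vec_of j) * (?n / ?n powr \<gamma>)" by simp
  also have "?n / ?n powr \<gamma> = ?n powr (1 - \<gamma>)" using n by (simp add: powr_diff)
  finally show ?thesis .
qed

section \<open>Distributions applied to trigonometric polynomials\<close>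

lemma omega_add:
  assumes "\<omega> \<in> distributions" "trigpoly f" "trigpoly g"
  shows "\<omega> (\<lambda>x. f x + g x) = \<omega> f + \<omega> g"
proof -
  have "\<forall>\<phi>\<in>test_functions. \<forall>\<psi>\<in>test_functions. \<omega> (\<lambda>x. \<phi> x + \<psi> x) = \<omega> \<phi> + \<omega> \<psi>"
    using assms(1) by (simp add: distributions_def)
  then show ?thesis using assms(2,3)[THEN trigpoly_test_function] by simp
qed

lemma omega_scale:
  assumes "\<omega> \<in> distributions" "trigpoly f"
  shows "\<omega> (\<lambda>x. c * f x) = c * \<omega> f"
proof -
  have "\<forall>\<phi>\<in>test_functions. \<forall>c. \<omega> (\<lambda>x. c * \<phi> x) = c * \<omega> \<phi>"
    using assms(1) by (simp add: distributions_def)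
  then show ?thesis using assms(2)[THEN trigpoly_test_function] by simp
qed

lemma omega_sum:
  assumes \<omega>: "\<omega> \<in> distributions" and f: "\<And>i. i \<in> I \<Longrightarrow> trigpoly (f i)"
  shows "\<omega> (\<lambda>x. \<Sum>i\<in>I. c i * f i x) = (\<Sum>i\<in>I. c i * \<omega> (f i))"
  using f
proof (induction I rule: infinite_finite_induct)
  case (insert i I)
  have "\<omega> (\<lambda>x. c i * f i x + (\<Sum>i\<in>I. c i * f i x)) = \<omega> (\<lambda>x. c i * f i x) + \<omega> (\<lambda>x. \<Sum>i\<in>I. c i * f i x)"
    using insert by (intro omega_add \<omega> trigpoly_scale trigpoly_sum) auto
  then show ?case using insert omega_scale[OF \<omega>, of "f i" "c i"] by simp
qed (use omega_scale[OF \<omega> trigpoly_const[of 0], of 0] in simp_all)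

lemma Hm1m_distribution: "\<omega> \<in> Hm1m \<Longrightarrow> \<omega> \<in> distributions" and Hm1m_mean: "\<omega> \<in> Hm1m \<Longrightarrow> \<omega> (\<lambda>x. 1) = 0"
proof -
  assume "\<omega> \<in> Hm1m"
  then have "\<omega> \<in> sobolev (- 1 - 1)" unfolding Hm1m_def by (rule INT_D) simp
  then show "\<omega> \<in> distributions" "\<omega> (\<lambda>x. 1) = 0" by (simp_all add: sobolev_def)
qed

lemma omega_efun_mult:
  assumes "\<omega> \<in> Hm1m"
  shows "\<omega> (\<lambda>x. efun a x * efun b x) = (\<Sum>m\<in>nbr a b. tau a b m * \<omega> (efun m))"
proof -
  let ?c = "torus_integral (\<lambda>x. efun a x * efun b x)"
  note \<omega> = Hm1m_distribution[OF assms]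
  have "\<omega> (\<lambda>x. efun a x * efun b x) = \<omega> (\<lambda>x. ?c * 1 + (\<Sum>m\<in>nbr a b. tau a b m * efun m x))"
    by (subst efun_mult_expand(1)) simp
  also have "\<dots> = \<omega> (\<lambda>x. ?c * 1) + \<omega> (\<lambda>x. \<Sum>m\<in>nbr a b. tau a b m * efun m x)"
    by (intro omega_add \<omega> trigpoly_const trigpoly_sum_efun)
  also have "\<dots> = (\<Sum>m\<in>nbr a b. tau a b m * \<omega> (efun m))"
    using omega_scale[OF \<omega> trigpoly_const[of 1], of ?c] Hm1m_mean[OF assms] omega_sum[OF \<omega>, of "nbr a b" efun "tau a b"]
    by (simp add: trigpoly_efun)
  finally show ?thesis .
qed

lemma sigma_grad_D_cyl:
  assumes \<omega>: "\<omega> \<in> Hm1m" and \<Lambda>: "\<Lambda> \<subseteq> Z20"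
  shows "sigma_grad \<gamma> k \<omega> (D_cyl \<Lambda> f \<omega>) =
    - (\<Sum>j\<in>\<Lambda>. partial_deriv j f (coords \<Lambda> \<omega>) * (\<Sum>m\<in>nbr k j. sigma_coeff \<gamma> k j m * \<omega> (efun m)))"
proof -
  define p where "p j = partial_deriv j f (coords \<Lambda> \<omega>)" for j
  have D: "D_cyl \<Lambda> f \<omega> = (\<lambda>x. \<Sum>j\<in>\<Lambda>. p j * efun j x)" by (simp add: D_cyl_def[abs_def] p_def)
  have test: "D_cyl \<Lambda> f \<omega> \<in> test_functions" unfolding D by (intro trigpoly_test_function trigpoly_sum_efun)
  define a where "a j = sqrt 2 * pi * (vec_of j \<bullet> perp k) / norm (vec_of k) powr \<gamma>" for j
  have s: "2 / sqrt 2 = sqrt 2" by (simp add: real_div_sqrt)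
  have *: "2 * pi * (vec_of j \<bullet> sigma_field \<gamma> k x) * efun (- j) x = a j * (efun k x * efun (- j) x)" for j x
  proof -
    have "2 * pi * (vec_of j \<bullet> sigma_field \<gamma> k x) * efun (- j) x
      = (2 / sqrt 2) * pi * (vec_of j \<bullet> perp k) / norm (vec_of k) powr \<gamma> * (efun k x * efun (- j) x)"
      by (simp add: sigma_field_def)
    then show ?thesis by (simp only: s a_def)
  qed
  have adv: "advect (sigma_field \<gamma> k) (D_cyl \<Lambda> f \<omega>) = (\<lambda>x. \<Sum>j\<in>\<Lambda>. (p j * a j) * (efun k x * efun (- j) x))"
    unfolding D by (rule ext) (simp only: advect_efun_sum[OF \<Lambda>] * mult.assoc[of "p _" "a _"])
  have "sigma_grad \<gamma> k \<omega> (D_cyl \<Lambda> f \<omega>) = - \<omega> (\<lambda>x. \<Sum>j\<in>\<Lambda>. (p j * a j) * (efun k x * efun (- j) x))"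
    using test by (simp add: sigma_grad_def adv)
  also have "\<dots> = - (\<Sum>j\<in>\<Lambda>. (p j * a j) * \<omega> (\<lambda>x. efun k x * efun (- j) x))"
    by (subst omega_sum[OF Hm1m_distribution[OF \<omega>]]) (auto intro: trigpoly_mult trigpoly_efun)
  also have "\<dots> = - (\<Sum>j\<in>\<Lambda>. p j * (\<Sum>m\<in>nbr k j. sigma_coeff \<gamma> k j m * \<omega> (efun m)))"
    by (simp add: omega_efun_mult[OF \<omega>] nbr_minus sigma_coeff_def a_def sum_distrib_left sum_divide_distrib mult_ac)
  finally show ?thesis by (simp add: p_def)
qed

section \<open>The Biot-Savart drift in Fourier coordinates\<close>

lemma square_finite: "finite (square N)"
proof (rule finite_subset)
  show "square N \<subseteq> {- int N..int N} \<times> {- int N..int N}" by (auto simp: square_def)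
qed simp

lemma square_Z20: "square N \<subseteq> Z20"
  by (auto simp: square_def)

lemma square_minus: "- k \<in> square N \<longleftrightarrow> k \<in> square N"
  by (simp add: square_def Z20_iff)

lemma square_mono: "M \<le> N \<Longrightarrow> square M \<subseteq> square N"
  by (auto simp: square_def)

lemma mem_square: "k \<in> Z20 \<Longrightarrow> \<exists>N. k \<in> square N"
  by (rule exI[of _ "nat \<bar>fst k\<bar> + nat \<bar>snd k\<bar>"]) (simp add: square_def)

lemma finite_subset_square:
  assumes "finite S" "S \<subseteq> Z20" shows "\<exists>N. S \<subseteq> square N"
  using assms
proof (induction S rule: finite_induct)
  case (insert k S)
  then obtain N where N: "S \<subseteq> square N" by auto
  obtain M where M: "k \<in> square M" using mem_square insert by blast
  have "insert k S \<subseteq> square (max M N)"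
    using N M square_mono[of M "max M N"] square_mono[of N "max M N"] by auto
  then show ?case by blast
qed simp

lemma norm_vec_of_ge_1:
  assumes "k \<in> Z20" shows "1 \<le> norm (vec_of k)"
proof -
  obtain a b where k: "k = (a, b)" by (cases k)
  have "a \<noteq> 0 \<or> b \<noteq> 0" using assms by (auto simp: k Z20_def)
  then have "1 \<le> a\<^sup>2 + b\<^sup>2"
    by (metis add_nonneg_nonneg int_one_le_iff_zero_less less_le sum_power2_gt_zero_iff zero_le_power2)
  then have "1 \<le> real_of_int (a\<^sup>2 + b\<^sup>2)" by linarith
  then have "sqrt 1 \<le> sqrt (real_of_int (a\<^sup>2 + b\<^sup>2))" by (rule real_sqrt_le_mono)
  then show ?thesis by (simp add: k vec_of_def norm_prod_def)
qed

lemma perp_minus: "perp (- k) = - perp k"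
  by (simp add: perp_def)

text \<open>The real part of i times an exponential is minus a sine, and up to sign the sine of a
  difference is half the difference of e_{-k}(x) e_k(y) and e_k(x) e_{-k}(y). The coefficients are
  odd in k, so the reflection k to - k shows that both halves have the same sum.\<close>

lemma kernel_partial_expand:
  assumes c: "c = fst \<or> c = snd"
  shows "Re (biot_savart_partial c N (x - y)) =
    (\<Sum>k\<in>square N. (2 * pi * c (perp k) / (norm (vec_of k))\<^sup>2) * efun (- k) x * efun k y)"
proof -
  define \<phi> where "\<phi> k = 2 * pi * c (perp k) / (norm (vec_of k))\<^sup>2" for k
  have odd: "\<phi> (- k) = - \<phi> k" for k using c by (auto simp: \<phi>_def perp_minus vec_of_minus)
  have ex: "exp (2 * complex_of_real pi * \<i> * of_real z) = cis (2 * pi * z)" for z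
    by (simp add: cis_conv_exp mult_ac)
  have "Re (biot_savart_partial c N (x - y)) = Re (\<Sum>k\<in>square N. 2 * of_real pi * \<i> * (of_real (c (perp k) / (norm (vec_of k))\<^sup>2) * cis (2 * pi * (vec_of k \<bullet> (x - y)))))"
    unfolding biot_savart_partial_def ex sum_distrib_left ..
  also have "\<dots> = (\<Sum>k\<in>square N. - (\<phi> k * sin (2 * pi * (vec_of k \<bullet> (x - y)))))"
    unfolding Re_sum by (intro sum.cong refl) (simp add: \<phi>_def)
  also have "\<dots> = (\<Sum>k\<in>square N. 1/2 * (\<phi> k * efun (- k) x * efun k y) + 1/2 * (- \<phi> k * efun k x * efun (- k) y))"
  proof (intro sum.cong refl)
    fix k assume k: "k \<in> square N"
    then have kZ: "k \<in> Z20" using square_Z20 by blast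
    define X Y where "X = 2 * pi * (vec_of k \<bullet> x)" and "Y = 2 * pi * (vec_of k \<bullet> y)"
    have arg: "2 * pi * (vec_of k \<bullet> (x - y)) = X - Y" by (simp add: X_def Y_def inner_diff_right algebra_simps)
    have s2: "sqrt 2 * (sqrt 2 * z) = 2 * z" for z :: real by (simp flip: mult.assoc)
    have e: "efun k x = (if k \<in> Z2plus then sqrt 2 * cos X else sqrt 2 * sin X)"
      "efun k y = (if k \<in> Z2plus then sqrt 2 * cos Y else sqrt 2 * sin Y)"
      "efun (- k) x = (if k \<in> Z2plus then - (sqrt 2 * sin X) else sqrt 2 * cos X)"
      "efun (- k) y = (if k \<in> Z2plus then - (sqrt 2 * sin Y) else sqrt 2 * cos Y)"
      by (simp_all add: efun_def X_def Y_def vec_of_minus Z2plus_minus[OF kZ])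
    have "efun (- k) x * efun k y - efun k x * efun (- k) y = - 2 * sin (X - Y)"
      unfolding e by (simp add: sin_diff algebra_simps s2)
    then have "1/2 * \<phi> k * (efun (- k) x * efun k y - efun k x * efun (- k) y) = - (\<phi> k * sin (X - Y))" by simp
    then show "- (\<phi> k * sin (2 * pi * (vec_of k \<bullet> (x - y)))) =
        1/2 * (\<phi> k * efun (- k) x * efun k y) + 1/2 * (- \<phi> k * efun k x * efun (- k) y)"
      unfolding arg by (simp add: algebra_simps)
  qed
  also have "\<dots> = 1/2 * (\<Sum>k\<in>square N. \<phi> k * efun (- k) x * efun k y) + 1/2 * (\<Sum>k\<in>square N. - \<phi> k * efun k x * efun (- k) y)"
    by (simp only: sum.distrib sum_distrib_left)
  also have "(\<Sum>k\<in>square N. - \<phi> k * efun k x * efun (- k) y) = (\<Sum>k\<in>square N. \<phi> k * efun (- k) x * efun k y)"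
    by (rule sum.reindex_bij_witness[of _ uminus uminus]) (simp_all add: square_minus odd)
  finally show ?thesis by (simp add: \<phi>_def)
qed

text \<open>The partial sums converge to the kernel in L1, the case p = 1, and e_l is bounded by
  sqrt 2, so the coefficients pass to the limit. They are constant in N once the square contains l.
  Invariance of the torus integral under y to x - y makes the error independent of x.\<close>

lemma kernel_fourier_coefficient:
  assumes K: "biot_savart_kernel K" and c: "c = fst \<or> c = snd" and l: "l \<in> Z20"
  shows "set_integrable lborel (cbox (0, 0) (1, 1)) (\<lambda>y. efun l y * c (K (x - y)))"
    and "torus_integral (\<lambda>y. efun l y * c (K (x - y))) = 2 * pi * c (perp l) / (norm (vec_of l))\<^sup>2 * efun (- l) x"
proof -
  let ?sq = "cbox (0, 0) (1, 1) :: (real \<times> real) set"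
  have cm[measurable]: "c \<in> borel_measurable borel" using c by (auto simp: borel_prod[symmetric])
  have [measurable]: "K \<in> borel_measurable borel" using K by (simp add: biot_savart_kernel_def)
  have "periodic K" using K by (simp add: biot_savart_kernel_def)
  then have per: "K (z + vec_of m) = K z" for z m unfolding periodic_def by blast
  have clin: "\<bar>c z\<bar> \<le> norm z" for z using c by (cases z) (auto simp: norm_fst_le norm_snd_le simp flip: real_norm_def intro: norm_fst_le norm_snd_le)
  have p1: "set_integrable lborel ?sq (\<lambda>x. norm (K x) powr 1) \<and> (\<lambda>N. torus_integral (\<lambda>x. cmod (biot_savart_partial c N x - of_real (c (K x))) powr 1)) \<longlonglongrightarrow> 0"
    using K c unfolding biot_savart_kernel_def by (auto dest: spec[of _ 1])
  have Kint: "integrable lborel (\<lambda>x. indicator ?sq x * norm (K x))" using p1 by (simp add: set_integrable_def)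
  have lim: "(\<lambda>N. torus_integral (\<lambda>x. cmod (biot_savart_partial c N x - of_real (c (K x))))) \<longlonglongrightarrow> 0" using p1 by simp
  have em[measurable]: "efun a \<in> borel_measurable borel" for a
    by (rule borel_measurable_continuous_onI[OF trigpoly_continuous[OF trigpoly_efun]])
  have ebound: "\<bar>efun a y\<bar> \<le> sqrt 2" for a y by (simp add: efun_def abs_mult)
  have Kfin: "(\<integral>\<^sup>+y. indicator ?sq y * ennreal \<bar>c (K y)\<bar> \<partial>lborel) < \<infinity>"
  proof -
    have "(\<integral>\<^sup>+y. indicator ?sq y * ennreal \<bar>c (K y)\<bar> \<partial>lborel) \<le> (\<integral>\<^sup>+y. ennreal (norm (indicator ?sq y * norm (K y))) \<partial>lborel)"
      using clin by (intro nn_integral_mono) (auto simp: indicator_def)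
    also have "\<dots> < \<infinity>" using Kint by (simp add: integrable_iff_bounded)
    finally show ?thesis .
  qed
  have shift: "(\<integral>\<^sup>+y. indicator ?sq y * ennreal \<bar>h (x - y)\<bar> \<partial>lborel) = (\<integral>\<^sup>+y. indicator ?sq y * ennreal \<bar>h y\<bar> \<partial>lborel)"
    if "h \<in> borel_measurable borel" "\<And>z m. h (z + vec_of m) = h z" for h :: "real \<times> real \<Rightarrow> real"
    using that by (intro nn_torus_shift(2)[of "\<lambda>y. ennreal \<bar>h y\<bar>"]) auto
  have cKshift: "integrable lborel (\<lambda>y. indicator ?sq y * c (K (x - y)))"
  proof (rule integrableI_bounded)
    have "(\<integral>\<^sup>+y. ennreal (norm (indicator ?sq y * c (K (x - y)))) \<partial>lborel) = (\<integral>\<^sup>+y. indicator ?sq y * ennreal \<bar>c (K (x - y))\<bar> \<partial>lborel)"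
      by (intro nn_integral_cong) (auto simp: indicator_def)
    also have "\<dots> < \<infinity>" using shift[of "\<lambda>z. c (K z)"] per Kfin by simp
    finally show "(\<integral>\<^sup>+y. ennreal (norm (indicator ?sq y * c (K (x - y)))) \<partial>lborel) < \<infinity>" .
  qed measurable
  have int: "integrable lborel (\<lambda>y. indicator ?sq y * (efun l y * c (K (x - y))))"
  proof (rule Bochner_Integration.integrable_bound)
    show "integrable lborel (\<lambda>y. sqrt 2 * (indicator ?sq y * c (K (x - y))))" using cKshift by simp
    show "AE y in lborel. norm (indicator ?sq y * (efun l y * c (K (x - y)))) \<le> norm (sqrt 2 * (indicator ?sq y * c (K (x - y))))"
      using ebound[of l] by (auto simp: abs_mult indicator_def intro!: mult_right_mono)
  qed measurable
  then show "set_integrable lborel ?sq (\<lambda>y. efun l y * c (K (x - y)))" by (simp add: set_integrable_def)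
  define R where "R N z = Re (biot_savart_partial c N z)" for N z
  have Rtrig: "R N = (\<lambda>z. \<Sum>k\<in>square N. (2 * pi * c (perp k) / (norm (vec_of k))\<^sup>2 * efun k 0) * efun (- k) z)" for N
    using kernel_partial_expand[OF c, of N _ 0] by (simp add: R_def fun_eq_iff mult_ac)
  have Rtp: "trigpoly (R N)" for N unfolding Rtrig by (intro trigpoly_sum trigpoly_scale trigpoly_efun)
  have [measurable]: "R N \<in> borel_measurable borel" for N
    by (rule borel_measurable_continuous_onI[OF trigpoly_continuous[OF Rtp]])
  let ?v = "2 * pi * c (perp l) / (norm (vec_of l))\<^sup>2 * efun (- l) x"
  have Rint: "torus_integral (\<lambda>y. efun l y * R N (x - y)) = ?v" and Ri: "integrable lborel (\<lambda>y. indicator ?sq y * (efun l y * R N (x - y)))"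
    if "l \<in> square N" for N
  proof -
    have eq: "(\<lambda>y. efun l y * R N (x - y)) = (\<lambda>y. \<Sum>k\<in>square N. (2 * pi * c (perp k) / (norm (vec_of k))\<^sup>2 * efun (- k) x) * (efun l y * efun k y))"
      unfolding R_def kernel_partial_expand[OF c] by (simp add: fun_eq_iff sum_distrib_left mult_ac)
    have "trigpoly (\<lambda>y. efun l y * R N (x - y))" unfolding eq by (intro trigpoly_sum trigpoly_scale trigpoly_efun trigpoly_mult)
    from trigpoly_set_integrable[OF this] show "integrable lborel (\<lambda>y. indicator ?sq y * (efun l y * R N (x - y)))"
      by (simp add: set_integrable_def)
    have "torus_integral (\<lambda>y. efun l y * R N (x - y)) = (\<Sum>k\<in>square N. (2 * pi * c (perp k) / (norm (vec_of k))\<^sup>2 * efun (- k) x) * torus_integral (\<lambda>y. efun l y * efun k y))"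
      unfolding eq by (subst torus_integral_sum, intro trigpoly_scale trigpoly_mult trigpoly_efun, simp only: torus_integral_scale)
    also have "\<dots> = (\<Sum>k\<in>square N. if l = k then ?v else 0)"
      using square_Z20 l by (intro sum.cong refl) (auto simp: efun_orthonormal subset_iff)
    also have "\<dots> = ?v" using that square_finite by simp
    finally show "torus_integral (\<lambda>y. efun l y * R N (x - y)) = ?v" .
  qed
  obtain N0 where N0: "l \<in> square N0" using mem_square[OF l] by blast
  let ?I = "torus_integral (\<lambda>y. efun l y * c (K (x - y)))"
  have est: "\<bar>?I - ?v\<bar> \<le> sqrt 2 * torus_integral (\<lambda>x. cmod (biot_savart_partial c N x - of_real (c (K x))))" if "N \<ge> N0" for N
  proof -
    have lN: "l \<in> square N" using N0 square_mono[OF that] by blast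
    let ?d = "\<lambda>y. c (K y) - R N y"
    have dper: "?d (z + vec_of m) = ?d z" for z m using per trigpoly_periodic[OF Rtp] by simp
    have "?I - ?v = (LINT y|lborel. indicator ?sq y * (efun l y * c (K (x - y)))) - (LINT y|lborel. indicator ?sq y * (efun l y * R N (x - y)))"
      using Rint[OF lN] by (simp add: torus_integral_def set_lebesgue_integral_def)
    also have "\<dots> = (LINT y|lborel. indicator ?sq y * (efun l y * ?d (x - y)))"
      using int Ri[OF lN] by (subst Bochner_Integration.integral_diff[symmetric]) (simp_all add: algebra_simps)
    finally have "\<bar>?I - ?v\<bar> = norm (LINT y|lborel. indicator ?sq y * (efun l y * ?d (x - y)))" by simp
    then have "ennreal \<bar>?I - ?v\<bar> \<le> (\<integral>\<^sup>+y. ennreal (norm (indicator ?sq y * (efun l y * ?d (x - y)))) \<partial>lborel)"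
      using integral_norm_bound_ennreal[of lborel "\<lambda>y. indicator ?sq y * (efun l y * ?d (x - y))"] int Ri[OF lN]
      by (simp add: right_diff_distrib)
    also have "\<dots> \<le> (\<integral>\<^sup>+y. ennreal (sqrt 2) * (indicator ?sq y * ennreal \<bar>?d (x - y)\<bar>) \<partial>lborel)"
      using ebound[of l] by (intro nn_integral_mono)
        (auto simp: indicator_def abs_mult ennreal_mult'[symmetric] intro!: ennreal_leI mult_right_mono)
    also have "\<dots> = ennreal (sqrt 2) * (\<integral>\<^sup>+y. indicator ?sq y * ennreal \<bar>?d (x - y)\<bar> \<partial>lborel)"
      by (rule nn_integral_cmult) measurable
    also have "(\<integral>\<^sup>+y. indicator ?sq y * ennreal \<bar>?d (x - y)\<bar> \<partial>lborel) = (\<integral>\<^sup>+y. indicator ?sq y * ennreal \<bar>?d y\<bar> \<partial>lborel)"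
      by (rule shift[of ?d]) (use dper in auto)
    also have "\<dots> \<le> (\<integral>\<^sup>+y. ennreal (indicator ?sq y * cmod (biot_savart_partial c N y - of_real (c (K y)))) \<partial>lborel)"
    proof (rule nn_integral_mono)
      fix y
      have "\<bar>?d y\<bar> = \<bar>Re (biot_savart_partial c N y - of_real (c (K y)))\<bar>" by (simp add: R_def)
      also have "\<dots> \<le> cmod (biot_savart_partial c N y - of_real (c (K y)))" by (rule abs_Re_le_cmod)
      finally show "indicator ?sq y * ennreal \<bar>?d y\<bar> \<le> ennreal (indicator ?sq y * cmod (biot_savart_partial c N y - of_real (c (K y))))"
        by (auto simp: indicator_def intro: ennreal_leI)
    qed
    also have "\<dots> = ennreal (torus_integral (\<lambda>x. cmod (biot_savart_partial c N x - of_real (c (K x)))))"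
    proof -
      have pm: "continuous_on UNIV (biot_savart_partial c N)"
        unfolding biot_savart_partial_def[abs_def] by (intro continuous_intros)
      have [measurable]: "biot_savart_partial c N \<in> borel_measurable borel" by (rule borel_measurable_continuous_onI[OF pm])
      have i1: "integrable lborel (\<lambda>y. indicator ?sq y *\<^sub>R biot_savart_partial c N y)"
        by (rule borel_integrable_compact[OF compact_cbox continuous_on_subset[OF pm]]) simp
      have i2: "integrable lborel (\<lambda>y. indicator ?sq y * c (K y))"
        by (rule Bochner_Integration.integrable_bound[OF Kint]) (use clin in \<open>auto simp: indicator_def\<close>)
      have "integrable lborel (\<lambda>y. indicator ?sq y * cmod (biot_savart_partial c N y - of_real (c (K y))))"
      proof (rule Bochner_Integration.integrable_bound)
        show "integrable lborel (\<lambda>y. norm (indicator ?sq y *\<^sub>R biot_savart_partial c N y) + norm (indicator ?sq y * c (K y)))"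
          using i1 i2 by (intro Bochner_Integration.integrable_add integrable_norm)
        show "AE y in lborel. norm (indicator ?sq y * cmod (biot_savart_partial c N y - of_real (c (K y)))) \<le>
            norm (norm (indicator ?sq y *\<^sub>R biot_savart_partial c N y) + norm (indicator ?sq y * c (K y)))"
          by (rule AE_I2) (auto simp: indicator_def intro: order_trans[OF norm_triangle_ineq4])
      qed measurable
      then show ?thesis by (subst nn_integral_eq_integral) (auto simp: torus_integral_def set_lebesgue_integral_def)
    qed
    finally have "ennreal \<bar>?I - ?v\<bar> \<le> ennreal (sqrt 2) * ennreal (torus_integral (\<lambda>x. cmod (biot_savart_partial c N x - of_real (c (K x)))))"
      by (simp add: mult_left_mono)
    moreover have "0 \<le> torus_integral (\<lambda>x. cmod (biot_savart_partial c N x - of_real (c (K x))))"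
      unfolding torus_integral_def set_lebesgue_integral_def by (intro integral_nonneg_AE) auto
    ultimately show ?thesis by (simp add: ennreal_mult[symmetric])
  qed
  have "(\<lambda>N. sqrt 2 * torus_integral (\<lambda>x. cmod (biot_savart_partial c N x - of_real (c (K x))))) \<longlonglongrightarrow> sqrt 2 * 0"
    by (intro tendsto_intros lim)
  then have "\<bar>?I - ?v\<bar> \<le> sqrt 2 * 0"
    by (rule LIMSEQ_le_const) (use est in blast)
  then show "?I = ?v" by simp
qed

lemma velocity_proj:
  assumes K: "biot_savart_kernel K"
  shows "velocity K (proj (square N) \<omega>) x =
    (\<Sum>l\<in>square N. (\<omega> (efun l) * (2 * pi / (norm (vec_of l))\<^sup>2) * efun (- l) x) *\<^sub>R perp l)"
proof -
  let ?sq = "cbox (0, 0) (1, 1) :: (real \<times> real) set"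
  have int: "integrable lborel (\<lambda>y. indicator ?sq y * (efun l y * c (K (x - y))))"
    if "c = fst \<or> c = snd" "l \<in> square N" for c l
    using kernel_fourier_coefficient(1)[OF K that(1) subsetD[OF square_Z20 that(2)]] by (simp add: set_integrable_def)
  have one: "(LINT y|lborel. indicator ?sq y * (efun l y * c (K (x - y)))) = 2 * pi * c (perp l) / (norm (vec_of l))\<^sup>2 * efun (- l) x"
    if "c = fst \<or> c = snd" "l \<in> square N" for c l
    using kernel_fourier_coefficient(2)[OF K that(1) subsetD[OF square_Z20 that(2)]]
    by (simp add: torus_integral_def set_lebesgue_integral_def)
  have comp: "(LINT y|lborel. indicator ?sq y * (proj (square N) \<omega> y * c (K (x - y)))) =
      (\<Sum>l\<in>square N. \<omega> (efun l) * (2 * pi / (norm (vec_of l))\<^sup>2) * efun (- l) x * c (perp l))"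
    and cint: "integrable lborel (\<lambda>y. indicator ?sq y * (proj (square N) \<omega> y * c (K (x - y))))"
    if c: "c = fst \<or> c = snd" for c
  proof -
    have eq: "(\<lambda>y. indicator ?sq y * (proj (square N) \<omega> y * c (K (x - y)))) =
        (\<lambda>y. \<Sum>l\<in>square N. \<omega> (efun l) * (indicator ?sq y * (efun l y * c (K (x - y)))))"
      by (simp add: proj_def sum_distrib_left sum_distrib_right fun_eq_iff mult_ac)
    show "integrable lborel (\<lambda>y. indicator ?sq y * (proj (square N) \<omega> y * c (K (x - y))))"
      unfolding eq by (intro Bochner_Integration.integrable_sum integrable_mult_right int[OF c])
    have "(LINT y|lborel. indicator ?sq y * (proj (square N) \<omega> y * c (K (x - y)))) =
        (\<Sum>l\<in>square N. \<omega> (efun l) * (LINT y|lborel. indicator ?sq y * (efun l y * c (K (x - y)))))"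
      unfolding eq by (subst Bochner_Integration.integral_sum) (auto intro: int[OF c])
    also have "\<dots> = (\<Sum>l\<in>square N. \<omega> (efun l) * (2 * pi / (norm (vec_of l))\<^sup>2) * efun (- l) x * c (perp l))"
      by (intro sum.cong refl) (simp add: one[OF c])
    finally show "(LINT y|lborel. indicator ?sq y * (proj (square N) \<omega> y * c (K (x - y)))) =
      (\<Sum>l\<in>square N. \<omega> (efun l) * (2 * pi / (norm (vec_of l))\<^sup>2) * efun (- l) x * c (perp l))" .
  qed
  let ?V = "\<lambda>y. indicator ?sq y *\<^sub>R (proj (square N) \<omega> y *\<^sub>R K (x - y))"
  have Veq: "?V = (\<lambda>y. (indicator ?sq y * (proj (square N) \<omega> y * fst (K (x - y)))) *\<^sub>R (1, 0)
      + (indicator ?sq y * (proj (square N) \<omega> y * snd (K (x - y)))) *\<^sub>R (0, 1))"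
    by (simp add: fun_eq_iff prod_eq_iff)
  have "velocity K (proj (square N) \<omega>) x = (LINT y|lborel. ?V y)"
    by (simp add: velocity_def torus_integral_def set_lebesgue_integral_def)
  also have "\<dots> = (LINT y|lborel. indicator ?sq y * (proj (square N) \<omega> y * fst (K (x - y)))) *\<^sub>R (1, 0)
      + (LINT y|lborel. indicator ?sq y * (proj (square N) \<omega> y * snd (K (x - y)))) *\<^sub>R (0, 1)"
    unfolding Veq
    by (subst Bochner_Integration.integral_add, (intro integrable_scaleR_left cint, simp)+,
        subst (1 2) integral_scaleR_left, (intro cint, simp)+, rule refl)
  also have "\<dots> = (\<Sum>l\<in>square N. (\<omega> (efun l) * (2 * pi / (norm (vec_of l))\<^sup>2) * efun (- l) x) *\<^sub>R perp l)"
    unfolding comp[of fst, simplified] comp[of snd, simplified] by (simp add: prod_eq_iff fst_sum snd_sum)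
  finally show ?thesis .
qed

text \<open>Mode l generates the velocity, mode m is transported, and the result is tested against
  e_j. One factor 2 pi comes from the kernel, the other from the gradient.\<close>

definition drift_coeff :: "int \<times> int \<Rightarrow> int \<times> int \<Rightarrow> int \<times> int \<Rightarrow> real" where
  "drift_coeff l m j = 4 * pi\<^sup>2 * (vec_of m \<bullet> perp l) / (norm (vec_of l))\<^sup>2 * tau (- l) (- m) j"

lemma drift_approx_eq:
  assumes K: "biot_savart_kernel K"
  shows "drift_approx K \<Lambda> f N \<omega> = (\<Sum>j\<in>\<Lambda>. partial_deriv j f (coords \<Lambda> \<omega>) *
     (\<Sum>l\<in>square N. \<Sum>m\<in>square N. drift_coeff l m j * (\<omega> (efun l) * \<omega> (efun m))))"
proof -
  define p where "p j = partial_deriv j f (coords \<Lambda> \<omega>)" for j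
  define X where "X l = \<omega> (efun l)" for l
  define b where "b l m = 4 * pi\<^sup>2 * (vec_of m \<bullet> perp l) / (norm (vec_of l))\<^sup>2" for l m
  let ?v = "velocity K (proj (square N) \<omega>)"
  have w: "proj (square N) \<omega> = (\<lambda>x. \<Sum>m\<in>square N. X m * efun m x)" by (simp add: proj_def[abs_def] X_def)
  have adv: "advect ?v (proj (square N) \<omega>) x = (\<Sum>l\<in>square N. \<Sum>m\<in>square N. X l * X m * b l m * (efun (- l) x * efun (- m) x))" for x
  proof -
    have "advect ?v (proj (square N) \<omega>) x = (\<Sum>m\<in>square N. X m * (2 * pi * (vec_of m \<bullet> ?v x) * efun (- m) x))"
      using advect_efun_sum[OF square_Z20, of ?v X N x] by (simp only: w)
    also have "\<dots> = (\<Sum>m\<in>square N. \<Sum>l\<in>square N. X l * X m * b l m * (efun (- l) x * efun (- m) x))"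
      unfolding velocity_proj[OF K] by (simp add: X_def[symmetric] inner_sum_right sum_distrib_left sum_distrib_right b_def power2_eq_square mult_ac)
    also have "\<dots> = (\<Sum>l\<in>square N. \<Sum>m\<in>square N. X l * X m * b l m * (efun (- l) x * efun (- m) x))"
      by (rule sum.swap)
    finally show ?thesis .
  qed
  have "drift_approx K \<Lambda> f N \<omega> = torus_integral (\<lambda>x. advect ?v (proj (square N) \<omega>) x * D_cyl \<Lambda> f \<omega> x)"
    by (simp add: drift_approx_def Let_def)
  also have "(\<lambda>x. advect ?v (proj (square N) \<omega>) x * D_cyl \<Lambda> f \<omega> x) =
     (\<lambda>x. \<Sum>j\<in>\<Lambda>. \<Sum>l\<in>square N. \<Sum>m\<in>square N. (p j * X l * X m * b l m) * (efun (- l) x * efun (- m) x * efun j x))"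
  proof (rule ext)
    fix x
    define A where "A = advect ?v (proj (square N) \<omega>) x"
    have "A * D_cyl \<Lambda> f \<omega> x = (\<Sum>j\<in>\<Lambda>. (p j * efun j x) * A)"
      by (simp add: D_cyl_def p_def sum_distrib_left mult_ac)
    also have "\<dots> = (\<Sum>j\<in>\<Lambda>. \<Sum>l\<in>square N. \<Sum>m\<in>square N. (p j * X l * X m * b l m) * (efun (- l) x * efun (- m) x * efun j x))"
      unfolding A_def adv by (simp add: sum_distrib_left mult_ac)
    finally show "advect ?v (proj (square N) \<omega>) x * D_cyl \<Lambda> f \<omega> x = \<dots>" by (simp add: A_def)
  qed
  also have "torus_integral \<dots> = (\<Sum>j\<in>\<Lambda>. \<Sum>l\<in>square N. \<Sum>m\<in>square N. (p j * X l * X m * b l m) * tau (- l) (- m) j)"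
    by (simp add: torus_integral_sum trigpoly_sum trigpoly_scale trigpoly_mult trigpoly_efun torus_integral_scale tau_def)
  also have "\<dots> = (\<Sum>j\<in>\<Lambda>. p j * (\<Sum>l\<in>square N. \<Sum>m\<in>square N. drift_coeff l m j * (X l * X m)))"
    by (simp add: sum_distrib_left drift_coeff_def b_def mult_ac)
  finally show ?thesis by (simp add: p_def X_def)
qed

text \<open>For fixed l this is transport by the divergence free velocity field of a single mode:
  \<open>tau_identity\<close> with v = \<open>perp l\<close>.\<close>

lemma drift_coeff_antisym:
  assumes "l \<in> Z20" "m \<in> Z20" "j \<in> Z20"
  shows "drift_coeff l m j = - drift_coeff l j m"
proof -
  have "- l \<in> Z20" using assms(1) by (simp add: Z20_iff)
  from tau_identity[OF this assms(2,3), of "perp l"]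
  have "(vec_of m \<bullet> perp l) * tau (- l) (- m) j + (vec_of j \<bullet> perp l) * tau (- l) (- j) m = 0"
    using tau_commute(2)[of "- l" m "- j"] by (simp add: vec_of_minus perp_inner_self)
  then have *: "(vec_of m \<bullet> perp l) * tau (- l) (- m) j = - ((vec_of j \<bullet> perp l) * tau (- l) (- j) m)" by simp
  have "drift_coeff l m j = 4 * pi\<^sup>2 / (norm (vec_of l))\<^sup>2 * ((vec_of m \<bullet> perp l) * tau (- l) (- m) j)"
    by (simp add: drift_coeff_def)
  then show ?thesis unfolding * by (simp add: drift_coeff_def)
qed

lemma drift_coeff_diag: "drift_coeff l l j = 0"
  by (simp add: drift_coeff_def perp_inner_self)

text \<open>Only the part of the drift that is symmetric in \<open>(l, m)\<close> matters, and there the leading order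
  in the two frequencies cancels; this makes the coefficients square summable.\<close>

definition sym_coeff :: "int \<times> int \<Rightarrow> int \<times> int \<Rightarrow> int \<times> int \<Rightarrow> real" where
  "sym_coeff j l m = (drift_coeff l m j + drift_coeff m l j) / 2"

lemma nbr_iff: "l \<in> Z20 \<Longrightarrow> m \<in> Z20 \<Longrightarrow> m \<in> nbr l j \<longleftrightarrow> l \<in> nbr m j"
  using nbr_sym by blast

text \<open>Antisymmetry moves the derivative from the transported mode to j. By
  \<open>tau_identity\<close> with v = \<open>perp j\<close> the two products that arise differ only
  in sign, so the inverse squares of the two frequencies are subtracted.\<close>

lemma sym_coeff_formula:
  assumes l: "l \<in> Z20" and m: "m \<in> Z20" and j: "j \<in> Z20"
  shows "sym_coeff j l m = - 2 * pi\<^sup>2 * ((vec_of j \<bullet> perp l) * tau (- l) (- j) m) *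
     (1 / (norm (vec_of l))\<^sup>2 - 1 / (norm (vec_of m))\<^sup>2)"
proof -
  have pj: "vec_of l \<bullet> perp j = - (vec_of j \<bullet> perp l)" for l by (simp add: vec_of_def perp_def)
  have mj: "- j \<in> Z20" using j by (simp add: Z20_iff)
  have t: "tau (- m) (- j) l = tau l (- j) (- m)" by (metis tau_commute)
  from tau_identity[OF l mj m, of "perp j"]
  have X: "(vec_of j \<bullet> perp m) * tau (- m) (- j) l = - ((vec_of j \<bullet> perp l) * tau (- l) (- j) m)"
    by (simp add: vec_of_minus perp_inner_self pj t)
  have e: "drift_coeff l m j = - (4 * pi\<^sup>2 / (norm (vec_of l))\<^sup>2 * ((vec_of j \<bullet> perp l) * tau (- l) (- j) m))"
    unfolding drift_coeff_antisym[OF l m j] by (simp add: drift_coeff_def)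
  have e': "drift_coeff m l j = - (4 * pi\<^sup>2 / (norm (vec_of m))\<^sup>2 * ((vec_of j \<bullet> perp m) * tau (- m) (- j) l))"
    unfolding drift_coeff_antisym[OF m l j] by (simp add: drift_coeff_def)
  have "sym_coeff j l m = (- (4 * pi\<^sup>2 / (norm (vec_of l))\<^sup>2 * ((vec_of j \<bullet> perp l) * tau (- l) (- j) m))
     - (4 * pi\<^sup>2 / (norm (vec_of m))\<^sup>2 * - ((vec_of j \<bullet> perp l) * tau (- l) (- j) m))) / 2"
    unfolding sym_coeff_def e e' X by simp
  then show ?thesis by (simp add: field_simps)
qed

lemma sym_coeff_commute: "sym_coeff j l m = sym_coeff j m l"
  by (simp add: sym_coeff_def add.commute)

lemma sym_coeff_diag: "sym_coeff j l l = 0"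
  by (simp add: sym_coeff_def drift_coeff_diag)

lemma sym_coeff_zero:
  assumes "l \<in> Z20" "m \<in> Z20" "j \<in> Z20" "l \<notin> nbr m j"
  shows "sym_coeff j l m = 0"
proof -
  have "m \<notin> nbr l j" using assms nbr_iff by blast
  moreover have "nbr (- l) (- j) = nbr l j" by (auto simp: nbr_def)
  ultimately have "tau (- l) (- j) m = 0" using efun_mult_expand(2)[of m "- l" "- j"] assms(2) by simp
  then show ?thesis using sym_coeff_formula[OF assms(1-3)] by simp
qed

text \<open>Where the coefficient is nonzero, |l| and |m| differ by at most |j|, so the inverse
  squares differ by at most 3 |j|^2 / (|l| |m|^2). The factor 1 / |l| compensates the growth |j| |l|
  of the inner product. The constant collects 2, the bound 2 sqrt 2 on \<open>tau\<close>, and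
  3.\<close>

lemma sym_coeff_bound:
  assumes l: "l \<in> Z20" and m: "m \<in> Z20" and j: "j \<in> Z20"
  shows "\<bar>sym_coeff j l m\<bar> \<le> 12 * sqrt 2 * pi\<^sup>2 * norm (vec_of j) ^ 3 / (norm (vec_of m))\<^sup>2"
proof (cases "l \<in> nbr m j")
  case False
  then show ?thesis using sym_coeff_zero[OF l m j] by simp
next
  case True
  define L M J where "L = norm (vec_of l)" and "M = norm (vec_of m)" and "J = norm (vec_of j)"
  have ge1: "1 \<le> L" "1 \<le> M" "1 \<le> J" using l m j norm_vec_of_ge_1 by (auto simp: L_def M_def J_def)
  have "m \<in> nbr l j" using True nbr_iff[OF l m] by blast
  then have "norm (vec_of m) = norm (vec_of (l + j)) \<or> norm (vec_of m) = norm (vec_of (l - j))"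
    by (auto simp: nbr_def vec_of_add vec_of_diff vec_of_minus norm_minus_commute simp flip: norm_minus_cancel[of "vec_of l + vec_of j"])
  then have M: "M = norm (vec_of l + vec_of j) \<or> M = norm (vec_of l - vec_of j)"
    by (auto simp: M_def vec_of_add vec_of_diff)
  have "\<bar>M - L\<bar> \<le> J"
    using M norm_triangle_ineq3[of "vec_of l + vec_of j" "vec_of l"] norm_triangle_ineq3[of "vec_of l - vec_of j" "vec_of l"]
    by (auto simp: L_def J_def)
  moreover have "M + L \<le> 2 * L + J" using calculation by linarith
  ultimately have "\<bar>M - L\<bar> * (M + L) \<le> J * (2 * L + J)" using ge1 by (intro mult_mono) auto
  also have "\<dots> \<le> J * (3 * (L * J))"
  proof -
    have "L \<le> L * J" "J \<le> L * J" using ge1 mult_left_mono[of 1 J L] mult_right_mono[of 1 L J] by auto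
    then show ?thesis using ge1 by (intro mult_left_mono) linarith+
  qed
  finally have diff: "\<bar>M\<^sup>2 - L\<^sup>2\<bar> \<le> 3 * (L * J\<^sup>2)"
    using ge1 by (simp add: square_diff_square_factored power2_eq_square abs_mult mult_ac)
  have inv: "1 / L\<^sup>2 - 1 / M\<^sup>2 = (M\<^sup>2 - L\<^sup>2) / (L\<^sup>2 * M\<^sup>2)" using ge1 by (simp add: field_simps)
  have "\<bar>1 / L\<^sup>2 - 1 / M\<^sup>2\<bar> \<le> 3 * (L * J\<^sup>2) / (L\<^sup>2 * M\<^sup>2)"
    unfolding inv using diff by (simp add: abs_mult divide_right_mono)
  moreover have "\<bar>vec_of j \<bullet> perp l\<bar> \<le> J * L"
    using Cauchy_Schwarz_ineq2[of "vec_of j" "perp l"] by (simp add: J_def L_def norm_perp)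
  moreover have "\<bar>sym_coeff j l m\<bar> = 2 * pi\<^sup>2 * (\<bar>vec_of j \<bullet> perp l\<bar> * \<bar>tau (- l) (- j) m\<bar>) * \<bar>1 / L\<^sup>2 - 1 / M\<^sup>2\<bar>"
    unfolding sym_coeff_formula[OF l m j] L_def[symmetric] M_def[symmetric] by (simp add: abs_mult)
  ultimately have "\<bar>sym_coeff j l m\<bar> \<le> 2 * pi\<^sup>2 * ((J * L) * (2 * sqrt 2)) * (3 * (L * J\<^sup>2) / (L\<^sup>2 * M\<^sup>2))"
    using ge1 by (simp only:) (intro mult_mono tau_bound order_refl, auto)
  also have "\<dots> = 12 * sqrt 2 * pi\<^sup>2 * J ^ 3 / M\<^sup>2"
    using ge1 by (simp add: power2_eq_square power3_eq_cube field_simps)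
  finally show ?thesis by (simp add: J_def M_def)
qed

section \<open>Gaussian integrals on the line\<close>

lemma power_le_fact_exp: "0 \<le> (x::real) \<Longrightarrow> x ^ n \<le> fact n * exp x"
proof -
  assume x: "0 \<le> x"
  have s: "(\<lambda>n. x ^ n /\<^sub>R fact n) sums exp x" by (rule exp_converges)
  have "(\<Sum>i\<in>{n}. x ^ i /\<^sub>R fact i) \<le> (\<Sum>i. x ^ i /\<^sub>R fact i)"
    using x s by (intro sum_le_suminf) (auto simp: sums_iff)
  then have "x ^ n / fact n \<le> exp x" using s by (simp add: sums_iff field_simps)
  then show ?thesis by (simp add: field_simps)
qed

lemma one_plus_power_le: "0 \<le> (a::real) \<Longrightarrow> (1 + a) ^ n \<le> 2 ^ n * (1 + a ^ n)"
proof -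
  assume a: "0 \<le> a"
  have "(1 + a) ^ n \<le> (2 * max 1 a) ^ n" using a by (intro power_mono) auto
  also have "\<dots> = 2 ^ n * (max 1 a) ^ n" by (simp add: power_mult_distrib)
  also have "(max 1 a) ^ n \<le> 1 + a ^ n" using a by (auto simp: max_def)
  finally show ?thesis by simp
qed

definition gauss :: "real measure" where
  "gauss = density lborel std_normal_density"

lemma gauss_prob: "prob_space gauss"
  unfolding gauss_def by (rule prob_space_normal_density) simp

lemma sets_gauss[measurable_cong]: "sets gauss = sets borel"
  by (simp add: gauss_def)

lemma space_gauss: "space gauss = UNIV"
  by (simp add: gauss_def)

lemma gauss_growth_integrable: "integrable lborel (\<lambda>t. std_normal_density t * (1 + \<bar>t\<bar>) ^ n)"
proof (rule Bochner_Integration.integrable_bound)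
  show "integrable lborel (\<lambda>t. 2 ^ n * (std_normal_density t * \<bar>t\<bar> ^ 0 + std_normal_density t * \<bar>t\<bar> ^ n))"
    by (intro integrable_mult_right Bochner_Integration.integrable_add integrable_std_normal_moment_abs)
  show "AE t in lborel. norm (std_normal_density t * (1 + \<bar>t\<bar>) ^ n) \<le>
      norm (2 ^ n * (std_normal_density t * \<bar>t\<bar> ^ 0 + std_normal_density t * \<bar>t\<bar> ^ n))"
  proof (rule AE_I2)
    fix t
    have "std_normal_density t * (1 + \<bar>t\<bar>) ^ n \<le> std_normal_density t * (2 ^ n * (1 + \<bar>t\<bar> ^ n))"
      by (intro mult_left_mono one_plus_power_le) auto
    then show "norm (std_normal_density t * (1 + \<bar>t\<bar>) ^ n) \<le>
      norm (2 ^ n * (std_normal_density t * \<bar>t\<bar> ^ 0 + std_normal_density t * \<bar>t\<bar> ^ n))"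
      by (simp add: abs_mult algebra_simps)
  qed
qed simp

lemma gauss_integrable:
  assumes "f \<in> borel_measurable borel" "\<And>t. \<bar>f t\<bar> \<le> C * (1 + \<bar>t\<bar>) ^ n"
  shows "integrable lborel (\<lambda>t. std_normal_density t * f t)"
proof (rule Bochner_Integration.integrable_bound)
  show "integrable lborel (\<lambda>t. C * (std_normal_density t * (1 + \<bar>t\<bar>) ^ n))"
    by (intro integrable_mult_right gauss_growth_integrable)
  show "AE t in lborel. norm (std_normal_density t * f t) \<le> norm (C * (std_normal_density t * (1 + \<bar>t\<bar>) ^ n))"
  proof (rule AE_I2)
    fix t
    have "std_normal_density t * \<bar>f t\<bar> \<le> std_normal_density t * \<bar>C * (1 + \<bar>t\<bar>) ^ n\<bar>"
      using assms(2)[of t] by (intro mult_left_mono) auto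
    then show "norm (std_normal_density t * f t) \<le> norm (C * (std_normal_density t * (1 + \<bar>t\<bar>) ^ n))"
      by (simp add: abs_mult mult_ac)
  qed
qed (use assms(1) in simp)

lemma std_normal_density_deriv:
  "(std_normal_density has_real_derivative - t * std_normal_density t) (at t)"
  unfolding std_normal_density_def[abs_def]
  by (auto intro!: derivative_eq_intros simp: field_simps)

lemma gauss_decay:
  assumes "\<And>t. \<bar>f t\<bar> \<le> C * (1 + \<bar>t\<bar>) ^ n" "F = at_top \<or> F = at_bot"
  shows "((\<lambda>t. std_normal_density t * f t) \<longlongrightarrow> 0) F"
proof -
  let ?b = "\<lambda>t. \<bar>C\<bar> * (fact n * (1 / sqrt (2 * pi) * exp (1 + \<bar>t\<bar> - t\<^sup>2 / 2)))"
  have top: "((\<lambda>t::real. exp (1 + t - t\<^sup>2 / 2)) \<longlongrightarrow> 0) at_top" by real_asymp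
  have "((\<lambda>t::real. exp (1 + \<bar>t\<bar> - t\<^sup>2 / 2)) \<longlongrightarrow> 0) at_top"
    using top by (rule Lim_transform_eventually) (use eventually_ge_at_top[of 0] in eventually_elim, simp)
  moreover have "((\<lambda>t::real. exp (1 + \<bar>t\<bar> - t\<^sup>2 / 2)) \<longlongrightarrow> 0) at_bot"
    using calculation by (subst filterlim_at_bot_mirror) simp
  ultimately have e: "((\<lambda>t::real. exp (1 + \<bar>t\<bar> - t\<^sup>2 / 2)) \<longlongrightarrow> 0) F" using assms(2) by auto
  have "(?b \<longlongrightarrow> \<bar>C\<bar> * (fact n * (1 / sqrt (2 * pi) * 0))) F"
    by (intro tendsto_intros e)
  then have b0: "(?b \<longlongrightarrow> 0) F" by simp
  show ?thesis
  proof (rule tendsto_0_le[OF b0, of _ 1])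
    have "norm (std_normal_density t * f t) \<le> norm (?b t) * 1" for t
    proof -
      have "std_normal_density t * \<bar>f t\<bar> \<le> std_normal_density t * (\<bar>C\<bar> * (fact n * exp (1 + \<bar>t\<bar>)))"
      proof (intro mult_left_mono)
        have "\<bar>f t\<bar> \<le> \<bar>C\<bar> * (1 + \<bar>t\<bar>) ^ n"
        proof -
          have "C * (1 + \<bar>t\<bar>) ^ n \<le> \<bar>C\<bar> * (1 + \<bar>t\<bar>) ^ n" by (intro mult_right_mono) auto
          then show ?thesis using assms(1)[of t] by linarith
        qed
        also have "\<dots> \<le> \<bar>C\<bar> * (fact n * exp (1 + \<bar>t\<bar>))" by (intro mult_left_mono power_le_fact_exp) auto
        finally show "\<bar>f t\<bar> \<le> \<bar>C\<bar> * (fact n * exp (1 + \<bar>t\<bar>))" .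
      qed simp
      also have "\<dots> = ?b t"
      proof -
        have "exp (1 + \<bar>t\<bar> - t\<^sup>2 / 2) = exp (- t\<^sup>2 / 2) * exp (1 + \<bar>t\<bar>)"
          unfolding mult_exp_exp by (rule arg_cong[of _ _ exp]) simp
        then show ?thesis by (simp add: std_normal_density_def)
      qed
      finally show ?thesis by (simp add: abs_mult)
    qed
    then show "\<forall>\<^sub>F t in F. norm (std_normal_density t * f t) \<le> norm (?b t) * 1" by simp
  qed
qed

text \<open>The derivative of the density is - t times the density. So density times f has the
  derivative density times (f' - t f), and it decays at both ends.\<close>

lemma gauss_ibp:
  fixes f f' :: "real \<Rightarrow> real"
  assumes f: "\<And>t. (f has_real_derivative f' t) (at t)" and f'c: "continuous_on UNIV f'"
    and b: "\<And>t. \<bar>f t\<bar> \<le> C * (1 + \<bar>t\<bar>) ^ n" and b': "\<And>t. \<bar>f' t\<bar> \<le> C' * (1 + \<bar>t\<bar>) ^ n'"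
  shows "(LINT t|gauss. f' t) = (LINT t|gauss. t * f t)"
proof -
  have fc: "continuous_on UNIV f" using f by (intro DERIV_continuous_on) auto
  have [measurable]: "f \<in> borel_measurable borel" "f' \<in> borel_measurable borel"
    using fc f'c by (auto intro: borel_measurable_continuous_onI)
  have C0: "0 \<le> C" using b[of 0] by simp
  have btf: "\<bar>t * f t\<bar> \<le> C * (1 + \<bar>t\<bar>) ^ Suc n" for t
  proof -
    have "\<bar>t\<bar> * \<bar>f t\<bar> \<le> (1 + \<bar>t\<bar>) * (C * (1 + \<bar>t\<bar>) ^ n)" by (intro mult_mono b) auto
    then show ?thesis by (simp add: abs_mult mult_ac)
  qed
  have i1: "integrable lborel (\<lambda>t. std_normal_density t * f' t)" by (rule gauss_integrable[OF _ b']) simp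
  have i2: "integrable lborel (\<lambda>t. std_normal_density t * (t * f t))" by (rule gauss_integrable[OF _ btf]) simp
  let ?g = "\<lambda>t. std_normal_density t * f t"
  let ?g' = "\<lambda>t. std_normal_density t * f' t - std_normal_density t * (t * f t)"
  have "(LBINT t=-\<infinity>..\<infinity>. ?g' t) = 0 - 0"
  proof (rule interval_integral_FTC_integrable)
    show "(?g has_vector_derivative ?g' t) (at t)" for t
      unfolding has_real_derivative_iff_has_vector_derivative[symmetric]
      by (rule derivative_eq_intros std_normal_density_deriv f)+ simp
    have nc: "continuous_on UNIV std_normal_density"
      using std_normal_density_deriv by (intro DERIV_continuous_on) auto
    have "continuous_on UNIV ?g'" by (intro continuous_intros nc fc f'c)
    then show "isCont ?g' t" for t by (simp add: continuous_on_eq_continuous_at)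
    show "set_integrable lborel (einterval (- \<infinity>) \<infinity>) ?g'"
      using Bochner_Integration.integrable_diff[OF i1 i2] by (simp add: set_integrable_def)
    show "((?g \<circ> real_of_ereal) \<longlongrightarrow> 0) (at_right (- \<infinity>))" "((?g \<circ> real_of_ereal) \<longlongrightarrow> 0) (at_left \<infinity>)"
      unfolding ereal_tendsto_simps using gauss_decay[OF b] by auto
  qed simp
  then have "(LINT t|lborel. ?g' t) = 0"
    by (simp add: interval_lebesgue_integral_def set_lebesgue_integral_def)
  then show ?thesis
    using i1 i2 by (simp add: gauss_def integral_density)
qed

subsection \<open>White noise coordinates\<close>

abbreviation cspace :: "(int \<times> int) set \<Rightarrow> (int \<times> int \<Rightarrow> real) set" where
  "cspace \<Lambda> \<equiv> \<Lambda> \<rightarrow>\<^sub>E UNIV"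

lemma white_noiseD:
  assumes "white_noise \<mu>"
  shows "prob_space \<mu>" "space \<mu> = Hm1m" "prob_space.indep_vars \<mu> (\<lambda>_. borel) (\<lambda>k \<omega>. \<omega> (efun k)) Z20"
    and "k \<in> Z20 \<Longrightarrow> (\<lambda>\<omega>. \<omega> (efun k)) \<in> borel_measurable \<mu>"
    and "k \<in> Z20 \<Longrightarrow> distr \<mu> borel (\<lambda>\<omega>. \<omega> (efun k)) = gauss"
proof -
  show P: "prob_space \<mu>" and "space \<mu> = Hm1m" and
    I: "prob_space.indep_vars \<mu> (\<lambda>_. borel) (\<lambda>k \<omega>. \<omega> (efun k)) Z20"
    using assms by (simp_all add: white_noise_def)
  assume k: "k \<in> Z20"
  interpret prob_space \<mu> by (rule P)
  show m: "(\<lambda>\<omega>. \<omega> (efun k)) \<in> borel_measurable \<mu>" using I k by (simp add: indep_vars_def)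
  have "distr \<mu> lborel (\<lambda>\<omega>. \<omega> (efun k)) = gauss"
    using assms k by (simp add: white_noise_def gauss_def distributed_def)
  moreover have "distr \<mu> lborel (\<lambda>\<omega>. \<omega> (efun k)) = distr \<mu> borel (\<lambda>\<omega>. \<omega> (efun k))"
    by (rule distr_cong) auto
  ultimately show "distr \<mu> borel (\<lambda>\<omega>. \<omega> (efun k)) = gauss" by simp
qed

lemma coords_distr:
  assumes wn: "white_noise \<mu>" and \<Lambda>: "\<Lambda> \<subseteq> Z20" "\<Lambda> \<noteq> {}"
  shows "distr \<mu> (Pi\<^sub>M \<Lambda> (\<lambda>_. borel)) (coords \<Lambda>) = Pi\<^sub>M \<Lambda> (\<lambda>_. gauss)"
proof -
  interpret prob_space \<mu> by (rule white_noiseD(1)[OF wn])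
  have "indep_vars (\<lambda>_. borel) (\<lambda>k \<omega>. \<omega> (efun k)) \<Lambda>"
    by (rule indep_vars_subset[OF white_noiseD(3)[OF wn] \<Lambda>(1)])
  then have "distr \<mu> (Pi\<^sub>M \<Lambda> (\<lambda>_. borel)) (\<lambda>\<omega>. \<lambda>k\<in>\<Lambda>. \<omega> (efun k)) = Pi\<^sub>M \<Lambda> (\<lambda>k. distr \<mu> borel (\<lambda>\<omega>. \<omega> (efun k)))"
    by (rule iffD1[OF indep_vars_iff_distr_eq_PiM'[OF \<Lambda>(2)], rotated])
      (rule white_noiseD(4)[OF wn subsetD[OF \<Lambda>(1)]])
  also have "Pi\<^sub>M \<Lambda> (\<lambda>k. distr \<mu> borel (\<lambda>\<omega>. \<omega> (efun k))) = Pi\<^sub>M \<Lambda> (\<lambda>_. gauss)"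
    by (intro PiM_cong refl white_noiseD(5)[OF wn subsetD[OF \<Lambda>(1)]])
  finally show ?thesis by (simp add: coords_def[abs_def])
qed

lemma coords_measurable_PiM:
  assumes wn: "white_noise \<mu>" and \<Lambda>: "\<Lambda> \<subseteq> Z20"
  shows "coords \<Lambda> \<in> measurable \<mu> (Pi\<^sub>M \<Lambda> (\<lambda>_. borel))"
  unfolding coords_def[abs_def]
  by (intro measurable_restrict white_noiseD(4)[OF wn subsetD[OF \<Lambda>]])

lemma continuous_PiM_measurable:
  fixes h :: "(int \<times> int \<Rightarrow> real) \<Rightarrow> real"
  assumes "continuous_on (cspace \<Lambda>) h"
  shows "h \<in> borel_measurable (Pi\<^sub>M \<Lambda> (\<lambda>_. borel))"
proof -
  have "(\<lambda>x. x) \<in> measurable (Pi\<^sub>M \<Lambda> (\<lambda>_. borel :: real measure)) borel"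
  proof (rule measurable_coordinatewise_then_product)
    fix i
    show "(\<lambda>x. x i) \<in> borel_measurable (Pi\<^sub>M \<Lambda> (\<lambda>_. borel :: real measure))"
    proof (cases "i \<in> \<Lambda>")
      \<comment> \<open>Off \<Lambda> every point of the product space has the value
        \<open>undefined\<close>, so these coordinates are constant.\<close>
      case False
      then have "x i = undefined" if "x \<in> space (Pi\<^sub>M \<Lambda> (\<lambda>_. borel :: real measure))" for x
        using PiE_arb[of x \<Lambda> _ i] that by (simp add: space_PiM)
      then show ?thesis by (subst measurable_cong[where g = "\<lambda>_. undefined"]) auto
    qed simp
  qed
  then have "(\<lambda>x. x) \<in> measurable (Pi\<^sub>M \<Lambda> (\<lambda>_. borel :: real measure)) (restrict_space borel (cspace \<Lambda>))"
    by (rule measurable_restrict_space2[rotated]) (simp add: space_PiM)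
  from measurable_compose[OF this borel_measurable_continuous_on_restrict[OF assms]]
  show ?thesis .
qed

lemma coords_measurable:
  fixes h :: "(int \<times> int \<Rightarrow> real) \<Rightarrow> real"
  assumes "white_noise \<mu>" "\<Lambda> \<subseteq> Z20" "continuous_on (cspace \<Lambda>) h"
  shows "(\<lambda>\<omega>. h (coords \<Lambda> \<omega>)) \<in> borel_measurable \<mu>"
  by (rule measurable_compose[OF coords_measurable_PiM[OF assms(1,2)] continuous_PiM_measurable[OF assms(3)]])

text \<open>A product weight in place of a power of the norm: it factors over the independent
  coordinates, so its integrability is a question in one variable, and products of weights are again
  weights.\<close>

definition growth :: "(int \<times> int) set \<Rightarrow> nat \<Rightarrow> (int \<times> int \<Rightarrow> real) \<Rightarrow> real" where
  "growth \<Lambda> n x = (\<Prod>k\<in>\<Lambda>. (1 + \<bar>x k\<bar>) ^ n)"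

lemma growth_ge_1: "1 \<le> growth \<Lambda> n x"
  unfolding growth_def by (intro prod_ge_1) (simp add: one_le_power)

lemma growth_mult: "growth \<Lambda> n x * growth \<Lambda> m x = growth \<Lambda> (n + m) x"
  by (simp add: growth_def prod.distrib power_add)

lemma growth_mono_exp: "n \<le> m \<Longrightarrow> growth \<Lambda> n x \<le> growth \<Lambda> m x"
  unfolding growth_def by (intro prod_mono conjI power_increasing) auto

lemma growth_integrable:
  assumes wn: "white_noise \<mu>" and \<Lambda>: "finite \<Lambda>" "\<Lambda> \<subseteq> Z20"
  shows "integrable \<mu> (\<lambda>\<omega>. growth \<Lambda> n (coords \<Lambda> \<omega>))"
proof -
  interpret prob_space \<mu> by (rule white_noiseD(1)[OF wn])
  show ?thesis
  proof (cases "\<Lambda> = {}")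
    case False
    have "indep_vars (\<lambda>_. borel) (\<lambda>k \<omega>. \<omega> (efun k)) \<Lambda>"
      by (rule indep_vars_subset[OF white_noiseD(3)[OF wn] \<Lambda>(2)])
    then have "indep_vars (\<lambda>_. borel) (\<lambda>k \<omega>. (1 + \<bar>\<omega> (efun k)\<bar>) ^ n) \<Lambda>"
      by (rule indep_vars_compose2[where Y = "\<lambda>_ t. (1 + \<bar>t\<bar>) ^ n"]) simp
    moreover have "integrable \<mu> (\<lambda>\<omega>. (1 + \<bar>\<omega> (efun k)\<bar>) ^ n)" if k: "k \<in> \<Lambda>" for k
    proof -
      have kZ: "k \<in> Z20" using \<Lambda> k by auto
      have "integrable gauss (\<lambda>t. (1 + \<bar>t\<bar>) ^ n)"
        unfolding gauss_def using gauss_growth_integrable[of n] by (subst integrable_density) auto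
      then have "integrable (distr \<mu> borel (\<lambda>\<omega>. \<omega> (efun k))) (\<lambda>t. (1 + \<bar>t\<bar>) ^ n)"
        by (simp only: white_noiseD(5)[OF wn kZ])
      then show ?thesis using white_noiseD(4)[OF wn kZ] by (subst (asm) integrable_distr_eq) auto
    qed
    ultimately have "integrable \<mu> (\<lambda>\<omega>. \<Prod>k\<in>\<Lambda>. (1 + \<bar>\<omega> (efun k)\<bar>) ^ n)"
      by (intro indep_vars_integrable \<Lambda>(1)) auto
    then show ?thesis by (simp add: growth_def coords_def)
  qed (simp add: growth_def)
qed

definition C0P :: "(int \<times> int) set \<Rightarrow> ((int \<times> int \<Rightarrow> real) \<Rightarrow> real) \<Rightarrow> bool" where
  "C0P \<Lambda> h \<longleftrightarrow> continuous_on (cspace \<Lambda>) h \<and> (\<exists>C n. \<forall>x\<in>cspace \<Lambda>. \<bar>h x\<bar> \<le> C * growth \<Lambda> n x)"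

lemma C0P_E:
  assumes "C0P \<Lambda> h" obtains C n where "0 \<le> C" "\<And>x. x \<in> cspace \<Lambda> \<Longrightarrow> \<bar>h x\<bar> \<le> C * growth \<Lambda> n x"
proof -
  obtain C n where C: "\<And>x. x \<in> cspace \<Lambda> \<Longrightarrow> \<bar>h x\<bar> \<le> C * growth \<Lambda> n x" using assms by (auto simp: C0P_def)
  have "\<bar>h x\<bar> \<le> \<bar>C\<bar> * growth \<Lambda> n x" if "x \<in> cspace \<Lambda>" for x
    using C[OF that] growth_ge_1[of \<Lambda> n x] mult_right_mono[of C "\<bar>C\<bar>" "growth \<Lambda> n x"] by linarith
  then show ?thesis using that[of "\<bar>C\<bar>" n] by auto
qed

lemma C0P_mult:
  assumes "C0P \<Lambda> f" "C0P \<Lambda> g" shows "C0P \<Lambda> (\<lambda>x. f x * g x)"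
proof -
  obtain C n where C: "0 \<le> C" "\<And>x. x \<in> cspace \<Lambda> \<Longrightarrow> \<bar>f x\<bar> \<le> C * growth \<Lambda> n x" using C0P_E[OF assms(1)] by blast
  obtain D m where D: "0 \<le> D" "\<And>x. x \<in> cspace \<Lambda> \<Longrightarrow> \<bar>g x\<bar> \<le> D * growth \<Lambda> m x" using C0P_E[OF assms(2)] by blast
  have "\<bar>f x * g x\<bar> \<le> (C * D) * growth \<Lambda> (n + m) x" if "x \<in> cspace \<Lambda>" for x
  proof -
    have "\<bar>f x\<bar> * \<bar>g x\<bar> \<le> (C * growth \<Lambda> n x) * (D * growth \<Lambda> m x)"
      using C D that growth_ge_1[of \<Lambda> n x] by (intro mult_mono) auto
    then show ?thesis by (simp add: abs_mult growth_mult[symmetric] mult_ac)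
  qed
  then show ?thesis using assms by (auto simp: C0P_def intro!: continuous_intros)
qed

lemma C0P_add:
  assumes "C0P \<Lambda> f" "C0P \<Lambda> g" shows "C0P \<Lambda> (\<lambda>x. f x + g x)"
proof -
  obtain C n where C: "0 \<le> C" "\<And>x. x \<in> cspace \<Lambda> \<Longrightarrow> \<bar>f x\<bar> \<le> C * growth \<Lambda> n x" using C0P_E[OF assms(1)] by blast
  obtain D m where D: "0 \<le> D" "\<And>x. x \<in> cspace \<Lambda> \<Longrightarrow> \<bar>g x\<bar> \<le> D * growth \<Lambda> m x" using C0P_E[OF assms(2)] by blast
  have "\<bar>f x + g x\<bar> \<le> (C + D) * growth \<Lambda> (max n m) x" if "x \<in> cspace \<Lambda>" for x
  proof -
    have "C * growth \<Lambda> n x \<le> C * growth \<Lambda> (max n m) x" "D * growth \<Lambda> m x \<le> D * growth \<Lambda> (max n m) x"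
      using C(1) D(1) by (auto intro!: mult_left_mono growth_mono_exp)
    then show ?thesis using C(2)[OF that] D(2)[OF that] unfolding distrib_right by linarith
  qed
  then show ?thesis using assms by (auto simp: C0P_def intro!: continuous_intros)
qed

lemma C0P_const: "C0P \<Lambda> (\<lambda>x. c)"
  unfolding C0P_def
proof (intro conjI exI ballI)
  show "\<bar>c\<bar> \<le> \<bar>c\<bar> * growth \<Lambda> 0 x" for x by (simp add: growth_def)
qed simp

lemma C0P_scale: "C0P \<Lambda> f \<Longrightarrow> C0P \<Lambda> (\<lambda>x. c * f x)"
  by (rule C0P_mult[OF C0P_const])

lemma C0P_sum: "(\<And>i. i \<in> I \<Longrightarrow> C0P \<Lambda> (f i)) \<Longrightarrow> C0P \<Lambda> (\<lambda>x. \<Sum>i\<in>I. f i x)"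
  by (induction I rule: infinite_finite_induct) (auto intro: C0P_const C0P_add)

lemma C0P_coord:
  assumes "finite \<Lambda>" "m \<in> \<Lambda>" shows "C0P \<Lambda> (\<lambda>x. x m)"
proof -
  have "\<bar>x m\<bar> \<le> 1 * growth \<Lambda> 1 x" for x :: "int \<times> int \<Rightarrow> real"
  proof -
    have "1 * (1 + \<bar>x m\<bar>) \<le> (\<Prod>k\<in>\<Lambda> - {m}. 1 + \<bar>x k\<bar>) * (1 + \<bar>x m\<bar>)"
      by (intro mult_right_mono prod_ge_1) auto
    also have "\<dots> = (\<Prod>k\<in>\<Lambda>. 1 + \<bar>x k\<bar>)" using prod.remove[OF assms, of "\<lambda>k. 1 + \<bar>x k\<bar>"] by (simp add: mult.commute)
    finally show ?thesis by (simp add: growth_def)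
  qed
  moreover have "continuous_on (cspace \<Lambda>) (\<lambda>x. x m)"
    by (rule continuous_on_subset[OF continuous_on_product_coordinates]) simp
  ultimately show ?thesis unfolding C0P_def by blast
qed

text \<open>Functions of different sets of modes are brought to one common larger set by composing
  them with restriction.\<close>

lemma C0P_extend:
  assumes h: "C0P \<Lambda> h" and sub: "\<Lambda> \<subseteq> \<Lambda>'" "finite \<Lambda>'"
  shows "C0P \<Lambda>' (\<lambda>x. h (restrict x \<Lambda>))"
proof -
  obtain C n where C: "0 \<le> C" "\<And>x. x \<in> cspace \<Lambda> \<Longrightarrow> \<bar>h x\<bar> \<le> C * growth \<Lambda> n x" using C0P_E[OF h] by blast
  have "\<bar>h (restrict x \<Lambda>)\<bar> \<le> C * growth \<Lambda>' n x" for x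
  proof -
    have "growth \<Lambda> n (restrict x \<Lambda>) = (\<Prod>k\<in>\<Lambda>. (1 + \<bar>x k\<bar>) ^ n)" by (simp add: growth_def)
    also have "\<dots> \<le> growth \<Lambda>' n x"
      unfolding growth_def using sub by (intro prod_mono2) (auto simp: one_le_power)
    finally have "C * growth \<Lambda> n (restrict x \<Lambda>) \<le> C * growth \<Lambda>' n x" using C(1) by (rule mult_left_mono)
    then show ?thesis by (rule order_trans[OF C(2), rotated]) simp
  qed
  moreover have "continuous_on (cspace \<Lambda>') (\<lambda>x. h (restrict x \<Lambda>))"
  proof (rule continuous_on_compose2[of "cspace \<Lambda>" h])
    show "continuous_on (cspace \<Lambda>) h" using h by (simp add: C0P_def)
    show "continuous_on (cspace \<Lambda>') (\<lambda>x. restrict x \<Lambda>)"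
    proof (rule continuous_on_coordinatewise_then_product)
      show "continuous_on (cspace \<Lambda>') (\<lambda>x. restrict x \<Lambda> i)" for i
        by (cases "i \<in> \<Lambda>") (auto simp: restrict_def intro: continuous_on_subset[OF continuous_on_product_coordinates])
    qed
  qed auto
  ultimately show ?thesis unfolding C0P_def by blast
qed

lemma C0P_integrable:
  assumes wn: "white_noise \<mu>" and \<Lambda>: "finite \<Lambda>" "\<Lambda> \<subseteq> Z20" and h: "C0P \<Lambda> h"
  shows "integrable \<mu> (\<lambda>\<omega>. h (coords \<Lambda> \<omega>))"
proof -
  obtain C n where C: "0 \<le> C" "\<And>x. x \<in> cspace \<Lambda> \<Longrightarrow> \<bar>h x\<bar> \<le> C * growth \<Lambda> n x" using C0P_E[OF h] by blast
  show ?thesis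
  proof (rule Bochner_Integration.integrable_bound)
    show "integrable \<mu> (\<lambda>\<omega>. C * growth \<Lambda> n (coords \<Lambda> \<omega>))" using growth_integrable[OF wn \<Lambda>] by simp
    show "(\<lambda>\<omega>. h (coords \<Lambda> \<omega>)) \<in> borel_measurable \<mu>"
      using h by (intro coords_measurable[OF wn \<Lambda>(2)]) (simp add: C0P_def)
    show "AE \<omega> in \<mu>. norm (h (coords \<Lambda> \<omega>)) \<le> norm (C * growth \<Lambda> n (coords \<Lambda> \<omega>))"
    proof (rule AE_I2)
      fix \<omega>
      have "coords \<Lambda> \<omega> \<in> cspace \<Lambda>" by (simp add: coords_def)
      from C(2)[OF this] show "norm (h (coords \<Lambda> \<omega>)) \<le> norm (C * growth \<Lambda> n (coords \<Lambda> \<omega>))"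
        by simp
    qed
  qed
qed

lemma C0P_L2:
  assumes wn: "white_noise \<mu>" and \<Lambda>: "finite \<Lambda>" "\<Lambda> \<subseteq> Z20" and h: "C0P \<Lambda> h"
  shows "L2_space \<mu> (\<lambda>\<omega>. h (coords \<Lambda> \<omega>))"
  using C0P_integrable[OF wn \<Lambda> C0P_mult[OF h h]] coords_measurable[OF wn \<Lambda>(2), of h] h
  by (simp add: L2_space_def C0P_def power2_eq_square)

text \<open>The derivatives are a parameter, so that sums and products carry explicit derivatives to
  which integration by parts applies directly.\<close>

definition C1P :: "(int \<times> int) set \<Rightarrow> ((int \<times> int \<Rightarrow> real) \<Rightarrow> real) \<Rightarrow>
    (int \<times> int \<Rightarrow> (int \<times> int \<Rightarrow> real) \<Rightarrow> real) \<Rightarrow> bool" where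
  "C1P \<Lambda> h h' \<longleftrightarrow> C0P \<Lambda> h \<and> (\<forall>j\<in>\<Lambda>. C0P \<Lambda> (h' j) \<and>
     (\<forall>x\<in>cspace \<Lambda>. ((\<lambda>t. h (x(j := t))) has_real_derivative h' j x) (at (x j))))"

lemma C1P_C0P: "C1P \<Lambda> h h' \<Longrightarrow> C0P \<Lambda> h"
  and C1P_deriv_C0P: "C1P \<Lambda> h h' \<Longrightarrow> j \<in> \<Lambda> \<Longrightarrow> C0P \<Lambda> (h' j)"
  by (auto simp: C1P_def)

lemma C1P_const: "C1P \<Lambda> (\<lambda>x. c) (\<lambda>j x. 0)"
  by (simp add: C1P_def C0P_const)

lemma C1P_coord:
  assumes "finite \<Lambda>" "m \<in> \<Lambda>" shows "C1P \<Lambda> (\<lambda>x. x m) (\<lambda>j x. if j = m then 1 else 0)"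
  unfolding C1P_def
proof (intro conjI ballI)
  fix j and x :: "int \<times> int \<Rightarrow> real"
  show "((\<lambda>t. (x(j := t)) m) has_real_derivative (if j = m then 1 else 0)) (at (x j))" by simp
qed (auto intro: C0P_coord[OF assms] C0P_const)

lemma C1P_add:
  assumes "C1P \<Lambda> f f'" "C1P \<Lambda> g g'"
  shows "C1P \<Lambda> (\<lambda>x. f x + g x) (\<lambda>j x. f' j x + g' j x)"
  using assms by (auto simp: C1P_def intro!: C0P_add DERIV_add)

lemma C1P_mult:
  assumes f: "C1P \<Lambda> f f'" and g: "C1P \<Lambda> g g'"
  shows "C1P \<Lambda> (\<lambda>x. f x * g x) (\<lambda>j x. f' j x * g x + g' j x * f x)"
  unfolding C1P_def
proof (intro conjI ballI)
  fix j x assume j: "j \<in> \<Lambda>" and x: "x \<in> cspace \<Lambda>"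
  have "((\<lambda>t. f (x(j := t)) * g (x(j := t))) has_real_derivative
      f' j x * g (x(j := x j)) + g' j x * f (x(j := x j))) (at (x j))"
    using f g j x by (intro DERIV_mult) (auto simp: C1P_def)
  then show "((\<lambda>t. f (x(j := t)) * g (x(j := t))) has_real_derivative f' j x * g x + g' j x * f x) (at (x j))"
    by simp
qed (use f g in \<open>auto simp: C1P_def intro!: C0P_add C0P_mult\<close>)

lemma C1P_scale: "C1P \<Lambda> f f' \<Longrightarrow> C1P \<Lambda> (\<lambda>x. c * f x) (\<lambda>j x. c * f' j x)"
  using C1P_mult[OF C1P_const, of \<Lambda> f f' c] by (simp add: mult.commute)

lemma C1P_sum:
  "(\<And>i. i \<in> I \<Longrightarrow> C1P \<Lambda> (f i) (f' i)) \<Longrightarrow> C1P \<Lambda> (\<lambda>x. \<Sum>i\<in>I. f i x) (\<lambda>j x. \<Sum>i\<in>I. f' i j x)"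
  by (induction I rule: infinite_finite_induct) (auto intro: C1P_const C1P_add)

lemma C1P_extend:
  assumes h: "C1P \<Lambda> h h'" and sub: "\<Lambda> \<subseteq> \<Lambda>'" "finite \<Lambda>'"
  shows "C1P \<Lambda>' (\<lambda>x. h (restrict x \<Lambda>)) (\<lambda>j x. if j \<in> \<Lambda> then h' j (restrict x \<Lambda>) else 0)"
  unfolding C1P_def
proof (intro conjI ballI)
  show "C0P \<Lambda>' (\<lambda>x. h (restrict x \<Lambda>))" by (rule C0P_extend[OF C1P_C0P[OF h] sub])
  fix j assume "j \<in> \<Lambda>'"
  show "C0P \<Lambda>' (\<lambda>x. if j \<in> \<Lambda> then h' j (restrict x \<Lambda>) else 0)"
    using C0P_extend[OF C1P_deriv_C0P[OF h] sub] by (cases "j \<in> \<Lambda>") (auto intro: C0P_const)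
  fix x assume "x \<in> cspace \<Lambda>'"
  show "((\<lambda>t. h (restrict (x(j := t)) \<Lambda>)) has_real_derivative (if j \<in> \<Lambda> then h' j (restrict x \<Lambda>) else 0)) (at (x j))"
  proof (cases "j \<in> \<Lambda>")
    case True
    have "restrict (x(j := t)) \<Lambda> = (restrict x \<Lambda>)(j := t)" for t using True by (auto simp: restrict_def)
    moreover have all: "\<forall>y\<in>cspace \<Lambda>. ((\<lambda>t. h (y(j := t))) has_real_derivative h' j y) (at (y j))"
      using h True by (simp add: C1P_def)
    have "((\<lambda>t. h ((restrict x \<Lambda>)(j := t))) has_real_derivative h' j (restrict x \<Lambda>)) (at (restrict x \<Lambda> j))"
      by (rule bspec[OF all]) simp
    ultimately show ?thesis using True by simp
  next
    case False
    have "restrict (x(j := t)) \<Lambda> = restrict x \<Lambda>" for t using False by (auto simp: restrict_def)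
    then show ?thesis using False by simp
  qed
qed

text \<open>Compares the Euclidean growth in \<open>smooth_poly_growth\<close> with the product
  weight \<open>growth\<close>.\<close>

lemma one_plus_sum_le_prod:
  fixes a :: "'b \<Rightarrow> real"
  assumes "\<And>i. 0 \<le> a i" shows "1 + sum a I \<le> (\<Prod>i\<in>I. 1 + a i)"
proof (induction I rule: infinite_finite_induct)
  case (insert i I)
  have "1 + (a i + sum a I) \<le> (1 + a i) * (1 + sum a I)"
    using assms[of i] sum_nonneg[of I a] assms by (simp add: algebra_simps)
  also have "\<dots> \<le> (1 + a i) * (\<Prod>i\<in>I. 1 + a i)"
    using insert.IH assms[of i] by (intro mult_left_mono) auto
  finally show ?case using insert by simp
qed auto

lemma smooth_C1P:
  assumes f: "smooth_poly_growth \<Lambda> f" and js: "js \<in> lists \<Lambda>" and \<Lambda>: "finite \<Lambda>"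
  shows "C1P \<Lambda> (iter_partial js f) (\<lambda>j. partial_deriv j (iter_partial js f))"
proof -
  have C0: "C0P \<Lambda> (iter_partial js f)" if js: "js \<in> lists \<Lambda>" for js
  proof -
    obtain C n where C: "\<forall>x\<in>cspace \<Lambda>. \<bar>iter_partial js f x\<bar> \<le> C * (1 + L2_set x \<Lambda>) ^ n"
      using f js unfolding smooth_poly_growth_def by blast
    have "\<bar>iter_partial js f x\<bar> \<le> \<bar>C\<bar> * growth \<Lambda> n x" if "x \<in> cspace \<Lambda>" for x
    proof -
      have "1 + L2_set x \<Lambda> \<le> (\<Prod>k\<in>\<Lambda>. 1 + \<bar>x k\<bar>)"
      proof -
        have "L2_set x \<Lambda> \<le> (\<Sum>k\<in>\<Lambda>. \<bar>x k\<bar>)" by (rule L2_set_le_sum_abs)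
        moreover have "1 + (\<Sum>k\<in>\<Lambda>. \<bar>x k\<bar>) \<le> (\<Prod>k\<in>\<Lambda>. 1 + \<bar>x k\<bar>)" by (rule one_plus_sum_le_prod) simp
        ultimately show ?thesis by linarith
      qed
      then have "(1 + L2_set x \<Lambda>) ^ n \<le> growth \<Lambda> n x"
        unfolding growth_def prod_power_distrib[symmetric] by (intro power_mono) auto
      moreover have "C * (1 + L2_set x \<Lambda>) ^ n \<le> \<bar>C\<bar> * (1 + L2_set x \<Lambda>) ^ n"
        by (intro mult_right_mono) auto
      moreover have "\<bar>iter_partial js f x\<bar> \<le> C * (1 + L2_set x \<Lambda>) ^ n" using C that by blast
      ultimately show ?thesis by (smt (verit) mult_left_mono abs_ge_zero)
    qed
    moreover have "continuous_on (cspace \<Lambda>) (iter_partial js f)"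
      using f js unfolding smooth_poly_growth_def by blast
    ultimately show ?thesis unfolding C0P_def by blast
  qed
  have "C0P \<Lambda> (partial_deriv j (iter_partial js f))" if "j \<in> \<Lambda>" for j
    using C0[of "j # js"] js that by simp
  moreover have "((\<lambda>t. iter_partial js f (x(j := t))) has_real_derivative partial_deriv j (iter_partial js f) x) (at (x j))"
    if "j \<in> \<Lambda>" "x \<in> cspace \<Lambda>" for j x
  proof -
    have "(\<lambda>t. iter_partial js f (x(j := t))) field_differentiable (at (x j))"
      using f js that unfolding smooth_poly_growth_def by blast
    then show ?thesis unfolding partial_deriv_def by (simp add: DERIV_deriv_iff_field_differentiable)
  qed
  ultimately show ?thesis using C0[OF js] unfolding C1P_def by blast
qed

lemma expectation_PiM:
  assumes wn: "white_noise \<mu>" and \<Lambda>: "\<Lambda> \<subseteq> Z20" "\<Lambda> \<noteq> {}" and h: "C0P \<Lambda> h"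
  shows "(LINT \<omega>|\<mu>. h (coords \<Lambda> \<omega>)) = (LINT x|Pi\<^sub>M \<Lambda> (\<lambda>_. gauss). h x)"
    and "finite \<Lambda> \<Longrightarrow> integrable (Pi\<^sub>M \<Lambda> (\<lambda>_. gauss)) h"
proof -
  have m: "h \<in> borel_measurable (Pi\<^sub>M \<Lambda> (\<lambda>_. borel))" using h by (intro continuous_PiM_measurable) (simp add: C0P_def)
  note cm = coords_measurable_PiM[OF wn \<Lambda>(1)]
  show "(LINT \<omega>|\<mu>. h (coords \<Lambda> \<omega>)) = (LINT x|Pi\<^sub>M \<Lambda> (\<lambda>_. gauss). h x)"
    unfolding coords_distr[OF wn \<Lambda>, symmetric] by (rule integral_distr[OF cm m, symmetric])
  assume "finite \<Lambda>"
  then show "integrable (Pi\<^sub>M \<Lambda> (\<lambda>_. gauss)) h"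
    unfolding coords_distr[OF wn \<Lambda>, symmetric] integrable_distr_eq[OF cm m]
    by (rule C0P_integrable[OF wn _ \<Lambda>(1) h])
qed

text \<open>The coordinates are independent, so Fubini reduces the claim to \<open>gauss_ibp\<close>
  in coordinate j with the other coordinates frozen.\<close>

lemma gaussian_ibp:
  assumes wn: "white_noise \<mu>" and \<Lambda>: "finite \<Lambda>" "\<Lambda> \<subseteq> Z20" and h: "C1P \<Lambda> h h'" and j: "j \<in> \<Lambda>"
  shows "(LINT \<omega>|\<mu>. h' j (coords \<Lambda> \<omega>)) = (LINT \<omega>|\<mu>. coords \<Lambda> \<omega> j * h (coords \<Lambda> \<omega>))"
proof -
  let ?I = "\<Lambda> - {j}"
  have ins: "insert j ?I = \<Lambda>" and ne: "\<Lambda> \<noteq> {}" using j by auto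
  interpret g: prob_space gauss by (rule gauss_prob)
  interpret product_sigma_finite "\<lambda>_. gauss" by (unfold_locales)
  note hC = C1P_C0P[OF h] and h'C = C1P_deriv_C0P[OF h j]
  have xhC: "C0P \<Lambda> (\<lambda>x. x j * h x)" by (rule C0P_mult[OF C0P_coord[OF \<Lambda>(1) j] hC])
  have fub: "(LINT \<omega>|\<mu>. g (coords \<Lambda> \<omega>)) = (LINT x|Pi\<^sub>M ?I (\<lambda>_. gauss). LINT t|gauss. g (x(j := t)))"
    if "C0P \<Lambda> g" for g
  proof -
    have "integrable (Pi\<^sub>M (insert j ?I) (\<lambda>_. gauss)) g"
      unfolding ins by (rule expectation_PiM(2)[OF wn \<Lambda>(2) ne that \<Lambda>(1)])
    from product_integral_insert[OF _ _ this] \<Lambda>(1) show ?thesis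
      unfolding expectation_PiM(1)[OF wn \<Lambda>(2) ne that] ins by simp
  qed
  obtain C n where C: "0 \<le> C" "\<And>x. x \<in> cspace \<Lambda> \<Longrightarrow> \<bar>h x\<bar> \<le> C * growth \<Lambda> n x" using C0P_E[OF hC] by blast
  obtain C' n' where C': "0 \<le> C'" "\<And>x. x \<in> cspace \<Lambda> \<Longrightarrow> \<bar>h' j x\<bar> \<le> C' * growth \<Lambda> n' x" using C0P_E[OF h'C] by blast
  have gr: "growth \<Lambda> n (x(j := t)) = growth ?I n x * (1 + \<bar>t\<bar>) ^ n" for n x t
  proof -
    have "growth \<Lambda> n (x(j := t)) = (1 + \<bar>t\<bar>) ^ n * (\<Prod>k\<in>?I. (1 + \<bar>(x(j := t)) k\<bar>) ^ n)"
      unfolding growth_def using prod.remove[OF \<Lambda>(1) j, of "\<lambda>k. (1 + \<bar>(x(j := t)) k\<bar>) ^ n"] by simp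
    also have "(\<Prod>k\<in>?I. (1 + \<bar>(x(j := t)) k\<bar>) ^ n) = growth ?I n x"
      unfolding growth_def by (intro prod.cong) auto
    finally show ?thesis by (simp only: mult.commute)
  qed
  have all: "\<forall>y\<in>cspace \<Lambda>. ((\<lambda>t. h (y(j := t))) has_real_derivative h' j y) (at (y j))"
    using h j by (simp add: C1P_def)
  have inner: "(LINT t|gauss. h' j (x(j := t))) = (LINT t|gauss. t * h (x(j := t)))" if x: "x \<in> cspace ?I" for x
  proof (rule gauss_ibp)
    have xj: "x(j := t) \<in> cspace \<Lambda>" for t using x j by (auto simp: PiE_def extensional_def)
    show "((\<lambda>t. h (x(j := t))) has_real_derivative h' j (x(j := t))) (at t)" for t
      using bspec[OF all xj[of t]] by simp
    show "continuous_on UNIV (\<lambda>t. h' j (x(j := t)))"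
    proof (rule continuous_on_compose2[of "cspace \<Lambda>" "h' j"])
      show "continuous_on (cspace \<Lambda>) (h' j)" using h'C by (simp add: C0P_def)
      show "continuous_on UNIV (\<lambda>t. x(j := t))"
      proof (rule continuous_on_coordinatewise_then_product)
        show "continuous_on UNIV (\<lambda>t. (x(j := t)) i)" for i by (cases "i = j") auto
      qed
    qed (use xj in auto)
    show "\<bar>h (x(j := t))\<bar> \<le> (C * growth ?I n x) * (1 + \<bar>t\<bar>) ^ n" for t
      using C(2)[OF xj[of t]] by (simp add: gr mult.assoc)
    show "\<bar>h' j (x(j := t))\<bar> \<le> (C' * growth ?I n' x) * (1 + \<bar>t\<bar>) ^ n'" for t
      using C'(2)[OF xj[of t]] by (simp add: gr mult.assoc)
  qed
  have "(LINT \<omega>|\<mu>. h' j (coords \<Lambda> \<omega>)) = (LINT x|Pi\<^sub>M ?I (\<lambda>_. gauss). LINT t|gauss. h' j (x(j := t)))"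
    by (rule fub[OF h'C])
  also have "\<dots> = (LINT x|Pi\<^sub>M ?I (\<lambda>_. gauss). LINT t|gauss. (x(j := t)) j * h (x(j := t)))"
  proof (rule Bochner_Integration.integral_cong[OF refl])
    fix x assume "x \<in> space (Pi\<^sub>M ?I (\<lambda>_. gauss))"
    then have "x \<in> cspace ?I" by (simp add: space_PiM space_gauss)
    then show "(LINT t|gauss. h' j (x(j := t))) = (LINT t|gauss. (x(j := t)) j * h (x(j := t)))"
      unfolding fun_upd_same by (rule inner)
  qed
  also have "\<dots> = (LINT \<omega>|\<mu>. coords \<Lambda> \<omega> j * h (coords \<Lambda> \<omega>))"
    by (rule fub[OF xhC, symmetric])
  finally show ?thesis .
qed

lemma coords_restrict: "\<Lambda> \<subseteq> \<Lambda>' \<Longrightarrow> restrict (coords \<Lambda>' \<omega>) \<Lambda> = coords \<Lambda> \<omega>"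
  by (auto simp: coords_def restrict_def fun_eq_iff)

lemma coords_apply: "j \<in> \<Lambda> \<Longrightarrow> coords \<Lambda> \<omega> j = \<omega> (efun j)"
  by (simp add: coords_def)

text \<open>A vector field that is divergence free and orthogonal to the radial direction preserves the
  Gaussian measure, hence is an antisymmetric operator.\<close>

lemma vector_field_antisym:
  assumes wn: "white_noise \<mu>" and \<Lambda>: "finite \<Lambda>" "\<Lambda> \<subseteq> Z20"
    and f: "C1P \<Lambda> f f'" and g: "C1P \<Lambda> g g'" and a: "\<And>j. j \<in> \<Lambda> \<Longrightarrow> C1P \<Lambda> (a j) (a' j)"
    and radial: "\<And>x. x \<in> cspace \<Lambda> \<Longrightarrow> (\<Sum>j\<in>\<Lambda>. x j * a j x) = 0"
    and divfree: "\<And>x. x \<in> cspace \<Lambda> \<Longrightarrow> (\<Sum>j\<in>\<Lambda>. a' j j x) = 0"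
  shows "(LINT \<omega>|\<mu>. (\<Sum>j\<in>\<Lambda>. f' j (coords \<Lambda> \<omega>) * a j (coords \<Lambda> \<omega>)) * g (coords \<Lambda> \<omega>)) =
    - (LINT \<omega>|\<mu>. f (coords \<Lambda> \<omega>) * (\<Sum>j\<in>\<Lambda>. g' j (coords \<Lambda> \<omega>) * a j (coords \<Lambda> \<omega>)))"
proof -
  let ?c = "coords \<Lambda>"
  have cs: "?c \<omega> \<in> cspace \<Lambda>" for \<omega> by (simp add: coords_def)
  note I = C0P_integrable[OF wn \<Lambda>]
  note fC = C1P_C0P[OF f] and gC = C1P_C0P[OF g] and aC = C1P_C0P[OF a]
  note f'C = C1P_deriv_C0P[OF f] and g'C = C1P_deriv_C0P[OF g]
  have i1: "C0P \<Lambda> (\<lambda>x. f' j x * a j x * g x)" and i2: "C0P \<Lambda> (\<lambda>x. f x * (g' j x * a j x))"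
    and i3: "C0P \<Lambda> (\<lambda>x. a' j j x * (f x * g x))" and i4: "C0P \<Lambda> (\<lambda>x. x j * ((f x * g x) * a j x))"
    if "j \<in> \<Lambda>" for j
    using that by (auto intro!: C0P_mult fC gC aC f'C g'C C0P_coord \<Lambda>(1) C1P_deriv_C0P[OF a])
  \<comment> \<open>Integration by parts of f g a_j in coordinate j. After summation over j the
    third integral vanishes by \<open>divfree\<close> and the right-hand side by
    \<open>radial\<close>.\<close>
  have each: "(LINT \<omega>|\<mu>. f' j (?c \<omega>) * a j (?c \<omega>) * g (?c \<omega>)) + (LINT \<omega>|\<mu>. f (?c \<omega>) * (g' j (?c \<omega>) * a j (?c \<omega>)))
      + (LINT \<omega>|\<mu>. a' j j (?c \<omega>) * (f (?c \<omega>) * g (?c \<omega>))) = (LINT \<omega>|\<mu>. ?c \<omega> j * ((f (?c \<omega>) * g (?c \<omega>)) * a j (?c \<omega>)))"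
    if j: "j \<in> \<Lambda>" for j
  proof -
    have "(LINT \<omega>|\<mu>. (f' j (?c \<omega>) * g (?c \<omega>) + g' j (?c \<omega>) * f (?c \<omega>)) * a j (?c \<omega>) + a' j j (?c \<omega>) * (f (?c \<omega>) * g (?c \<omega>)))
      = (LINT \<omega>|\<mu>. ?c \<omega> j * ((f (?c \<omega>) * g (?c \<omega>)) * a j (?c \<omega>)))"
      by (rule gaussian_ibp[OF wn \<Lambda> C1P_mult[OF C1P_mult[OF f g] a[OF j]] j])
    moreover have "(LINT \<omega>|\<mu>. (f' j (?c \<omega>) * g (?c \<omega>) + g' j (?c \<omega>) * f (?c \<omega>)) * a j (?c \<omega>) + a' j j (?c \<omega>) * (f (?c \<omega>) * g (?c \<omega>)))
      = (LINT \<omega>|\<mu>. f' j (?c \<omega>) * a j (?c \<omega>) * g (?c \<omega>) + f (?c \<omega>) * (g' j (?c \<omega>) * a j (?c \<omega>)) + a' j j (?c \<omega>) * (f (?c \<omega>) * g (?c \<omega>)))"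
      by (intro Bochner_Integration.integral_cong refl) (simp add: algebra_simps)
    ultimately show ?thesis using I[OF i1[OF j]] I[OF i2[OF j]] I[OF i3[OF j]] by simp
  qed
  have s1: "(LINT \<omega>|\<mu>. (\<Sum>j\<in>\<Lambda>. f' j (?c \<omega>) * a j (?c \<omega>)) * g (?c \<omega>)) = (\<Sum>j\<in>\<Lambda>. LINT \<omega>|\<mu>. f' j (?c \<omega>) * a j (?c \<omega>) * g (?c \<omega>))"
    unfolding sum_distrib_right by (rule Bochner_Integration.integral_sum) (rule I[OF i1])
  have s2: "(LINT \<omega>|\<mu>. f (?c \<omega>) * (\<Sum>j\<in>\<Lambda>. g' j (?c \<omega>) * a j (?c \<omega>))) = (\<Sum>j\<in>\<Lambda>. LINT \<omega>|\<mu>. f (?c \<omega>) * (g' j (?c \<omega>) * a j (?c \<omega>)))"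
    unfolding sum_distrib_left by (rule Bochner_Integration.integral_sum) (rule I[OF i2])
  have s3: "(\<Sum>j\<in>\<Lambda>. LINT \<omega>|\<mu>. a' j j (?c \<omega>) * (f (?c \<omega>) * g (?c \<omega>))) = 0"
  proof -
    have "(\<Sum>j\<in>\<Lambda>. LINT \<omega>|\<mu>. a' j j (?c \<omega>) * (f (?c \<omega>) * g (?c \<omega>))) = (LINT \<omega>|\<mu>. (\<Sum>j\<in>\<Lambda>. a' j j (?c \<omega>) * (f (?c \<omega>) * g (?c \<omega>))))"
      by (rule Bochner_Integration.integral_sum[symmetric]) (rule I[OF i3])
    also have "\<dots> = 0" unfolding sum_distrib_right[symmetric] by (simp add: divfree[OF cs])
    finally show ?thesis .
  qed
  have s4: "(\<Sum>j\<in>\<Lambda>. LINT \<omega>|\<mu>. ?c \<omega> j * ((f (?c \<omega>) * g (?c \<omega>)) * a j (?c \<omega>))) = 0"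
  proof -
    have "(\<Sum>j\<in>\<Lambda>. LINT \<omega>|\<mu>. ?c \<omega> j * ((f (?c \<omega>) * g (?c \<omega>)) * a j (?c \<omega>))) = (LINT \<omega>|\<mu>. (\<Sum>j\<in>\<Lambda>. ?c \<omega> j * ((f (?c \<omega>) * g (?c \<omega>)) * a j (?c \<omega>))))"
      by (rule Bochner_Integration.integral_sum[symmetric]) (rule I[OF i4])
    also have "\<dots> = (LINT \<omega>|\<mu>. (f (?c \<omega>) * g (?c \<omega>)) * (\<Sum>j\<in>\<Lambda>. ?c \<omega> j * a j (?c \<omega>)))"
      by (intro Bochner_Integration.integral_cong refl) (simp add: sum_distrib_left mult_ac)
    also have "\<dots> = 0" by (simp add: radial[OF cs])
    finally show ?thesis .
  qed
  have "(\<Sum>j\<in>\<Lambda>. (LINT \<omega>|\<mu>. f' j (?c \<omega>) * a j (?c \<omega>) * g (?c \<omega>)) + (LINT \<omega>|\<mu>. f (?c \<omega>) * (g' j (?c \<omega>) * a j (?c \<omega>)))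
      + (LINT \<omega>|\<mu>. a' j j (?c \<omega>) * (f (?c \<omega>) * g (?c \<omega>)))) = (\<Sum>j\<in>\<Lambda>. LINT \<omega>|\<mu>. ?c \<omega> j * ((f (?c \<omega>) * g (?c \<omega>)) * a j (?c \<omega>)))"
    by (intro sum.cong refl each)
  then show ?thesis unfolding s1 s2 sum.distrib s3 s4 by simp
qed

section \<open>Antisymmetry on cylindrical functions\<close>

lemma FCP_D: "FCP \<Lambda> f \<Longrightarrow> finite \<Lambda>" "FCP \<Lambda> f \<Longrightarrow> \<Lambda> \<subseteq> Z20"
    "FCP \<Lambda> f \<Longrightarrow> C1P \<Lambda> f (\<lambda>j. partial_deriv j f)"
    "FCP \<Lambda> f \<Longrightarrow> j \<in> \<Lambda> \<Longrightarrow> C1P \<Lambda> (partial_deriv j f) (\<lambda>i. partial_deriv i (partial_deriv j f))"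
  using smooth_C1P[of \<Lambda> f "[]"] smooth_C1P[of \<Lambda> f "[j]"] by (auto simp: FCP_def)

lemma cyl_coords: "\<Lambda> \<subseteq> \<Lambda>' \<Longrightarrow> cyl \<Lambda> f \<omega> = f (restrict (coords \<Lambda>' \<omega>) \<Lambda>)"
  by (simp add: cyl_def coords_restrict)

lemma cyl_L2:
  assumes "white_noise \<mu>" "FCP \<Lambda> f" shows "L2_space \<mu> (cyl \<Lambda> f)"
  using C0P_L2[OF assms(1) FCP_D(1,2)[OF assms(2)] C1P_C0P[OF FCP_D(3)[OF assms(2)]]]
  by (simp add: cyl_def[abs_def])

text \<open>The vector field of an operator involves more modes than f depends on; in the additional
  modes the derivative of f is 0.\<close>

definition pd_ext :: "(int \<times> int) set \<Rightarrow> ((int \<times> int \<Rightarrow> real) \<Rightarrow> real) \<Rightarrow> int \<times> int \<Rightarrow> (int \<times> int \<Rightarrow> real) \<Rightarrow> real" where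
  "pd_ext \<Lambda> f j x = (if j \<in> \<Lambda> then partial_deriv j f (restrict x \<Lambda>) else 0)"

lemma C1P_pd_ext:
  assumes "FCP \<Lambda> f" "\<Lambda> \<subseteq> \<Lambda>'" "finite \<Lambda>'"
  shows "C1P \<Lambda>' (\<lambda>x. f (restrict x \<Lambda>)) (pd_ext \<Lambda> f)"
  using C1P_extend[OF FCP_D(3)[OF assms(1)] assms(2,3)] by (simp add: pd_ext_def[abs_def])

lemma sum_pd_ext:
  assumes "finite \<Lambda>'" "\<Lambda> \<subseteq> \<Lambda>'" and "\<And>j. j \<in> \<Lambda> \<Longrightarrow> b j = a j"
  shows "(\<Sum>j\<in>\<Lambda>. partial_deriv j f (coords \<Lambda> \<omega>) * b j) = (\<Sum>j\<in>\<Lambda>'. pd_ext \<Lambda> f j (coords \<Lambda>' \<omega>) * a j)"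
proof -
  have "(\<Sum>j\<in>\<Lambda>'. pd_ext \<Lambda> f j (coords \<Lambda>' \<omega>) * a j) = (\<Sum>j\<in>\<Lambda>. pd_ext \<Lambda> f j (coords \<Lambda>' \<omega>) * a j)"
    using assms by (intro sum.mono_neutral_right) (auto simp: pd_ext_def)
  also have "\<dots> = (\<Sum>j\<in>\<Lambda>. partial_deriv j f (coords \<Lambda> \<omega>) * b j)"
    using assms by (intro sum.cong refl) (simp add: pd_ext_def coords_restrict)
  finally show ?thesis ..
qed

text \<open>By \<open>nb\<close> the larger set contains every mode reached from \<Lambda> by
  transport with \<sigma>_k, so the sum over neighbours may be taken over the whole set.\<close>

lemma sigma_grad_rep:
  assumes \<omega>: "\<omega> \<in> Hm1m" and \<Lambda>: "\<Lambda> \<subseteq> \<Lambda>'" "finite \<Lambda>'" "\<Lambda>' \<subseteq> Z20"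
    and nb: "\<And>j. j \<in> \<Lambda> \<Longrightarrow> nbr k j \<subseteq> \<Lambda>'"
  shows "sigma_grad \<gamma> k \<omega> (D_cyl \<Lambda> f \<omega>) =
    - (\<Sum>j\<in>\<Lambda>'. pd_ext \<Lambda> f j (coords \<Lambda>' \<omega>) * (\<Sum>m\<in>\<Lambda>'. sigma_coeff \<gamma> k j m * coords \<Lambda>' \<omega> m))"
proof -
  have "(\<Sum>m\<in>nbr k j. sigma_coeff \<gamma> k j m * \<omega> (efun m)) = (\<Sum>m\<in>\<Lambda>'. sigma_coeff \<gamma> k j m * coords \<Lambda>' \<omega> m)"
    if j: "j \<in> \<Lambda>" for j
  proof -
    have "(\<Sum>m\<in>\<Lambda>'. sigma_coeff \<gamma> k j m * coords \<Lambda>' \<omega> m) = (\<Sum>m\<in>nbr k j. sigma_coeff \<gamma> k j m * coords \<Lambda>' \<omega> m)"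
    proof (rule sum.mono_neutral_right[OF \<Lambda>(2) nb[OF j]], rule ballI)
      fix m assume "m \<in> \<Lambda>' - nbr k j"
      then have "sigma_coeff \<gamma> k j m = 0" using \<Lambda>(3) by (intro sigma_coeff_zero) auto
      then show "sigma_coeff \<gamma> k j m * coords \<Lambda>' \<omega> m = 0" by simp
    qed
    also have "\<dots> = (\<Sum>m\<in>nbr k j. sigma_coeff \<gamma> k j m * \<omega> (efun m))"
      using nb[OF j] by (intro sum.cong refl) (auto simp: coords_apply)
    finally show ?thesis ..
  qed
  from sum_pd_ext[OF \<Lambda>(2,1), where b = "\<lambda>j. \<Sum>m\<in>nbr k j. sigma_coeff \<gamma> k j m * \<omega> (efun m)", OF this]
  show ?thesis unfolding sigma_grad_D_cyl[OF \<omega> order_trans[OF \<Lambda>(1,3)]] by simp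
qed

lemma sigma_square_exists:
  assumes "FCP \<Lambda> f" "FCP \<Lambda>' g"
  shows "\<exists>N. \<Lambda> \<subseteq> square N \<and> \<Lambda>' \<subseteq> square N \<and> (\<forall>j\<in>\<Lambda> \<union> \<Lambda>'. nbr k j \<subseteq> square N)"
proof -
  let ?U = "\<Lambda> \<union> \<Lambda>' \<union> (\<Union>j\<in>\<Lambda> \<union> \<Lambda>'. nbr k j)"
  have "finite ?U" using FCP_D(1)[OF assms(1)] FCP_D(1)[OF assms(2)] nbr_finite by auto
  moreover have "?U \<subseteq> Z20" by (intro Un_least UN_least nbr_Z20 FCP_D(2)[OF assms(1)] FCP_D(2)[OF assms(2)])
  ultimately obtain N where N: "?U \<subseteq> square N" by (rule finite_subset_square[THEN exE])
  then have "\<Lambda> \<subseteq> square N" "\<Lambda>' \<subseteq> square N" "\<forall>j\<in>\<Lambda> \<union> \<Lambda>'. nbr k j \<subseteq> square N"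
    unfolding Un_subset_iff UN_subset_iff by simp_all
  then show ?thesis by (intro exI conjI)
qed

lemma sigma_grad_L2:
  assumes wn: "white_noise \<mu>" and f: "FCP \<Lambda> f"
  shows "L2_space \<mu> (\<lambda>\<omega>. sigma_grad \<gamma> k \<omega> (D_cyl \<Lambda> f \<omega>))"
proof -
  obtain N where N: "\<Lambda> \<subseteq> square N" "\<forall>j\<in>\<Lambda>. nbr k j \<subseteq> square N" using sigma_square_exists[OF f f] by blast
  let ?S = "square N"
  define h where "h x = - (\<Sum>j\<in>?S. pd_ext \<Lambda> f j x * (\<Sum>m\<in>?S. sigma_coeff \<gamma> k j m * x m))" for x :: "int \<times> int \<Rightarrow> real"
  have "C0P ?S (\<lambda>x. (-1) * (\<Sum>j\<in>?S. pd_ext \<Lambda> f j x * (\<Sum>m\<in>?S. sigma_coeff \<gamma> k j m * x m)))"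
    by (intro C0P_scale C0P_sum C0P_mult C0P_coord square_finite C1P_deriv_C0P[OF C1P_pd_ext[OF f N(1) square_finite]])
  then have "C0P ?S h" by (simp add: h_def[abs_def])
  from C0P_L2[OF wn square_finite square_Z20 this]
  have L2: "L2_space \<mu> (\<lambda>\<omega>. h (coords ?S \<omega>))" .
  have eq: "sigma_grad \<gamma> k \<omega> (D_cyl \<Lambda> f \<omega>) = h (coords ?S \<omega>)" if "\<omega> \<in> space \<mu>" for \<omega>
    using that sigma_grad_rep[OF _ N(1) square_finite square_Z20, of \<omega> k \<gamma> f] N(2) white_noiseD(2)[OF wn] by (simp add: h_def)
  show ?thesis using L2 unfolding L2_space_def
    using measurable_cong[of \<mu> "\<lambda>\<omega>. sigma_grad \<gamma> k \<omega> (D_cyl \<Lambda> f \<omega>)" "\<lambda>\<omega>. h (coords ?S \<omega>)" borel]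
      Bochner_Integration.integrable_cong[of \<mu> \<mu> "\<lambda>\<omega>. (sigma_grad \<gamma> k \<omega> (D_cyl \<Lambda> f \<omega>))\<^sup>2" "\<lambda>\<omega>. (h (coords ?S \<omega>))\<^sup>2"] eq
    by simp
qed

text \<open>In coordinates the vector field is linear with an antisymmetric matrix: it is orthogonal
  to x, and its divergence is the trace, which is 0.\<close>

lemma sigma_grad_antisym:
  assumes wn: "white_noise \<mu>" and f: "FCP \<Lambda> f" and g: "FCP \<Lambda>' g" and k: "k \<in> Z20"
  shows "(LINT \<omega>|\<mu>. sigma_grad \<gamma> k \<omega> (D_cyl \<Lambda> f \<omega>) * cyl \<Lambda>' g \<omega>) =
    - (LINT \<omega>|\<mu>. cyl \<Lambda> f \<omega> * sigma_grad \<gamma> k \<omega> (D_cyl \<Lambda>' g \<omega>))"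
proof -
  obtain N where N: "\<Lambda> \<subseteq> square N" "\<Lambda>' \<subseteq> square N" "\<forall>j\<in>\<Lambda> \<union> \<Lambda>'. nbr k j \<subseteq> square N"
    using sigma_square_exists[OF f g] by blast
  let ?S = "square N"
  define a where "a j x = (\<Sum>m\<in>?S. sigma_coeff \<gamma> k j m * x m)" for j and x :: "int \<times> int \<Rightarrow> real"
  define a' where "a' j i x = (\<Sum>m\<in>?S. sigma_coeff \<gamma> k j m * (if i = m then 1 else 0))" for j i and x :: "int \<times> int \<Rightarrow> real"
  have sZ: "j \<in> Z20" if "j \<in> ?S" for j using square_Z20 that by blast
  have "(LINT \<omega>|\<mu>. (\<Sum>j\<in>?S. pd_ext \<Lambda> f j (coords ?S \<omega>) * a j (coords ?S \<omega>)) * g (restrict (coords ?S \<omega>) \<Lambda>')) =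
    - (LINT \<omega>|\<mu>. f (restrict (coords ?S \<omega>) \<Lambda>) * (\<Sum>j\<in>?S. pd_ext \<Lambda>' g j (coords ?S \<omega>) * a j (coords ?S \<omega>)))"
  proof (rule vector_field_antisym[OF wn square_finite square_Z20 C1P_pd_ext[OF f N(1) square_finite] C1P_pd_ext[OF g N(2) square_finite]])
    show "C1P ?S (a j) (a' j)" for j
      unfolding a_def a'_def by (intro C1P_sum C1P_scale C1P_coord square_finite)
    show "(\<Sum>j\<in>?S. x j * a j x) = 0" for x
    proof -
      have "(\<Sum>j\<in>?S. x j * a j x) = (\<Sum>j\<in>?S. \<Sum>m\<in>?S. sigma_coeff \<gamma> k j m * (x j * x m))"
        by (simp add: a_def sum_distrib_left mult_ac)
      also have "\<dots> = 0"
      proof -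
        have "(\<Sum>j\<in>?S. \<Sum>m\<in>?S. sigma_coeff \<gamma> k j m * (x j * x m)) = (\<Sum>j\<in>?S. \<Sum>m\<in>?S. - (sigma_coeff \<gamma> k m j * (x m * x j)))"
        proof (intro sum.cong refl)
          fix j m assume "j \<in> ?S" "m \<in> ?S"
          then show "sigma_coeff \<gamma> k j m * (x j * x m) = - (sigma_coeff \<gamma> k m j * (x m * x j))"
            using sigma_coeff_antisym[OF k sZ sZ, of j m \<gamma>] by (simp add: mult.commute)
        qed
        also have "\<dots> = - (\<Sum>m\<in>?S. \<Sum>j\<in>?S. sigma_coeff \<gamma> k m j * (x m * x j))"
          unfolding sum_negf by (subst sum.swap) (rule refl)
        finally show ?thesis by simp
      qed
      finally show ?thesis .
    qed
    show "(\<Sum>j\<in>?S. a' j j x) = 0" for x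
    proof (rule sum.neutral, rule ballI)
      fix j assume j: "j \<in> ?S"
      have "a' j j x = sigma_coeff \<gamma> k j j" using j square_finite unfolding a'_def by (simp add: if_distrib cong: if_cong)
      then show "a' j j x = 0" using sigma_coeff_antisym[OF k sZ[OF j] sZ[OF j], of \<gamma>] by simp
    qed
  qed
  moreover have "sigma_grad \<gamma> k \<omega> (D_cyl \<Lambda> f \<omega>) = - (\<Sum>j\<in>?S. pd_ext \<Lambda> f j (coords ?S \<omega>) * a j (coords ?S \<omega>))"
    "sigma_grad \<gamma> k \<omega> (D_cyl \<Lambda>' g \<omega>) = - (\<Sum>j\<in>?S. pd_ext \<Lambda>' g j (coords ?S \<omega>) * a j (coords ?S \<omega>))"
    if "\<omega> \<in> space \<mu>" for \<omega>
    using that sigma_grad_rep[OF _ N(1) square_finite square_Z20, of \<omega> k \<gamma> f] sigma_grad_rep[OF _ N(2) square_finite square_Z20, of \<omega> k \<gamma> g]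
      N(3) white_noiseD(2)[OF wn] by (simp_all add: a_def)
  note eq = this
  have "(LINT \<omega>|\<mu>. sigma_grad \<gamma> k \<omega> (D_cyl \<Lambda> f \<omega>) * cyl \<Lambda>' g \<omega>) =
      (LINT \<omega>|\<mu>. - ((\<Sum>j\<in>?S. pd_ext \<Lambda> f j (coords ?S \<omega>) * a j (coords ?S \<omega>)) * g (restrict (coords ?S \<omega>) \<Lambda>')))"
    by (rule Bochner_Integration.integral_cong[OF refl]) (simp add: cyl_coords[OF N(2)] eq)
  moreover have "(LINT \<omega>|\<mu>. cyl \<Lambda> f \<omega> * sigma_grad \<gamma> k \<omega> (D_cyl \<Lambda>' g \<omega>)) =
      (LINT \<omega>|\<mu>. - (f (restrict (coords ?S \<omega>) \<Lambda>) * (\<Sum>j\<in>?S. pd_ext \<Lambda>' g j (coords ?S \<omega>) * a j (coords ?S \<omega>))))"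
    by (rule Bochner_Integration.integral_cong[OF refl]) (simp add: cyl_coords[OF N(1)] eq)
  ultimately show ?thesis by simp
qed

lemma drift_approx_rep:
  assumes K: "biot_savart_kernel K" and \<Lambda>: "\<Lambda> \<subseteq> \<Lambda>'" "finite \<Lambda>'" and N: "square N \<subseteq> \<Lambda>'"
  shows "drift_approx K \<Lambda> f N \<omega> = (\<Sum>j\<in>\<Lambda>'. pd_ext \<Lambda> f j (coords \<Lambda>' \<omega>) *
    (\<Sum>l\<in>square N. \<Sum>m\<in>square N. drift_coeff l m j * (coords \<Lambda>' \<omega> l * coords \<Lambda>' \<omega> m)))"
proof -
  have "(\<Sum>l\<in>square N. \<Sum>m\<in>square N. drift_coeff l m j * (\<omega> (efun l) * \<omega> (efun m))) =
      (\<Sum>l\<in>square N. \<Sum>m\<in>square N. drift_coeff l m j * (coords \<Lambda>' \<omega> l * coords \<Lambda>' \<omega> m))" for j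
    using N by (intro sum.cong refl) (auto simp: coords_apply subset_iff)
  from sum_pd_ext[OF \<Lambda>(2,1), where b = "\<lambda>j. \<Sum>l\<in>square N. \<Sum>m\<in>square N. drift_coeff l m j * (\<omega> (efun l) * \<omega> (efun m))", OF this]
  show ?thesis unfolding drift_approx_eq[OF K] .
qed

lemma drift_approx_L2:
  assumes wn: "white_noise \<mu>" and K: "biot_savart_kernel K" and f: "FCP \<Lambda> f"
  shows "L2_space \<mu> (drift_approx K \<Lambda> f N)"
proof -
  let ?S = "\<Lambda> \<union> square N"
  have S: "finite ?S" "?S \<subseteq> Z20" using FCP_D(1,2)[OF f] square_finite square_Z20 by auto
  have "C0P ?S (\<lambda>x. \<Sum>j\<in>?S. pd_ext \<Lambda> f j x * (\<Sum>l\<in>square N. \<Sum>m\<in>square N. drift_coeff l m j * (x l * x m)))"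
    by (intro C0P_sum C0P_mult C0P_scale C1P_deriv_C0P[OF C1P_pd_ext[OF f _ S(1)]] C0P_coord S(1)) auto
  from C0P_L2[OF wn S this] show ?thesis
    by (subst ext[of "drift_approx K \<Lambda> f N", OF drift_approx_rep[OF K _ S(1)]]) auto
qed

text \<open>The square has to contain the modes of f and of g, so that the derivatives of both meet
  the same truncated quadratic field. For each l the coefficients are antisymmetric in the other two
  indices, which makes the field tangent to spheres. Its divergence vanishes because coefficients
  with a repeated index are 0.\<close>

lemma drift_approx_antisym:
  assumes wn: "white_noise \<mu>" and K: "biot_savart_kernel K" and f: "FCP \<Lambda> f" and g: "FCP \<Lambda>' g"
    and N: "\<Lambda> \<subseteq> square N" "\<Lambda>' \<subseteq> square N"
  shows "(LINT \<omega>|\<mu>. drift_approx K \<Lambda> f N \<omega> * cyl \<Lambda>' g \<omega>) = - (LINT \<omega>|\<mu>. cyl \<Lambda> f \<omega> * drift_approx K \<Lambda>' g N \<omega>)"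
proof -
  let ?S = "square N"
  define b where "b j x = (\<Sum>l\<in>?S. \<Sum>m\<in>?S. drift_coeff l m j * (x l * x m))" for j and x :: "int \<times> int \<Rightarrow> real"
  define b' where "b' j i x = (\<Sum>l\<in>?S. \<Sum>m\<in>?S. drift_coeff l m j * ((if i = l then 1 else 0) * x m + (if i = m then 1 else 0) * x l))"
    for j i and x :: "int \<times> int \<Rightarrow> real"
  have sZ: "j \<in> Z20" if "j \<in> ?S" for j using square_Z20 that by blast
  have "(LINT \<omega>|\<mu>. (\<Sum>j\<in>?S. pd_ext \<Lambda> f j (coords ?S \<omega>) * b j (coords ?S \<omega>)) * g (restrict (coords ?S \<omega>) \<Lambda>')) =
    - (LINT \<omega>|\<mu>. f (restrict (coords ?S \<omega>) \<Lambda>) * (\<Sum>j\<in>?S. pd_ext \<Lambda>' g j (coords ?S \<omega>) * b j (coords ?S \<omega>)))"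
  proof (rule vector_field_antisym[OF wn square_finite square_Z20 C1P_pd_ext[OF f N(1) square_finite] C1P_pd_ext[OF g N(2) square_finite]])
    show "C1P ?S (b j) (b' j)" for j
      unfolding b_def b'_def by (intro C1P_sum C1P_scale C1P_mult C1P_coord square_finite)
    show "(\<Sum>j\<in>?S. x j * b j x) = 0" for x
    proof -
      have "(\<Sum>j\<in>?S. x j * b j x) = (\<Sum>j\<in>?S. \<Sum>l\<in>?S. \<Sum>m\<in>?S. x l * (drift_coeff l m j * (x j * x m)))"
        by (simp add: b_def sum_distrib_left mult_ac)
      also have "\<dots> = (\<Sum>l\<in>?S. \<Sum>j\<in>?S. \<Sum>m\<in>?S. x l * (drift_coeff l m j * (x j * x m)))" by (rule sum.swap)
      also have "\<dots> = 0"
      proof (rule sum.neutral, rule ballI)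
        fix l assume l: "l \<in> ?S"
        let ?s = "\<Sum>j\<in>?S. \<Sum>m\<in>?S. x l * (drift_coeff l m j * (x j * x m))"
        have "?s = (\<Sum>j\<in>?S. \<Sum>m\<in>?S. - (x l * (drift_coeff l j m * (x m * x j))))"
        proof (intro sum.cong refl)
          fix j m assume "j \<in> ?S" "m \<in> ?S"
          then show "x l * (drift_coeff l m j * (x j * x m)) = - (x l * (drift_coeff l j m * (x m * x j)))"
            using drift_coeff_antisym[OF sZ[OF l] sZ sZ, of m j] by (simp add: mult.commute)
        qed
        also have "\<dots> = - ?s" unfolding sum_negf by (subst sum.swap) (rule refl)
        finally show "?s = 0" by simp
      qed
      finally show ?thesis .
    qed
    show "(\<Sum>j\<in>?S. b' j j x) = 0" for x
    proof (rule sum.neutral, rule ballI)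
      fix j assume j: "j \<in> ?S"
      have z1: "drift_coeff j m j = 0" if "m \<in> ?S" for m
        using drift_coeff_antisym[OF sZ[OF j] sZ[OF that] sZ[OF j]] by (simp add: drift_coeff_diag)
      have z2: "drift_coeff l j j = 0" if "l \<in> ?S" for l
        using drift_coeff_antisym[OF sZ[OF that] sZ[OF j] sZ[OF j]] by simp
      show "b' j j x = 0"
        unfolding b'_def
      proof (intro sum.neutral ballI)
        fix l m assume "l \<in> ?S" "m \<in> ?S"
        then show "drift_coeff l m j * ((if j = l then 1 else 0) * x m + (if j = m then 1 else 0) * x l) = 0"
          using z1[of m] z2[of l] by (cases "j = l"; cases "j = m") simp_all
      qed
    qed
  qed
  then show ?thesis
    unfolding drift_approx_rep[OF K N(1) square_finite order_refl] drift_approx_rep[OF K N(2) square_finite order_refl]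
      b_def cyl_coords[OF N(1)] cyl_coords[OF N(2)] .
qed

subsection \<open>Second and fourth moments\<close>

text \<open>Mode m does not occur in g, so integration by parts in that mode differentiates only the
  factor of mode q.\<close>

lemma expectation_pair:
  assumes wn: "white_noise \<mu>" and \<Lambda>: "finite \<Lambda>" "\<Lambda> \<subseteq> Z20" and g: "C1P \<Lambda> g g'"
    and m: "m \<in> Z20" "m \<notin> \<Lambda>" and q: "q \<in> Z20"
  shows "(LINT \<omega>|\<mu>. g (coords \<Lambda> \<omega>) * (\<omega> (efun m) * \<omega> (efun q))) = (if m = q then 1 else 0) * (LINT \<omega>|\<mu>. g (coords \<Lambda> \<omega>))"
proof -
  let ?S = "insert m (insert q \<Lambda>)"
  have S: "finite ?S" "?S \<subseteq> Z20" "\<Lambda> \<subseteq> ?S" using \<Lambda> m q by auto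
  have "C1P ?S (\<lambda>x. g (restrict x \<Lambda>) * x q) (\<lambda>j x. (if j \<in> \<Lambda> then g' j (restrict x \<Lambda>) else 0) * x q + (if j = q then 1 else 0) * g (restrict x \<Lambda>))"
    by (intro C1P_mult C1P_extend[OF g] C1P_coord S) auto
  from gaussian_ibp[OF wn S(1,2) this, of m] m
  have "(LINT \<omega>|\<mu>. coords ?S \<omega> m * (g (coords \<Lambda> \<omega>) * coords ?S \<omega> q)) = (LINT \<omega>|\<mu>. (if m = q then 1 else 0) * g (coords \<Lambda> \<omega>))"
    by (simp add: coords_restrict[OF S(3)])
  then show ?thesis by (simp add: coords_apply mult_ac)
qed

text \<open>Wick's rule with a weight g independent of l and m: integration by parts in l pairs it
  with p or q, and \<open>expectation_pair\<close> pairs m with the other one. As l and m differ,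
  they are not paired with each other.\<close>

lemma expectation_quad:
  assumes wn: "white_noise \<mu>" and \<Lambda>: "finite \<Lambda>" "\<Lambda> \<subseteq> Z20" and g: "C1P \<Lambda> g g'"
    and l: "l \<in> Z20" "l \<notin> \<Lambda>" and m: "m \<in> Z20" "m \<notin> \<Lambda>" and ne: "l \<noteq> m" and p: "p \<in> Z20" and q: "q \<in> Z20"
  shows "(LINT \<omega>|\<mu>. g (coords \<Lambda> \<omega>) * ((\<omega> (efun l) * \<omega> (efun m)) * (\<omega> (efun p) * \<omega> (efun q)))) =
    ((if (p, q) = (l, m) then 1 else 0) + (if (p, q) = (m, l) then 1 else 0)) * (LINT \<omega>|\<mu>. g (coords \<Lambda> \<omega>))"
proof -
  let ?S = "insert l (insert m (insert p (insert q \<Lambda>)))"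
  have S: "finite ?S" "?S \<subseteq> Z20" "\<Lambda> \<subseteq> ?S" using \<Lambda> l m p q by auto
  let ?h = "\<lambda>x. g (restrict x \<Lambda>) * (x m * (x p * x q))"
  let ?h' = "\<lambda>j x. (if j \<in> \<Lambda> then g' j (restrict x \<Lambda>) else 0) * (x m * (x p * x q)) +
      ((if j = m then 1 else 0) * (x p * x q) + ((if j = p then 1 else 0) * x q + (if j = q then 1 else 0) * x p) * x m) * g (restrict x \<Lambda>)"
  have "C1P ?S ?h ?h'" by (intro C1P_mult C1P_extend[OF g] C1P_coord S) auto
  from gaussian_ibp[OF wn S(1,2) this, of l] l ne
  have "(LINT \<omega>|\<mu>. coords ?S \<omega> l * ?h (coords ?S \<omega>)) =
     (LINT \<omega>|\<mu>. (if l = p then 1 else 0) * (g (coords \<Lambda> \<omega>) * (coords ?S \<omega> m * coords ?S \<omega> q)) + (if l = q then 1 else 0) * (g (coords \<Lambda> \<omega>) * (coords ?S \<omega> m * coords ?S \<omega> p)))"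
    by (simp add: coords_restrict[OF S(3)] algebra_simps)
  also have "\<dots> = (if l = p then 1 else 0) * (LINT \<omega>|\<mu>. g (coords \<Lambda> \<omega>) * (\<omega> (efun m) * \<omega> (efun q)))
      + (if l = q then 1 else 0) * (LINT \<omega>|\<mu>. g (coords \<Lambda> \<omega>) * (\<omega> (efun m) * \<omega> (efun p)))"
  proof -
    have "integrable \<mu> (\<lambda>\<omega>. g (coords \<Lambda> \<omega>) * (coords ?S \<omega> m * coords ?S \<omega> r))" if "r \<in> ?S" for r
    proof -
      have "C0P ?S (\<lambda>x. g (restrict x \<Lambda>) * (x m * x r))"
        using that by (intro C0P_mult C0P_extend[OF C1P_C0P[OF g]] C0P_coord S) auto
      from C0P_integrable[OF wn S(1,2) this] show ?thesis by (simp add: coords_restrict[OF S(3)])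
    qed
    from this[of q] this[of p] show ?thesis
      by (subst Bochner_Integration.integral_add) (auto simp: coords_apply)
  qed
  finally show ?thesis
    using expectation_pair[OF wn \<Lambda> g m q] expectation_pair[OF wn \<Lambda> g m p] ne
    by (auto simp: coords_apply coords_restrict[OF S(3)] mult_ac)
qed

text \<open>The isometry of the second Wiener chaos: each pair matches itself and its transpose,
  whence the factor 2 for symmetric s. Since D avoids \<Lambda>, the weight g factors out.\<close>

lemma expectation_quadratic_form:
  assumes wn: "white_noise \<mu>" and \<Lambda>: "finite \<Lambda>" "\<Lambda> \<subseteq> Z20" and g: "C1P \<Lambda> g g'"
    and D: "finite D" "D \<subseteq> (Z20 - \<Lambda>) \<times> (Z20 - \<Lambda>)" "\<And>l m. (l, m) \<in> D \<Longrightarrow> (m, l) \<in> D \<and> l \<noteq> m"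
    and s: "\<And>l m. s (l, m) = s (m, l)"
  shows "(LINT \<omega>|\<mu>. g (coords \<Lambda> \<omega>) * (\<Sum>d\<in>D. s d * (\<omega> (efun (fst d)) * \<omega> (efun (snd d))))\<^sup>2) =
    2 * (LINT \<omega>|\<mu>. g (coords \<Lambda> \<omega>)) * (\<Sum>d\<in>D. (s d)\<^sup>2)"
proof -
  let ?E = "LINT \<omega>|\<mu>. g (coords \<Lambda> \<omega>)"
  define X where "X \<omega> d = \<omega> (efun (fst d)) * \<omega> (efun (snd d))" for \<omega> :: functional and d :: "(int \<times> int) \<times> (int \<times> int)"
  have int: "integrable \<mu> (\<lambda>\<omega>. g (coords \<Lambda> \<omega>) * (X \<omega> d * X \<omega> d'))" if "d \<in> D" "d' \<in> D" for d d'
  proof -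
    let ?S = "insert (fst d) (insert (snd d) (insert (fst d') (insert (snd d') \<Lambda>)))"
    have S: "finite ?S" "?S \<subseteq> Z20" "\<Lambda> \<subseteq> ?S" using \<Lambda> D(2) that by auto
    have "C0P ?S (\<lambda>x. g (restrict x \<Lambda>) * ((x (fst d) * x (snd d)) * (x (fst d') * x (snd d'))))"
      by (intro C0P_mult C0P_extend[OF C1P_C0P[OF g]] C0P_coord S) auto
    from C0P_integrable[OF wn S(1,2) this] show ?thesis by (simp add: coords_restrict[OF S(3)] coords_apply X_def)
  qed
  have "(LINT \<omega>|\<mu>. g (coords \<Lambda> \<omega>) * (\<Sum>d\<in>D. s d * X \<omega> d)\<^sup>2) =
      (LINT \<omega>|\<mu>. (\<Sum>d\<in>D. \<Sum>d'\<in>D. s d * s d' * (g (coords \<Lambda> \<omega>) * (X \<omega> d * X \<omega> d'))))"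
    by (intro Bochner_Integration.integral_cong refl) (simp add: power2_eq_square sum_product sum_distrib_left mult_ac)
  also have "\<dots> = (\<Sum>d\<in>D. \<Sum>d'\<in>D. s d * s d' * (LINT \<omega>|\<mu>. g (coords \<Lambda> \<omega>) * (X \<omega> d * X \<omega> d')))"
    using int by (simp add: Bochner_Integration.integral_sum)
  also have "\<dots> = (\<Sum>d\<in>D. 2 * ?E * (s d)\<^sup>2)"
  proof (intro sum.cong refl)
    fix d assume d: "d \<in> D"
    obtain l m where lm: "d = (l, m)" by (cases d)
    have dd: "(m, l) \<in> D" "l \<noteq> m" using D(3) d lm by auto
    have "(\<Sum>d'\<in>D. s d * s d' * (LINT \<omega>|\<mu>. g (coords \<Lambda> \<omega>) * (X \<omega> d * X \<omega> d'))) =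
      (\<Sum>d'\<in>D. (if d' = (l, m) then s d * s d' * ?E else 0) + (if d' = (m, l) then s d * s d' * ?E else 0))"
    proof (intro sum.cong refl)
      fix d' assume d': "d' \<in> D"
      obtain p q where pq: "d' = (p, q)" by (cases d')
      have "(LINT \<omega>|\<mu>. g (coords \<Lambda> \<omega>) * (X \<omega> d * X \<omega> d')) =
          ((if (p, q) = (l, m) then 1 else 0) + (if (p, q) = (m, l) then 1 else 0)) * ?E"
        unfolding X_def lm pq fst_conv snd_conv
        using d d' D(2) lm pq dd by (intro expectation_quad[OF wn \<Lambda> g]) auto
      then show "s d * s d' * (LINT \<omega>|\<mu>. g (coords \<Lambda> \<omega>) * (X \<omega> d * X \<omega> d')) =
          (if d' = (l, m) then s d * s d' * ?E else 0) + (if d' = (m, l) then s d * s d' * ?E else 0)"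
        using dd by (auto simp: pq)
    qed
    also have "\<dots> = s d * s (l, m) * ?E + s d * s (m, l) * ?E"
      using D(1) d dd lm by (simp add: sum.distrib)
    also have "\<dots> = 2 * ?E * (s d)\<^sup>2" using s[of m l] lm by (simp add: power2_eq_square)
    finally show "(\<Sum>d'\<in>D. s d * s d' * (LINT \<omega>|\<mu>. g (coords \<Lambda> \<omega>) * (X \<omega> d * X \<omega> d'))) = 2 * ?E * (s d)\<^sup>2" .
  qed
  finally show ?thesis by (simp add: X_def sum_distrib_left)
qed

section \<open>Lattice sums\<close>

lemma sum_int_shell_le:
  fixes u :: "nat \<Rightarrow> real"
  assumes u: "summable u" "\<And>n. 0 \<le> u n" and A: "finite A"
  shows "(\<Sum>a\<in>A. u (nat \<bar>a\<bar>)) \<le> 2 * suminf u"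
proof -
  have part: "(\<Sum>a\<in>B. u (nat \<bar>a\<bar>)) \<le> suminf u" if B: "finite B" "inj_on (\<lambda>a::int. nat \<bar>a\<bar>) B" for B
  proof -
    have "(\<Sum>a\<in>B. u (nat \<bar>a\<bar>)) = sum u ((\<lambda>a. nat \<bar>a\<bar>) ` B)" using B(2) by (simp add: sum.reindex)
    also have "\<dots> \<le> suminf u" using u B(1) by (intro sum_le_suminf) auto
    finally show ?thesis .
  qed
  have "(\<Sum>a\<in>A. u (nat \<bar>a\<bar>)) = (\<Sum>a\<in>A \<inter> {0..}. u (nat \<bar>a\<bar>)) + (\<Sum>a\<in>A - {0..}. u (nat \<bar>a\<bar>))"
    by (rule sum.Int_Diff[OF A])
  also have "\<dots> \<le> suminf u + suminf u"
    using A by (intro add_mono part) (auto simp: inj_on_def)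
  finally show ?thesis by simp
qed

text \<open>Comparing |k|^2 with the product of 1 + |k_1| and 1 + |k_2| reduces the sum to the
  square of a one-dimensional series with exponent p / 2 > 1.\<close>

lemma lattice_summable:
  assumes p: "p > 2" shows "(\<lambda>k. norm (vec_of k) powr (- p)) summable_on Z20"
proof (rule nonneg_bdd_above_summable_on)
  define u where "u n = (1 + real n) powr (- p / 2)" for n
  have u0: "0 \<le> u n" for n by (simp add: u_def)
  have "summable (\<lambda>n. real n powr (- p / 2))" using p by (simp add: summable_real_powr_iff)
  then have "summable (\<lambda>n. real (Suc n) powr (- p / 2))" by (subst summable_Suc_iff)
  then have us: "summable u" by (simp add: u_def[abs_def])
  have bound: "norm (vec_of k) powr (- p) \<le> 3 powr (p / 2) * (u (nat \<bar>fst k\<bar>) * u (nat \<bar>snd k\<bar>))" if k: "k \<in> Z20" for k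
  proof -
    define a b where "a = \<bar>real_of_int (fst k)\<bar>" and "b = \<bar>real_of_int (snd k)\<bar>"
    have ab: "0 \<le> a" "0 \<le> b" by (simp_all add: a_def b_def)
    have n1: "1 \<le> norm (vec_of k)" by (rule norm_vec_of_ge_1[OF k])
    have n2: "(norm (vec_of k))\<^sup>2 = a\<^sup>2 + b\<^sup>2" by (simp add: vec_of_def norm_prod_def a_def b_def)
    have "1 \<le> a\<^sup>2 + b\<^sup>2" using power_mono[OF n1, of 2] n2 by simp
    \<comment> \<open>The three squares bound ab by (a^2 + b^2) / 2, a by (1 + a^2) / 2 and b by (1
      + b^2) / 2; the constants are then absorbed by 1 \<le> a^2 + b^2.\<close>
    moreover have "0 \<le> (a - b)\<^sup>2" "0 \<le> (a - 1)\<^sup>2" "0 \<le> (b - 1)\<^sup>2" by simp_all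
    ultimately have "(1 + a) * (1 + b) \<le> 3 * (norm (vec_of k))\<^sup>2"
      unfolding n2 by (simp add: power2_eq_square algebra_simps)
    then have "(3 * (norm (vec_of k))\<^sup>2) powr (- p / 2) \<le> ((1 + a) * (1 + b)) powr (- p / 2)"
      using p ab by (intro powr_mono2') auto
    also have "((1 + a) * (1 + b)) powr (- p / 2) = u (nat \<bar>fst k\<bar>) * u (nat \<bar>snd k\<bar>)"
      using ab by (simp add: powr_mult u_def a_def b_def)
    also have "(3 * (norm (vec_of k))\<^sup>2) powr (- p / 2) = 3 powr (- p / 2) * norm (vec_of k) powr (- p)"
    proof -
      have "(norm (vec_of k))\<^sup>2 powr (- p / 2) = norm (vec_of k) powr (- p)"
        using n1 by (simp add: powr_powr flip: powr_numeral)
      then show ?thesis by (simp add: powr_mult)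
    qed
    finally have le: "3 powr (- p / 2) * norm (vec_of k) powr (- p) \<le> u (nat \<bar>fst k\<bar>) * u (nat \<bar>snd k\<bar>)" .
    have "3 powr (p / 2) * 3 powr (- p / 2) = (1::real)" by (simp flip: powr_add)
    then have "norm (vec_of k) powr (- p) = 3 powr (p / 2) * (3 powr (- p / 2) * norm (vec_of k) powr (- p))"
      by (simp only: mult.assoc[symmetric] mult_1_left)
    also have "\<dots> \<le> 3 powr (p / 2) * (u (nat \<bar>fst k\<bar>) * u (nat \<bar>snd k\<bar>))"
      by (rule mult_left_mono[OF le]) simp
    finally show ?thesis .
  qed
  have "sum (\<lambda>k. norm (vec_of k) powr (- p)) F \<le> 3 powr (p / 2) * ((2 * suminf u) * (2 * suminf u))"
    if F: "F \<subseteq> Z20" "finite F" for F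
  proof -
    have "sum (\<lambda>k. norm (vec_of k) powr (- p)) F \<le> (\<Sum>k\<in>F. 3 powr (p / 2) * (u (nat \<bar>fst k\<bar>) * u (nat \<bar>snd k\<bar>)))"
      using F by (intro sum_mono bound) auto
    also have "\<dots> \<le> (\<Sum>k\<in>fst ` F \<times> snd ` F. 3 powr (p / 2) * (u (nat \<bar>fst k\<bar>) * u (nat \<bar>snd k\<bar>)))"
      by (rule sum_mono2) (use F u0 subset_fst_snd in simp_all)
    also have "\<dots> = 3 powr (p / 2) * ((\<Sum>a\<in>fst ` F. u (nat \<bar>a\<bar>)) * (\<Sum>b\<in>snd ` F. u (nat \<bar>b\<bar>)))"
      unfolding sum_product sum.cartesian_product by (simp add: sum_distrib_left case_prod_beta')
    also have "\<dots> \<le> 3 powr (p / 2) * ((2 * suminf u) * (2 * suminf u))"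
      using F us u0 by (intro mult_left_mono mult_mono sum_int_shell_le sum_nonneg mult_nonneg_nonneg suminf_nonneg) auto
    finally show ?thesis .
  qed
  then show "bdd_above (sum (\<lambda>k. norm (vec_of k) powr (- p)) ` {F. F \<subseteq> Z20 \<and> finite F})"
    by (intro bdd_aboveI[of _ "3 powr (p / 2) * ((2 * suminf u) * (2 * suminf u))"]) auto
qed simp

text \<open>For each m at most four l contribute, each with a square of order |m|^-4, and 4 exceeds
  the dimension 2.\<close>

lemma sym_coeff_summable:
  assumes j: "j \<in> Z20" shows "(\<lambda>(l, m). (sym_coeff j l m)\<^sup>2) summable_on Z20 \<times> Z20"
proof (rule nonneg_bdd_above_summable_on)
  define C where "C = 12 * sqrt 2 * pi\<^sup>2 * norm (vec_of j) ^ 3"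
  let ?w = "\<lambda>m. norm (vec_of m) powr (- 4)"
  have ws: "?w summable_on Z20" by (rule lattice_summable) simp
  have bound: "(sym_coeff j l m)\<^sup>2 \<le> C\<^sup>2 * ?w m" if "l \<in> Z20" "m \<in> Z20" for l m
  proof -
    have n: "0 < norm (vec_of m)" using norm_vec_of_ge_1[OF that(2)] by linarith
    have "(sym_coeff j l m)\<^sup>2 = \<bar>sym_coeff j l m\<bar>\<^sup>2" by simp
    also have "\<dots> \<le> (C / (norm (vec_of m))\<^sup>2)\<^sup>2"
      unfolding C_def using sym_coeff_bound[OF that j] by (intro power_mono) auto
    also have "\<dots> = C\<^sup>2 / norm (vec_of m) ^ 4" by (simp add: power_divide flip: power_mult)
    also have "\<dots> = C\<^sup>2 * ?w m" using n powr_realpow[OF n, of 4] by (simp add: powr_minus divide_inverse)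
    finally show ?thesis .
  qed
  have "sum (\<lambda>(l, m). (sym_coeff j l m)\<^sup>2) F \<le> 4 * C\<^sup>2 * infsum ?w Z20" if F: "F \<subseteq> Z20 \<times> Z20" "finite F" for F
  proof -
    have Fp: "fst ` F \<subseteq> Z20" "snd ` F \<subseteq> Z20" using F(1) by auto
    have "sum (\<lambda>(l, m). (sym_coeff j l m)\<^sup>2) F \<le> sum (\<lambda>(l, m). (sym_coeff j l m)\<^sup>2) (fst ` F \<times> snd ` F)"
      by (rule sum_mono2) (use F subset_fst_snd in \<open>simp_all add: case_prod_beta'\<close>)
    also have "\<dots> = (\<Sum>m\<in>snd ` F. \<Sum>l\<in>fst ` F. (sym_coeff j l m)\<^sup>2)"
      by (subst sum.swap) (simp add: sum.cartesian_product)
    also have "\<dots> \<le> (\<Sum>m\<in>snd ` F. 4 * (C\<^sup>2 * ?w m))"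
    proof (rule sum_mono)
      fix m assume m: "m \<in> snd ` F"
      then have mZ: "m \<in> Z20" using Fp by auto
      have "(\<Sum>l\<in>fst ` F. (sym_coeff j l m)\<^sup>2) = (\<Sum>l\<in>fst ` F \<inter> nbr m j. (sym_coeff j l m)\<^sup>2)"
      proof (rule sum.mono_neutral_right)
        show "\<forall>l\<in>fst ` F - fst ` F \<inter> nbr m j. (sym_coeff j l m)\<^sup>2 = 0"
        proof
          fix l assume l: "l \<in> fst ` F - fst ` F \<inter> nbr m j"
          then have "sym_coeff j l m = 0" using Fp mZ j by (intro sym_coeff_zero) auto
          then show "(sym_coeff j l m)\<^sup>2 = 0" by simp
        qed
      qed (use F in auto)
      also have "\<dots> \<le> (\<Sum>l\<in>fst ` F \<inter> nbr m j. C\<^sup>2 * ?w m)"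
        using Fp mZ by (intro sum_mono bound) auto
      also have "\<dots> = real (card (fst ` F \<inter> nbr m j)) * (C\<^sup>2 * ?w m)" by simp
      also have "\<dots> \<le> 4 * (C\<^sup>2 * ?w m)"
      proof (rule mult_right_mono)
        have "card (fst ` F \<inter> nbr m j) \<le> 4"
          using card_mono[OF nbr_finite, of "fst ` F \<inter> nbr m j" m j] card_nbr[of m j] by auto
        then show "real (card (fst ` F \<inter> nbr m j)) \<le> 4" by simp
      qed simp
      finally show "(\<Sum>l\<in>fst ` F. (sym_coeff j l m)\<^sup>2) \<le> 4 * (C\<^sup>2 * ?w m)" .
    qed
    also have "\<dots> = 4 * C\<^sup>2 * (\<Sum>m\<in>snd ` F. ?w m)" by (simp add: sum_distrib_left mult.assoc)
    also have "\<dots> \<le> 4 * C\<^sup>2 * infsum ?w Z20"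
      using F Fp by (intro mult_left_mono finite_sum_le_infsum ws) auto
    finally show ?thesis .
  qed
  then show "bdd_above (sum (\<lambda>(l, m). (sym_coeff j l m)\<^sup>2) ` {F. F \<subseteq> Z20 \<times> Z20 \<and> finite F})"
    by (intro bdd_aboveI[of _ "4 * C\<^sup>2 * infsum ?w Z20"]) auto
qed auto

lemma summable_on_tail:
  fixes f :: "'b \<Rightarrow> real"
  assumes f: "f summable_on A" "\<And>x. x \<in> A \<Longrightarrow> 0 \<le> f x" and e: "e > 0"
  shows "\<exists>A0. finite A0 \<and> A0 \<subseteq> A \<and> (\<forall>D. finite D \<longrightarrow> D \<subseteq> A \<longrightarrow> D \<inter> A0 = {} \<longrightarrow> sum f D \<le> e)"
proof -
  obtain A0 where A0: "finite A0" "A0 \<subseteq> A" "dist (sum f A0) (infsum f A) \<le> e"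
    using infsum_finite_approximation[OF f(1) e] by blast
  have "sum f D \<le> e" if D: "finite D" "D \<subseteq> A" "D \<inter> A0 = {}" for D
  proof -
    have "sum f D + sum f A0 = sum f (D \<union> A0)" using D A0 by (simp add: sum.union_disjoint)
    also have "\<dots> \<le> infsum f A" using D A0 f by (intro finite_sum_le_infsum) auto
    finally show ?thesis using A0(3) by (simp add: dist_real_def)
  qed
  then show ?thesis using A0 by blast
qed

subsection \<open>The drift\<close>

text \<open>The sum runs over pairs d, so that the increment between two squares is a sum over a set
  of pairs, as in \<open>expectation_quadratic_form\<close>.\<close>

definition quad :: "int \<times> int \<Rightarrow> nat \<Rightarrow> functional \<Rightarrow> real" where
  "quad j N \<omega> = (\<Sum>d\<in>square N \<times> square N. sym_coeff j (fst d) (snd d) * (\<omega> (efun (fst d)) * \<omega> (efun (snd d))))"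

lemma quad_drift_coeff:
  "(\<Sum>l\<in>square N. \<Sum>m\<in>square N. drift_coeff l m j * (\<omega> (efun l) * \<omega> (efun m))) = quad j N \<omega>"
proof -
  let ?s = "\<Sum>l\<in>square N. \<Sum>m\<in>square N. drift_coeff l m j * (\<omega> (efun l) * \<omega> (efun m))"
  have sw: "?s = (\<Sum>l\<in>square N. \<Sum>m\<in>square N. drift_coeff m l j * (\<omega> (efun l) * \<omega> (efun m)))"
    by (subst sum.swap) (simp add: mult_ac)
  have "quad j N \<omega> = (\<Sum>l\<in>square N. \<Sum>m\<in>square N. sym_coeff j l m * (\<omega> (efun l) * \<omega> (efun m)))"
    by (simp add: quad_def sum.cartesian_product case_prod_beta')
  also have "\<dots> = (?s + (\<Sum>l\<in>square N. \<Sum>m\<in>square N. drift_coeff m l j * (\<omega> (efun l) * \<omega> (efun m)))) / 2"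
    unfolding sum.distrib[symmetric] sum_divide_distrib by (intro sum.cong refl) (simp add: sym_coeff_def algebra_simps)
  finally show ?thesis using sw by simp
qed

lemma drift_approx_quad:
  assumes "biot_savart_kernel K"
  shows "drift_approx K \<Lambda> f N \<omega> = (\<Sum>j\<in>\<Lambda>. partial_deriv j f (coords \<Lambda> \<omega>) * quad j N \<omega>)"
  unfolding drift_approx_eq[OF assms] quad_drift_coeff ..

text \<open>Beyond a threshold the increments of \<open>quad\<close> involve only modes outside
  \<Lambda>, which are independent of the derivatives of f. Their weighted second moment is then
  exactly twice the mean squared derivative times a tail of the summable squares of
  \<open>sym_coeff\<close>.\<close>

lemma drift_limit_exists:
  assumes wn: "white_noise \<mu>" and K: "biot_savart_kernel K" and f: "FCP \<Lambda> f"
  shows "\<exists>B. L2_tendsto \<mu> (drift_approx K \<Lambda> f) B"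
proof (rule L2_complete)
  show L2: "L2_space \<mu> (drift_approx K \<Lambda> f n)" for n by (rule drift_approx_L2[OF wn K f])
  note \<Lambda> = FCP_D(1,2)[OF f]
  define g where "g j x = partial_deriv j f x * partial_deriv j f x" for j x
  define E where "E j = (LINT \<omega>|\<mu>. g j (coords \<Lambda> \<omega>))" for j
  have E0: "0 \<le> E j" for j by (simp add: E_def g_def)
  have gC: "\<exists>g'. C1P \<Lambda> (g j) g'" if "j \<in> \<Lambda>" for j
    using C1P_mult[OF FCP_D(4)[OF f that] FCP_D(4)[OF f that]] unfolding g_def[abs_def] by blast
  fix e :: real assume e: "e > 0"
  \<comment> \<open>The final estimate is \<delta> times 2 card \<Lambda> times the sum of the E j;
    the two added ones keep the divisor positive.\<close>
  define \<delta> where "\<delta> = e / (2 * (real (card \<Lambda>) + 1) * (sum E \<Lambda> + 1))"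
  have SE: "0 \<le> sum E \<Lambda>" by (intro sum_nonneg E0)
  have \<delta>: "\<delta> > 0" unfolding \<delta>_def using e SE by (intro divide_pos_pos mult_pos_pos) auto
  have "\<exists>A0. finite A0 \<and> A0 \<subseteq> Z20 \<times> Z20 \<and> (\<forall>D. finite D \<longrightarrow> D \<subseteq> Z20 \<times> Z20 \<longrightarrow> D \<inter> A0 = {} \<longrightarrow> sum (\<lambda>(l, m). (sym_coeff j l m)\<^sup>2) D \<le> \<delta>)"
    if "j \<in> \<Lambda>" for j
    using \<Lambda>(2) that by (intro summable_on_tail sym_coeff_summable \<delta>) auto
  then obtain A0 where A0: "\<And>j. j \<in> \<Lambda> \<Longrightarrow> finite (A0 j)" "\<And>j. j \<in> \<Lambda> \<Longrightarrow> A0 j \<subseteq> Z20 \<times> Z20"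
    "\<And>j D. j \<in> \<Lambda> \<Longrightarrow> finite D \<Longrightarrow> D \<subseteq> Z20 \<times> Z20 \<Longrightarrow> D \<inter> A0 j = {} \<Longrightarrow> sum (\<lambda>(l, m). (sym_coeff j l m)\<^sup>2) D \<le> \<delta>"
    by metis
  \<comment> \<open>The neighbours of \<Lambda> keep increments away from \<Lambda>: if l lies in
    \<Lambda> and the coefficient is nonzero, then m is such a neighbour, so both modes lie in the
    smaller square already. The sets A0 carry each sum of squares up to \<delta>.\<close>
  let ?U = "\<Lambda> \<union> (\<Union>p\<in>\<Lambda>. \<Union>j\<in>\<Lambda>. nbr p j) \<union> (\<Union>j\<in>\<Lambda>. fst ` A0 j \<union> snd ` A0 j)"
  have "finite ?U" using \<Lambda>(1) A0(1) nbr_finite by auto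
  moreover have "?U \<subseteq> Z20"
  proof (intro Un_least UN_least)
    show "fst ` A0 j \<subseteq> Z20" "snd ` A0 j \<subseteq> Z20" if "j \<in> \<Lambda>" for j using A0(2)[OF that] by auto
  qed (use \<Lambda>(2) nbr_Z20 in auto)
  ultimately obtain N0 where U: "?U \<subseteq> square N0" by (rule finite_subset_square[THEN exE])
  have N0: "\<Lambda> \<subseteq> square N0" using U by (simp only: Un_subset_iff)
  have N0n: "nbr p j \<subseteq> square N0" if "p \<in> \<Lambda>" "j \<in> \<Lambda>" for p j
  proof -
    have "(\<Union>p\<in>\<Lambda>. \<Union>j\<in>\<Lambda>. nbr p j) \<subseteq> square N0" using U by (simp only: Un_subset_iff)
    then show ?thesis using that by blast
  qed
  have N0A: "A0 j \<subseteq> square N0 \<times> square N0" if "j \<in> \<Lambda>" for j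
  proof -
    have "(\<Union>j\<in>\<Lambda>. fst ` A0 j \<union> snd ` A0 j) \<subseteq> square N0" using U by (simp only: Un_subset_iff)
    then have "fst ` A0 j \<union> snd ` A0 j \<subseteq> square N0" using that by blast
    then show ?thesis by force
  qed
  have main: "(LINT \<omega>|\<mu>. (drift_approx K \<Lambda> f M \<omega> - drift_approx K \<Lambda> f N \<omega>)\<^sup>2) \<le> e" if N: "N0 \<le> N" and NM: "N \<le> M" for M N
  proof -
    \<comment> \<open>Pairs with zero coefficient are discarded, because only pairs with a nonzero
      one are sure to avoid \<Lambda>.\<close>
    define D where "D j = {d \<in> square M \<times> square M - square N \<times> square N. sym_coeff j (fst d) (snd d) \<noteq> 0}" for j
    define \<Delta> where "\<Delta> j \<omega> = (\<Sum>d\<in>D j. sym_coeff j (fst d) (snd d) * (\<omega> (efun (fst d)) * \<omega> (efun (snd d))))" for j and \<omega> :: functional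
    note sNM = square_mono[OF NM] and sN = square_mono[OF N]
    have Dfin: "finite (D j)" for j unfolding D_def using square_finite by auto
    have \<Delta>: "quad j M \<omega> - quad j N \<omega> = \<Delta> j \<omega>" for j \<omega>
    proof -
      let ?t = "\<lambda>d. sym_coeff j (fst d) (snd d) * (\<omega> (efun (fst d)) * \<omega> (efun (snd d)))"
      have "quad j M \<omega> - quad j N \<omega> = sum ?t (square M \<times> square M - square N \<times> square N)"
        unfolding quad_def using sNM square_finite by (intro sum_diff[symmetric]) auto
      also have "\<dots> = \<Delta> j \<omega>"
        unfolding \<Delta>_def D_def using square_finite by (intro sum.mono_neutral_right) auto
      finally show ?thesis .
    qed
    have Dsub: "D j \<subseteq> (Z20 - \<Lambda>) \<times> (Z20 - \<Lambda>)" if j: "j \<in> \<Lambda>" for j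
    proof
      fix d assume d: "d \<in> D j"
      obtain l m where lm: "d = (l, m)" by (cases d)
      have Z: "l \<in> Z20" "m \<in> Z20" "j \<in> Z20" using d lm square_Z20 j \<Lambda>(2) by (auto simp: D_def)
      have nz: "sym_coeff j l m \<noteq> 0" "\<not> (l \<in> square N \<and> m \<in> square N)" using d lm by (auto simp: D_def)
      have "l \<in> nbr m j" using sym_coeff_zero[OF Z] nz by blast
      moreover have "m \<in> nbr l j" using calculation nbr_iff[OF Z(1,2)] by blast
      ultimately have "l \<notin> \<Lambda>" "m \<notin> \<Lambda>"
        using nz(2) N0 N0n[OF _ j] sN by blast+
      then show "d \<in> (Z20 - \<Lambda>) \<times> (Z20 - \<Lambda>)" using Z lm by simp
    qed
    have Dsym: "(m, l) \<in> D j \<and> l \<noteq> m" if "(l, m) \<in> D j" for l m j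
      using that sym_coeff_commute[of j l m] by (auto simp: D_def sym_coeff_diag)
    have Dsum: "(\<Sum>d\<in>D j. (sym_coeff j (fst d) (snd d))\<^sup>2) \<le> \<delta>" if j: "j \<in> \<Lambda>" for j
    proof -
      have "D j \<inter> A0 j = {}" using N0A[OF j] sN by (auto simp: D_def)
      moreover have "D j \<subseteq> Z20 \<times> Z20" using Dsub[OF j] by blast
      ultimately show ?thesis using A0(3)[OF j Dfin] by (simp add: case_prod_beta')
    qed
    have form: "(LINT \<omega>|\<mu>. g j (coords \<Lambda> \<omega>) * (\<Delta> j \<omega>)\<^sup>2) = 2 * E j * (\<Sum>d\<in>D j. (sym_coeff j (fst d) (snd d))\<^sup>2)" if j: "j \<in> \<Lambda>" for j
    proof -
      obtain g' where g': "C1P \<Lambda> (g j) g'" using gC[OF j] by blast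
      show ?thesis unfolding \<Delta>_def E_def
        by (rule expectation_quadratic_form[OF wn \<Lambda> g' Dfin Dsub[OF j] Dsym]) (simp_all add: sym_coeff_commute)
    qed
    have int: "integrable \<mu> (\<lambda>\<omega>. g j (coords \<Lambda> \<omega>) * (\<Delta> j \<omega>)\<^sup>2)" if j: "j \<in> \<Lambda>" for j
    proof -
      let ?S = "\<Lambda> \<union> square M"
      have S: "finite ?S" "?S \<subseteq> Z20" "\<Lambda> \<subseteq> ?S" using \<Lambda> square_finite square_Z20 by auto
      obtain g' where g': "C1P \<Lambda> (g j) g'" using gC[OF j] by blast
      let ?h = "\<lambda>x. \<Sum>d\<in>D j. sym_coeff j (fst d) (snd d) * (x (fst d) * x (snd d))"
      have DM: "fst d \<in> ?S" "snd d \<in> ?S" if "d \<in> D j" for d using that by (auto simp: D_def)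
      have "C0P ?S (\<lambda>x. g j (restrict x \<Lambda>) * (?h x * ?h x))"
        by (intro C0P_mult C0P_sum C0P_scale C0P_extend[OF C1P_C0P[OF g'] S(3,1)] C0P_coord S(1) DM)
      from C0P_integrable[OF wn S(1,2) this]
      have "integrable \<mu> (\<lambda>\<omega>. g j (coords \<Lambda> \<omega>) * (?h (coords ?S \<omega>) * ?h (coords ?S \<omega>)))"
        by (simp only: coords_restrict[OF S(3)])
      moreover have "?h (coords ?S \<omega>) = \<Delta> j \<omega>" for \<omega>
        unfolding \<Delta>_def by (intro sum.cong refl) (simp add: coords_apply[OF DM(1)] coords_apply[OF DM(2)])
      ultimately show ?thesis by (simp add: power2_eq_square)
    qed
    have "(LINT \<omega>|\<mu>. (drift_approx K \<Lambda> f M \<omega> - drift_approx K \<Lambda> f N \<omega>)\<^sup>2) \<le>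
        (LINT \<omega>|\<mu>. (\<Sum>j\<in>\<Lambda>. g j (coords \<Lambda> \<omega>) * (\<Delta> j \<omega>)\<^sup>2) * real (card \<Lambda>))"
    proof (rule integral_mono)
      show "integrable \<mu> (\<lambda>\<omega>. (drift_approx K \<Lambda> f M \<omega> - drift_approx K \<Lambda> f N \<omega>)\<^sup>2)"
        using L2_diff[OF L2[of M] L2[of N]] by (simp add: L2_space_def)
      show "integrable \<mu> (\<lambda>\<omega>. (\<Sum>j\<in>\<Lambda>. g j (coords \<Lambda> \<omega>) * (\<Delta> j \<omega>)\<^sup>2) * real (card \<Lambda>))"
        by (intro integrable_mult_left Bochner_Integration.integrable_sum int)
      fix \<omega>
      have "drift_approx K \<Lambda> f M \<omega> - drift_approx K \<Lambda> f N \<omega> = (\<Sum>j\<in>\<Lambda>. partial_deriv j f (coords \<Lambda> \<omega>) * \<Delta> j \<omega>)"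
        unfolding drift_approx_quad[OF K] \<Delta>[symmetric] by (simp add: sum_subtractf right_diff_distrib)
      then have "(drift_approx K \<Lambda> f M \<omega> - drift_approx K \<Lambda> f N \<omega>)\<^sup>2 \<le> (\<Sum>j\<in>\<Lambda>. (partial_deriv j f (coords \<Lambda> \<omega>) * \<Delta> j \<omega>)\<^sup>2) * real (card \<Lambda>)"
        using sum_squared_le_sum_of_squares[of "\<lambda>j. partial_deriv j f (coords \<Lambda> \<omega>) * \<Delta> j \<omega>" \<Lambda>] by simp
      then show "(drift_approx K \<Lambda> f M \<omega> - drift_approx K \<Lambda> f N \<omega>)\<^sup>2 \<le> (\<Sum>j\<in>\<Lambda>. g j (coords \<Lambda> \<omega>) * (\<Delta> j \<omega>)\<^sup>2) * real (card \<Lambda>)"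
        by (simp add: g_def power2_eq_square mult_ac)
    qed
    also have "\<dots> = (\<Sum>j\<in>\<Lambda>. 2 * E j * (\<Sum>d\<in>D j. (sym_coeff j (fst d) (snd d))\<^sup>2)) * real (card \<Lambda>)"
      using int form by (simp add: Bochner_Integration.integral_sum)
    also have "\<dots> \<le> (\<Sum>j\<in>\<Lambda>. 2 * E j * \<delta>) * real (card \<Lambda>)"
      using E0 Dsum by (intro mult_right_mono sum_mono mult_left_mono) auto
    also have "\<dots> = \<delta> * (2 * sum E \<Lambda> * real (card \<Lambda>))" by (simp add: sum_distrib_left sum_distrib_right mult_ac)
    also have "\<dots> \<le> \<delta> * (2 * (real (card \<Lambda>) + 1) * (sum E \<Lambda> + 1))"
      using \<delta> SE by (intro mult_left_mono) (auto simp: algebra_simps)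
    also have "\<dots> = e"
      unfolding \<delta>_def using SE by (simp add: add_nonneg_eq_0_iff)
    finally show ?thesis .
  qed
  show "\<exists>N. \<forall>m\<ge>N. \<forall>n\<ge>N. (LINT x|\<mu>. (drift_approx K \<Lambda> f m x - drift_approx K \<Lambda> f n x)\<^sup>2) \<le> e"
  proof (intro exI[of _ N0] allI impI)
    fix m n assume "N0 \<le> m" "N0 \<le> n"
    then show "(LINT x|\<mu>. (drift_approx K \<Lambda> f m x - drift_approx K \<Lambda> f n x)\<^sup>2) \<le> e"
      using main[of n m] main[of m n] by (cases "n \<le> m") (auto simp: power2_commute)
  qed
qed

lemma drift_tendsto:
  assumes "white_noise \<mu>" "biot_savart_kernel K" "FCP \<Lambda> f"
  shows "L2_tendsto \<mu> (drift_approx K \<Lambda> f) (drift \<mu> K \<Lambda> f)"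
  unfolding drift_def using drift_limit_exists[OF assms] by (rule someI_ex)

text \<open>The truncated identity holds for all large N and passes to the limit, since on each side
  an L2 convergent sequence is paired with a fixed cylindrical function.\<close>

lemma drift_antisym:
  assumes wn: "white_noise \<mu>" and K: "biot_savart_kernel K" and f: "FCP \<Lambda> f" and g: "FCP \<Lambda>' g"
  shows "l2_inner \<mu> (drift \<mu> K \<Lambda> f) (cyl \<Lambda>' g) = - l2_inner \<mu> (cyl \<Lambda> f) (drift \<mu> K \<Lambda>' g)"
proof -
  obtain N0 where N0: "\<Lambda> \<subseteq> square N0" "\<Lambda>' \<subseteq> square N0" using sigma_square_exists[OF f g] by blast
  have l1: "(\<lambda>n. l2_inner \<mu> (drift_approx K \<Lambda> f n) (cyl \<Lambda>' g)) \<longlonglongrightarrow> l2_inner \<mu> (drift \<mu> K \<Lambda> f) (cyl \<Lambda>' g)"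
    by (rule L2_tendsto_inner[OF drift_tendsto[OF wn K f] cyl_L2[OF wn g]])
  have "(\<lambda>n. - l2_inner \<mu> (drift_approx K \<Lambda>' g n) (cyl \<Lambda> f)) \<longlonglongrightarrow> - l2_inner \<mu> (drift \<mu> K \<Lambda>' g) (cyl \<Lambda> f)"
    by (intro tendsto_minus L2_tendsto_inner[OF drift_tendsto[OF wn K g] cyl_L2[OF wn f]])
  moreover have "\<forall>\<^sub>F n in sequentially. - l2_inner \<mu> (drift_approx K \<Lambda>' g n) (cyl \<Lambda> f) = l2_inner \<mu> (drift_approx K \<Lambda> f n) (cyl \<Lambda>' g)"
    using eventually_ge_at_top[of N0]
  proof eventually_elim
    case (elim n)
    have "\<Lambda> \<subseteq> square n" "\<Lambda>' \<subseteq> square n" using N0 square_mono[OF elim] by auto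
    from drift_approx_antisym[OF wn K f g this] show ?case
      by (simp add: l2_inner_def mult.commute)
  qed
  ultimately have "(\<lambda>n. l2_inner \<mu> (drift_approx K \<Lambda> f n) (cyl \<Lambda>' g)) \<longlonglongrightarrow> - l2_inner \<mu> (drift \<mu> K \<Lambda>' g) (cyl \<Lambda> f)"
    by (rule Lim_transform_eventually)
  from LIMSEQ_unique[OF l1 this] show ?thesis by (simp add: l2_inner_commute)
qed

text \<open>By \<open>sigma_coeff_bound\<close> and the bounded number of neighbours, the squared
  norm is at most a multiple of |k|^(2 - 2 \<gamma>), and \<gamma> > 2 is exactly the condition 2
  \<gamma> - 2 > 2 of \<open>lattice_summable\<close>.\<close>

lemma sigma_grad_summable:
  assumes wn: "white_noise \<mu>" and f: "FCP \<Lambda> f" and \<gamma>: "\<gamma> > 2"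
  shows "(\<lambda>k. LINT \<omega>|\<mu>. (sigma_grad \<gamma> k \<omega> (D_cyl \<Lambda> f \<omega>))\<^sup>2) summable_on Z20"
proof -
  note \<Lambda> = FCP_D(1,2)[OF f]
  define p where "p j \<omega> = partial_deriv j f (coords \<Lambda> \<omega>)" for j \<omega>
  define P where "P j = (LINT \<omega>|\<mu>. (p j \<omega>)^4)" for j
  define W where "W = (LINT t|gauss. t^4)"
  have pint: "integrable \<mu> (\<lambda>\<omega>. (p j \<omega>)^4)" if "j \<in> \<Lambda>" for j
  proof -
    note c = C1P_C0P[OF FCP_D(4)[OF f that]]
    have "C0P \<Lambda> (\<lambda>x. (partial_deriv j f x * partial_deriv j f x) * (partial_deriv j f x * partial_deriv j f x))"
      by (intro C0P_mult c)
    from C0P_integrable[OF wn \<Lambda> this] show ?thesis by (simp add: p_def power4_eq_xxxx mult.assoc)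
  qed
  have x4: "integrable gauss (\<lambda>t. t^4)"
    unfolding gauss_def using integrable_std_normal_moment[of 4] by (subst integrable_density) auto
  have Xint: "integrable \<mu> (\<lambda>\<omega>. \<omega> (efun m)^4)" and XW: "(LINT \<omega>|\<mu>. \<omega> (efun m)^4) = W" if m: "m \<in> Z20" for m
  proof -
    have "integrable (distr \<mu> borel (\<lambda>\<omega>. \<omega> (efun m))) (\<lambda>t. t^4)" using x4 by (simp only: white_noiseD(5)[OF wn m])
    then show "integrable \<mu> (\<lambda>\<omega>. \<omega> (efun m)^4)" using white_noiseD(4)[OF wn m] by (subst (asm) integrable_distr_eq) auto
    have "W = (LINT t|distr \<mu> borel (\<lambda>\<omega>. \<omega> (efun m)). t^4)" by (simp only: W_def white_noiseD(5)[OF wn m])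
    also have "\<dots> = (LINT \<omega>|\<mu>. \<omega> (efun m)^4)" using white_noiseD(4)[OF wn m] by (subst integral_distr) auto
    finally show "(LINT \<omega>|\<mu>. \<omega> (efun m)^4) = W" ..
  qed
  have W0: "0 \<le> W" by (simp add: W_def)
  have P0: "0 \<le> P j" for j by (simp add: P_def)
  \<comment> \<open>The 16 is 4 from Cauchy-Schwarz over at most four neighbours, times 4 for the
    number of summands that remain.\<close>
  define C where "C = (\<Sum>j\<in>\<Lambda>. 16 * (4 * pi * norm (vec_of j))\<^sup>2 * (P j + W)) * real (card \<Lambda>)"
  have bound: "(LINT \<omega>|\<mu>. (sigma_grad \<gamma> k \<omega> (D_cyl \<Lambda> f \<omega>))\<^sup>2) \<le> C * norm (vec_of k) powr (- (2 * \<gamma> - 2))" if k: "k \<in> Z20" for k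
  proof -
    define r where "r = norm (vec_of k) powr (1 - \<gamma>)"
    define b where "b j = 4 * pi * norm (vec_of j) * r" for j
    let ?H = "\<lambda>\<omega>. (\<Sum>j\<in>\<Lambda>. 4 * (b j)\<^sup>2 * (\<Sum>m\<in>nbr k j. (p j \<omega>)^4 + \<omega> (efun m)^4)) * real (card \<Lambda>)"
    have Hint: "integrable \<mu> (\<lambda>\<omega>. (p j \<omega>)^4 + \<omega> (efun m)^4)" if "j \<in> \<Lambda>" "m \<in> nbr k j" for j m
      by (rule Bochner_Integration.integrable_add[OF pint[OF that(1)] Xint[OF subsetD[OF nbr_Z20 that(2)]]])
    have pw: "(sigma_grad \<gamma> k \<omega> (D_cyl \<Lambda> f \<omega>))\<^sup>2 \<le> ?H \<omega>" if \<omega>: "\<omega> \<in> space \<mu>" for \<omega>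
    proof -
      define \<xi> where "\<xi> j = (\<Sum>m\<in>nbr k j. sigma_coeff \<gamma> k j m * \<omega> (efun m))" for j
      have "sigma_grad \<gamma> k \<omega> (D_cyl \<Lambda> f \<omega>) = - (\<Sum>j\<in>\<Lambda>. p j \<omega> * \<xi> j)"
        using sigma_grad_D_cyl[OF _ \<Lambda>(2), of \<omega> \<gamma> k f] \<omega> white_noiseD(2)[OF wn] by (simp add: p_def \<xi>_def)
      then have "(sigma_grad \<gamma> k \<omega> (D_cyl \<Lambda> f \<omega>))\<^sup>2 \<le> (\<Sum>j\<in>\<Lambda>. (p j \<omega> * \<xi> j)\<^sup>2) * real (card \<Lambda>)"
        using sum_squared_le_sum_of_squares[of "\<lambda>j. p j \<omega> * \<xi> j" \<Lambda>] by simp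
      also have "\<dots> \<le> ?H \<omega>"
      proof (intro mult_right_mono sum_mono)
        fix j assume j: "j \<in> \<Lambda>"
        have "(\<xi> j)\<^sup>2 \<le> (\<Sum>m\<in>nbr k j. (sigma_coeff \<gamma> k j m * \<omega> (efun m))\<^sup>2) * real (card (nbr k j))"
          unfolding \<xi>_def using sum_squared_le_sum_of_squares[of "\<lambda>m. sigma_coeff \<gamma> k j m * \<omega> (efun m)" "nbr k j"] by simp
        also have "\<dots> \<le> (\<Sum>m\<in>nbr k j. (b j)\<^sup>2 * (\<omega> (efun m))\<^sup>2) * 4"
        proof (intro mult_mono sum_mono sum_nonneg)
          fix m
          have "\<bar>sigma_coeff \<gamma> k j m\<bar> \<le> b j" using sigma_coeff_bound[OF k, of \<gamma> j m] by (simp add: b_def r_def)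
          then have "(sigma_coeff \<gamma> k j m)\<^sup>2 \<le> (b j)\<^sup>2" by (metis abs_ge_zero power2_abs power_mono)
          then show "(sigma_coeff \<gamma> k j m * \<omega> (efun m))\<^sup>2 \<le> (b j)\<^sup>2 * (\<omega> (efun m))\<^sup>2"
            by (simp add: power_mult_distrib mult_right_mono)
        qed (use card_nbr[of k j] in auto)
        finally have "(p j \<omega>)\<^sup>2 * (\<xi> j)\<^sup>2 \<le> (p j \<omega>)\<^sup>2 * ((\<Sum>m\<in>nbr k j. (b j)\<^sup>2 * (\<omega> (efun m))\<^sup>2) * 4)"
          by (intro mult_left_mono) auto
        also have "\<dots> = 4 * (b j)\<^sup>2 * (\<Sum>m\<in>nbr k j. (p j \<omega>)\<^sup>2 * (\<omega> (efun m))\<^sup>2)"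
          by (simp add: sum_distrib_left sum_distrib_right mult_ac)
        \<comment> \<open>A derivative of f and a coordinate of \<omega> need not be independent, so
          their product is split into separate fourth moments.\<close>
        also have "\<dots> \<le> 4 * (b j)\<^sup>2 * (\<Sum>m\<in>nbr k j. (p j \<omega>)^4 + \<omega> (efun m)^4)"
        proof (intro mult_left_mono sum_mono)
          fix m
          have "x\<^sup>2 * y\<^sup>2 \<le> x^4 + y^4" for x y :: real
          proof -
            have "0 \<le> (x\<^sup>2 - y\<^sup>2)\<^sup>2" "0 \<le> x\<^sup>2 * y\<^sup>2" by simp_all
            moreover have "x^4 = (x\<^sup>2)\<^sup>2" "y^4 = (y\<^sup>2)\<^sup>2" by simp_all
            ultimately show ?thesis unfolding power2_diff[of "x\<^sup>2" "y\<^sup>2"] by linarith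
          qed
          then show "(p j \<omega>)\<^sup>2 * (\<omega> (efun m))\<^sup>2 \<le> (p j \<omega>)^4 + \<omega> (efun m)^4" .
        qed simp
        finally show "(p j \<omega> * \<xi> j)\<^sup>2 \<le> 4 * (b j)\<^sup>2 * (\<Sum>m\<in>nbr k j. (p j \<omega>)^4 + \<omega> (efun m)^4)"
          by (simp add: power_mult_distrib)
      qed simp
      finally show ?thesis .
    qed
    have "(LINT \<omega>|\<mu>. (sigma_grad \<gamma> k \<omega> (D_cyl \<Lambda> f \<omega>))\<^sup>2) \<le> (LINT \<omega>|\<mu>. ?H \<omega>)"
    proof (rule integral_mono[OF _ _ pw])
      show "integrable \<mu> (\<lambda>\<omega>. (sigma_grad \<gamma> k \<omega> (D_cyl \<Lambda> f \<omega>))\<^sup>2)"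
        using sigma_grad_L2[OF wn f] by (simp add: L2_space_def)
      show "integrable \<mu> ?H"
        by (intro integrable_mult_left integrable_mult_right Bochner_Integration.integrable_sum Hint)
    qed
    also have "\<dots> = (\<Sum>j\<in>\<Lambda>. 4 * (b j)\<^sup>2 * (\<Sum>m\<in>nbr k j. P j + W)) * real (card \<Lambda>)"
    proof -
      have one: "(LINT \<omega>|\<mu>. (p j \<omega>)^4 + \<omega> (efun m)^4) = P j + W" if "j \<in> \<Lambda>" "m \<in> nbr k j" for j m
      proof -
        have mZ: "m \<in> Z20" using that(2) nbr_Z20 by blast
        show ?thesis using pint[OF that(1)] Xint[OF mZ] XW[OF mZ] by (simp add: P_def)
      qed
      have "(LINT \<omega>|\<mu>. ?H \<omega>) = (LINT \<omega>|\<mu>. (\<Sum>j\<in>\<Lambda>. 4 * (b j)\<^sup>2 * (\<Sum>m\<in>nbr k j. (p j \<omega>)^4 + \<omega> (efun m)^4))) * real (card \<Lambda>)"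
        by (rule integral_mult_left_zero)
      also have "(LINT \<omega>|\<mu>. (\<Sum>j\<in>\<Lambda>. 4 * (b j)\<^sup>2 * (\<Sum>m\<in>nbr k j. (p j \<omega>)^4 + \<omega> (efun m)^4))) =
          (\<Sum>j\<in>\<Lambda>. LINT \<omega>|\<mu>. 4 * (b j)\<^sup>2 * (\<Sum>m\<in>nbr k j. (p j \<omega>)^4 + \<omega> (efun m)^4))"
        by (intro Bochner_Integration.integral_sum integrable_mult_right Bochner_Integration.integrable_sum Hint)
      also have "\<dots> = (\<Sum>j\<in>\<Lambda>. 4 * (b j)\<^sup>2 * (LINT \<omega>|\<mu>. (\<Sum>m\<in>nbr k j. (p j \<omega>)^4 + \<omega> (efun m)^4)))"
        by (intro sum.cong refl integral_mult_right_zero)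
      also have "\<dots> = (\<Sum>j\<in>\<Lambda>. 4 * (b j)\<^sup>2 * (\<Sum>m\<in>nbr k j. LINT \<omega>|\<mu>. (p j \<omega>)^4 + \<omega> (efun m)^4))"
        by (intro sum.cong refl arg_cong2[where f = "(*)"] Bochner_Integration.integral_sum Hint)
      also have "\<dots> = (\<Sum>j\<in>\<Lambda>. 4 * (b j)\<^sup>2 * (\<Sum>m\<in>nbr k j. P j + W))"
        by (intro sum.cong refl arg_cong2[where f = "(*)"] one)
      finally show ?thesis .
    qed
    also have "\<dots> \<le> (\<Sum>j\<in>\<Lambda>. 4 * (b j)\<^sup>2 * (4 * (P j + W))) * real (card \<Lambda>)"
    proof (intro mult_right_mono sum_mono mult_left_mono)
      fix j
      have "(\<Sum>m\<in>nbr k j. P j + W) = real (card (nbr k j)) * (P j + W)" by simp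
      also have "\<dots> \<le> 4 * (P j + W)" using card_nbr[of k j] P0[of j] W0 by (intro mult_right_mono) auto
      finally show "(\<Sum>m\<in>nbr k j. P j + W) \<le> 4 * (P j + W)" .
    qed auto
    also have "\<dots> = C * r\<^sup>2"
    proof -
      have "(\<Sum>j\<in>\<Lambda>. 4 * (b j)\<^sup>2 * (4 * (P j + W))) = (\<Sum>j\<in>\<Lambda>. 16 * (4 * pi * norm (vec_of j))\<^sup>2 * (P j + W) * r\<^sup>2)"
        unfolding b_def by (intro sum.cong refl) (simp add: power_mult_distrib)
      also have "\<dots> = (\<Sum>j\<in>\<Lambda>. 16 * (4 * pi * norm (vec_of j))\<^sup>2 * (P j + W)) * r\<^sup>2"
        by (rule sum_distrib_right[symmetric])
      finally show ?thesis by (simp only: C_def mult_ac)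
    qed
    also have "r\<^sup>2 = norm (vec_of k) powr (- (2 * \<gamma> - 2))"
    proof -
      have "0 < norm (vec_of k)" using norm_vec_of_ge_1[OF k] by linarith
      then have "r\<^sup>2 = norm (vec_of k) powr ((1 - \<gamma>) + (1 - \<gamma>))" by (simp only: r_def power2_eq_square powr_add)
      also have "(1 - \<gamma>) + (1 - \<gamma>) = - (2 * \<gamma> - 2)" by simp
      finally show ?thesis .
    qed
    finally show ?thesis .
  qed
  have "(\<lambda>k. C * norm (vec_of k) powr (- (2 * \<gamma> - 2))) summable_on Z20"
    using \<gamma> by (intro summable_on_cmult_right lattice_summable) simp
  then show ?thesis
    by (rule summable_on_comparison_test) (use bound in auto)
qed

theorem theorem1p1:
  fixes T \<gamma> :: real
    and \<mu> :: "functional measure"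
    and K :: "real \<times> real \<Rightarrow> real \<times> real"
    and \<rho>\<^sub>0 :: "functional \<Rightarrow> real"
  assumes "T > 0" and "\<gamma> \<ge> 2"
    and "white_noise \<mu>"
    and "biot_savart_kernel K"
    and "L2_space \<mu> \<rho>\<^sub>0"
  shows "\<exists>(\<rho> :: real \<Rightarrow> functional \<Rightarrow> real) (\<phi> :: int \<times> int \<Rightarrow> real \<Rightarrow> functional \<Rightarrow> real).
    Linf_L2 T \<mu> \<rho> \<and>
    (\<forall>k\<in>Z20. has_distr_deriv T \<mu> \<gamma> k \<rho> (\<phi> k)) \<and>
    (\<lambda>k. LINT t|time_measure T. LINT \<omega>|\<mu>. (\<phi> k t \<omega>)\<^sup>2) summable_on Z20 \<and>
    (\<Sum>\<^sub>\<infinity>k\<in>Z20. LINT t|time_measure T. LINT \<omega>|\<mu>. (\<phi> k t \<omega>)\<^sup>2) \<le> (LINT \<omega>|\<mu>. (\<rho>\<^sub>0 \<omega>)\<^sup>2) \<and>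
    (\<gamma> > 2 \<longrightarrow>
      (\<forall>\<Lambda> f \<alpha> \<alpha>'. FCP \<Lambda> f \<longrightarrow>
        (\<forall>t\<in>{0..T}. (\<alpha> has_real_derivative \<alpha>' t) (at t within {0..T})) \<longrightarrow>
        continuous_on {0..T} \<alpha>' \<longrightarrow> \<alpha> T = 0 \<longrightarrow>
        (\<lambda>k. LINT t|time_measure T. LINT \<omega>|\<mu>.
               \<alpha> t * sigma_grad \<gamma> k \<omega> (D_cyl \<Lambda> f \<omega>) * \<phi> k t \<omega>) summable_on Z20 \<and>
        0 = \<alpha> 0 * (LINT \<omega>|\<mu>. cyl \<Lambda> f \<omega> * \<rho>\<^sub>0 \<omega>)
          + (LINT t|time_measure T. LINT \<omega>|\<mu>.
               \<rho> t \<omega> * (\<alpha>' t * cyl \<Lambda> f \<omega> - \<alpha> t * drift \<mu> K \<Lambda> f \<omega>))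
          - 1 / 2 * (\<Sum>\<^sub>\<infinity>k\<in>Z20. LINT t|time_measure T. LINT \<omega>|\<mu>.
               \<alpha> t * sigma_grad \<gamma> k \<omega> (D_cyl \<Lambda> f \<omega>) * \<phi> k t \<omega>)))"
proof (cases "\<gamma> > 2")
  case False
  \<comment> \<open>at \<open>\<gamma> = 2\<close> only (i) and (ii) are claimed, so \<open>\<rho> = 0\<close> will do\<close>
  have "case_prod (\<lambda>(t::real) \<omega>. 0 :: real) \<in> borel_measurable (time_measure T \<Otimes>\<^sub>M \<mu>)" by simp
  then have "Linf_L2 T \<mu> (\<lambda>t \<omega>. 0)" by (simp add: Linf_L2_def L2_zero exI[of _ 0])
  moreover have "has_distr_deriv T \<mu> \<gamma> k (\<lambda>t \<omega>. 0) (\<lambda>t \<omega>. 0)" for k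
    using L2_zero by (simp add: has_distr_deriv_def case_prod_beta')
  ultimately show ?thesis using False
    by (intro exI[of _ "\<lambda>t \<omega>. 0"] exI[of _ "\<lambda>k t \<omega>. 0"]) simp
next
  case True
  note wn = assms(3) and K = assms(4)
  interpret prob_space \<mu> by (rule white_noiseD(1)[OF wn])
  \<comment> \<open>The zero frequency is not in \<open>Z20\<close>, so it is free to serve as the
    spare index.\<close>
  have Z: "- {(0, 0)} = Z20" by (auto simp: Z20_def)
  let ?X = "{x. FCP (fst x) (snd x)}"
  let ?F = "\<lambda>x. cyl (fst x) (snd x)" and ?D = "\<lambda>k x \<omega>. sigma_grad \<gamma> k \<omega> (D_cyl (fst x) (snd x) \<omega>)"
    and ?b = "\<lambda>x. drift \<mu> K (fst x) (snd x)"
  have "\<exists>\<rho> \<phi>. case_prod \<rho> \<in> borel_measurable (time_measure T \<Otimes>\<^sub>M \<mu>) \<and>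
     (AE t in time_measure T. L2_space \<mu> (\<rho> t) \<and> (LINT x|\<mu>. (\<rho> t x)\<^sup>2) \<le> (LINT x|\<mu>. (\<rho>\<^sub>0 x)\<^sup>2)) \<and>
     L2_space (time_measure T \<Otimes>\<^sub>M \<mu>) (case_prod \<rho>) \<and>
     (\<forall>k. L2_space (time_measure T \<Otimes>\<^sub>M \<mu>) (case_prod (\<phi> k))) \<and>
     (\<forall>k x \<beta>. k \<noteq> (0, 0) \<longrightarrow> x \<in> ?X \<longrightarrow> continuous_on {0..T} \<beta> \<longrightarrow>
        (LINT t|time_measure T. LINT \<omega>|\<mu>. \<beta> t * ?D k x \<omega> * \<rho> t \<omega>) =
        - (LINT t|time_measure T. LINT \<omega>|\<mu>. \<beta> t * ?F x \<omega> * \<phi> k t \<omega>)) \<and>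
     (\<lambda>k. LINT t|time_measure T. LINT x|\<mu>. (\<phi> k t x)\<^sup>2) summable_on (- {(0, 0)}) \<and>
     (\<Sum>\<^sub>\<infinity>k\<in>- {(0, 0)}. LINT t|time_measure T. LINT x|\<mu>. (\<phi> k t x)\<^sup>2) \<le> (LINT x|\<mu>. (\<rho>\<^sub>0 x)\<^sup>2) \<and>
     (\<forall>x \<alpha> \<alpha>'. x \<in> ?X \<longrightarrow> (\<forall>t\<in>{0..T}. (\<alpha> has_real_derivative \<alpha>' t) (at t within {0..T})) \<longrightarrow>
        continuous_on {0..T} \<alpha>' \<longrightarrow> \<alpha> T = 0 \<longrightarrow>
        (\<lambda>k. LINT t|time_measure T. LINT \<omega>|\<mu>. \<alpha> t * ?D k x \<omega> * \<phi> k t \<omega>) summable_on (- {(0, 0)}) \<and>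
        0 = \<alpha> 0 * (LINT \<omega>|\<mu>. ?F x \<omega> * \<rho>\<^sub>0 \<omega>)
          + (LINT t|time_measure T. LINT \<omega>|\<mu>. \<rho> t \<omega> * (\<alpha>' t * ?F x \<omega> - \<alpha> t * ?b x \<omega>))
          - 1 / 2 * (\<Sum>\<^sub>\<infinity>k\<in>- {(0, 0)}. LINT t|time_measure T. LINT \<omega>|\<mu>. \<alpha> t * ?D k x \<omega> * \<phi> k t \<omega>))"
  proof (rule weak_solution_exists[OF assms(1) sigma_finite_measure_axioms])
    show "L2_space \<mu> (?F x)" if "x \<in> ?X" for x
      by (rule cyl_L2[OF wn CollectD[OF that]])
    show "L2_space \<mu> (?b x)" if "x \<in> ?X" for x
      using drift_tendsto[OF wn K CollectD[OF that]] by (simp only: L2_tendsto_def)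
    show "L2_space \<mu> (?D k x)" if "x \<in> ?X" for k x
      by (rule sigma_grad_L2[OF wn CollectD[OF that]])
    show "(\<lambda>k. LINT \<omega>|\<mu>. (?D k x \<omega>)\<^sup>2) summable_on (- {(0, 0)})" if "x \<in> ?X" for x
      unfolding Z by (rule sigma_grad_summable[OF wn CollectD[OF that] True])
    show "l2_inner \<mu> (?D k x) (?F y) = - l2_inner \<mu> (?F x) (?D k y)" if "x \<in> ?X" "y \<in> ?X" "k \<noteq> (0, 0)" for k x y
      using sigma_grad_antisym[OF wn CollectD[OF that(1)] CollectD[OF that(2)], of k \<gamma>] that(3) by (simp add: Z20_def l2_inner_def)
    show "l2_inner \<mu> (?b x) (?F y) = - l2_inner \<mu> (?F x) (?b y)" if "x \<in> ?X" "y \<in> ?X" for x y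
      by (rule drift_antisym[OF wn K CollectD[OF that(1)] CollectD[OF that(2)]])
  qed (rule assms(5))
  then obtain \<rho> \<phi> where meas: "case_prod \<rho> \<in> borel_measurable (time_measure T \<Otimes>\<^sub>M \<mu>)"
    and ae: "AE t in time_measure T. L2_space \<mu> (\<rho> t) \<and> (LINT x|\<mu>. (\<rho> t x)\<^sup>2) \<le> (LINT x|\<mu>. (\<rho>\<^sub>0 x)\<^sup>2)"
    and L2: "L2_space (time_measure T \<Otimes>\<^sub>M \<mu>) (case_prod \<rho>)" "\<forall>k. L2_space (time_measure T \<Otimes>\<^sub>M \<mu>) (case_prod (\<phi> k))"
    and con: "\<forall>k x \<beta>. k \<noteq> (0, 0) \<longrightarrow> x \<in> ?X \<longrightarrow> continuous_on {0..T} \<beta> \<longrightarrow>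
        (LINT t|time_measure T. LINT \<omega>|\<mu>. \<beta> t * ?D k x \<omega> * \<rho> t \<omega>) =
        - (LINT t|time_measure T. LINT \<omega>|\<mu>. \<beta> t * ?F x \<omega> * \<phi> k t \<omega>)"
    and en: "(\<lambda>k. LINT t|time_measure T. LINT x|\<mu>. (\<phi> k t x)\<^sup>2) summable_on (- {(0, 0)})"
      "(\<Sum>\<^sub>\<infinity>k\<in>- {(0, 0)}. LINT t|time_measure T. LINT x|\<mu>. (\<phi> k t x)\<^sup>2) \<le> (LINT x|\<mu>. (\<rho>\<^sub>0 x)\<^sup>2)"
    and weak: "\<forall>x \<alpha> \<alpha>'. x \<in> ?X \<longrightarrow> (\<forall>t\<in>{0..T}. (\<alpha> has_real_derivative \<alpha>' t) (at t within {0..T})) \<longrightarrow>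
        continuous_on {0..T} \<alpha>' \<longrightarrow> \<alpha> T = 0 \<longrightarrow>
        (\<lambda>k. LINT t|time_measure T. LINT \<omega>|\<mu>. \<alpha> t * ?D k x \<omega> * \<phi> k t \<omega>) summable_on (- {(0, 0)}) \<and>
        0 = \<alpha> 0 * (LINT \<omega>|\<mu>. ?F x \<omega> * \<rho>\<^sub>0 \<omega>)
          + (LINT t|time_measure T. LINT \<omega>|\<mu>. \<rho> t \<omega> * (\<alpha>' t * ?F x \<omega> - \<alpha> t * ?b x \<omega>))
          - 1 / 2 * (\<Sum>\<^sub>\<infinity>k\<in>- {(0, 0)}. LINT t|time_measure T. LINT \<omega>|\<mu>. \<alpha> t * ?D k x \<omega> * \<phi> k t \<omega>)"
    by (elim exE conjE) (rule that)
  show ?thesis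
  proof (intro exI[of _ \<rho>] exI[of _ \<phi>] conjI impI ballI allI)
    show "Linf_L2 T \<mu> \<rho>" using meas ae unfolding Linf_L2_def by blast
    show "has_distr_deriv T \<mu> \<gamma> k \<rho> (\<phi> k)" if "k \<in> Z20" for k
      unfolding has_distr_deriv_def
    proof (intro conjI allI impI L2(1) spec[OF L2(2)])
      fix \<alpha> :: "real \<Rightarrow> real" and \<Lambda> f assume "continuous_on {0..T} \<alpha>" "FCP \<Lambda> f"
      then show "(LINT t|time_measure T. LINT \<omega>|\<mu>. \<alpha> t * sigma_grad \<gamma> k \<omega> (D_cyl \<Lambda> f \<omega>) * \<rho> t \<omega>) =
        - (LINT t|time_measure T. LINT \<omega>|\<mu>. \<alpha> t * cyl \<Lambda> f \<omega> * \<phi> k t \<omega>)"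
        using con[THEN spec, THEN spec, of k "(\<Lambda>, f)"] that by (simp add: Z20_def)
    qed
    show "(\<lambda>k. LINT t|time_measure T. LINT \<omega>|\<mu>. (\<phi> k t \<omega>)\<^sup>2) summable_on Z20"
      "(\<Sum>\<^sub>\<infinity>k\<in>Z20. LINT t|time_measure T. LINT \<omega>|\<mu>. (\<phi> k t \<omega>)\<^sup>2) \<le> (LINT \<omega>|\<mu>. (\<rho>\<^sub>0 \<omega>)\<^sup>2)"
      using en by (simp_all only: Z)
    fix \<Lambda> f \<alpha> \<alpha>'
    assume "FCP \<Lambda> f" "\<forall>t\<in>{0..T}. (\<alpha> has_real_derivative \<alpha>' t) (at t within {0..T})"
      "continuous_on {0..T} \<alpha>'" "\<alpha> T = 0"
    note w = weak[THEN spec, THEN spec, THEN spec, of "(\<Lambda>, f)" \<alpha> \<alpha>', unfolded Z mem_Collect_eq fst_conv snd_conv, THEN mp, THEN mp, THEN mp, THEN mp, OF this]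
    show "(\<lambda>k. LINT t|time_measure T. LINT \<omega>|\<mu>. \<alpha> t * sigma_grad \<gamma> k \<omega> (D_cyl \<Lambda> f \<omega>) * \<phi> k t \<omega>) summable_on Z20"
      by (rule conjunct1[OF w])
    show "0 = \<alpha> 0 * (LINT \<omega>|\<mu>. cyl \<Lambda> f \<omega> * \<rho>\<^sub>0 \<omega>)
          + (LINT t|time_measure T. LINT \<omega>|\<mu>. \<rho> t \<omega> * (\<alpha>' t * cyl \<Lambda> f \<omega> - \<alpha> t * drift \<mu> K \<Lambda> f \<omega>))
          - 1 / 2 * (\<Sum>\<^sub>\<infinity>k\<in>Z20. LINT t|time_measure T. LINT \<omega>|\<mu>. \<alpha> t * sigma_grad \<gamma> k \<omega> (D_cyl \<Lambda> f \<omega>) * \<phi> k t \<omega>)"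
      by (rule conjunct2[OF w])
  qed
qed

end
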